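(* Let $\mathbb B$ be a non-collinear class of conjugate bars of $T(f,g)$. Then the intersection multiplicities satisfy $$I(C_f,P_{\mathbb B}^{\top})=I(C_f,P_{\mathbb B})=\nu_f(\mathbb B)m^*(\mathbb B),\qquad I(C_g,P_{\mathbb B}^{\top})=I(C_g,P_{\mathbb B})=\nu_g(\mathbb B)m^*(\mathbb B),$$ $$I(C,P_{\mathbb B}^{\top})=I(C,P_{\mathbb B})=[\nu_f(\mathbb B)+\nu_g(\mathbb B)]m^*(\mathbb B),$$ where $C_f=f^{-1}(0)$, $C_g=g^{-1}(0)$, $C=C_f\cup C_g$; i.e. they do not change when $P_{\mathbb B}$ is replaced by the curve germ defined by $P_{\mathbb B}^{\top}(x,y)=0$. Moreover the truncations $P_{\mathbb B}^{\top}(x,y)$ are mero-invariants.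
   Context: SETTING. Let $f,g:(\mathbb C^2,O)\to(\mathbb C,O)$ be holomorphic germs in coordinates $(x,y)$, with Newton–Puiseux factorisations $f=u\,y^{E_1}\prod_{i=1}^p[x-\alpha_i(y)]$, $g=u'\,y^{E_2}\prod_{j=1}^q[x-\beta_j(y)]$, where $E_1,E_2\ge 0$, $u,u'$ are units and $\alpha_i,\beta_j$ are fractional power series in $y$ of positive order $O_y$. Write $\lambda_1,\dots,\lambda_N$ ($N=p+q\ge1$) for $\alpha_1,\dots,\alpha_p,\beta_1,\dots,\beta_q$; they are assumed pairwise distinct. Put $O(\lambda,\mu):=O_y(\lambda(y)-\mu(y))$ (contact order). An arc is a fractional power series in $y$. Let $J=f_yg_x-f_xg_y$. A polar root is a Newton–Puiseux root $x=\gamma(y)$ of $J$ with $O_y(\gamma)>0$ and $f(\gamma(y),y)g(\gamma(y),y)\ne0$; let $\gamma_j$ be the polar roots, listed with multiplicity. TREE $T(f,g)$. The ground bar $B_*$ has height $h(B_* )=0$ and carries one trunk (the main trunk), consisting of all $\lambda_k$. On top of each trunk there is one bar $B$ whose height $h(B)$ is the minimum of the contact orders between members of the trunk ($\infty$ if the trunk has one member); the members of the trunk are divided into classes by $\lambda\equiv\mu$ iff $O(\lambda,\mu)>h(B)$, and each class is a trunk growing on $B$; continue recursively. Bars of infinite height are omitted: "bar" means bar of finite height. A trunk consisting of $s$ of the $\alpha_i$ and $t$ of the $\beta_j$ has bimultiplicity $[s,t]$. For a bar $B$ and a root $\lambda_k$ in a trunk on $B$, let $\lambda_B$ be $\lambda_k$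 with all terms $y^e$, $e\ge h(B)$, omitted (independent of the choice of $\lambda_k$; $\lambda_{B_*}=0$). Then $\lambda_k=\lambda_B+cy^{h(B)}+\cdots$, and the trunk containing $\lambda_k$ is said to grow on $B$ at $c\in\mathbb C$ (the main trunk grows on $B_*$ at $0$). An arc $\xi$ climbs over $B$ at $a\in\mathbb C$ if $\xi=\lambda_B+ay^{h(B)}+\cdots$ ($\cdots$ meaning higher order terms); if moreover no trunk grows on $B$ at $a$, then $\xi$ leaves the tree on $B$ at $a$. RATIONAL FUNCTION. For a bar $B$ and $F\in\{f,g\}$ let $\nu_F(B):=O_y(F(\lambda_B(y)+zy^{h(B)},y))$ for generic $z$ (so $\nu_f(B_* )=E_1$, $\nu_g(B_* )=E_2$). Let the trunks on $B$ grow at $z_1,\dots,z_l$ with bimultiplicities $[p_k,q_k]$. Put $\Delta_B(z_k):=\nu_f(B)q_k-\nu_g(B)p_k$ and $\mathcal M_B(z):=\sum_{k}\frac{\Delta_B(z_k)}{z-z_k}$. The point $z_k$ is collinear if $\Delta_B(z_k)=0$ and non-collinear otherwise; $C(B)$, $N(B)$ are the sets of collinear and non-collinear points. $B$ is collinear if $N(B)=\emptyset$, non-collinear otherwise. For non-collinear $B$, $m_B(z)$ is the multiplicity of $z\in\mathbb C$ as a zero of $\mathcal M_B$ ($0$ if not a zero), $m(B)=\sum_zm_B(z)$; a zero of $\mathcal M_B$ not in $C(B)$ is a pure mero-zero, and $m^*(B)$ is the number of pure mero-zeros on $B$ counted with multiplicity $m_B$ (the mero-multiplicity). CONJUGATE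 BARS AND FACTORS. Bars $B,\bar B$ are conjugate if $h(B)=h(\bar B)$ and there is an irreducible $p(x,y)\in\mathbb C\{x,y\}$ one of whose Newton–Puiseux roots climbs over $B$ and one of whose roots climbs over $\bar B$. This is an equivalence relation. The bars of a class $\mathbb B$ have common values of $\nu_f,\nu_g$, denoted $\nu_f(\mathbb B),\nu_g(\mathbb B)$, and are all collinear or all non-collinear; $\mathbb B$ is called accordingly. For non-collinear $\mathbb B$: $m^*(\mathbb B):=\sum_{B\in\mathbb B}m^*(B)$; $P_{\mathbb B}(x,y):=\prod_j[x-\gamma_j(y)]$ over all $j$ such that $\gamma_j$ leaves the tree on some $B\in\mathbb B$ (an element of $\mathbb C\{x,y\}$; $P_{\mathbb B}$ also denotes the curve germ it defines). $I(\cdot,\cdot)$ is the intersection multiplicity at $O$, with $C_f,C_g,C$ taken as defined by $f$, $g$, $fg$, e.g. $I(C_f,P_{\mathbb B})=\dim_{\mathbb C}\mathbb C\{x,y\}/(f,P_{\mathbb B})$. TRUNCATION. For an arc $\xi$, not a root of $f\cdot g$, leaving the tree on $B$ at $a$, put $\xi^{\top}(y):=\lambda_B(y)+ay^{h(B)}$; for a root $\lambda_k$ put $\lambda_k^\top:=\lambda_k$. For $P_{\mathbb B}(x,y)=\prod_j[x-\gamma_j(y)]$, put $P_{\mathbb B}^\top(x,y):=\prod_j[x-\gamma_j^\top(y)]$, an element of $\mathbb C\{x,y\}$. MERO-EQUIVALENCE. $(f,g)$ and $(f',g')$ (both as in the setting, with the same $E_1,E_2$) are mero-equivalent if: (1)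 there are bijections $\alpha_i\mapsto\alpha_i'$, $\beta_j\mapsto\beta_j'$ between the roots of $f,f'$ and of $g,g'$ preserving all contact orders $O(\alpha_i,\alpha_k)$, $O(\alpha_i,\beta_j)$, $O(\beta_j,\beta_s)$ (this induces a bijection between bars and trunks of the two trees, and a correspondence of points where trunks grow on corresponding bars, preserving heights, bimultiplicities, $\nu_f,\nu_g$ and collinearity); (2) if $B$ corresponds to $B'$, both non-collinear, then $m(B)=m(B')$, and if $c\in C(B)$ corresponds to $c'\in C(B')$ then $m_B(c)=m_{B'}(c')$; (3) if $B$ corresponds to $B'$, non-collinear, there is a bijection between the pure mero-zeros of $B$ and of $B'$ preserving the mero-multiplicity. A function germ associated to $T(f,g)$ is a mero-invariant if its Zariski equisingularity type (components counted with their multiplicities) depends only on the mero-equivalence class of $(f,g)$; for $P_{\mathbb B}^\top$ this means $P_{\mathbb B}^\top$ and $P_{\mathbb B'}^\top$ are Zariski equisingular whenever $(f',g')$ is mero-equivalent to $(f,g)$ and $\mathbb B'$ corresponds to $\mathbb B$ (the bijection of bars carrying $\mathbb B$ onto $\mathbb B'$). *)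

theory Defs
  imports
    "HOL-Complex_Analysis.Complex_Analysis"
    "HOL-Algebra.QuotRing"
    "HOL-Algebra.Ring_Divisibility"
    "HOL-Algebra.Embedded_Algebras"
begin

section \<open>The ring of convergent power series in two variables\<close>

text \<open>
  A germ \<open>F = \<Sum>\<^sub>i\<^sub>j c\<^sub>i\<^sub>j x\<^sup>i y\<^sup>j\<close> at the origin is its Taylor series: the outer series variable
  is \<open>x\<close>, the inner one is \<open>y\<close>, so that \<open>c\<^sub>i\<^sub>j = fps_nth (fps_nth F i) j\<close>.
\<close>

type_synonym germ = "complex fps fps"

definition germ_x :: germ where
  "germ_x = fps_X"

definition germ_y :: germ where
  "germ_y = fps_const fps_X"

definition germ_const :: "complex \<Rightarrow> germ" where
  "germ_const c = fps_const (fps_const c)"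

definition germ_convergent :: "germ \<Rightarrow> bool" where
  "germ_convergent F \<longleftrightarrow>
     (\<exists>r>0. (\<lambda>(i, j). norm (fps_nth (fps_nth F i) j) * r ^ i * r ^ j) summable_on UNIV)"

definition Cxy :: "germ ring" where
  "Cxy = \<lparr>carrier = {F. germ_convergent F}, mult = (*), one = 1, zero = 0, add = (+)\<rparr>"

definition deriv_x :: "germ \<Rightarrow> germ" where
  "deriv_x F = fps_deriv F"

definition deriv_y :: "germ \<Rightarrow> germ" where
  "deriv_y F = Abs_fps (\<lambda>i. fps_deriv (fps_nth F i))"

definition jacobian :: "germ \<Rightarrow> germ \<Rightarrow> germ" where
  "jacobian f g = deriv_y f * deriv_x g - deriv_x f * deriv_y g"

definition germ_swap :: "germ \<Rightarrow> germ" where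
  "germ_swap F = Abs_fps (\<lambda>i. Abs_fps (\<lambda>j. fps_nth (fps_nth F j) i))"

definition germ_mult :: "germ \<Rightarrow> nat" where
  "germ_mult F = (LEAST m. \<exists>i\<le>m. fps_nth (fps_nth F i) (m - i) \<noteq> 0)"

text \<open>
  \<open>I(F, G) = dim \<complex>{x,y}/(F, G)\<close>, where \<open>\<complex>\<close> sits in the quotient ring as the set of residue
  classes of constants.
\<close>

definition int_mult :: "germ \<Rightarrow> germ \<Rightarrow> enat" where
  "int_mult F G =
     (let I = Idl\<^bsub>Cxy\<^esub> {F, G};
          Q = Cxy Quot I;
          K = (\<lambda>c. I +>\<^bsub>Cxy\<^esub> germ_const c) ` UNIV
      in if ring.finite_dimension Q K (carrier Q) then enat (ring.dim Q K (carrier Q)) else \<infinity>)"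


section \<open>Arcs\<close>

text \<open>
  A fractional power series \<open>\<xi>(y) = \<Sum>\<^sub>e \<xi>\<^sub>e y\<^sup>e\<close> is given by its coefficient function
  \<open>e \<mapsto> \<xi>\<^sub>e\<close>; all exponents with nonzero coefficient lie in \<open>(1/n)\<nat>\<close> for some \<open>n > 0\<close>.
\<close>

type_synonym arc = "real \<Rightarrow> complex"

definition arc_denom :: "nat \<Rightarrow> arc \<Rightarrow> bool" where
  "arc_denom n \<xi> \<longleftrightarrow> n > 0 \<and> (\<forall>e. \<xi> e \<noteq> 0 \<longrightarrow> (\<exists>k::nat. e = real k / real n))"

definition is_arc :: "arc \<Rightarrow> bool" where
  "is_arc \<xi> \<longleftrightarrow> (\<exists>n. arc_denom n \<xi>)"

definition arc_den :: "arc \<Rightarrow> nat" where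
  "arc_den \<xi> = (LEAST n. arc_denom n \<xi>)"

definition arc_order :: "arc \<Rightarrow> ereal" where
  "arc_order \<xi> = (INF e\<in>{e. \<xi> e \<noteq> 0}. ereal e)"

definition contact :: "arc \<Rightarrow> arc \<Rightarrow> ereal" where
  "contact \<xi> \<zeta> = arc_order (\<lambda>e. \<xi> e - \<zeta> e)"

text \<open>The series \<open>\<xi>(t\<^sup>n)\<close>, and conversely the arc \<open>\<phi>(y\<^sup>1\<^sup>/\<^sup>n)\<close>.\<close>

definition arc_param :: "nat \<Rightarrow> arc \<Rightarrow> complex fps" where
  "arc_param n \<xi> = Abs_fps (\<lambda>k. \<xi> (real k / real n))"

definition arc_of_param :: "nat \<Rightarrow> complex fps \<Rightarrow> arc" where
  "arc_of_param n \<phi> =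
     (\<lambda>e. if \<exists>k::nat. e = real k / real n then fps_nth \<phi> (THE k. e = real k / real n) else 0)"

text \<open>
  \<open>F(\<xi>(y), y)\<close>, computed as \<open>\<Sum>\<^sub>i F\<^sub>i(t\<^sup>n) \<xi>(t\<^sup>n)\<^sup>i\<close> with \<open>y = t\<^sup>n\<close>. Each coefficient is a series over
  \<open>i\<close>: a finite sum if \<open>\<xi>\<close> has positive order, and a convergent series if \<open>F\<close> is convergent and the
  constant term of \<open>\<xi>\<close> is small. The latter case is needed for the ground bar.
\<close>

definition subst_arc :: "germ \<Rightarrow> arc \<Rightarrow> arc" where
  "subst_arc F \<xi> =
     (let n = arc_den \<xi> in
        arc_of_param n
          (Abs_fps (\<lambda>k. \<Sum>i. fps_nth ((fps_nth F i oo fps_X ^ n) * arc_param n \<xi> ^ i) k)))"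


section \<open>Newton--Puiseux factorisation\<close>

text \<open>\<open>F(x, t\<^sup>n)\<close>\<close>

definition ramify :: "nat \<Rightarrow> germ \<Rightarrow> germ" where
  "ramify n F = Abs_fps (\<lambda>i. fps_nth F i oo fps_X ^ n)"

text \<open>\<open>\<Prod>\<^sub>\<gamma> [x - \<gamma>(t\<^sup>n)]\<close>\<close>

definition root_prod :: "nat \<Rightarrow> arc multiset \<Rightarrow> germ" where
  "root_prod n \<Gamma> = (\<Prod>\<gamma>\<in>#\<Gamma>. fps_X - fps_const (arc_param n \<gamma>))"

text \<open>
  \<open>F = u y\<^sup>E \<Prod>\<^sub>\<gamma> [x - \<gamma>(y)]\<close> with a unit \<open>u\<close>; the identity is written out after \<open>y = t\<^sup>n\<close> for a common
  denominator \<open>n\<close> of the roots.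
\<close>

definition np_factorization :: "germ \<Rightarrow> nat \<Rightarrow> arc multiset \<Rightarrow> bool" where
  "np_factorization F E \<Gamma> \<longleftrightarrow>
     (\<forall>\<gamma>\<in>#\<Gamma>. is_arc \<gamma> \<and> 0 < arc_order \<gamma>) \<and>
     (\<exists>u\<in>Units Cxy. \<exists>n>0. (\<forall>\<gamma>\<in>#\<Gamma>. arc_denom n \<gamma>) \<and>
        ramify n F = ramify n (u * germ_y ^ E) * root_prod n \<Gamma>)"

definition np_roots :: "germ \<Rightarrow> arc multiset" where
  "np_roots F = (THE \<Gamma>. \<exists>E. np_factorization F E \<Gamma>)"

text \<open>The element \<open>\<Prod>\<^sub>\<gamma> [x - \<gamma>(y)]\<close> of \<open>\<complex>{x,y}\<close>, when the product is one.\<close>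

definition arc_prod :: "arc multiset \<Rightarrow> germ" where
  "arc_prod \<Gamma> = (THE P. \<exists>n>0. (\<forall>\<gamma>\<in>#\<Gamma>. arc_denom n \<gamma>) \<and> ramify n P = root_prod n \<Gamma>)"

definition mero_setting :: "germ \<Rightarrow> germ \<Rightarrow> nat \<Rightarrow> nat \<Rightarrow> bool" where
  "mero_setting f g E1 E2 \<longleftrightarrow>
     f \<in> carrier Cxy \<and> fps_nth (fps_nth f 0) 0 = 0 \<and>
     g \<in> carrier Cxy \<and> fps_nth (fps_nth g 0) 0 = 0 \<and>
     (\<exists>\<alpha>s \<beta>s. np_factorization f E1 (mset \<alpha>s) \<and> np_factorization g E2 (mset \<beta>s) \<and>
        distinct (\<alpha>s @ \<beta>s) \<and> length (\<alpha>s @ \<beta>s) \<ge> 1)"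

definition roots :: "germ \<Rightarrow> arc set" where
  "roots F = set_mset (np_roots F)"

definition polar_roots :: "germ \<Rightarrow> germ \<Rightarrow> arc multiset" where
  "polar_roots f g =
     {#\<gamma> \<in># np_roots (jacobian f g).
        subst_arc f \<gamma> \<noteq> (\<lambda>_. 0) \<and> subst_arc g \<gamma> \<noteq> (\<lambda>_. 0)#}"


section \<open>The tree\<close>

definition tree_roots :: "germ \<Rightarrow> germ \<Rightarrow> arc set" where
  "tree_roots f g = roots f \<union> roots g"

text \<open>
  A bar is the pair of the trunk on top of which it lies (for the ground bar: all roots) and its
  height. Trunks are sets of roots. On the ground bar the classes give back the whole set of roots,
  since all contact orders are positive.
\<close>

type_synonym bar = "arc set \<times> real"

definition trunk_height :: "arc set \<Rightarrow> ereal" where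
  "trunk_height T = (INF \<kappa>\<in>T. INF \<mu>\<in>T. contact \<kappa> \<mu>)"

definition trunks_on :: "bar \<Rightarrow> arc set set" where
  "trunks_on B = {{\<mu> \<in> fst B. contact \<kappa> \<mu> > ereal (snd B)} | \<kappa>. \<kappa> \<in> fst B}"

inductive_set bars :: "germ \<Rightarrow> germ \<Rightarrow> bar set" for f g where
  ground: "(tree_roots f g, 0) \<in> bars f g"
| top: "B \<in> bars f g \<Longrightarrow> T \<in> trunks_on B \<Longrightarrow> trunk_height T = ereal h \<Longrightarrow> (T, h) \<in> bars f g"

definition arc_trunc :: "real \<Rightarrow> arc \<Rightarrow> arc" where
  "arc_trunc h \<xi> = (\<lambda>e. if e < h then \<xi> e else 0)"

text \<open>\<open>\<lambda>\<^sub>B\<close>\<close>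

definition bar_arc :: "bar \<Rightarrow> arc" where
  "bar_arc B = arc_trunc (snd B) (SOME \<kappa>. \<kappa> \<in> fst B)"

text \<open>\<open>\<lambda>\<^sub>B(y) + a y\<^sup>h\<close>, where \<open>h\<close> is the height of \<open>B\<close>\<close>

definition bar_arc_at :: "bar \<Rightarrow> complex \<Rightarrow> arc" where
  "bar_arc_at B a = (bar_arc B)(snd B := a)"

definition trunk_point :: "bar \<Rightarrow> arc set \<Rightarrow> complex" where
  "trunk_point B T = (THE c. \<forall>\<kappa>\<in>T. \<kappa> (snd B) = c)"

definition climbs :: "arc \<Rightarrow> bar \<Rightarrow> complex \<Rightarrow> bool" where
  "climbs \<xi> B a \<longleftrightarrow> is_arc \<xi> \<and> (\<forall>e\<le>snd B. \<xi> e = bar_arc_at B a e)"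

definition leaves :: "arc \<Rightarrow> bar \<Rightarrow> complex \<Rightarrow> bool" where
  "leaves \<xi> B a \<longleftrightarrow> climbs \<xi> B a \<and> a \<notin> trunk_point B ` trunks_on B"


section \<open>The rational function of a bar\<close>

text \<open>
  The coefficients of \<open>F(\<lambda>\<^sub>B(y) + z y\<^sup>h, y)\<close> are polynomials in \<open>z\<close> for \<open>h > 0\<close>, and power series
  in \<open>z\<close> convergent near \<open>0\<close> for \<open>h = 0\<close>. So the order for generic \<open>z\<close> is the one attained for all
  sufficiently small \<open>z \<noteq> 0\<close>.
\<close>

definition nu :: "germ \<Rightarrow> bar \<Rightarrow> real" where
  "nu F B = (THE v. \<forall>\<^sub>F z in at 0. arc_order (subst_arc F (bar_arc_at B z)) = ereal v)"

definition Delta :: "germ \<Rightarrow> germ \<Rightarrow> bar \<Rightarrow> arc set \<Rightarrow> real" where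
  "Delta f g B T = nu f B * real (card (T \<inter> roots g)) - nu g B * real (card (T \<inter> roots f))"

definition mero_fun :: "germ \<Rightarrow> germ \<Rightarrow> bar \<Rightarrow> complex \<Rightarrow> complex" where
  "mero_fun f g B z = (\<Sum>T\<in>trunks_on B. of_real (Delta f g B T) / (z - trunk_point B T))"

definition collinear_points :: "germ \<Rightarrow> germ \<Rightarrow> bar \<Rightarrow> complex set" where
  "collinear_points f g B = {trunk_point B T | T. T \<in> trunks_on B \<and> Delta f g B T = 0}"

definition noncollinear_points :: "germ \<Rightarrow> germ \<Rightarrow> bar \<Rightarrow> complex set" where
  "noncollinear_points f g B = {trunk_point B T | T. T \<in> trunks_on B \<and> Delta f g B T \<noteq> 0}"

definition noncollinear_bar :: "germ \<Rightarrow> germ \<Rightarrow> bar \<Rightarrow> bool" where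
  "noncollinear_bar f g B \<longleftrightarrow> noncollinear_points f g B \<noteq> {}"

text \<open>\<^const>\<open>zorder\<close> is negative at a pole; \<^const>\<open>nat\<close> then gives \<open>0\<close>.\<close>

definition zero_mult :: "germ \<Rightarrow> germ \<Rightarrow> bar \<Rightarrow> complex \<Rightarrow> nat" where
  "zero_mult f g B z = nat (zorder (mero_fun f g B) z)"

definition total_mult :: "germ \<Rightarrow> germ \<Rightarrow> bar \<Rightarrow> nat" where
  "total_mult f g B = (\<Sum>z | zero_mult f g B z > 0. zero_mult f g B z)"

definition pure_zeros :: "germ \<Rightarrow> germ \<Rightarrow> bar \<Rightarrow> complex set" where
  "pure_zeros f g B = {z. zero_mult f g B z > 0 \<and> z \<notin> collinear_points f g B}"

definition mero_mult :: "germ \<Rightarrow> germ \<Rightarrow> bar \<Rightarrow> nat" where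
  "mero_mult f g B = (\<Sum>z\<in>pure_zeros f g B. zero_mult f g B z)"


section \<open>Conjugate bars, factors of the Jacobian, truncation\<close>

definition conj_rel :: "germ \<Rightarrow> germ \<Rightarrow> (bar \<times> bar) set" where
  "conj_rel f g =
     {(B, B'). B \<in> bars f g \<and> B' \<in> bars f g \<and> snd B = snd B' \<and>
        (\<exists>p\<in>carrier Cxy. ring_irreducible\<^bsub>Cxy\<^esub> p \<and>
           (\<exists>\<xi>\<in>roots p. \<exists>a. climbs \<xi> B a) \<and> (\<exists>\<xi>\<in>roots p. \<exists>a. climbs \<xi> B' a))}"

definition conj_classes :: "germ \<Rightarrow> germ \<Rightarrow> bar set set" where
  "conj_classes f g = bars f g // conj_rel f g"

definition noncollinear_class :: "germ \<Rightarrow> germ \<Rightarrow> bar set \<Rightarrow> bool" where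
  "noncollinear_class f g \<BB> \<longleftrightarrow> (\<forall>B\<in>\<BB>. noncollinear_bar f g B)"

text \<open>The common value of \<^const>\<open>nu\<close> on a class of conjugate bars.\<close>

definition nu_class :: "germ \<Rightarrow> bar set \<Rightarrow> real" where
  "nu_class F \<BB> = (THE v. \<forall>B\<in>\<BB>. nu F B = v)"

definition mero_mult_class :: "germ \<Rightarrow> germ \<Rightarrow> bar set \<Rightarrow> nat" where
  "mero_mult_class f g \<BB> = (\<Sum>B\<in>\<BB>. mero_mult f g B)"

definition class_polar_roots :: "germ \<Rightarrow> germ \<Rightarrow> bar set \<Rightarrow> arc multiset" where
  "class_polar_roots f g \<BB> = {#\<gamma> \<in># polar_roots f g. \<exists>B\<in>\<BB>. \<exists>a. leaves \<gamma> B a#}"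

definition polar_factor :: "germ \<Rightarrow> germ \<Rightarrow> bar set \<Rightarrow> germ" where
  "polar_factor f g \<BB> = arc_prod (class_polar_roots f g \<BB>)"

definition truncation :: "germ \<Rightarrow> germ \<Rightarrow> arc \<Rightarrow> arc" where
  "truncation f g \<xi> =
     (if \<xi> \<in> tree_roots f g then \<xi>
      else (THE \<zeta>. \<exists>B\<in>bars f g. \<exists>a. leaves \<xi> B a \<and> \<zeta> = bar_arc_at B a))"

definition truncated_factor :: "germ \<Rightarrow> germ \<Rightarrow> bar set \<Rightarrow> germ" where
  "truncated_factor f g \<BB> = arc_prod (image_mset (truncation f g) (class_polar_roots f g \<BB>))"


section \<open>Mero-equivalence\<close>

definition bar_map :: "(arc \<Rightarrow> arc) \<Rightarrow> bar \<Rightarrow> bar" where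
  "bar_map \<phi> B = (\<phi> ` fst B, snd B)"

text \<open>
  Mero-equivalence realised by the bijection \<open>\<phi>\<close> of roots. As the roots of \<open>f\<close> and \<open>g\<close> are disjoint,
  the two bijections of roots are the restrictions of one map.
\<close>

definition mero_equivalence ::
    "nat \<Rightarrow> nat \<Rightarrow> germ \<Rightarrow> germ \<Rightarrow> germ \<Rightarrow> germ \<Rightarrow> (arc \<Rightarrow> arc) \<Rightarrow> bool" where
  "mero_equivalence E1 E2 f g f' g' \<phi> \<longleftrightarrow>
     mero_setting f g E1 E2 \<and> mero_setting f' g' E1 E2 \<and>
     bij_betw \<phi> (roots f) (roots f') \<and> bij_betw \<phi> (roots g) (roots g') \<and>
     (\<forall>\<kappa>\<in>tree_roots f g. \<forall>\<mu>\<in>tree_roots f g. contact (\<phi> \<kappa>) (\<phi> \<mu>) = contact \<kappa> \<mu>) \<and>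
     (\<forall>B\<in>bars f g. noncollinear_bar f g B \<and> noncollinear_bar f' g' (bar_map \<phi> B) \<longrightarrow>
        total_mult f g B = total_mult f' g' (bar_map \<phi> B) \<and>
        (\<forall>T\<in>trunks_on B. trunk_point B T \<in> collinear_points f g B \<longrightarrow>
           zero_mult f g B (trunk_point B T) =
           zero_mult f' g' (bar_map \<phi> B) (trunk_point (bar_map \<phi> B) (\<phi> ` T))) \<and>
        (\<exists>\<theta>. bij_betw \<theta> (pure_zeros f g B) (pure_zeros f' g' (bar_map \<phi> B)) \<and>
           (\<forall>z\<in>pure_zeros f g B.
              zero_mult f' g' (bar_map \<phi> B) (\<theta> z) = zero_mult f g B z)))"


section \<open>Zariski equisingularity\<close>

text \<open>
  The characteristic exponents of \<open>\<xi>\<close>: the exponents occurring in \<open>\<xi>\<close> that are not multiples of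
  \<open>1/d\<close>, where \<open>d\<close> is the least common denominator of the smaller exponents of \<open>\<xi>\<close>.
\<close>

definition char_exponents :: "arc \<Rightarrow> real set" where
  "char_exponents \<xi> = {e. \<xi> e \<noteq> 0 \<and> e * real (arc_den (arc_trunc e \<xi>)) \<notin> \<int>}"

text \<open>
  The Puiseux characteristic of a branch is read off in coordinates in which it is mini-regular in
  \<open>x\<close>, i.e. \<open>x\<^sup>m\<close> occurs in \<open>p\<close> for \<open>m\<close> the multiplicity of \<open>p\<close>. A branch has a single tangent, so
  this holds for \<open>p\<close> or after exchanging \<open>x\<close> and \<open>y\<close>. All roots of a branch are conjugate and have
  the same characteristic exponents.
\<close>

definition puiseux_char :: "germ \<Rightarrow> real set" where
  "puiseux_char p =
     (let q = (if fps_nth (fps_nth p (germ_mult p)) 0 \<noteq> 0 then p else germ_swap p)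
      in THE C. \<forall>\<xi>\<in>roots q. char_exponents \<xi> = C)"

text \<open>
  Two curve germs are equisingular if there is a bijection between their branches which preserves
  the multiplicities of the branches as components, their Puiseux characteristics and the
  intersection multiplicities of pairs of distinct branches.
\<close>

definition branch_decomp :: "germ \<Rightarrow> nat \<Rightarrow> (nat \<Rightarrow> germ) \<Rightarrow> (nat \<Rightarrow> nat) \<Rightarrow> bool" where
  "branch_decomp P k p m \<longleftrightarrow>
     (\<forall>i<k. p i \<in> carrier Cxy \<and> ring_irreducible\<^bsub>Cxy\<^esub> (p i) \<and> m i > 0) \<and>
     (\<forall>i<k. \<forall>j<k. i \<noteq> j \<longrightarrow> \<not> p i \<sim>\<^bsub>Cxy\<^esub> p j) \<and>
     (\<exists>u\<in>Units Cxy. P = u * (\<Prod>i<k. p i ^ m i))"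

definition zariski_equisingular :: "germ \<Rightarrow> germ \<Rightarrow> bool" where
  "zariski_equisingular P P' \<longleftrightarrow>
     (\<exists>k p p' m. branch_decomp P k p m \<and> branch_decomp P' k p' m \<and>
        (\<forall>i<k. puiseux_char (p i) = puiseux_char (p' i)) \<and>
        (\<forall>i<k. \<forall>j<k. i \<noteq> j \<longrightarrow> int_mult (p i) (p j) = int_mult (p' i) (p' j)))"

end

theory Submission
 imports Defs "HOL-Computational_Algebra.Fundamental_Theorem_Algebra"
begin

text \<open>
  Everything is read off from the lines \<open>x = \<lambda>\<^sub>B(y) + z y\<^sup>h\<close> over the bars \<open>B\<close> of height \<open>h > 0\<close>.

  Polar roots. On such a line \<open>f\<close> and \<open>g\<close> have the leading terms \<open>y\<^sup>\<nu>\<close> with \<open>\<nu> = \<nu>\<^sub>f(B), \<nu>\<^sub>g(B)\<close> times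
  \<open>\<Prod>(z - z\<^sub>k)\<^sup>p\<close> and \<open>\<Prod>(z - z\<^sub>k)\<^sup>q\<close>, where \<open>[p, q]\<close> is the bimultiplicity at \<open>z\<^sub>k\<close>. By the chain rule the
  Wronskian of the two restrictions in \<open>y\<close> and \<open>z\<close> is the Jacobian, whose leading coefficient is
  therefore the rational function of \<open>B\<close> times \<open>\<Prod>(z - z\<^sub>k)\<^sup>p\<^sup>+\<^sup>q\<close>. Comparing it with the product over
  the roots of the Jacobian shows that those leaving the tree on \<open>B\<close> at \<open>a\<close> are as many as the
  multiplicity of \<open>a\<close> as a zero of the rational function (\<open>polar_count\<close>). So the truncated roots are
  the arcs \<open>\<lambda>\<^sub>C + a y\<^sup>h\<close> for the pure mero-zeros \<open>a\<close> of the bars \<open>C\<close> of the class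
  (\<open>count_truncated\<close>), and their number is the mero-multiplicity.

  Intersection multiplicities. The intersection of \<open>F\<close> with \<open>\<Prod>[x - \<gamma>\<^sub>j]\<close> is the sum of the orders of
  \<open>F(\<gamma>\<^sub>j(y), y)\<close> (\<open>int_mult_arc_prod\<close>). The order of \<open>f\<close> is \<open>\<nu>\<^sub>f(B)\<close> along every arc leaving \<open>B\<close>, be it a
  polar root or its truncation (\<open>order_leaving\<close>). No polar root leaves the ground bar, so there both
  factors are \<open>1\<close>; a comparison of lowest monomials shows that the Jacobian is not \<open>0\<close>.

  Equisingularity. The branches of the truncated factor are the conjugation orbits of the truncated
  roots. Their multiplicities, Puiseux characteristics and intersection numbers follow from the size
  of the orbits, the characteristic exponents of the roots and the contact orders between them
  (\<open>equisingular_arc_prod\<close>). All of this is visible in the tree. If \<open>d\<close> is the number of bars in the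
  class, an orbit has \<open>d\<close> elements if \<open>a = 0\<close>, and otherwise \<open>D\<close>, the least multiple of \<open>d\<close> with \<open>D h\<close> an
  integer. As at most one orbit has the smaller size, the number of pure mero-zeros of each
  multiplicity determines the number of orbits of each size (\<open>card_orbits\<close>). The characteristic
  exponents are the contact orders between conjugates (\<open>char_exponents_eq\<close>): those between the bars of
  the class and, if \<open>D \<noteq> d\<close> and \<open>a \<noteq> 0\<close>, also \<open>h\<close>. An orbit has equally many elements over each bar,
  hence the sum of its contact orders with another one depends on their sizes only
  (\<open>orbit_contact_sum\<close>). If the tangent is \<open>y = 0\<close>, the Puiseux characteristic refers to the exchanged
  coordinates; the inversion formula still expresses it by the exponents of \<open>x(y)\<close> (\<open>puiseux_char_swap\<close>).
\<close>

unbundle no vec_syntax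
hide_const (open) up_ring.coeff up_ring.monom Coset.order module.smult

section \<open>Substitution into power series in two variables\<close>

text \<open>\<open>G(X(t), t)\<close>. The series \<open>X\<close> has no constant term, so that terms with \<open>i > k\<close> do not meet \<open>t\<^sup>k\<close>.\<close>

definition ev :: "'a::comm_ring_1 fps \<Rightarrow> 'a fps fps \<Rightarrow> 'a fps" where
 "ev X G = Abs_fps (\<lambda>k. \<Sum>i\<le>k. (G $ i * X ^ i) $ k)"

lemma fps_mult_power_nth_eq_0:
 fixes X :: "'a::comm_ring_1 fps"
 assumes "X $ 0 = 0" "k < i"
 shows "(c * X ^ i) $ k = 0"
proof -
 have "(X ^ i) $ j = 0" if "j \<le> k" for j using startsby_zero_power_prefix[OF assms(1), of i] that assms(2) by auto
 then show ?thesis by (simp add: fps_mult_nth)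
qed

lemma ev_nth:
 fixes X :: "'a::comm_ring_1 fps"
 assumes "X $ 0 = 0" "k \<le> n"
 shows "ev X G $ k = (\<Sum>i\<le>n. G $ i * X ^ i) $ k"
proof -
 have "(\<Sum>i\<le>n. G $ i * X ^ i) $ k = (\<Sum>i\<le>n. (G $ i * X ^ i) $ k)" by (simp add: fps_sum_nth)
 also have "\<dots> = (\<Sum>i\<le>k. (G $ i * X ^ i) $ k)"
  by (rule sum.mono_neutral_right) (use assms fps_mult_power_nth_eq_0[OF assms(1)] in auto)
 finally show ?thesis by (simp add: ev_def)
qed

lemma ev_add: "ev X (G + H) = ev X G + ev X H" by (simp add: ev_def fps_eq_iff sum.distrib distrib_right)

lemma ev_uminus: "ev X (- G) = - ev X G" by (simp add: ev_def fps_eq_iff sum_negf)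

lemma ev_diff: "ev X (G - H) = ev X G - ev X H" using ev_add[of X G "- H"] by (simp add: ev_uminus)

lemma ev_0 [simp]: "ev X 0 = 0" by (simp add: ev_def fps_eq_iff)

lemma ev_const [simp]: "ev X (fps_const a) = a"
proof -
 have "(\<Sum>i\<le>k. (fps_const a $ i * X ^ i) $ k) = a $ k" for k by (subst sum.remove[of _ 0]) (auto intro!: sum.neutral)
 then show ?thesis by (simp add: ev_def fps_eq_iff)
qed

lemma ev_1 [simp]: "ev X 1 = 1" using ev_const[of X 1] by (simp del: ev_const)

lemma ev_X:
 assumes "X $ 0 = 0"
 shows "ev X fps_X = X"
proof -
 have "ev X fps_X $ k = X $ k" for k
 proof -
  have "ev X fps_X $ k = (\<Sum>i\<le>Suc k. fps_X $ i * X ^ i) $ k" by (rule ev_nth) (use assms in auto)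
  also have "(\<Sum>i\<le>Suc k. fps_X $ i * X ^ i) = X" by (subst sum.remove[of _ 1]) (auto intro!: sum.neutral simp: fps_X_def)
  finally show ?thesis .
 qed
 then show ?thesis by (simp add: fps_eq_iff)
qed

lemma fps_mult_nth_cong:
 assumes "\<And>i. i \<le> k \<Longrightarrow> a $ i = a' $ i" "\<And>i. i \<le> k \<Longrightarrow> b $ i = b' $ i"
 shows "(a * b) $ k = (a' * b') $ k" by (simp add: fps_mult_nth assms)

lemma ev_mult:
 assumes X: "X $ 0 = 0"
 shows "ev X (G * H) = ev X G * ev X H"
proof -
 have "ev X (G * H) $ k = (ev X G * ev X H) $ k" for k
 proof -
  let ?S = "\<lambda>G. \<Sum>i\<le>k. G $ i * X ^ i"
  have "(ev X G * ev X H) $ k = (?S G * ?S H) $ k" by (rule fps_mult_nth_cong) (auto simp: ev_nth[OF X])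
  also have "?S G * ?S H = (\<Sum>(i, j)\<in>{..k} \<times> {..k}. (G $ i * H $ j) * X ^ (i + j))"
   by (simp add: sum_product sum.cartesian_product power_add algebra_simps)
  also have "\<dots> $ k = (\<Sum>(i, j)\<in>{..k} \<times> {..k}. ((G $ i * H $ j) * X ^ (i + j)) $ k)"
   by (simp add: fps_sum_nth case_prod_unfold)
  also have "\<dots> = (\<Sum>(i, j)\<in>{(i, j). i + j \<le> k}. ((G $ i * H $ j) * X ^ (i + j)) $ k)" by (rule sum.mono_neutral_right)
    (auto intro!: fps_mult_power_nth_eq_0[OF X])
  also have "\<dots> = (\<Sum>s\<le>k. \<Sum>i\<le>s. ((G $ i * H $ (s - i)) * X ^ s) $ k)" by (subst sum.triangle_reindex_eq) simp
  also have "\<dots> = ev X (G * H) $ k" by (simp add: ev_def fps_mult_nth[of G H] sum_distrib_right fps_sum_nth atMost_atLeast0)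
  finally show ?thesis by simp
 qed
 then show ?thesis by (simp add: fps_eq_iff)
qed

lemma ev_power:
 assumes "X $ 0 = 0"
 shows "ev X (G ^ n) = ev X G ^ n" by (induction n) (simp_all add: ev_mult[OF assms])

lemma ev_prod_mset:
 assumes "X $ 0 = 0"
 shows "ev X (\<Prod>c\<in>#C. F c) = (\<Prod>c\<in>#C. ev X (F c))" by (induction C) (simp_all add: ev_mult[OF assms])

text \<open>Composition of the coefficients, i.e. of the inner variable, with a series.\<close>

definition cmap :: "'a::idom fps \<Rightarrow> 'a fps fps \<Rightarrow> 'a fps fps" where
 "cmap c G = Abs_fps (\<lambda>i. G $ i oo c)"

lemma cmap_nth [simp]: "cmap c G $ i = G $ i oo c" by (simp add: cmap_def)

lemma cmap_add: "cmap c (G + H) = cmap c G + cmap c H" by (simp add: fps_eq_iff fps_compose_add_distrib)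

lemma cmap_diff: "cmap c (G - H) = cmap c G - cmap c H" by (simp add: fps_eq_iff fps_compose_sub_distrib)

lemma cmap_0 [simp]: "cmap c 0 = 0" by (simp add: fps_eq_iff)

lemma cmap_const [simp]: "cmap c (fps_const a) = fps_const (a oo c)"
proof (rule fps_ext)
 fix n show "cmap c (fps_const a) $ n = fps_const (a oo c) $ n" by (cases n) auto
qed

lemma cmap_1 [simp]: "cmap c 1 = 1" using cmap_const[of c 1] by (simp del: cmap_const)

lemma cmap_X [simp]: "cmap c fps_X = fps_X"
proof (rule fps_ext)
 fix n show "cmap c fps_X $ n = fps_X $ n" by (cases "n = 1") (auto simp: fps_X_def)
qed

lemma cmap_mult:
 assumes "c $ 0 = 0"
 shows "cmap c (G * H) = cmap c G * cmap c H" by (rule fps_ext)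
  (simp add: fps_mult_nth fps_compose_sum_distrib fps_compose_mult_distrib[OF assms])

lemma cmap_prod_mset:
 assumes "c $ 0 = 0"
 shows "cmap c (\<Prod>x\<in>#C. F x) = (\<Prod>x\<in>#C. cmap c (F x))" by (induction C) (simp_all add: cmap_mult[OF assms])

lemma fps_compose_nth_cong:
 assumes "\<And>i. i \<le> k \<Longrightarrow> a $ i = b $ i"
 shows "(a oo c) $ k = (b oo c) $ k" by (simp add: fps_compose_nth assms)

lemma ev_cmap:
 fixes X c :: "'a::idom fps"
 assumes X: "X $ 0 = 0" and c: "c $ 0 = 0"
 shows "ev (X oo c) (cmap c G) = ev X G oo c"
proof (rule fps_ext)
 fix k
 have "(ev X G oo c) $ k = ((\<Sum>i\<le>k. G $ i * X ^ i) oo c) $ k" by (rule fps_compose_nth_cong) (simp add: ev_nth[OF X])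
 also have "(\<Sum>i\<le>k. G $ i * X ^ i) oo c = (\<Sum>i\<le>k. cmap c G $ i * (X oo c) ^ i)"
  by (simp add: fps_compose_sum_distrib fps_compose_mult_distrib[OF c] fps_compose_power[OF c])
 also have "\<dots> $ k = ev (X oo c) (cmap c G) $ k" by (rule ev_nth[symmetric]) (use X in auto)
 finally show "ev (X oo c) (cmap c G) $ k = (ev X G oo c) $ k" by simp
qed

lemma ramify_eq_cmap: "ramify n = cmap (fps_X ^ n)" by (auto simp: ramify_def cmap_def)

lemma fps_compose_X_power_nth:
 fixes a :: "'a::comm_ring_1 fps"
 assumes n: "0 < n"
 shows "(a oo fps_X ^ n) $ k = (if n dvd k then a $ (k div n) else 0)"
proof -
 have "(a oo fps_X ^ n) $ k = (\<Sum>i=0..k. if k = n * i then a $ i else 0)"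
  unfolding fps_compose_nth by (intro sum.cong) (auto simp flip: power_mult)
 also have "\<dots> = (if n dvd k then a $ (k div n) else 0)"
 proof (cases "n dvd k")
  case True
  then obtain j where j: "k = n * j" by auto
  have "(\<Sum>i=0..k. if k = n * i then a $ i else 0) = (\<Sum>i=0..k. if i = j then a $ i else 0)"
   using n j by (intro sum.cong) auto
  also have "\<dots> = a $ j" using n j by (simp add: sum.delta)
  finally show ?thesis using n j by simp
 qed (auto intro!: sum.neutral)
 finally show ?thesis .
qed

lemma fps_compose_X_power_inj:
 fixes a b :: "'a::idom fps"
 assumes "0 < n" "a oo fps_X ^ n = b oo fps_X ^ n"
 shows "a = b"
proof (rule fps_ext)
 fix k
 show "a $ k = b $ k" using arg_cong[OF assms(2), of "\<lambda>f. f $ (n * k)"] assms(1) by (simp add: fps_compose_X_power_nth)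
qed

lemma fps_X_power_compose_X_power:
 assumes "0 < m"
 shows "(fps_X ^ n :: 'a::idom fps) oo fps_X ^ m = fps_X ^ (m * n)"
 using assms by (simp add: fps_X_power_compose power_mult)

lemma cmap_cmap:
 fixes c d :: "'a::idom fps"
 assumes "c $ 0 = 0" "d $ 0 = 0"
 shows "cmap d (cmap c G) = cmap (c oo d) G" by (rule fps_ext) (simp add: fps_compose_assoc[OF assms(2,1)])

lemma ramify_ramify:
 assumes "0 < n" "0 < m"
 shows "ramify m (ramify n G) = ramify (n * m) G"
 using assms by (simp add: ramify_eq_cmap cmap_cmap fps_X_power_compose_X_power mult.commute)

lemma ramify_1 [simp]: "ramify 1 G = G" "ramify (Suc 0) G = G" by (simp_all add: ramify_eq_cmap fps_eq_iff)

lemma ramify_inj: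
 assumes "0 < n" "ramify n G = ramify n H"
 shows "G = H"
proof (rule fps_ext)
 fix i
 show "G $ i = H $ i" using arg_cong[OF assms(2), of "\<lambda>F. F $ i"] fps_compose_X_power_inj[OF assms(1)]
  by (auto simp: ramify_eq_cmap)
qed

lemma ramify_mult: "0 < n \<Longrightarrow> ramify n (G * H) = ramify n G * ramify n H" by (simp add: ramify_eq_cmap cmap_mult)

lemma ramify_germ_y_power: "0 < n \<Longrightarrow> ramify n (germ_y ^ E) = fps_const (fps_X ^ (n * E))"
 by (simp add: germ_y_def fps_const_power ramify_eq_cmap fps_X_power_compose_X_power)

lemma ramify_nth_0_0: "0 < n \<Longrightarrow> ramify n G $ i $ 0 = G $ i $ 0" by (simp add: ramify_eq_cmap)

section \<open>Arcs and their parametrisations\<close>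

lemma arc_denom_pos: "arc_denom n \<xi> \<Longrightarrow> 0 < n" by (simp add: arc_denom_def)

lemma arc_denom_mult:
 assumes "arc_denom n \<xi>" "0 < m"
 shows "arc_denom (n * m) \<xi>"
proof -
 have "\<exists>k'::nat. real k / real n = real k' / real (n * m)" for k
  using assms arc_denom_pos by (intro exI[of _ "k * m"]) (auto simp: field_simps)
 then show ?thesis using assms unfolding arc_denom_def by (metis mult_pos_pos)
qed

lemma arc_denom_dvd: "arc_denom n \<xi> \<Longrightarrow> n dvd m \<Longrightarrow> 0 < m \<Longrightarrow> arc_denom m \<xi>"
 using arc_denom_mult by (metis dvdE mult_0_right neq0_conv)

lemma arc_denom_imp_is_arc: "arc_denom n \<xi> \<Longrightarrow> is_arc \<xi>" by (auto simp: is_arc_def)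

lemma arc_den: "is_arc \<xi> \<Longrightarrow> arc_denom (arc_den \<xi>) \<xi>" unfolding is_arc_def arc_den_def by (rule LeastI_ex)

lemma arc_param_nth [simp]: "arc_param n \<xi> $ k = \<xi> (real k / real n)" by (simp add: arc_param_def)

lemma arc_of_param_nth [simp]:
 assumes "0 < n"
 shows "arc_of_param n \<phi> (real k / real n) = \<phi> $ k"
proof -
 have "(THE k'. real k / real n = real k' / real n) = k" using assms by (intro the_equality) auto
 then show ?thesis by (auto simp: arc_of_param_def)
qed

lemma arc_of_param_eq_0: "(\<And>k::nat. e \<noteq> real k / real n) \<Longrightarrow> arc_of_param n \<phi> e = 0" by (auto simp: arc_of_param_def)

lemma arc_denom_of_param: "0 < n \<Longrightarrow> arc_denom n (arc_of_param n \<phi>)" using arc_of_param_eq_0 unfolding arc_denom_def by metis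

lemma arc_param_of_param [simp]: "0 < n \<Longrightarrow> arc_param n (arc_of_param n \<phi>) = \<phi>" by (simp add: fps_eq_iff)

lemma arc_of_param_param [simp]:
 assumes "arc_denom n \<xi>"
 shows "arc_of_param n (arc_param n \<xi>) = \<xi>"
proof
 fix e
 show "arc_of_param n (arc_param n \<xi>) e = \<xi> e"
 proof (cases "\<exists>k::nat. e = real k / real n")
  case True
  then show ?thesis using assms arc_denom_pos by auto
 next
  case False
  then show ?thesis using assms arc_of_param_eq_0 unfolding arc_denom_def by metis
 qed
qed

lemma arc_param_inj:
 "arc_denom n \<xi> \<Longrightarrow> arc_denom n \<zeta> \<Longrightarrow> arc_param n \<xi> = arc_param n \<zeta> \<Longrightarrow> \<xi> = \<zeta>" by (metis arc_of_param_param)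

lemma arc_param_mult:
 assumes "arc_denom n \<xi>" "0 < m"
 shows "arc_param (n * m) \<xi> = arc_param n \<xi> oo fps_X ^ m"
proof (rule fps_ext)
 fix k
 show "arc_param (n * m) \<xi> $ k = (arc_param n \<xi> oo fps_X ^ m) $ k"
 proof (cases "m dvd k")
  case True
  then show ?thesis using assms(2) by (auto simp: fps_compose_X_power_nth field_simps elim!: dvdE)
 next
  case False
  have "real k / real (n * m) \<noteq> real j / real n" for j
  proof
   assume "real k / real (n * m) = real j / real n"
   then have "real k = real (j * m)" using assms arc_denom_pos[OF assms(1)] by (simp add: field_simps)
   then show False using False by (metis dvd_triv_right of_nat_eq_iff)
  qed
  then have "\<xi> (real k / real (n * m)) = 0" using assms(1) unfolding arc_denom_def by metis
  then show ?thesis using False assms(2) by (simp add: fps_compose_X_power_nth)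
 qed
qed

lemma arc_of_param_compose:
 assumes "0 < n" "0 < m"
 shows "arc_of_param (n * m) (\<phi> oo fps_X ^ m) = arc_of_param n \<phi>"
proof -
 have "arc_param (n * m) (arc_of_param n \<phi>) = \<phi> oo fps_X ^ m"
  using arc_param_mult[OF arc_denom_of_param[OF assms(1)] assms(2)] assms by simp
 then show ?thesis by (metis arc_denom_mult arc_denom_of_param arc_of_param_param assms)
qed

text \<open>The series \<open>F(\<xi>(t\<^sup>n), t\<^sup>n)\<close>.\<close>

definition arc_ev :: "nat \<Rightarrow> arc \<Rightarrow> germ \<Rightarrow> complex fps" where
 "arc_ev n \<xi> F = ev (arc_param n \<xi>) (ramify n F)"

lemma arc_ev_mult_den:
 assumes "arc_denom n \<xi>" "\<xi> 0 = 0" "0 < m"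
 shows "arc_ev (n * m) \<xi> F = arc_ev n \<xi> F oo fps_X ^ m"
proof -
 have "ramify (n * m) F = cmap (fps_X ^ m) (ramify n F)"
  using ramify_ramify[of n m F] assms arc_denom_pos by (metis ramify_eq_cmap)
 then show ?thesis using assms by (simp add: arc_ev_def arc_param_mult ev_cmap)
qed

lemma arc_ev_mult: "0 < n \<Longrightarrow> \<xi> 0 = 0 \<Longrightarrow> arc_ev n \<xi> (F * G) = arc_ev n \<xi> F * arc_ev n \<xi> G"
 by (simp add: arc_ev_def ramify_mult ev_mult)

lemma subst_arc_den:
 assumes \<xi>: "is_arc \<xi>" "\<xi> 0 = 0"
 shows "subst_arc F \<xi> = arc_of_param (arc_den \<xi>) (arc_ev (arc_den \<xi>) \<xi> F)"
proof -
 define n where "n = arc_den \<xi>"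
 have "(\<Sum>i. ((F $ i oo fps_X ^ n) * arc_param n \<xi> ^ i) $ k) = arc_ev n \<xi> F $ k" for k
 proof -
  have "(\<Sum>i. ((F $ i oo fps_X ^ n) * arc_param n \<xi> ^ i) $ k) =
    (\<Sum>i\<le>k. ((F $ i oo fps_X ^ n) * arc_param n \<xi> ^ i) $ k)"
   using \<xi>(2) by (intro suminf_finite) (auto intro!: fps_mult_power_nth_eq_0)
  then show ?thesis by (simp add: arc_ev_def ev_def ramify_def)
 qed
 then show ?thesis unfolding subst_arc_def Let_def n_def[symmetric] by (simp add: fps_nth_inverse)
qed

text \<open>
  Substitution is defined through the least denominator; ramification commutes with \<open>ev\<close>, so any other one
  does.
\<close>

lemma subst_arc_eq:
 assumes n: "arc_denom n \<xi>" and \<xi>: "\<xi> 0 = 0"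
 shows "subst_arc F \<xi> = arc_of_param n (arc_ev n \<xi> F)"
proof -
 define d where "d = arc_den \<xi>"
 have d: "arc_denom d \<xi>" using n arc_den arc_denom_imp_is_arc d_def by blast
 have "subst_arc F \<xi> = arc_of_param d (arc_ev d \<xi> F)"
  using subst_arc_den[OF arc_denom_imp_is_arc[OF n] \<xi>] by (simp add: d_def)
 also have "\<dots> = arc_of_param (d * n) (arc_ev (d * n) \<xi> F)"
  by (simp add: arc_ev_mult_den[OF d \<xi>] arc_of_param_compose arc_denom_pos[OF d] arc_denom_pos[OF n])
 also have "\<dots> = arc_of_param (n * d) (arc_ev (n * d) \<xi> F)" by (simp add: mult.commute)
 also have "\<dots> = arc_of_param n (arc_ev n \<xi> F)"
  by (simp add: arc_ev_mult_den[OF n \<xi>] arc_of_param_compose arc_denom_pos[OF d] arc_denom_pos[OF n])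
 finally show ?thesis .
qed

lemma arc_of_param_eq_0_iff: "0 < n \<Longrightarrow> arc_of_param n \<phi> = (\<lambda>_. 0) \<longleftrightarrow> \<phi> = 0"
proof
 assume n: "0 < n" and "arc_of_param n \<phi> = (\<lambda>_. 0)"
 then show "\<phi> = 0" by (metis arc_of_param_nth fps_ext fps_zero_nth)
next
 assume "\<phi> = 0"
 then show "arc_of_param n \<phi> = (\<lambda>_. 0)" by (auto simp: arc_of_param_def)
qed

subsection \<open>Orders\<close>

lemma arc_order_geI: "(\<And>e. \<xi> e \<noteq> 0 \<Longrightarrow> h \<le> ereal e) \<Longrightarrow> h \<le> arc_order \<xi>" unfolding arc_order_def by (rule INF_greatest) auto

lemma arc_order_le: "\<xi> e \<noteq> 0 \<Longrightarrow> arc_order \<xi> \<le> ereal e" unfolding arc_order_def by (rule INF_lower) auto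

lemma arc_order_eqI:
 "\<xi> h \<noteq> 0 \<Longrightarrow> (\<And>e. e < h \<Longrightarrow> \<xi> e = 0) \<Longrightarrow> arc_order \<xi> = ereal h" by (intro antisym arc_order_le arc_order_geI) (auto intro: leI)

lemma arc_order_zero [simp]: "arc_order (\<lambda>_. 0) = \<infinity>" by (simp add: arc_order_def top_ereal_def)

lemma arc_order_of_param:
 assumes "0 < n" "\<phi> \<noteq> 0"
 shows "arc_order (arc_of_param n \<phi>) = ereal (real (subdegree \<phi>) / real n)"
proof (rule arc_order_eqI)
 show "arc_of_param n \<phi> (real (subdegree \<phi>) / real n) \<noteq> 0" using assms by simp
next
 fix e assume e: "e < real (subdegree \<phi>) / real n"
 show "arc_of_param n \<phi> e = 0"
 proof (cases "\<exists>k::nat. e = real k / real n")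
  case True
  then obtain k where k: "e = real k / real n" by blast
  then have "real k / real n < real (subdegree \<phi>) / real n" using e by simp
  then have "k < subdegree \<phi>" using assms(1) by (simp only: divide_less_cancel of_nat_less_iff of_nat_0_less_iff)
  then have "\<phi> $ k = 0" by (rule nth_less_subdegree_zero)
  then show ?thesis using k assms by simp
 qed (auto intro: arc_of_param_eq_0)
qed

lemma arc_order_param:
 assumes "arc_denom n \<xi>" "\<xi> \<noteq> (\<lambda>_. 0)"
 shows "arc_order \<xi> = ereal (real (subdegree (arc_param n \<xi>)) / real n)"
proof -
 have "arc_param n \<xi> \<noteq> 0" using assms arc_of_param_param arc_of_param_eq_0_iff arc_denom_pos by metis
 then show ?thesis using arc_order_of_param[of n "arc_param n \<xi>"] assms arc_denom_pos by simp
qed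

lemma is_arc_nonneg: "is_arc \<xi> \<Longrightarrow> \<xi> e \<noteq> 0 \<Longrightarrow> 0 \<le> e" by (auto simp: is_arc_def arc_denom_def)

lemma arc_denom_common:
 assumes "is_arc \<xi>" "is_arc \<zeta>"
 obtains n where "arc_denom n \<xi>" "arc_denom n \<zeta>"
proof -
 obtain a b where "arc_denom a \<xi>" "arc_denom b \<zeta>" using assms is_arc_def by blast
 then have "arc_denom (a * b) \<xi>" "arc_denom (a * b) \<zeta>" using arc_denom_mult arc_denom_pos by (metis, metis mult.commute)
 then show ?thesis using that by blast
qed

lemma finite_arc_denom_common:
 assumes "finite A" "\<And>\<xi>. \<xi> \<in> A \<Longrightarrow> is_arc \<xi>"
 obtains n where "0 < n" "\<And>\<xi>. \<xi> \<in> A \<Longrightarrow> arc_denom n \<xi>"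
proof -
 have "\<exists>n>0. \<forall>\<xi>\<in>A. arc_denom n \<xi>" using assms
 proof (induction rule: finite_induct)
  case (insert x F)
  from insert have "\<exists>n>0. \<forall>\<xi>\<in>F. arc_denom n \<xi>" "is_arc x" by auto
  then obtain n m where n: "0 < n" "\<forall>\<xi>\<in>F. arc_denom n \<xi>" and m: "arc_denom m x" by (metis is_arc_def)
  then have "\<forall>\<xi>\<in>insert x F. arc_denom (n * m) \<xi>" using arc_denom_mult arc_denom_pos by (metis insert_iff mult.commute)
  then show ?case using n m arc_denom_pos by (meson mult_pos_pos)
 qed auto
 then show ?thesis using that by blast
qed

lemma arc_denom_diff:
 assumes "arc_denom n \<xi>" "arc_denom n \<zeta>"
 shows "arc_denom n (\<lambda>e. \<xi> e - \<zeta> e)" using assms unfolding arc_denom_def by (metis diff_self)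

lemma arc_param_diff: "arc_param n (\<lambda>e. \<xi> e - \<zeta> e) = arc_param n \<xi> - arc_param n \<zeta>" by (simp add: fps_eq_iff)

lemma is_arc_diff: "is_arc \<xi> \<Longrightarrow> is_arc \<zeta> \<Longrightarrow> is_arc (\<lambda>e. \<xi> e - \<zeta> e)"
 by (rule arc_denom_common[of \<xi> \<zeta>]) (auto intro: arc_denom_diff arc_denom_imp_is_arc)

text \<open>Exponents lie in a lattice, so a nonzero arc has a first exponent.\<close>

lemma arc_order_obtain:
 assumes "is_arc \<xi>" "\<xi> \<noteq> (\<lambda>_. 0)"
 obtains h where "\<xi> h \<noteq> 0" "\<And>e. e < h \<Longrightarrow> \<xi> e = 0" "arc_order \<xi> = ereal h"
proof -
 obtain n where n: "arc_denom n \<xi>" using assms is_arc_def by blast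
 define h where "h = real (subdegree (arc_param n \<xi>)) / real n"
 have o: "arc_order \<xi> = ereal h" using arc_order_param[OF n assms(2)] h_def by simp
 have "arc_param n \<xi> \<noteq> 0" using n assms arc_of_param_param arc_of_param_eq_0_iff arc_denom_pos by metis
 then have "\<xi> h \<noteq> 0" unfolding h_def using nth_subdegree_nonzero by (metis arc_param_nth)
 moreover have "\<xi> e = 0" if "e < h" for e using arc_order_le[of \<xi> e] o that by auto
 ultimately show ?thesis using that o by blast
qed

lemma arc_order_ge_iff: "ereal h \<le> arc_order \<xi> \<longleftrightarrow> (\<forall>e<h. \<xi> e = 0)"
 by (metis arc_order_geI arc_order_le ereal_less_eq(3) le_less_trans linorder_not_less order_trans)

lemma arc_order_gt_iff:
 assumes "is_arc \<xi>"
 shows "ereal h < arc_order \<xi> \<longleftrightarrow> (\<forall>e\<le>h. \<xi> e = 0)"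
proof (cases "\<xi> = (\<lambda>_. 0)")
 case False
 then obtain h' where "\<xi> h' \<noteq> 0" "\<And>e. e < h' \<Longrightarrow> \<xi> e = 0" "arc_order \<xi> = ereal h'" using arc_order_obtain[OF assms] by blast
 then show ?thesis by (metis ereal_less(1) less_ereal.simps(1) linorder_not_less order_le_less_trans)
qed auto

lemma arc_order_pos_iff: "is_arc \<xi> \<Longrightarrow> 0 < arc_order \<xi> \<longleftrightarrow> \<xi> 0 = 0"
 using arc_order_gt_iff[of \<xi> 0] is_arc_nonneg by (metis ereal_eq_0(2) order_antisym order_refl)

lemma contact_ge_iff: "ereal h \<le> contact \<xi> \<zeta> \<longleftrightarrow> (\<forall>e<h. \<xi> e = \<zeta> e)" unfolding contact_def arc_order_ge_iff by simp

lemma contact_gt_iff: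
 "is_arc \<xi> \<Longrightarrow> is_arc \<zeta> \<Longrightarrow> ereal h < contact \<xi> \<zeta> \<longleftrightarrow> (\<forall>e\<le>h. \<xi> e = \<zeta> e)"
 unfolding contact_def by (subst arc_order_gt_iff) (auto intro: is_arc_diff)

lemma contact_self [simp]: "contact \<xi> \<xi> = \<infinity>" by (simp add: contact_def)

lemma contact_obtain:
 assumes "is_arc \<xi>" "is_arc \<zeta>" "\<xi> \<noteq> \<zeta>"
 obtains h where "\<xi> h \<noteq> \<zeta> h" "\<And>e. e < h \<Longrightarrow> \<xi> e = \<zeta> e" "contact \<xi> \<zeta> = ereal h"
proof -
 have "(\<lambda>e. \<xi> e - \<zeta> e) \<noteq> (\<lambda>_. 0)" using assms(3) by (metis eq_iff_diff_eq_0 ext)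
 from arc_order_obtain[OF is_arc_diff[OF assms(1,2)] this] obtain h where
  "\<xi> h - \<zeta> h \<noteq> 0" "\<And>e. e < h \<Longrightarrow> \<xi> e - \<zeta> e = 0" "arc_order (\<lambda>e. \<xi> e - \<zeta> e) = ereal h" by blast
 then show ?thesis using that by (simp add: contact_def)
qed

lemma contact_eqI:
 "\<xi> h \<noteq> \<zeta> h \<Longrightarrow> (\<And>e. e < h \<Longrightarrow> \<xi> e = \<zeta> e) \<Longrightarrow> contact \<xi> \<zeta> = ereal h" unfolding contact_def by (rule arc_order_eqI) auto

lemma contact_param:
 assumes "arc_denom n \<xi>" "arc_denom n \<zeta>" "\<xi> \<noteq> \<zeta>"
 shows "contact \<xi> \<zeta> = ereal (real (subdegree (arc_param n \<xi> - arc_param n \<zeta>)) / real n)"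
proof -
 have "(\<lambda>e. \<xi> e - \<zeta> e) \<noteq> (\<lambda>_. 0)" using assms(3) by (metis eq_iff_diff_eq_0 ext)
 then show ?thesis unfolding contact_def using arc_order_param[OF arc_denom_diff[OF assms(1,2)]]
  by (simp add: arc_param_diff)
qed

section \<open>Conjugation\<close>

text \<open>The effect of the substitution \<open>y\<^sup>1\<^sup>/\<^sup>n \<mapsto> exp(2 \<pi> i k / n) y\<^sup>1\<^sup>/\<^sup>n\<close>, which does not depend on \<open>n\<close>.\<close>

definition conj_arc :: "nat \<Rightarrow> arc \<Rightarrow> arc" where
 "conj_arc k \<xi> = (\<lambda>e. cis (2 * pi * real k * e) * \<xi> e)"

definition twist :: "complex \<Rightarrow> complex fps" where
 "twist z = fps_const z * fps_X"

lemma twist_nth_0 [simp]: "twist z $ 0 = 0" by (simp add: twist_def)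

lemma compose_twist_nth: "(f oo twist z) $ k = z ^ k * f $ k" by (simp add: twist_def fps_compose_linear)

lemma conj_arc_0 [simp]: "conj_arc 0 \<xi> = \<xi>" by (simp add: conj_arc_def)

lemma conj_arc_conj_arc: "conj_arc k (conj_arc l \<xi>) = conj_arc (k + l) \<xi>"
 by (rule ext) (simp add: conj_arc_def mult.assoc[symmetric] cis_mult ring_distribs)

lemma conj_arc_eq_0_iff [simp]: "conj_arc k \<xi> e = 0 \<longleftrightarrow> \<xi> e = 0" by (simp add: conj_arc_def)

lemma arc_denom_conj [simp]: "arc_denom n (conj_arc k \<xi>) \<longleftrightarrow> arc_denom n \<xi>" by (simp add: arc_denom_def)

lemma is_arc_conj [simp]: "is_arc (conj_arc k \<xi>) \<longleftrightarrow> is_arc \<xi>" by (simp add: is_arc_def)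

lemma arc_order_conj [simp]: "arc_order (conj_arc k \<xi>) = arc_order \<xi>" by (simp add: arc_order_def)

lemma contact_conj [simp]: "contact (conj_arc k \<xi>) (conj_arc k \<zeta>) = contact \<xi> \<zeta>"
proof -
 have "(\<lambda>e. conj_arc k \<xi> e - conj_arc k \<zeta> e) = conj_arc k (\<lambda>e. \<xi> e - \<zeta> e)" by (auto simp: conj_arc_def algebra_simps)
 then show ?thesis by (simp add: contact_def)
qed

lemma conj_arc_inj: "conj_arc k \<xi> = conj_arc k \<zeta> \<Longrightarrow> \<xi> = \<zeta>" by (auto simp: conj_arc_def fun_eq_iff)

lemma arc_param_conj:
 assumes "0 < n"
 shows "arc_param n (conj_arc k \<xi>) = arc_param n \<xi> oo twist (cis (2 * pi * real k / real n))"
 by (rule fps_ext) (simp add: compose_twist_nth conj_arc_def Complex.DeMoivre algebra_simps)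

lemma cis_2pi_eq_1_iff: "cis (2 * pi * x) = 1 \<longleftrightarrow> x \<in> \<int>"
proof
 assume "cis (2 * pi * x) = 1"
 then have "cos (2 * pi * x) = 1" by (metis cis.sel(1) one_complex.sel(1))
 then obtain n :: int where "2 * pi * x = real_of_int n * 2 * pi" using cos_one_2pi_int by blast
 then have "x = real_of_int n" by simp
 then show "x \<in> \<int>" by simp
next
 assume "x \<in> \<int>"
 then show "cis (2 * pi * x) = 1" by (simp add: cis_multiple_2pi)
qed

lemma real_div_in_Ints_iff: "0 < n \<Longrightarrow> real k / real n \<in> \<int> \<longleftrightarrow> n dvd k"
proof
 assume n: "0 < n" and "real k / real n \<in> \<int>"
 then obtain j where j: "real k / real n = of_int j" by (auto elim: Ints_cases)
 then have "real_of_int (int k) = real_of_int (j * int n)" using n by (simp add: field_simps)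
 then have "int k = j * int n" by linarith
 then show "n dvd k" by (metis dvd_triv_right int_dvd_int_iff)
qed (auto elim!: dvdE)

lemma conj_arc_fix:
 assumes "arc_denom n \<xi>" "n dvd k"
 shows "conj_arc k \<xi> = \<xi>"
proof
 fix e
 show "conj_arc k \<xi> e = \<xi> e"
 proof (cases "\<xi> e = 0")
  case False
  then obtain j :: nat where j: "e = real j / real n" using assms arc_denom_def by metis
  obtain q where q: "k = n * q" using assms by auto
  have "real k * e = real (q * j)" using j q arc_denom_pos[OF assms(1)] by simp
  then have "real k * e \<in> \<int>" by (metis Ints_of_nat)
  then have "cis (2 * pi * (real k * e)) = 1" by (simp add: cis_2pi_eq_1_iff)
  then show ?thesis by (simp add: conj_arc_def mult.assoc)
 qed (simp add: conj_arc_def)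
qed

lemma conj_arc_inverse:
 assumes "is_arc \<xi>"
 obtains l where "conj_arc l (conj_arc k \<xi>) = \<xi>"
proof -
 obtain n where n: "arc_denom n \<xi>" using assms is_arc_def by blast
 define l where "l = n * k - k"
 have "l + k = n * k" using arc_denom_pos[OF n] by (simp add: l_def)
 then have "conj_arc l (conj_arc k \<xi>) = \<xi>" using conj_arc_fix[OF n, of "n * k"] by (simp add: conj_arc_conj_arc)
 then show ?thesis using that by blast
qed

lemma cmap_twist_ramify:
 assumes "0 < n" "z ^ n = 1"
 shows "cmap (twist z) (ramify n H) = ramify n H"
proof (rule fps_ext, rule fps_ext)
 fix i j
 show "cmap (twist z) (ramify n H) $ i $ j = ramify n H $ i $ j"
  using assms by (auto simp: ramify_eq_cmap compose_twist_nth fps_compose_X_power_nth power_mult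
    elim!: dvdE)
qed

lemma cis_root_power: "0 < n \<Longrightarrow> cis (2 * pi * real k / real n) ^ n = 1"
 using cis_2pi_eq_1_iff[of "real k"] by (simp add: Complex.DeMoivre)

text \<open>Invariance under \<open>t \<mapsto> \<zeta> t\<close> with \<open>\<zeta>\<close> of order \<open>n\<close> leaves only exponents divisible by \<open>n\<close>.\<close>

lemma twist_invariant_imp_ramify:
 assumes n: "0 < n" and inv: "cmap (twist (cis (2 * pi / real n))) G = G"
 obtains H where "G = ramify n H"
proof
 have *: "G $ i $ j = 0" if "\<not> n dvd j" for i j
 proof -
  have "cis (2 * pi / real n) ^ j * G $ i $ j = G $ i $ j"
   using arg_cong[OF inv, of "\<lambda>G. G $ i $ j"] by (simp add: compose_twist_nth)
  moreover have "cis (2 * pi / real n) ^ j \<noteq> 1" using cis_2pi_eq_1_iff[of "real j / real n"] that real_div_in_Ints_iff[OF n]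
   by (simp add: Complex.DeMoivre algebra_simps)
  ultimately show ?thesis by simp
 qed
 show "G = ramify n (Abs_fps (\<lambda>i. Abs_fps (\<lambda>j. G $ i $ (n * j))))"
  by (rule fps_ext, rule fps_ext) (use n * in \<open>auto simp: ramify_eq_cmap fps_compose_X_power_nth\<close>)
qed

lemma root_prod_conj:
 assumes "0 < n"
 shows "root_prod n (image_mset (conj_arc k) \<Gamma>) =
  cmap (twist (cis (2 * pi * real k / real n))) (root_prod n \<Gamma>)"
 by (simp add: root_prod_def cmap_prod_mset cmap_diff arc_param_conj[OF assms] image_mset.compositionality comp_def)

lemma root_prod_mult_den:
 assumes "0 < n" "0 < m" "\<forall>\<gamma>\<in>#\<Gamma>. arc_denom n \<gamma>"
 shows "root_prod (n * m) \<Gamma> = ramify m (root_prod n \<Gamma>)" using assms(3) by (induction \<Gamma>)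
   (use assms in \<open>auto simp: root_prod_def ramify_mult, auto simp: ramify_eq_cmap cmap_diff arc_param_mult\<close>)

section \<open>Convergence\<close>

text \<open>
  Partial sums of the majorant series. Over a set of exponents closed downwards they are
  submultiplicative, so that convergence is a matter of finite sums with a common bound.
\<close>

definition gsum :: "(nat \<times> nat) set \<Rightarrow> real \<Rightarrow> real \<Rightarrow> germ \<Rightarrow> real" where
 "gsum D r s F = (\<Sum>(i, j)\<in>D. norm (F $ i $ j) * r ^ i * s ^ j)"

definition down :: "(nat \<times> nat) set \<Rightarrow> bool" where
 "down D \<longleftrightarrow> finite D \<and> (\<forall>i j a b. (i, j) \<in> D \<longrightarrow> a \<le> i \<longrightarrow> b \<le> j \<longrightarrow> (a, b) \<in> D)"

lemma gsum_nonneg: "0 \<le> r \<Longrightarrow> 0 \<le> s \<Longrightarrow> 0 \<le> gsum D r s F" unfolding gsum_def by (intro sum_nonneg) auto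

lemma gsum_mono_set: "finite D' \<Longrightarrow> D \<subseteq> D' \<Longrightarrow> 0 \<le> r \<Longrightarrow> 0 \<le> s \<Longrightarrow> gsum D r s F \<le> gsum D' r s F"
 unfolding gsum_def by (intro sum_mono2) auto

lemma gsum_mono_radius:
 assumes "0 \<le> r" "r \<le> r'" "0 \<le> s" "s \<le> s'"
 shows "gsum D r s F \<le> gsum D r' s' F" unfolding gsum_def using assms
 by (intro sum_mono) (auto intro!: mult_mono power_mono mult_nonneg_nonneg)

lemma gsum_add: "0 \<le> r \<Longrightarrow> 0 \<le> s \<Longrightarrow> gsum D r s (F + G) \<le> gsum D r s F + gsum D r s G" unfolding gsum_def sum.distrib[symmetric]
 by (intro sum_mono) (auto simp: distrib_right[symmetric] intro!: mult_right_mono norm_triangle_ineq)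

lemma gsum_uminus [simp]: "gsum D r s (- F) = gsum D r s F" by (simp add: gsum_def)

lemma germ_mult_nth: "((F * G :: 'a::comm_ring_1 fps fps)) $ i $ j = (\<Sum>(a, b)\<in>{..i} \<times> {..j}. F $ a $ b * G $ (i - a) $ (j - b))"
 by (simp add: fps_mult_nth fps_sum_nth sum.cartesian_product atMost_atLeast0)

lemma gsum_mult:
 assumes D: "down D" and r: "0 \<le> r" "0 \<le> s"
 shows "gsum D r s (F * G) \<le> gsum D r s F * gsum D r s G"
proof -
 let ?w = "\<lambda>F (a, b). norm (F $ a $ b) * r ^ a * s ^ b"
 let ?S = "Sigma D (\<lambda>(i, j). {..i} \<times> {..j})"
 let ?f = "\<lambda>((i, j), (a, b)). ((a, b), (i - a, j - b))"
 have fin: "finite D" using D by (simp add: down_def)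
 have "gsum D r s (F * G) \<le> (\<Sum>(i, j)\<in>D. \<Sum>(a, b)\<in>{..i} \<times> {..j}. ?w F (a, b) * ?w G (i - a, j - b))" unfolding gsum_def
 proof (intro sum_mono, goal_cases)
  case (1 p)
  obtain i j where p: "p = (i, j)" by fastforce
  have "norm ((F * G) $ i $ j) * r ^ i * s ^ j \<le>
   (\<Sum>(a, b)\<in>{..i} \<times> {..j}. norm (F $ a $ b * G $ (i - a) $ (j - b))) * r ^ i * s ^ j"
   unfolding germ_mult_nth case_prod_unfold using r by (intro mult_right_mono norm_sum) auto
  also have "\<dots> = (\<Sum>(a, b)\<in>{..i} \<times> {..j}. ?w F (a, b) * ?w G (i - a, j - b))"
  proof -
   have "norm (F $ a $ b * G $ (i - a) $ (j - b)) * r ^ i * s ^ j = ?w F (a, b) * ?w G (i - a, j - b)"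
    if "a \<le> i" "b \<le> j" for a b
   proof -
    have "r ^ i = r ^ a * r ^ (i - a)" "s ^ j = s ^ b * s ^ (j - b)" using that by (simp_all flip: power_add)
    then show ?thesis by (simp add: norm_mult)
   qed
   then show ?thesis unfolding sum_distrib_right case_prod_unfold
    by (intro sum.cong refl) (simp only: mem_Times_iff atMost_iff fst_conv snd_conv)
  qed
  finally show ?case unfolding p prod.case .
 qed
 also have "\<dots> = (\<Sum>(p, q)\<in>?S. ?w F q * ?w G (fst p - fst q, snd p - snd q))"
  using fin by (subst sum.Sigma[symmetric]) (auto intro!: sum.cong)
 also have "\<dots> = (\<Sum>x\<in>?f ` ?S. ?w F (fst x) * ?w G (snd x))"
 proof (subst sum.reindex)
  show "inj_on ?f ?S" by (auto simp: inj_on_def)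
 qed (simp add: case_prod_unfold)
 also have "\<dots> \<le> (\<Sum>x\<in>D \<times> D. ?w F (fst x) * ?w G (snd x))"
 proof (rule sum_mono2)
  show "?f ` ?S \<subseteq> D \<times> D" using D unfolding down_def by auto
 qed (use fin r in \<open>auto simp: case_prod_unfold\<close>)
 also have "\<dots> = gsum D r s F * gsum D r s G"
  unfolding gsum_def sum_product by (simp add: sum.cartesian_product case_prod_unfold)
 finally show ?thesis .
qed

lemma down_box: "down ({..<n} \<times> {..<n})" by (auto simp: down_def)

lemma finite_subset_box:
 assumes "finite (D :: (nat \<times> nat) set)"
 obtains n where "D \<subseteq> {..<n} \<times> {..<n}"
proof -
 have "finite (fst ` D \<union> snd ` D)" using assms by auto
 then obtain n where n: "\<forall>x\<in>fst ` D \<union> snd ` D. x < n" by (metis finite_nat_set_iff_bounded)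
 have "p \<in> {..<n} \<times> {..<n}" if "p \<in> D" for p using n that by (cases p) force
 then show ?thesis using that by blast
qed

definition gbound :: "real \<Rightarrow> real \<Rightarrow> real \<Rightarrow> germ \<Rightarrow> bool" where
 "gbound r s C F \<longleftrightarrow> (\<forall>D. finite D \<longrightarrow> gsum D r s F \<le> C)"

lemma germ_convergent_iff: "germ_convergent F \<longleftrightarrow> (\<exists>r>0. \<exists>C. gbound r r C F)"
proof -
 have "(\<lambda>(i, j). norm (F $ i $ j) * r ^ i * r ^ j) summable_on UNIV \<longleftrightarrow> (\<exists>C. gbound r r C F)"
  if r: "r > 0" for r
 proof
  let ?f = "\<lambda>(i, j). norm (F $ i $ j) * r ^ i * r ^ j"
  assume s: "?f summable_on UNIV"
  have "gsum D r r F \<le> infsum ?f UNIV" if "finite D" for D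
   unfolding gsum_def by (rule finite_sum_le_infsum) (use s r that in auto)
  then show "\<exists>C. gbound r r C F" by (auto simp: gbound_def)
 next
  let ?f = "\<lambda>(i, j). norm (F $ i $ j) * r ^ i * r ^ j"
  assume "\<exists>C. gbound r r C F"
  then obtain C where "\<And>D. finite D \<Longrightarrow> sum ?f D \<le> C" by (auto simp: gbound_def gsum_def)
  then show "?f summable_on UNIV" using r by (intro nonneg_bdd_above_summable_on) (auto intro!: bdd_aboveI)
 qed
 then show ?thesis unfolding germ_convergent_def by auto
qed

lemma gbound_mono:
 "gbound r s C F \<Longrightarrow> 0 \<le> r' \<Longrightarrow> r' \<le> r \<Longrightarrow> 0 \<le> s' \<Longrightarrow> s' \<le> s \<Longrightarrow> gbound r' s' C F"
 unfolding gbound_def using gsum_mono_radius by (meson order_trans)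

lemma germ_convergentI:
 assumes "r > 0" "s > 0" "gbound r s C F"
 shows "germ_convergent F"
proof -
 have "gbound (min r s) (min r s) C F" by (rule gbound_mono[OF assms(3)]) (use assms in auto)
 then show ?thesis using assms unfolding germ_convergent_iff by (intro exI[of _ "min r s"]) auto
qed

lemma gbound_nonneg: "gbound r s C F \<Longrightarrow> 0 \<le> C" unfolding gbound_def by (drule spec[of _ "{}"]) (simp add: gsum_def)

lemma germ_convergent2:
 assumes "germ_convergent F" "germ_convergent G"
 obtains r A B where "r > 0" "gbound r r A F" "gbound r r B G"
proof -
 obtain r A r' B where *: "r > 0" "gbound r r A F" "r' > 0" "gbound r' r' B G" using assms germ_convergent_iff by blast
 have "gbound (min r r') (min r r') A F" "gbound (min r r') (min r r') B G"
  by (rule gbound_mono[OF *(2)], use * in auto) (rule gbound_mono[OF *(4)], use * in auto)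
 then show ?thesis using that[of "min r r'"] * by auto
qed

lemma germ_convergent_add:
 assumes "germ_convergent F" "germ_convergent G"
 shows "germ_convergent (F + G)"
proof -
 obtain r A B where r: "r > 0" and "gbound r r A F" "gbound r r B G" using germ_convergent2[OF assms] .
 then have "gbound r r (A + B) (F + G)" unfolding gbound_def by (smt (verit) gsum_add)
 then show ?thesis using r germ_convergentI by blast
qed

lemma germ_convergent_mult:
 assumes "germ_convergent F" "germ_convergent G"
 shows "germ_convergent (F * G)"
proof -
 obtain r A B where r: "r > 0" and AB: "gbound r r A F" "gbound r r B G" using germ_convergent2[OF assms] .
 have "gsum D r r (F * G) \<le> A * B" if D: "finite D" for D
 proof -
  obtain n where "D \<subseteq> {..<n} \<times> {..<n}" using D finite_subset_box by blast
  let ?E = "{..<n} \<times> {..<n}"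
  have "gsum D r r (F * G) \<le> gsum ?E r r (F * G)" using \<open>D \<subseteq> ?E\<close> r by (intro gsum_mono_set) auto
  also have "\<dots> \<le> gsum ?E r r F * gsum ?E r r G" using r by (intro gsum_mult down_box) auto
  also have "\<dots> \<le> A * B" using AB r gbound_nonneg[OF AB(1)] unfolding gbound_def by (intro mult_mono gsum_nonneg) auto
  finally show ?thesis .
 qed
 then have "gbound r r (A * B) (F * G)" by (simp add: gbound_def)
 then show ?thesis using r germ_convergentI by blast
qed

lemma germ_convergent_uminus [simp]: "germ_convergent (- F) \<longleftrightarrow> germ_convergent F" by (simp add: germ_convergent_def)

lemma germ_convergent_diff:
 "germ_convergent F \<Longrightarrow> germ_convergent G \<Longrightarrow> germ_convergent (F - G)" using germ_convergent_add[of F "- G"] by simp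

lemma germ_convergent_finite:
 assumes "finite {(i, j). F $ i $ j \<noteq> 0}"
 shows "germ_convergent F"
proof -
 let ?N = "{(i, j). F $ i $ j \<noteq> 0}"
 have "gsum D 1 1 F \<le> gsum ?N 1 1 F" if "finite D" for D
 proof -
  have "gsum D 1 1 F = gsum (D \<inter> ?N) 1 1 F" unfolding gsum_def using that by (intro sum.mono_neutral_right) auto
  also have "\<dots> \<le> gsum ?N 1 1 F" using assms by (intro gsum_mono_set) auto
  finally show ?thesis .
 qed
 then show ?thesis using germ_convergentI[of 1 1 _ F] by (auto simp: gbound_def)
qed

lemma germ_convergent_bounded:
 assumes "\<And>i j. N \<le> i \<or> M \<le> j \<Longrightarrow> F $ i $ j = 0"
 shows "germ_convergent F"
proof (rule germ_convergent_finite)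
 have "F $ i $ j \<noteq> 0 \<Longrightarrow> i < N \<and> j < M" for i j using assms[of i j] by (metis not_le)
 then have "{(i, j). F $ i $ j \<noteq> 0} \<subseteq> {..<N} \<times> {..<M}" by auto
 then show "finite {(i, j). F $ i $ j \<noteq> 0}" by (rule finite_subset) auto
qed

lemma germ_convergent_reindex:
 assumes F: "germ_convergent F"
  and H: "\<And>i j. H $ i $ j = 0 \<or> norm (H $ i $ j) \<le> K * norm (F $ (i + a) $ (j + b))"
  and K: "0 \<le> K"
 shows "germ_convergent H"
proof -
 obtain r C where r: "r > 0" and C: "gbound r r C F" using F germ_convergent_iff by blast
 have "gsum D r r H \<le> K * C / (r ^ a * r ^ b)" if "finite D" for D
 proof -
  have *: "norm (H $ i $ j) \<le> K * norm (F $ (i + a) $ (j + b))" for i j using H[of i j] K by auto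
  have "gsum D r r H \<le> (\<Sum>(i, j)\<in>D. K * norm (F $ (i + a) $ (j + b)) * r ^ i * r ^ j)"
   unfolding gsum_def using r by (intro sum_mono) (auto intro!: mult_right_mono *)
  also have "\<dots> = K / (r ^ a * r ^ b) * (\<Sum>(i, j)\<in>D. norm (F $ (i + a) $ (j + b)) * r ^ (i + a) * r ^ (j + b))"
   unfolding sum_distrib_left by (intro sum.cong) (use r in \<open>auto simp: power_add\<close>)
  also have "(\<Sum>(i, j)\<in>D. norm (F $ (i + a) $ (j + b)) * r ^ (i + a) * r ^ (j + b)) =
    gsum ((\<lambda>(i, j). (i + a, j + b)) ` D) r r F"
   unfolding gsum_def by (subst sum.reindex) (auto simp: inj_on_def intro!: sum.cong)
  also have "\<dots> \<le> C" using C that by (auto simp: gbound_def)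
  finally show ?thesis using r K by (simp add: mult_left_mono divide_right_mono)
 qed
 then show ?thesis using r germ_convergentI unfolding gbound_def by blast
qed

lemma germ_convergent_shift: "germ_convergent F \<Longrightarrow> germ_convergent (fps_shift m F)"
 by (rule germ_convergent_reindex[of F _ 1 m 0]) auto

lemma germ_convergent_cutoff: "germ_convergent F \<Longrightarrow> germ_convergent (fps_cutoff m F)"
 by (rule germ_convergent_reindex[of F _ 1 0 0]) auto

lemma germ_const_nth: "germ_const c $ i $ j = (if i = 0 \<and> j = 0 then c else 0)"
 by (cases i; cases j) (auto simp: germ_const_def)

lemma germ_convergent_1 [simp]: "germ_convergent 1"
 and germ_convergent_0 [simp]: "germ_convergent 0"
 and germ_convergent_X [simp]: "germ_convergent fps_X"
 and germ_convergent_y [simp]: "germ_convergent germ_y"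
 and germ_convergent_const [simp]: "germ_convergent (germ_const c)"
proof -
 have *: "germ_convergent F" if "\<And>i j. 2 \<le> i \<or> 2 \<le> j \<Longrightarrow> F $ i $ j = 0" for F using that by (rule germ_convergent_bounded)
 have y: "germ_y $ i = (if i = 0 then fps_X else 0)" for i by (cases i) (auto simp: germ_y_def)
 show "germ_convergent 1" by (rule *) (auto simp: fps_one_nth)
 show "germ_convergent 0" by (rule *) simp
 show "germ_convergent fps_X" by (rule *) (auto simp: fps_X_nth fps_one_nth)
 show "germ_convergent germ_y" by (rule *) (auto simp: y fps_X_nth)
 show "germ_convergent (germ_const c)" by (rule *) (auto simp: germ_const_nth)
qed

lemma germ_convergent_power: "germ_convergent F \<Longrightarrow> germ_convergent (F ^ n)"
 by (induction n) (auto intro: germ_convergent_mult)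

lemma germ_convergent_sum: "(\<And>x. x \<in> A \<Longrightarrow> germ_convergent (F x)) \<Longrightarrow> germ_convergent (sum F A)"
 by (induction A rule: infinite_finite_induct) (auto intro: germ_convergent_add)

lemma germ_convergent_prod_mset: "(\<And>x. x \<in># A \<Longrightarrow> germ_convergent (F x)) \<Longrightarrow> germ_convergent (\<Prod>x\<in>#A. F x)"
 by (induction A) (auto intro: germ_convergent_mult)

abbreviation fps_convergent :: "complex fps \<Rightarrow> bool" where
 "fps_convergent f \<equiv> germ_convergent (fps_const f)"

lemma germ_convergent_nth:
 assumes "germ_convergent F"
 shows "fps_convergent (F $ i)"
proof (rule germ_convergent_reindex[OF assms, of _ 1 i 0])
 fix k j show "fps_const (F $ i) $ k $ j = 0 \<or> norm (fps_const (F $ i) $ k $ j) \<le> 1 * norm (F $ (k + i) $ (j + 0))"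
  by (cases k) auto
qed simp

lemma fps_convergent_add: "fps_convergent f \<Longrightarrow> fps_convergent g \<Longrightarrow> fps_convergent (f + g)"
 using germ_convergent_add by (metis fps_const_add)

lemma fps_convergent_mult: "fps_convergent f \<Longrightarrow> fps_convergent g \<Longrightarrow> fps_convergent (f * g)"
 using germ_convergent_mult by (metis fps_const_mult)

lemma fps_convergent_sum: "(\<And>x. x \<in> A \<Longrightarrow> fps_convergent (f x)) \<Longrightarrow> fps_convergent (sum f A)"
 by (induction A rule: infinite_finite_induct) (auto intro: fps_convergent_add)

lemma fps_convergent_power: "fps_convergent f \<Longrightarrow> fps_convergent (f ^ n)"
 using germ_convergent_power by (metis fps_const_power)

lemma fps_convergent_const [simp]: "fps_convergent (fps_const c)"
 using germ_convergent_const[of c] by (simp add: germ_const_def)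

lemma fps_convergent_X [simp]: "fps_convergent fps_X" using germ_convergent_y by (simp add: germ_y_def)

lemma fps_convergent_shift:
 assumes "fps_convergent f"
 shows "fps_convergent (fps_shift m f)"
proof (rule germ_convergent_reindex[OF assms, of _ 1 0 m])
 fix i j show "fps_const (fps_shift m f) $ i $ j = 0 \<or>
  norm (fps_const (fps_shift m f) $ i $ j) \<le> 1 * norm (fps_const f $ (i + 0) $ (j + m))" by (cases i) auto
qed simp

lemma germ_convergent_radii:
 "germ_convergent F \<longleftrightarrow> (\<exists>r>0. \<exists>s>0. (\<lambda>(i, j). norm (F $ i $ j) * r ^ i * s ^ j) summable_on UNIV)"
proof
 assume "\<exists>r>0. \<exists>s>0. (\<lambda>(i, j). norm (F $ i $ j) * r ^ i * s ^ j) summable_on UNIV"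
 then obtain r s where rs: "r > 0" "s > 0" "(\<lambda>(i, j). norm (F $ i $ j) * r ^ i * s ^ j) summable_on UNIV" by blast
 have "norm (F $ i $ j) * min r s ^ i * min r s ^ j \<le> norm (F $ i $ j) * r ^ i * s ^ j" for i j
  using rs(1,2) by (intro mult_mono power_mono) auto
 then have "(\<lambda>(i, j). norm (F $ i $ j) * min r s ^ i * min r s ^ j) summable_on UNIV"
  by (intro summable_on_comparison_test[OF rs(3)]) (use rs(1,2) in auto)
 then show "germ_convergent F" unfolding germ_convergent_def using rs(1,2) by (intro exI[of _ "min r s"]) simp
qed (unfold germ_convergent_def, blast)

lemma germ_convergent_ramify_iff:
 assumes n: "0 < n"
 shows "germ_convergent (ramify n F) \<longleftrightarrow> germ_convergent F"
proof -
 let ?f = "\<lambda>(i :: nat, j). (i, n * j)"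
 have eq: "(\<lambda>(i, j). norm (ramify n F $ i $ j) * r ^ i * s ^ j) summable_on UNIV \<longleftrightarrow>
   (\<lambda>(i, j). norm (F $ i $ j) * r ^ i * (s ^ n) ^ j) summable_on UNIV" for r s
 proof -
  have "(\<lambda>(i, j). norm (ramify n F $ i $ j) * r ^ i * s ^ j) summable_on UNIV \<longleftrightarrow>
    (\<lambda>(i, j). norm (ramify n F $ i $ j) * r ^ i * s ^ j) summable_on range ?f"
  proof (intro summable_on_cong_neutral)
   fix p assume "p \<in> UNIV - range ?f"
   moreover obtain i j where p: "p = (i, j)" by fastforce
   moreover have "(i, j) \<in> range ?f" if "n dvd j" using that by (auto simp: dvd_def)
   ultimately have "\<not> n dvd j" by blast
   then show "(\<lambda>(i, j). norm (ramify n F $ i $ j) * r ^ i * s ^ j) p = 0"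
    using n by (simp add: p ramify_eq_cmap fps_compose_X_power_nth)
  qed auto
  also have "\<dots> \<longleftrightarrow> ((\<lambda>(i, j). norm (ramify n F $ i $ j) * r ^ i * s ^ j) \<circ> ?f) summable_on UNIV"
   using n by (intro summable_on_reindex) (auto simp: inj_on_def)
  also have "(\<lambda>(i, j). norm (ramify n F $ i $ j) * r ^ i * s ^ j) \<circ> ?f = (\<lambda>(i, j). norm (F $ i $ j) * r ^ i * (s ^ n) ^ j)"
   using n by (simp add: fun_eq_iff ramify_eq_cmap fps_compose_X_power_nth power_mult)
  finally show ?thesis .
 qed
 have "0 < s ^ n" "0 < root n s" "root n s ^ n = s" if "0 < s" for s :: real using n that by simp_all
 then have root: "(\<exists>s>0. P (s ^ n)) \<longleftrightarrow> (\<exists>s>0. P s)" for P :: "real \<Rightarrow> bool" by metis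
 show ?thesis unfolding germ_convergent_radii eq
  by (simp only: root[of "\<lambda>s. (\<lambda>(i, j). norm (F $ i $ j) * r ^ i * s ^ j) summable_on UNIV" for r])
qed

lemma fps_convergent_compose_X_power:
 assumes "0 < n" "fps_convergent f"
 shows "fps_convergent (f oo fps_X ^ n)"
proof -
 have "ramify n (fps_const f) = fps_const (f oo fps_X ^ n)" by (simp add: ramify_eq_cmap)
 then show ?thesis using germ_convergent_ramify_iff[OF assms(1), of "fps_const f"] assms(2) by simp
qed

section \<open>Weierstrass division\<close>

lemma germ_y_mult_nth: "(germ_y * F) $ i $ j = (if j = 0 then 0 else F $ i $ (j - 1))" by (simp add: germ_y_def)

text \<open>
  Division by \<open>x\<^sup>m + y E\<close> amounts to solving \<open>H = G - y E Q(H)\<close>, where \<open>H = x\<^sup>m Q(H) + R(H)\<close> with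
  \<open>R(H)\<close> of degree less than \<open>m\<close> in \<open>x\<close>. The solution is the Neumann series, formally convergent because
  each step raises the order in \<open>y\<close>. On the sets of exponents \<open>i + (m + 1) j < n\<close>, which the operator
  respects, its norm is at most \<open>1/2\<close> when \<open>y\<close> is small against \<open>x\<close>; this bounds \<open>H\<close>.
\<close>

lemma weierstrass_division:
 fixes E G :: germ
 assumes E: "germ_convergent E" and G: "germ_convergent G"
 obtains Q R where "germ_convergent Q" "germ_convergent R" "G = (fps_X ^ m + germ_y * E) * Q + R"
  "\<And>i. m \<le> i \<Longrightarrow> R $ i = 0"
proof -
 define T where "T H = - (E * (germ_y * fps_shift m H))" for H :: germ
 have T_add: "T (A + B) = T A + T B" for A B by (simp add: T_def fps_shift_add algebra_simps)
 have T_0: "T 0 = 0" by (simp add: T_def)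
 have T_sum: "T (\<Sum>k\<in>S. A k) = (\<Sum>k\<in>S. T (A k))" for A :: "nat \<Rightarrow> germ" and S
  by (induction S rule: infinite_finite_induct) (auto simp: T_add T_0)
 have T_nth: "T A $ i $ j = T B $ i $ j" if "\<And>i j'. j' < j \<Longrightarrow> A $ i $ j' = B $ i $ j'" for A B i j
  unfolding T_def fps_neg_nth germ_mult_nth[of E]
  by (intro arg_cong[of _ _ uminus] sum.cong) (auto simp: germ_y_mult_nth that)
 have T_pow: "(T ^^ k) G $ i $ j = 0" if "j < k" for i j k using that
 proof (induction k arbitrary: i j)
  case (Suc k)
  have "T ((T ^^ k) G) $ i $ j = T 0 $ i $ j" using Suc by (intro T_nth) auto
  then show ?case by (simp add: T_0)
 qed simp
 define H :: germ where "H = Abs_fps (\<lambda>i. Abs_fps (\<lambda>j. \<Sum>k\<le>j. (T ^^ k) G $ i $ j))"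
 have H: "H = G + T H"
 proof (rule fps_ext, rule fps_ext)
  fix i j
  define P where "P = (\<Sum>k\<le>j. (T ^^ k) G)"
  have HP: "H $ i $ j' = P $ i $ j'" if "j' \<le> j" for i j'
  proof -
   have "P $ i $ j' = (\<Sum>k\<le>j. (T ^^ k) G $ i $ j')" by (simp add: P_def fps_sum_nth)
   also have "\<dots> = (\<Sum>k\<le>j'. (T ^^ k) G $ i $ j')" by (rule sum.mono_neutral_right) (use that T_pow in auto)
   finally show ?thesis by (simp add: H_def)
  qed
  have "T H $ i $ j = T P $ i $ j" by (rule T_nth) (simp add: HP)
  also have "\<dots> = (\<Sum>k\<le>j. (T ^^ Suc k) G $ i $ j)" by (simp add: P_def T_sum fps_sum_nth)
  also have "G $ i $ j + \<dots> = (\<Sum>k\<le>Suc j. (T ^^ k) G $ i $ j)" by (subst sum.atMost_Suc_shift) simp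
  also have "\<dots> = H $ i $ j" using T_pow[of j "Suc j" i] by (simp add: H_def)
  finally show "H $ i $ j = (G + T H) $ i $ j" by simp
 qed
 obtain r A B where r: "r > 0" and A: "gbound r r A E" and B: "gbound r r B G" using germ_convergent2[OF E G] .
 have A0: "0 \<le> A" using gbound_nonneg[OF A] .
 \<comment> \<open>with this choice the operator has norm at most \<open>1/2\<close>\<close>
 define s where "s = min r (r ^ m / (2 * (A + 1)))"
 have s: "0 < s" "s \<le> r" using r A0 by (auto simp: s_def)
 have As: "A * (s / r ^ m) \<le> 1 / 2"
 proof -
  have "s / r ^ m \<le> 1 / (2 * (A + 1))" using r A0 min.cobounded2[of r "r ^ m / (2 * (A + 1))"] unfolding s_def[symmetric]
   by (simp add: field_simps)
  then have "A * (s / r ^ m) \<le> A * (1 / (2 * (A + 1)))" using A0 by (rule mult_left_mono)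
  also have "\<dots> \<le> 1 / 2" using A0 by (simp add: field_simps)
  finally show ?thesis .
 qed
 define D where "D n = {(i, j). i + Suc m * j < n}" for n
 have "D n \<subseteq> {..<n} \<times> {..<n}" for n by (auto simp: D_def)
 then have fin: "finite (D n)" for n using finite_subset by blast
 have down: "down (D n)" for n unfolding down_def
 proof (intro conjI allI impI fin)
  fix i j a b assume "(i, j) \<in> D n" "a \<le> i" "b \<le> j"
  moreover from this have "a + Suc m * b \<le> i + Suc m * j" by (intro add_mono mult_le_mono) auto
  ultimately show "(a, b) \<in> D n" by (auto simp: D_def)
 qed
 have shift: "gsum (D n) r s (germ_y * fps_shift m H) \<le> s / r ^ m * gsum (D n) r s H" for n
 proof -
  let ?D = "D n \<inter> {(i, j). 0 < j}"
  let ?f = "\<lambda>(i, j). (i + m, j - 1)"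
  have "gsum (D n) r s (germ_y * fps_shift m H) = gsum ?D r s (germ_y * fps_shift m H)"
   unfolding gsum_def using fin by (intro sum.mono_neutral_right) (auto simp: germ_y_mult_nth split: if_splits)
  also have "\<dots> = s / r ^ m * (\<Sum>(i, j)\<in>?D. norm (H $ (i + m) $ (j - 1)) * r ^ (i + m) * s ^ (j - 1))"
   unfolding gsum_def sum_distrib_left
  proof (intro sum.cong refl, clarify)
   fix i j :: nat assume "0 < j"
   then have "s ^ j = s * s ^ (j - 1)" by (metis power_eq_if neq0_conv)
   then show "norm ((germ_y * fps_shift m H) $ i $ j) * r ^ i * s ^ j =
    s / r ^ m * (norm (H $ (i + m) $ (j - 1)) * r ^ (i + m) * s ^ (j - 1))"
    using \<open>0 < j\<close> r by (simp add: germ_y_mult_nth power_add)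
  qed
  also have "(\<Sum>(i, j)\<in>?D. norm (H $ (i + m) $ (j - 1)) * r ^ (i + m) * s ^ (j - 1)) = gsum (?f ` ?D) r s H"
   unfolding gsum_def by (subst sum.reindex) (auto simp: inj_on_def intro!: sum.cong)
  also have "\<dots> \<le> gsum (D n) r s H"
  proof (rule gsum_mono_set)
   show "?f ` ?D \<subseteq> D n"
   proof clarify
    fix i j :: nat assume j: "0 < j" and "(i, j) \<in> D n"
    then have "i + Suc m * j < n" by (simp add: D_def)
    moreover obtain l where "j = Suc l" using j gr0_implies_Suc by blast
    ultimately have "i + m + Suc m * (j - 1) < n" by simp
    then show "(i + m, j - 1) \<in> D n" by (simp add: D_def)
   qed
  qed (use fin r s in auto)
  finally show ?thesis using r s by (simp add: mult_left_mono divide_right_mono)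
 qed
 have HD: "gsum (D n) r s H \<le> 2 * B" for n
 proof -
  have "gsum (D n) r s H \<le> gsum (D n) r s G + gsum (D n) r s (T H)"
   using gsum_add[of r s "D n" G "T H"] r s by (simp flip: H)
  also have "gsum (D n) r s (T H) \<le> gsum (D n) r s E * gsum (D n) r s (germ_y * fps_shift m H)"
   unfolding T_def gsum_uminus using r s by (intro gsum_mult down) auto
  also have "\<dots> \<le> A * (s / r ^ m * gsum (D n) r s H)"
  proof (intro mult_mono shift A0 gsum_nonneg)
   have "gsum (D n) r s E \<le> gsum (D n) r r E" using r s by (intro gsum_mono_radius) auto
   also have "\<dots> \<le> A" using A fin by (auto simp: gbound_def)
   finally show "gsum (D n) r s E \<le> A" .
  qed (use r s in auto)
  also have "\<dots> = A * (s / r ^ m) * gsum (D n) r s H" by simp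
  also have "\<dots> \<le> 1 / 2 * gsum (D n) r s H" using r s by (intro mult_right_mono As gsum_nonneg) auto
  also have "gsum (D n) r s G \<le> B"
  proof -
   have "gsum (D n) r s G \<le> gsum (D n) r r G" using r s by (intro gsum_mono_radius) auto
   also have "\<dots> \<le> B" using B fin by (auto simp: gbound_def)
   finally show ?thesis .
  qed
  finally show ?thesis by simp
 qed
 have "gbound r s (2 * B) H" unfolding gbound_def
 proof (intro allI impI)
  fix D' :: "(nat \<times> nat) set" assume "finite D'"
  then obtain n where n: "D' \<subseteq> {..<n} \<times> {..<n}" using finite_subset_box by blast
  have "D' \<subseteq> D (n + Suc m * n)"
  proof
   fix p assume "p \<in> D'"
   moreover obtain i j where p: "p = (i, j)" by fastforce
   ultimately have "i < n" "j \<le> n" using n by auto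
   then have "i + Suc m * j < n + Suc m * n" by (intro add_less_le_mono mult_le_mono2) auto
   then show "p \<in> D (n + Suc m * n)" by (simp add: D_def p)
  qed
  then have "gsum D' r s H \<le> gsum (D (n + Suc m * n)) r s H" using r s fin by (intro gsum_mono_set) auto
  then show "gsum D' r s H \<le> 2 * B" using HD order_trans by blast
 qed
 then have Hc: "germ_convergent H" using r s germ_convergentI by blast
 show ?thesis
 proof (rule that)
  show "germ_convergent (fps_shift m H)" "germ_convergent (fps_cutoff m H)"
   using Hc germ_convergent_shift germ_convergent_cutoff by auto
  have "(fps_X ^ m + germ_y * E) * fps_shift m H + fps_cutoff m H =
    (fps_shift m H * fps_X ^ m + fps_cutoff m H) - T H" by (simp add: T_def algebra_simps)
  also have "\<dots> = H - T H" by (simp only: fps_shift_cutoff)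
  also have "\<dots> = G" using H by (metis add_diff_cancel_right')
  finally show "G = (fps_X ^ m + germ_y * E) * fps_shift m H + fps_cutoff m H" ..
 qed auto
qed

subsection \<open>Units\<close>

lemma germ_mult_nth_0_0: "((F * G :: 'a::comm_ring_1 fps fps)) $ 0 $ 0 = F $ 0 $ 0 * G $ 0 $ 0" by simp

lemma germ_mult_eq_1_nth:
 fixes F :: "'a::comm_ring_1 fps fps"
 shows "F * G = 1 \<Longrightarrow> F $ 0 $ 0 * G $ 0 $ 0 = 1" using germ_mult_nth_0_0[of F G] by simp

lemma germ_swap_nth [simp]: "germ_swap F $ i $ j = F $ j $ i" by (simp add: germ_swap_def)

lemma germ_swap_swap [simp]: "germ_swap (germ_swap F) = F" by (rule fps_ext, rule fps_ext) simp

lemma germ_swap_mult: "germ_swap (F * G) = germ_swap F * germ_swap G"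
proof (rule fps_ext, rule fps_ext)
 fix i j
 have "germ_swap (F * G) $ i $ j = (\<Sum>a=0..j. \<Sum>b=0..i. F $ a $ b * G $ (j - a) $ (i - b))"
  by (simp add: fps_mult_nth fps_sum_nth)
 also have "\<dots> = (\<Sum>b=0..i. \<Sum>a=0..j. F $ a $ b * G $ (j - a) $ (i - b))" by (rule sum.swap)
 also have "\<dots> = (germ_swap F * germ_swap G) $ i $ j" by (simp add: fps_mult_nth fps_sum_nth)
 finally show "germ_swap (F * G) $ i $ j = (germ_swap F * germ_swap G) $ i $ j" .
qed

lemma germ_swap_0: "germ_swap F = 0 \<longleftrightarrow> F = 0" by (metis (no_types, lifting) fps_ext fps_zero_nth germ_swap_nth)

lemma germ_convergent_swap: "germ_convergent (germ_swap F) \<longleftrightarrow> germ_convergent F"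
proof -
 have *: "germ_convergent (germ_swap F)" if "germ_convergent F" for F
 proof -
  obtain r where r: "r > 0" "(\<lambda>(i, j). norm (F $ i $ j) * r ^ i * r ^ j) summable_on UNIV"
   using \<open>germ_convergent F\<close> by (auto simp: germ_convergent_def)
  have "(\<lambda>p. (\<lambda>(i, j). norm (F $ i $ j) * r ^ i * r ^ j) (prod.swap p)) summable_on UNIV"
   using r(2) by (subst summable_on_reindex_bij_betw[OF bij_swap]) auto
  then show ?thesis unfolding germ_convergent_def using r(1) by (intro exI[of _ r]) (simp add: case_prod_beta' mult_ac)
 qed
 show ?thesis using *[of F] *[of "germ_swap F"] by auto
qed

text \<open>
  Division by \<open>1 + y E\<close> inverts the germs with constant \<open>F(x, 0)\<close>. After exchanging the variables this
  applies to the inverse \<open>S\<close> of \<open>F(x, 0)\<close>, and then to \<open>F S\<close>.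
\<close>

lemma germ_convergent_unit:
 assumes "germ_convergent F" "F $ 0 $ 0 \<noteq> 0"
 obtains G where "germ_convergent G" "F * G = 1" "G $ 0 $ 0 \<noteq> 0"
proof -
 have const: "\<exists>G. germ_convergent G \<and> F * G = 1"
  if F: "germ_convergent F" "F $ 0 $ 0 \<noteq> 0" "\<And>i. 0 < i \<Longrightarrow> F $ i $ 0 = 0" for F :: germ
 proof -
  define c where "c = F $ 0 $ 0"
  define E where "E = germ_const (1 / c) * Abs_fps (\<lambda>i. fps_shift 1 (F $ i))"
  have "germ_convergent (Abs_fps (\<lambda>i. fps_shift 1 (F $ i)))" by (rule germ_convergent_reindex[OF F(1), of _ 1 0 1]) auto
  then have "germ_convergent E" by (simp add: E_def germ_convergent_mult)
  then obtain Q R where Q: "germ_convergent Q" "1 = (fps_X ^ 0 + germ_y * E) * Q + R" "\<And>i. 0 \<le> i \<Longrightarrow> R $ i = 0"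
   by (rule weierstrass_division[of E 1 0]) (simp, blast)
  have "R = 0" by (rule fps_ext) (simp add: Q(3))
  then have Q': "(1 + germ_y * E) * Q = 1" using Q(2) by simp
  have c: "germ_const c * germ_const (1 / c) = 1" using F(2) by (simp add: germ_const_def c_def)
  then have "germ_const c * (1 + germ_y * E) = germ_const c + germ_y * Abs_fps (\<lambda>i. fps_shift 1 (F $ i))"
   by (simp add: distrib_left mult.left_commute[of _ germ_y] E_def c flip: mult.assoc[of "germ_const c"])
  also have "\<dots> = F" by (rule fps_ext, rule fps_ext) (use F(3) in \<open>auto simp: germ_const_nth germ_y_mult_nth c_def\<close>)
  finally have F': "F = germ_const c * (1 + germ_y * E)" by (rule sym)
  have "F * (germ_const (1 / c) * Q) = germ_const c * germ_const (1 / c) * ((1 + germ_y * E) * Q)"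
   by (subst F') (simp only: mult_ac)
  then have "F * (germ_const (1 / c) * Q) = 1" by (simp add: Q' c)
  then show ?thesis using Q(1) germ_convergent_mult germ_convergent_const by blast
 qed
 define A :: germ where "A = Abs_fps (\<lambda>i. fps_const (F $ i $ 0))"
 have "germ_convergent A" by (rule germ_convergent_reindex[OF assms(1), of _ 1 0 0]) (auto simp: A_def)
 then obtain S where S: "germ_convergent S" "germ_swap A * S = 1"
  using const[of "germ_swap A"] assms(2) by (auto simp: germ_convergent_swap A_def)
 have "germ_swap 1 = 1" by (rule fps_ext, rule fps_ext) (simp add: fps_one_nth)
 then have AS: "A * germ_swap S = 1" using arg_cong[OF S(2), of germ_swap] by (simp add: germ_swap_mult)
 have "(F * germ_swap S) $ i $ 0 = (A * germ_swap S) $ i $ 0" for i by (simp add: fps_mult_nth fps_sum_nth A_def)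
 then have "(F * germ_swap S) $ i $ 0 = (if i = 0 then 1 else 0)" for i by (simp add: AS fps_one_nth)
 moreover have "germ_convergent (F * germ_swap S)"
  using assms(1) S(1) by (simp add: germ_convergent_mult germ_convergent_swap)
 ultimately have "\<exists>G. germ_convergent G \<and> F * germ_swap S * G = 1" by (intro const) (simp_all del: fps_mult_nth_0)
 then obtain G where G: "germ_convergent G" "F * germ_swap S * G = 1" by blast
 then have "F * (germ_swap S * G) = 1" by (simp add: mult.assoc)
 moreover have "germ_convergent (germ_swap S * G)" using G(1) S(1) by (simp add: germ_convergent_mult germ_convergent_swap)
 moreover from calculation have "(germ_swap S * G) $ 0 $ 0 \<noteq> 0" using germ_mult_eq_1_nth by force
 ultimately show ?thesis using that by blast
qed

lemma fps_convergent_inverse: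
 assumes "fps_convergent f" "f $ 0 \<noteq> 0"
 shows "fps_convergent (inverse f)"
proof -
 have "f * inverse f = 1" using assms by (simp add: inverse_mult_eq_1')
 then have inv: "fps_const f * fps_const (inverse f) = 1" by (simp add: fps_const_mult)
 obtain G where G: "germ_convergent G" "fps_const f * G = 1" using germ_convergent_unit[OF assms(1)] assms(2) by auto
 have "G = fps_const (inverse f)" using inv G(2) by (metis mult.left_commute mult.right_neutral)
 then show ?thesis using G(1) by simp
qed

lemma Cxy_simps [simp]:
 "carrier Cxy = {F. germ_convergent F}" "mult Cxy = (*)" "one Cxy = 1" "zero Cxy = 0" "add Cxy = (+)"
 by (simp_all add: Cxy_def)

lemma domain_Cxy: "domain Cxy"
proof (intro domain.intro cringI domain_axioms.intro)
 show "abelian_group Cxy" by (rule abelian_groupI) (auto intro: germ_convergent_add exI[of _ "- x" for x] simp: add_ac)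
 show "comm_monoid Cxy" by (rule comm_monoidI) (auto intro: germ_convergent_mult simp: mult_ac)
qed (auto simp: distrib_right)

lemma Units_Cxy: "Units Cxy = {F. germ_convergent F \<and> F $ 0 $ 0 \<noteq> 0}"
proof (rule Set.set_eqI, rule iffI)
 fix F assume "F \<in> Units Cxy"
 then obtain G where "germ_convergent F" and "germ_convergent G" and FG: "F * G = 1" by (auto simp: Units_def)
 then show "F \<in> {F. germ_convergent F \<and> F $ 0 $ 0 \<noteq> 0}" using germ_mult_eq_1_nth[OF FG] by auto
next
 fix F assume "F \<in> {F. germ_convergent F \<and> F $ 0 $ 0 \<noteq> 0}"
 then obtain G where "germ_convergent F" "germ_convergent G" "F * G = 1" using germ_convergent_unit[of F] by auto
 moreover from this have "G * F = 1" by (simp add: mult.commute)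
 ultimately show "F \<in> Units Cxy" by (auto simp: Units_def)
qed

subsection \<open>Weierstrass preparation\<close>

text \<open>
  As \<open>F = x\<^sup>m v + y L\<close> with a unit \<open>v\<close>, one may divide \<open>x\<^sup>m\<close> by \<open>x\<^sup>m + y L / v\<close>. The remainder \<open>R\<close>
 vanishes for \<open>y = 0\<close>, hence the quotient is a unit and \<open>x\<^sup>m - R\<close> is the polynomial.
\<close>

lemma weierstrass_preparation:
 fixes F :: germ
 assumes F: "germ_convergent F" and low: "\<And>i. i < m \<Longrightarrow> F $ i $ 0 = 0" and m: "F $ m $ 0 \<noteq> 0"
 obtains u W where "germ_convergent u" "u $ 0 $ 0 \<noteq> 0" "germ_convergent W" "F = u * W"
  "W $ m = 1" "\<And>i. m < i \<Longrightarrow> W $ i = 0" "\<And>i. i < m \<Longrightarrow> W $ i $ 0 = 0"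
proof -
 define v where "v = fps_shift m F"
 define L where "L = Abs_fps (\<lambda>i. fps_shift 1 (fps_cutoff m F $ i))"
 have v: "germ_convergent v" "v $ 0 $ 0 \<noteq> 0" using F m by (auto simp: v_def intro: germ_convergent_shift)
 have L: "germ_convergent L"
  by (rule germ_convergent_reindex[OF germ_convergent_cutoff[OF F, of m], of _ 1 0 1]) (auto simp: L_def)
 have FL: "F = v * fps_X ^ m + germ_y * L"
 proof -
  have "germ_y * L = fps_cutoff m F" by (rule fps_ext, rule fps_ext) (auto simp: germ_y_mult_nth L_def low)
  then show ?thesis using fps_shift_cutoff[of m F] by (simp add: v_def)
 qed
 obtain w where w: "germ_convergent w" "v * w = 1" "w $ 0 $ 0 \<noteq> 0" using germ_convergent_unit[OF v] .
 obtain Q R where Q: "germ_convergent Q" and R: "germ_convergent R"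
  and QR: "fps_X ^ m = (fps_X ^ m + germ_y * (w * L)) * Q + R" and R0: "\<And>i. m \<le> i \<Longrightarrow> R $ i = 0"
  using weierstrass_division[of "w * L" "fps_X ^ m" m] w L germ_convergent_mult germ_convergent_power germ_convergent_X
  by metis
 have eq: "(fps_X ^ m * Q) $ i $ 0 + R $ i $ 0 = (fps_X ^ m :: germ) $ i $ 0" for i
 proof -
  have "(germ_y * (w * L) * Q) $ i $ 0 = 0" by (simp add: mult.assoc germ_y_mult_nth)
  then show ?thesis by (subst QR) (simp add: distrib_right)
 qed
 have Rlow: "R $ i $ 0 = 0" if "i < m" for i using eq[of i] that by (simp add: fps_X_power_mult_nth)
 have Q0: "Q $ 0 $ 0 = 1" using eq[of m] R0[of m] by (simp add: fps_X_power_mult_nth)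
 obtain q where q: "germ_convergent q" "Q * q = 1" "q $ 0 $ 0 \<noteq> 0" using germ_convergent_unit[OF Q] Q0 by auto
 define W where "W = fps_X ^ m - R"
 have W: "W = (fps_X ^ m + germ_y * (w * L)) * Q" using QR by (simp add: W_def algebra_simps)
 have "v * q * W = v * (fps_X ^ m + germ_y * (w * L)) * (Q * q)" by (simp add: W mult_ac)
 also have "\<dots> = v * fps_X ^ m + germ_y * (v * w) * L" by (simp add: q algebra_simps)
 also have "\<dots> = F" using w FL by simp
 finally have FW: "F = (v * q) * W" ..
 show ?thesis
 proof (rule that[OF _ _ _ FW])
  show "germ_convergent (v * q)" "germ_convergent W"
   unfolding W_def by (intro germ_convergent_mult germ_convergent_diff germ_convergent_power v q R germ_convergent_X)+
  show "(v * q) $ 0 $ 0 \<noteq> 0" using v q by simp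
  show "W $ m = 1" using R0[of m] by (simp add: W_def)
  show "W $ i = 0" if "m < i" for i using R0[of i] that by (simp add: W_def)
  show "W $ i $ 0 = 0" if "i < m" for i using Rlow[OF that] that by (simp add: W_def)
 qed
qed

text \<open>Division with \<open>m = 1\<close>; substituting \<open>\<gamma>\<close> for \<open>x\<close> identifies the remainder.\<close>

lemma linear_division:
 fixes F :: germ
 assumes F: "germ_convergent F" and c: "fps_convergent c" "c $ 0 = 0"
 obtains Q where "germ_convergent Q" "F = (fps_X - fps_const c) * Q + fps_const (ev c F)"
  "fps_convergent (ev c F)"
proof -
 define E where "E = - fps_const (fps_shift 1 c)"
 have "fps_X * fps_shift 1 c = c" using c(2) by (simp add: fps_eq_iff)
 then have cE: "fps_X ^ 1 + germ_y * E = fps_X - fps_const c" by (simp add: E_def germ_y_def fps_const_mult)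
 have "germ_convergent E" using fps_convergent_shift[OF c(1)] by (simp add: E_def del: fps_const_neg)
 then obtain Q R where Q: "germ_convergent Q" and R: "germ_convergent R"
  and eq: "F = (fps_X ^ 1 + germ_y * E) * Q + R" and R0: "\<And>i. 1 \<le> i \<Longrightarrow> R $ i = 0" using weierstrass_division[OF _ F] by metis
 have R1: "R = fps_const (R $ 0)"
 proof (rule fps_ext)
  fix i show "R $ i = fps_const (R $ 0) $ i" using R0[of i] by (cases i) auto
 qed
 have eq': "F = (fps_X - fps_const c) * Q + fps_const (R $ 0)" using eq R1 unfolding cE by simp
 have "ev c F = R $ 0" by (subst eq') (simp add: ev_add ev_mult ev_diff ev_X c(2))
 then show ?thesis using that[OF Q] eq' R R1 by simp
qed

section \<open>Newton--Puiseux factorisation\<close>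

definition conv_poly :: "complex fps poly \<Rightarrow> bool" where
 "conv_poly P \<longleftrightarrow> (\<forall>i. fps_convergent (coeff P i))"

lemma fps_convergent_1 [simp]: "fps_convergent 1" using fps_convergent_const[of 1] by simp

lemma conv_poly_add: "conv_poly P \<Longrightarrow> conv_poly Q \<Longrightarrow> conv_poly (P + Q)" by (auto simp: conv_poly_def intro: fps_convergent_add)

lemma conv_poly_mult: "conv_poly P \<Longrightarrow> conv_poly Q \<Longrightarrow> conv_poly (P * Q)"
 by (auto simp: conv_poly_def coeff_mult intro!: fps_convergent_sum fps_convergent_mult)

lemma conv_poly_pCons: "fps_convergent a \<Longrightarrow> conv_poly P \<Longrightarrow> conv_poly (pCons a P)"
 by (auto simp: conv_poly_def coeff_pCons split: nat.splits)

lemma conv_poly_pCons_D: "conv_poly (pCons a P) \<Longrightarrow> fps_convergent a \<and> conv_poly P"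
 unfolding conv_poly_def by (metis coeff_pCons_0 coeff_pCons_Suc)

lemma conv_poly_0 [simp]: "conv_poly 0" by (simp add: conv_poly_def)

lemma conv_poly_pcompose: "conv_poly P \<Longrightarrow> conv_poly Q \<Longrightarrow> conv_poly (pcompose P Q)"
proof (induction P)
 case (pCons a P)
 then show ?case using conv_poly_pCons_D[OF pCons.prems(1)]
  by (simp add: pcompose_pCons conv_poly_add conv_poly_pCons conv_poly_mult)
qed simp

lemma conv_poly_imp_germ_convergent:
 assumes "conv_poly P"
 shows "germ_convergent (fps_of_poly P)"
proof -
 have "fps_of_poly P = (\<Sum>i\<le>degree P. fps_const (coeff P i) * fps_X ^ i)" by (subst poly_as_sum_of_monoms[symmetric])
    (simp only: fps_of_poly_sum fps_of_poly_monom)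
 then show ?thesis using assms
  by (auto simp: conv_poly_def intro!: germ_convergent_sum germ_convergent_mult germ_convergent_power)
qed

lemma map_poly_hom_pcompose:
 fixes \<phi> :: "'a::comm_ring_1 \<Rightarrow> 'b::comm_ring_1"
 assumes add: "\<And>a b. \<phi> (a + b) = \<phi> a + \<phi> b" and mult: "\<And>a b. \<phi> (a * b) = \<phi> a * \<phi> b"
 shows "map_poly \<phi> (pcompose P Q) = pcompose (map_poly \<phi> P) (map_poly \<phi> Q)"
proof -
 have 0: "\<phi> 0 = 0" using add[of 0 0] by simp
 have sum: "\<phi> (sum f A) = (\<Sum>x\<in>A. \<phi> (f x))" for f :: "nat \<Rightarrow> 'a" and A
  by (induction A rule: infinite_finite_induct) (auto simp: add 0)
 have madd: "map_poly \<phi> (P + Q) = map_poly \<phi> P + map_poly \<phi> Q" for P Q by (rule poly_eqI) (simp add: coeff_map_poly 0 add)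
 have mmult: "map_poly \<phi> (P * Q) = map_poly \<phi> P * map_poly \<phi> Q" for P Q
  by (rule poly_eqI) (simp add: coeff_map_poly 0 coeff_mult sum mult)
 have mconst: "map_poly \<phi> [:a:] = [:\<phi> a:]" for a
  by (rule poly_eqI) (auto simp: coeff_map_poly 0 coeff_pCons split: nat.splits)
 show ?thesis
 proof (induction P)
  case (pCons a P)
  have "map_poly \<phi> (pCons a P) = pCons (\<phi> a) (map_poly \<phi> P)"
   by (rule poly_eqI) (auto simp: coeff_map_poly 0 coeff_pCons split: nat.splits)
  then show ?case using pCons.IH by (simp add: pcompose_pCons madd mmult mconst)
 qed simp
qed

lemma coeff_pcompose_shift:
 fixes P :: "'a::comm_ring_1 poly"
 shows "coeff (pcompose P [:c, 1:]) j = (\<Sum>i\<le>degree P. coeff P i * coeff ([:c, 1:] ^ i) j)"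
proof -
 have mono: "pcompose (monom a i) Q = smult a (Q ^ i)" for a i and Q :: "'a poly"
  by (induction i) (auto simp: monom_0 monom_Suc pcompose_pCons pcompose_const)
 have "pcompose P [:c, 1:] = pcompose (\<Sum>i\<le>degree P. monom (coeff P i) i) [:c, 1:]" by (simp only: poly_as_sum_of_monoms)
 also have "\<dots> = (\<Sum>i\<le>degree P. smult (coeff P i) ([:c, 1:] ^ i))" by (simp add: pcompose_sum mono)
 finally show ?thesis by (simp add: coeff_sum)
qed

lemma coeff_pcompose_shift_subleading:
 fixes P :: "'a::comm_ring_1 poly"
 assumes "degree P = Suc k"
 shows "coeff (pcompose P [:c, 1:]) k = coeff P k + of_nat (Suc k) * coeff P (Suc k) * c"
proof -
 have "coeff ([:c, 1:] ^ i) k = (if i = k then 1 else if i = Suc k then of_nat (Suc k) * c else 0)"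
  if "i \<le> Suc k" for i
 proof (cases "i < k")
  case True
  have "degree ([:c, 1:] ^ i) \<le> i" by (rule order_trans[OF degree_power_le]) auto
  then show ?thesis using True coeff_eq_0 by (metis le_less_trans less_SucI less_irrefl)
 next
  case False
  then show ?thesis using that coeff_linear_poly_power[of k i c 1] by (auto simp: le_Suc_eq)
 qed
 then have "coeff (pcompose P [:c, 1:]) k =
  (\<Sum>i\<le>Suc k. coeff P i * (if i = k then 1 else if i = Suc k then of_nat (Suc k) * c else 0))"
  unfolding coeff_pcompose_shift assms by (intro sum.cong) auto
 also have "\<dots> = (\<Sum>i\<le>Suc k. (if i = k then coeff P k else 0) +
   (if i = Suc k then coeff P (Suc k) * (of_nat (Suc k) * c) else 0))" by (intro sum.cong) auto
 also have "\<dots> = coeff P k + coeff P (Suc k) * (of_nat (Suc k) * c)"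
  unfolding sum.distrib by (simp add: sum.delta del: sum.atMost_Suc)
 finally show ?thesis by (simp add: algebra_simps)
qed

lemma ev_sum: "ev X (sum F A) = (\<Sum>i\<in>A. ev X (F i))" by (induction A rule: infinite_finite_induct) (auto simp: ev_add)

lemma ev_fps_of_poly:
 assumes "X $ 0 = 0"
 shows "ev X (fps_of_poly P) = poly P X"
proof -
 have "ev X (fps_of_poly P) = ev X (fps_of_poly (\<Sum>i\<le>degree P. monom (coeff P i) i))" by (simp only: poly_as_sum_of_monoms)
 also have "\<dots> = (\<Sum>i\<le>degree P. coeff P i * X ^ i)"
  by (simp add: fps_of_poly_sum fps_of_poly_monom ev_sum ev_mult[OF assms] ev_power[OF assms] ev_X[OF assms])
 also have "\<dots> = poly P X" by (simp add: poly_altdef)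
 finally show ?thesis .
qed

lemma ramify_fps_of_poly: "ramify n (fps_of_poly P) = fps_of_poly (map_poly (\<lambda>f. f oo fps_X ^ n) P)"
 by (rule fps_ext) (simp add: ramify_eq_cmap coeff_map_poly)

lemma poly_map_compose_shift:
 fixes P :: "'a::idom fps poly"
 assumes "0 < n"
 shows "poly (map_poly (\<lambda>f. f oo fps_X ^ n) (pcompose P [:c, 1:])) z =
  poly (map_poly (\<lambda>f. f oo fps_X ^ n) P) ((c oo fps_X ^ n) + z)"
proof -
 have "map_poly (\<lambda>f. f oo fps_X ^ n) (pcompose P [:c, 1:]) =
   pcompose (map_poly (\<lambda>f. f oo fps_X ^ n) P) (map_poly (\<lambda>f. f oo fps_X ^ n) [:c, 1:])"
  using assms by (intro map_poly_hom_pcompose) (auto simp: fps_compose_add_distrib fps_compose_mult_distrib)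
 also have "map_poly (\<lambda>f. f oo fps_X ^ n) [:c, 1:] = [:c oo fps_X ^ n, 1:]"
  by (rule poly_eqI) (auto simp: coeff_map_poly coeff_pCons split: nat.splits)
 finally show ?thesis by (simp add: poly_pcompose)
qed

text \<open>
  A monic complex polynomial whose subleading coefficient vanishes and which is not a pure power
  \<open>x\<^sup>m\<close> is not an \<open>m\<close>-th power of a linear form, so its roots have multiplicity less than \<open>m\<close>.
\<close>

lemma monic_root_small_order:
 fixes p :: "complex poly"
 assumes deg: "degree p = m" and monic: "coeff p m = 1" and m: "0 < m"
  and sub: "coeff p (m - 1) = 0" and i: "i < m" "coeff p i \<noteq> 0"
 obtains a where "0 < order a p" "order a p < m"
proof -
 have p0: "p \<noteq> 0" using i by auto
 have "\<not> (\<exists>a l. a \<noteq> 0 \<and> l = 0 \<and> p = pCons a l)" using deg m by auto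
 then obtain a where a: "poly p a = 0" using fundamental_theorem_of_algebra_alt by blast
 have ord: "0 < order a p" using a p0 by (simp add: order_root)
 have "order a p \<noteq> m"
 proof
  assume om: "order a p = m"
  have "[:- a, 1:] ^ m dvd p" using om order_1 by metis
  then obtain q where q: "p = [:- a, 1:] ^ m * q" by auto
  have "q \<noteq> 0" using q p0 by auto
  then have "degree p = m + degree q" unfolding q by (subst degree_mult_eq) (auto simp: degree_power_eq)
  then have "degree q = 0" using deg by simp
  then obtain c where c: "q = [:c:]" by (auto elim: degree_eq_zeroE)
  have "coeff p m = coeff ([:- a, 1:] ^ m) m * c" by (simp add: q c)
  then have "c = 1" using monic coeff_linear_power[of "-a" m] by simp
  then have p: "p = [:- a, 1:] ^ m" using q c by (simp add: one_pCons[symmetric])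
  have "coeff p (m - 1) = of_nat (m choose (m - 1)) * (- a) ^ (m - (m - 1))"
   unfolding p by (subst coeff_linear_poly_power) auto
  moreover obtain k where "m = Suc k" using m gr0_implies_Suc by blast
  ultimately have "a = 0" using sub by (simp del: of_nat_Suc)
  then have "p = monom 1 m" using p by (simp add: monom_altdef)
  then show False using i by simp
 qed
 moreover have "order a p \<le> m" using order_degree[OF p0] deg by simp
 ultimately show ?thesis using that ord by fastforce
qed

text \<open>
  One root, by induction on the order \<open>m\<close> of \<open>F(x, 0)\<close>. Replace \<open>F\<close> by a Weierstrass polynomial and
  remove its subleading coefficient by a translation. If nothing but \<open>x\<^sup>m\<close> is left, the translation
  is a root. Otherwise the steepest edge of the Newton polygon gives a substitution
  \<open>y = t\<^sup>q, x = t\<^sup>p x'\<close> after which the polynomial at \<open>t = 0\<close> is not a pure \<open>m\<close>-th power; at one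
  of its roots the order is smaller than \<open>m\<close>.
\<close>

lemma newton_root_exists:
 assumes "germ_convergent F" "\<And>i. i < m \<Longrightarrow> F $ i $ 0 = 0" "F $ m $ 0 \<noteq> 0" "0 < m"
 shows "\<exists>n>0. \<exists>\<gamma>. fps_convergent \<gamma> \<and> \<gamma> $ 0 = 0 \<and> ev \<gamma> (ramify n F) = 0" using assms
proof (induction m arbitrary: F rule: less_induct)
 case (less m F)
 obtain u W where u: "germ_convergent u" "u $ 0 $ 0 \<noteq> 0" and W: "germ_convergent W" and F: "F = u * W"
  and Wm: "W $ m = 1" and Whigh: "\<And>i. m < i \<Longrightarrow> W $ i = 0" and Wlow: "\<And>i. i < m \<Longrightarrow> W $ i $ 0 = 0"
  using weierstrass_preparation[OF less.prems(1-3)] by metis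
 define P where "P = (\<Sum>i\<le>m. monom (W $ i) i)"
 have coeffP: "coeff P i = W $ i" for i using Whigh[of i] by (auto simp: P_def coeff_sum sum.delta)
 have PW: "fps_of_poly P = W" by (rule fps_ext) (simp add: coeffP)
 have "degree P \<le> m" by (rule degree_le) (auto simp: coeffP Whigh)
 moreover have "m \<le> degree P" by (rule le_degree) (simp add: coeffP Wm)
 ultimately have degP: "degree P = m" by simp
 have convP: "conv_poly P" using W germ_convergent_nth by (auto simp: conv_poly_def coeffP)
 define c where "c = fps_const (- 1 / of_nat m) * coeff P (m - 1)"
 have c: "fps_convergent c" "c $ 0 = 0" using convP less.prems(4) Wlow[of "m - 1"]
  by (auto simp: c_def conv_poly_def coeffP intro!: fps_convergent_mult)
 define P' where "P' = pcompose P [:c, 1:]"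
 have convP': "conv_poly P'" unfolding P'_def by (intro conv_poly_pcompose convP conv_poly_pCons) (auto simp: c)
 have degP': "degree P' = m" unfolding P'_def by (simp add: degree_pcompose degP)
 have leadP': "coeff P' m = 1"
 proof -
  have "lead_coeff P' = lead_coeff P * lead_coeff [:c, 1:] ^ degree P" unfolding P'_def by (rule lead_coeff_comp) simp
  then show ?thesis by (simp add: degP' degP coeffP Wm)
 qed
 have subP': "coeff P' (m - 1) = 0"
 proof -
  obtain k where k: "m = Suc k" using less.prems(4) gr0_implies_Suc by blast
  have "coeff P' k = coeff P k + of_nat (Suc k) * coeff P (Suc k) * c"
   unfolding P'_def by (rule coeff_pcompose_shift_subleading) (simp add: degP k)
  also have "of_nat (Suc k) * coeff P (Suc k) * c = fps_const (of_nat (Suc k)) * c"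
   using Wm k by (simp add: coeffP fps_of_nat[symmetric])
  also have "\<dots> = fps_const (of_nat (Suc k) * (- 1 / of_nat (Suc k))) * coeff P k"
   by (simp only: c_def k diff_Suc_1 mult.assoc[symmetric] fps_const_mult)
  also have "of_nat (Suc k) * (- 1 / of_nat (Suc k)) = (-1 :: complex)" by (simp del: of_nat_Suc)
  also have "fps_const (-1) * coeff P k = - coeff P k" by (simp flip: fps_const_neg)
  finally show ?thesis by (simp add: k)
 qed
 have P'0: "map_poly (\<lambda>f. f $ 0) P' = monom 1 m"
 proof -
  have "map_poly (\<lambda>f. f $ 0) P' = pcompose (map_poly (\<lambda>f. f $ 0) P) (map_poly (\<lambda>f. f $ 0) [:c, 1:])"
   unfolding P'_def by (rule map_poly_hom_pcompose) auto
  also have "map_poly (\<lambda>f. f $ 0) P = monom 1 m"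
  proof (rule poly_eqI)
   fix i show "coeff (map_poly (\<lambda>f. f $ 0) P) i = coeff (monom 1 m) i"
    using Wlow[of i] Whigh[of i] Wm by (cases i m rule: linorder_cases) (auto simp: coeff_map_poly coeffP)
  qed
  also have "map_poly (\<lambda>f. f $ 0) [:c, 1:] = [:0, 1:]"
   by (rule poly_eqI) (auto simp: coeff_map_poly coeff_pCons c split: nat.splits)
  finally show ?thesis by simp
 qed
 have P'low: "coeff P' i $ 0 = 0" if "i < m" for i
  using arg_cong[OF P'0, of "\<lambda>p. coeff p i"] that by (simp add: coeff_map_poly)
 show ?case
 proof (cases "\<forall>i<m. coeff P' i = 0")
  case True
  then have "coeff P' 0 = 0" using less.prems(4) by blast
  then have "poly P c = 0" by (simp add: P'_def)
  then have "ev c F = 0" using PW c by (simp add: F ev_mult flip: ev_fps_of_poly)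
  then show ?thesis using c by (intro exI[of _ 1] conjI exI[of _ c]) auto
 next
  case False
  define S where "S = {i. i < m \<and> coeff P' i \<noteq> 0}"
  define slope where "slope i = real (subdegree (coeff P' i)) / real (m - i)" for i
  have S: "finite S" "S \<noteq> {}" using False by (auto simp: S_def)
  obtain i0 where i0: "i0 \<in> S" and min: "\<And>i. i \<in> S \<Longrightarrow> slope i0 \<le> slope i"
   using S by (metis (no_types, lifting) arg_min_if_finite(1) arg_min_if_finite(2) not_le)
  define p where "p = subdegree (coeff P' i0)"
  define q where "q = m - i0"
  have q: "0 < q" using i0 by (simp add: q_def S_def)
  have p: "0 < p"
   using i0 P'low[of i0] unfolding p_def S_def by (metis (mono_tags, lifting) mem_Collect_eq neq0_conv nth_subdegree_zero_iff)
  have slopes: "p * (m - i) \<le> subdegree (coeff P' i) * q" if "i < m" "coeff P' i \<noteq> 0" for i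
  proof -
   have "slope i0 \<le> slope i" using that by (intro min) (simp add: S_def)
   then have "real p * real (m - i) \<le> real (subdegree (coeff P' i)) * real q"
    using that q by (simp add: slope_def p_def q_def field_simps)
   then show ?thesis by (metis of_nat_le_iff of_nat_mult)
  qed
  \<comment> \<open>the coefficients after \<open>x = t\<^sup>p x'\<close>, \<open>y = t\<^sup>q\<close> and division by \<open>t\<^sup>p\<^sup>m\<close>\<close>
  define d where "d i = (if i \<le> m then fps_shift (p * (m - i)) (coeff P' i oo fps_X ^ q) else 0)" for i
  have d: "coeff P' i oo fps_X ^ q = fps_X ^ (p * (m - i)) * d i" if "i \<le> m" for i
  proof (cases "coeff P' i = 0 \<or> i = m")
   case True
   then show ?thesis using that by (auto simp: d_def leadP')
  next
   case False
   then have "p * (m - i) \<le> subdegree (coeff P' i oo fps_X ^ q)"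
    using slopes[of i] that q by (simp add: fps_X_power_subdegree)
   then show ?thesis using that by (simp add: d_def mult.commute[of "fps_X ^ _"] fps_shift_times_fps_X_power)
  qed
  define P1 where "P1 = (\<Sum>i\<le>m. monom (d i) i)"
  have coeffP1: "coeff P1 i = d i" for i by (auto simp: P1_def coeff_sum sum.delta d_def)
  have convP1: "conv_poly P1" using convP' q
   by (auto simp: conv_poly_def coeffP1 d_def intro!: fps_convergent_shift fps_convergent_compose_X_power)
  define p0 where "p0 = map_poly (\<lambda>f. f $ 0) P1"
  have coeffp0: "coeff p0 i = d i $ 0" for i by (simp add: p0_def coeff_map_poly coeffP1)
  have dm: "d m = 1" by (simp add: d_def leadP')
  have "degree p0 \<le> m" by (rule degree_le) (auto simp: coeffp0 d_def)
  moreover have "m \<le> degree p0" by (rule le_degree) (simp add: coeffp0 dm)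
  ultimately have degp0: "degree p0 = m" by simp
  have i0m: "i0 < m" "i0 \<le> m" "coeff P' i0 \<noteq> 0" using i0 by (auto simp: S_def)
  have "coeff p0 i0 = (coeff P' i0 oo fps_X ^ q) $ (p * q)" using i0m by (simp add: coeffp0 d_def q_def)
  also have "\<dots> = coeff P' i0 $ p" using q by (simp add: fps_compose_X_power_nth)
  also have "\<dots> \<noteq> 0" using i0m by (simp add: p_def)
  finally have p0i0: "coeff p0 i0 \<noteq> 0" .
  have "coeff p0 (m - 1) = 0" using subP' by (simp add: coeffp0 d_def)
  moreover have "coeff p0 m = 1" by (simp add: coeffp0 dm)
  ultimately obtain a where a: "0 < order a p0" "order a p0 < m"
   using monic_root_small_order[OF degp0 _ less.prems(4) _ i0m(1) p0i0] by blast
  define m1 where "m1 = order a p0"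
  define P2 where "P2 = pcompose P1 [:fps_const a, 1:]"
  define G where "G = fps_of_poly P2"
  have convG: "germ_convergent G" unfolding G_def P2_def
   by (intro conv_poly_imp_germ_convergent conv_poly_pcompose convP1 conv_poly_pCons) auto
  have G0: "G $ i $ 0 = coeff (pcompose p0 [:a, 1:]) i" for i
  proof -
   have "map_poly (\<lambda>f. f $ 0) P2 = pcompose (map_poly (\<lambda>f. f $ 0) P1) (map_poly (\<lambda>f. f $ 0) [:fps_const a, 1:])"
    unfolding P2_def by (rule map_poly_hom_pcompose) auto
   also have "map_poly (\<lambda>f. f $ 0) [:fps_const a, 1:] = [:a, 1:]"
    by (rule poly_eqI) (auto simp: coeff_map_poly coeff_pCons split: nat.splits)
   finally show ?thesis unfolding G_def p0_def by (metis coeff_map_poly fps_of_poly_nth fps_zero_nth)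
  qed
  have p00: "p0 \<noteq> 0" using degp0 less.prems(4) by auto
  obtain r where r: "p0 = [:- a, 1:] ^ m1 * r" "\<not> [:- a, 1:] dvd r" using order_decomp[OF p00] m1_def by metis
  have shift: "pcompose p0 [:a, 1:] = monom 1 m1 * pcompose r [:a, 1:]"
  proof -
   have pow: "pcompose (f ^ k) g = pcompose f g ^ k" for f g :: "complex poly" and k
    by (induction k) (simp_all add: pcompose_mult pcompose_1)
   have "pcompose ([:- a, 1:] ^ m1) [:a, 1:] = [:0, 1:] ^ m1" by (simp add: pow pcompose_pCons)
   then show ?thesis by (subst r(1)) (simp add: pcompose_mult monom_altdef)
  qed
  have "coeff (pcompose r [:a, 1:]) 0 \<noteq> 0" using r(2) by (simp add: poly_eq_0_iff_dvd)
  then have G1: "\<And>i. i < m1 \<Longrightarrow> G $ i $ 0 = 0" "G $ m1 $ 0 \<noteq> 0" by (simp_all add: G0 shift coeff_monom_mult)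
  obtain n \<eta> where n: "0 < n" and \<eta>: "fps_convergent \<eta>" "\<eta> $ 0 = 0" "ev \<eta> (ramify n G) = 0"
   using less.IH[OF _ convG G1] a by (auto simp: m1_def)
  define N where "N = q * n"
  have N: "0 < N" using q n by (simp add: N_def)
  define \<zeta> where "\<zeta> = fps_const a + \<eta>"
  \<comment> \<open>undoing the substitution and both translations\<close>
  define \<gamma> where "\<gamma> = (c oo fps_X ^ N) + fps_X ^ (p * n) * \<zeta>"
  have \<gamma>: "fps_convergent \<gamma>" "\<gamma> $ 0 = 0" unfolding \<gamma>_def \<zeta>_def using c \<eta> p n N
   by (auto intro!: fps_convergent_add fps_convergent_mult fps_convergent_power fps_convergent_compose_X_power)
  let ?m = "\<lambda>k. map_poly (\<lambda>f. f oo fps_X ^ k)"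
  have degm: "degree (?m k P) \<le> degree P" for k and P :: "complex fps poly"
   by (rule degree_le) (auto simp: coeff_map_poly coeff_eq_0)
  have psum: "poly (?m k P) z = (\<Sum>i\<le>m. (coeff P i oo fps_X ^ k) * z ^ i)"
   if "degree P \<le> m" for k P and z :: "complex fps"
  proof -
   have "poly (?m k P) z = (\<Sum>i\<le>degree (?m k P). coeff (?m k P) i * z ^ i)" by (rule poly_altdef)
   also have "\<dots> = (\<Sum>i\<le>m. coeff (?m k P) i * z ^ i)"
    using degm[of k P] that by (intro sum.mono_neutral_left) (auto simp: coeff_eq_0)
   finally show ?thesis by (simp add: coeff_map_poly)
  qed
  have "degree P1 \<le> m" by (rule degree_le) (simp add: coeffP1 d_def)
  have "poly (?m N P) \<gamma> = poly (?m N P') (fps_X ^ (p * n) * \<zeta>)" unfolding P'_def poly_map_compose_shift[OF N] \<gamma>_def ..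
  also have "\<dots> = (\<Sum>i\<le>m. (coeff P' i oo fps_X ^ N) * (fps_X ^ (p * n) * \<zeta>) ^ i)" by (rule psum) (simp add: degP')
  also have "\<dots> = (\<Sum>i\<le>m. fps_X ^ (p * n * m) * ((d i oo fps_X ^ n) * \<zeta> ^ i))"
  proof (intro sum.cong refl)
   fix i assume "i \<in> {..m}"
   then have i: "i \<le> m" by simp
   have "coeff P' i oo fps_X ^ N = (coeff P' i oo fps_X ^ q) oo fps_X ^ n"
    using n q by (simp add: N_def fps_X_power_compose_X_power mult.commute flip: fps_compose_assoc)
   also have "\<dots> = fps_X ^ (p * n * (m - i)) * (d i oo fps_X ^ n)" unfolding d[OF i] using n
    by (simp add: fps_compose_mult_distrib fps_X_power_compose_X_power mult_ac)
   finally have "(coeff P' i oo fps_X ^ N) * (fps_X ^ (p * n) * \<zeta>) ^ i =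
     (fps_X ^ (p * n * (m - i)) * fps_X ^ (p * n * i)) * ((d i oo fps_X ^ n) * \<zeta> ^ i)"
    by (simp only: power_mult_distrib power_mult[symmetric] mult_ac)
   also have "fps_X ^ (p * n * (m - i)) * fps_X ^ (p * n * i) = (fps_X ^ (p * n * m) :: complex fps)"
    using i by (simp flip: power_add distrib_left)
   finally show "(coeff P' i oo fps_X ^ N) * (fps_X ^ (p * n) * \<zeta>) ^ i =
    fps_X ^ (p * n * m) * ((d i oo fps_X ^ n) * \<zeta> ^ i)" .
  qed
  also have "\<dots> = fps_X ^ (p * n * m) * poly (?m n P1) \<zeta>" by (simp add: psum[OF \<open>degree P1 \<le> m\<close>] coeffP1 sum_distrib_left)
  also have "poly (?m n P1) \<zeta> = poly (?m n P2) \<eta>" unfolding P2_def poly_map_compose_shift[OF n] \<zeta>_def using n by simp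
  also have "\<dots> = 0" using \<eta>(3) ev_fps_of_poly[OF \<eta>(2)] by (simp add: G_def ramify_fps_of_poly)
  finally have "ev \<gamma> (ramify N W) = 0" by (simp add: PW[symmetric] ramify_fps_of_poly ev_fps_of_poly \<gamma>)
  then have "ev \<gamma> (ramify N F) = 0" by (simp add: F ramify_mult N ev_mult \<gamma>)
  then show ?thesis using N \<gamma> by blast
 qed
qed

definition rprod :: "complex fps multiset \<Rightarrow> germ" where
 "rprod C = (\<Prod>c\<in>#C. fps_X - fps_const c)"

lemma rprod_empty [simp]: "rprod {#} = 1"
 and rprod_add [simp]: "rprod (add_mset c C) = (fps_X - fps_const c) * rprod C"
 and rprod_union: "rprod (C + D) = rprod C * rprod D" by (simp_all add: rprod_def)

lemma root_prod_eq_rprod: "root_prod n \<Gamma> = rprod (image_mset (arc_param n) \<Gamma>)"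
 by (simp add: root_prod_def rprod_def image_mset.compositionality comp_def)

lemma cmap_rprod:
 assumes "b $ 0 = 0"
 shows "cmap b (rprod C) = rprod (image_mset (\<lambda>c. c oo b) C)"
 by (simp add: rprod_def cmap_prod_mset[OF assms] cmap_diff image_mset.compositionality comp_def)

lemma fps_X_minus_const_neq_0: "fps_X - fps_const c \<noteq> (0 :: 'a::comm_ring_1 fps)"
proof
 assume "fps_X - fps_const c = 0"
 then have "(fps_X - fps_const c) $ 1 = 0" by simp
 then show False by simp
qed

lemma rprod_neq_0 [simp]: "rprod C \<noteq> 0" by (induction C) (auto simp: fps_X_minus_const_neq_0)

lemma ev_rprod:
 assumes "x $ 0 = 0"
 shows "ev x (rprod C) = (\<Prod>c\<in>#C. x - c)" by (simp add: rprod_def ev_prod_mset[OF assms] ev_diff ev_X[OF assms])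

lemma ev_rprod_eq_0_iff: "x $ 0 = 0 \<Longrightarrow> ev x (rprod C) = 0 \<longleftrightarrow> x \<in># C" by (auto simp: ev_rprod prod_mset_zero_iff image_iff)

lemma ev_unit_neq_0: "U $ 0 $ 0 \<noteq> 0 \<Longrightarrow> x $ 0 = 0 \<Longrightarrow> ev x U $ 0 \<noteq> 0" by (simp add: ev_def)

text \<open>
  Dividing by \<open>x - \<gamma>\<close> for one root \<open>\<gamma>\<close> lowers the order in \<open>x\<close> by one. The remaining roots may need a
  further ramification, which carries \<open>\<gamma>\<close> along.
\<close>

lemma newton_puiseux_regular:
 assumes "germ_convergent F" "\<And>i. i < m \<Longrightarrow> F $ i $ 0 = 0" "F $ m $ 0 \<noteq> 0"
 shows "\<exists>n>0. \<exists>C u. size C = m \<and> (\<forall>c\<in>#C. fps_convergent c \<and> c $ 0 = 0) \<and>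
  germ_convergent u \<and> u $ 0 $ 0 \<noteq> 0 \<and> ramify n F = u * rprod C" using assms
proof (induction m arbitrary: F)
 case 0
 then show ?case by (intro exI[of _ 1] conjI exI[of _ "{#}"] exI[of _ F]) auto
next
 case (Suc m)
 obtain n \<gamma> where n: "0 < n" and \<gamma>: "fps_convergent \<gamma>" "\<gamma> $ 0 = 0" "ev \<gamma> (ramify n F) = 0"
  using newton_root_exists[OF Suc.prems] by auto
 have cF: "germ_convergent (ramify n F)" using Suc.prems(1) n germ_convergent_ramify_iff by blast
 obtain Q where Q: "germ_convergent Q" and QF: "ramify n F = (fps_X - fps_const \<gamma>) * Q"
  using linear_division[OF cF \<gamma>(1,2)] \<gamma>(3) by (metis add.right_neutral fps_const_0_eq_0)
 have Q0: "Q $ i $ 0 = F $ Suc i $ 0" for i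
 proof -
  have "F $ Suc i $ 0 = ((fps_X - fps_const \<gamma>) * Q) $ Suc i $ 0" using ramify_nth_0_0[OF n] by (simp flip: QF)
  then show ?thesis by (simp add: left_diff_distrib \<gamma>)
 qed
 have "\<And>i. i < m \<Longrightarrow> Q $ i $ 0 = 0" "Q $ m $ 0 \<noteq> 0" using Q0 Suc.prems by auto
 from Suc.IH[OF Q this] obtain n' C u where n': "0 < n'" and C: "size C = m"
  "\<forall>c\<in>#C. fps_convergent c \<and> c $ 0 = 0" and u: "germ_convergent u" "u $ 0 $ 0 \<noteq> 0"
  and eq: "ramify n' Q = u * rprod C" by blast
 have "ramify (n * n') F = ramify n' ((fps_X - fps_const \<gamma>) * Q)" using ramify_ramify[OF n n', of F] QF by simp
 also have "\<dots> = u * rprod (add_mset (\<gamma> oo fps_X ^ n') C)"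
  using n' eq by (simp add: ramify_mult) (simp add: ramify_eq_cmap cmap_diff algebra_simps)
 finally show ?case using n n' C u \<gamma>
  by (intro exI[of _ "n * n'"] conjI exI[of _ "add_mset (\<gamma> oo fps_X ^ n') C"] exI[of _ u])
    (auto intro: fps_convergent_compose_X_power)
qed

text \<open>A unit has no roots, so the two products have the same ones, which can be cancelled one by one.\<close>

lemma rprod_unique:
 fixes U1 U2 :: germ
 assumes "U1 * fps_const (fps_X ^ a) * rprod C1 = U2 * fps_const (fps_X ^ b) * rprod C2"
  and U: "U1 $ 0 $ 0 \<noteq> 0" "U2 $ 0 $ 0 \<noteq> 0"
  and "\<And>c. c \<in># C1 \<Longrightarrow> c $ 0 = 0" "\<And>c. c \<in># C2 \<Longrightarrow> c $ 0 = 0"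
 shows "C1 = C2" using assms(1,4,5)
proof (induction C1 arbitrary: C2)
 case empty
 show ?case
 proof (rule ccontr)
  assume "{#} \<noteq> C2"
  then obtain c where c: "c \<in># C2" by auto
  then have c0: "c $ 0 = 0" using empty.prems by blast
  have "ev c U1 * fps_X ^ a = 0" using arg_cong[OF empty.prems(1), of "ev c"] c by (simp add: ev_mult c0 ev_rprod_eq_0_iff)
  then show False using ev_unit_neq_0[OF U(1) c0] by auto
 qed
next
 case (add c C1)
 have c0: "c $ 0 = 0" using add.prems by simp
 have "ev c (U2 * fps_const (fps_X ^ b) * rprod C2) = 0"
  unfolding add.prems(1)[symmetric] by (simp add: ev_mult c0 ev_diff ev_X)
 then have "c \<in># C2" using ev_unit_neq_0[OF U(2) c0] by (auto simp: ev_mult c0 ev_rprod_eq_0_iff)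
 then obtain C2' where C2': "C2 = add_mset c C2'" by (metis multi_member_split)
 have "(fps_X - fps_const c) * (U1 * fps_const (fps_X ^ a) * rprod C1) =
    (fps_X - fps_const c) * (U2 * fps_const (fps_X ^ b) * rprod C2')"
  using add.prems(1) unfolding C2' rprod_add by (simp only: mult_ac)
 then have "U1 * fps_const (fps_X ^ a) * rprod C1 = U2 * fps_const (fps_X ^ b) * rprod C2'"
  by (simp add: fps_X_minus_const_neq_0)
 then show ?case using add.IH add.prems C2' by auto
qed

lemma np_factorization_arcs:
 assumes "np_factorization F E \<Gamma>" "\<gamma> \<in># \<Gamma>"
 shows "is_arc \<gamma>" "\<gamma> 0 = 0" using assms arc_order_pos_iff unfolding np_factorization_def by blast+

lemma np_factorization_den:
 assumes "np_factorization F E \<Gamma>"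
 obtains u n where "u $ 0 $ 0 \<noteq> 0" "0 < n" "\<And>\<gamma>. \<gamma> \<in># \<Gamma> \<Longrightarrow> arc_denom n \<gamma>"
  "\<And>m. 0 < m \<Longrightarrow> ramify (n * m) F =
   ramify (n * m) u * fps_const (fps_X ^ (n * m * E)) * root_prod (n * m) \<Gamma>"
proof -
 obtain u n where u: "u \<in> Units Cxy" and n: "0 < n" "\<And>\<gamma>. \<gamma> \<in># \<Gamma> \<Longrightarrow> arc_denom n \<gamma>"
  and eq: "ramify n F = ramify n (u * germ_y ^ E) * root_prod n \<Gamma>" using assms unfolding np_factorization_def by blast
 have "ramify (n * m) F = ramify (n * m) u * fps_const (fps_X ^ (n * m * E)) * root_prod (n * m) \<Gamma>"
  if m: "0 < m" for m using arg_cong[OF eq, of "ramify m"] n m root_prod_mult_den[OF n(1) m, of \<Gamma>]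
  by (simp add: ramify_mult[OF m] ramify_ramify ramify_mult[of "n * m"] ramify_germ_y_power)
 then show ?thesis using that[of u n] u n by (simp add: Units_Cxy)
qed

lemma image_arc_param_inj:
 assumes "\<And>\<gamma>. \<gamma> \<in># \<Gamma> \<Longrightarrow> arc_denom n \<gamma>" "\<And>\<gamma>. \<gamma> \<in># \<Gamma>' \<Longrightarrow> arc_denom n \<gamma>"
  and "image_mset (arc_param n) \<Gamma> = image_mset (arc_param n) \<Gamma>'"
 shows "\<Gamma> = \<Gamma>'"
proof -
 have "image_mset (arc_of_param n) (image_mset (arc_param n) \<Delta>) = \<Delta>"
  if "\<And>\<gamma>. \<gamma> \<in># \<Delta> \<Longrightarrow> arc_denom n \<gamma>" for \<Delta>
 proof -
  have "image_mset (arc_of_param n) (image_mset (arc_param n) \<Delta>) = image_mset (\<lambda>\<gamma>. \<gamma>) \<Delta>"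
   unfolding image_mset.compositionality comp_def by (rule image_mset_cong) (simp add: that)
  then show ?thesis by simp
 qed
 then show ?thesis using assms by metis
qed

lemma np_factorization_unique:
 assumes 1: "np_factorization F E \<Gamma>" and 2: "np_factorization F E' \<Gamma>'"
 shows "\<Gamma> = \<Gamma>'"
proof -
 obtain u n where u: "u $ 0 $ 0 \<noteq> 0" and n: "0 < n" and den: "\<And>\<gamma>. \<gamma> \<in># \<Gamma> \<Longrightarrow> arc_denom n \<gamma>"
  and eq: "\<And>m. 0 < m \<Longrightarrow> ramify (n * m) F =
   ramify (n * m) u * fps_const (fps_X ^ (n * m * E)) * root_prod (n * m) \<Gamma>" using np_factorization_den[OF 1] by metis
 obtain u' n' where u': "u' $ 0 $ 0 \<noteq> 0" and n': "0 < n'" and den': "\<And>\<gamma>. \<gamma> \<in># \<Gamma>' \<Longrightarrow> arc_denom n' \<gamma>"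
  and eq': "\<And>m. 0 < m \<Longrightarrow> ramify (n' * m) F =
   ramify (n' * m) u' * fps_const (fps_X ^ (n' * m * E')) * root_prod (n' * m) \<Gamma>'" using np_factorization_den[OF 2] by metis
 let ?N = "n * n'"
 have N: "0 < ?N" using n n' by simp
 have "ramify ?N u * fps_const (fps_X ^ (?N * E)) * rprod (image_mset (arc_param ?N) \<Gamma>) =
    ramify ?N u' * fps_const (fps_X ^ (?N * E')) * rprod (image_mset (arc_param ?N) \<Gamma>')"
  using eq[OF n'] eq'[OF n] by (simp add: root_prod_eq_rprod mult.commute[of n' n])
 then have "image_mset (arc_param ?N) \<Gamma> = image_mset (arc_param ?N) \<Gamma>'"
 proof (rule rprod_unique)
  show "ramify ?N u $ 0 $ 0 \<noteq> 0" "ramify ?N u' $ 0 $ 0 \<noteq> 0" using u u' by (simp_all add: ramify_nth_0_0[OF N])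
 qed (use np_factorization_arcs[OF 1] np_factorization_arcs[OF 2] in auto)
 then show ?thesis by (rule image_arc_param_inj[rotated 2])
    (metis den arc_denom_mult n', metis den' arc_denom_mult n mult.commute)
qed

lemma np_roots_eq: "np_factorization F E \<Gamma> \<Longrightarrow> np_roots F = \<Gamma>" unfolding np_roots_def using np_factorization_unique by blast

lemma np_factorization_conj:
 assumes "np_factorization F E \<Gamma>"
 shows "np_factorization F E (image_mset (conj_arc k) \<Gamma>)"
proof -
 obtain u n where u: "u \<in> Units Cxy" and n: "0 < n" "\<forall>\<gamma>\<in>#\<Gamma>. arc_denom n \<gamma>"
  and eq: "ramify n F = ramify n (u * germ_y ^ E) * root_prod n \<Gamma>" using assms unfolding np_factorization_def by blast
 let ?z = "cis (2 * pi * real k / real n)"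
 have "cmap (twist ?z) (ramify n F) = cmap (twist ?z) (ramify n (u * germ_y ^ E)) * cmap (twist ?z) (root_prod n \<Gamma>)"
  unfolding eq by (rule cmap_mult) simp
 then have "ramify n F = ramify n (u * germ_y ^ E) * root_prod n (image_mset (conj_arc k) \<Gamma>)"
  unfolding cmap_twist_ramify[OF n(1) cis_root_power[OF n(1)]] root_prod_conj[OF n(1)] .
 then show ?thesis using assms u n unfolding np_factorization_def by auto
qed

text \<open>The twist permutes the linear factors, so their product is invariant and a series in \<open>t\<^sup>n\<close>.\<close>

lemma rprod_twist_descend:
 assumes n: "0 < n" and inv: "image_mset (\<lambda>c. c oo twist (cis (2 * pi / real n))) C = C"
 obtains H where "rprod C = ramify n H"
proof -
 have "cmap (twist (cis (2 * pi / real n))) (rprod C) = rprod C" by (simp add: cmap_rprod inv)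
 then show ?thesis using twist_invariant_imp_ramify[OF n] that by metis
qed

lemma newton_puiseux:
 assumes F: "germ_convergent F" and F0: "F \<noteq> 0"
 obtains E \<Gamma> n where "np_factorization F E \<Gamma>" "0 < n"
  "\<And>\<gamma>. \<gamma> \<in># \<Gamma> \<Longrightarrow> arc_denom n \<gamma> \<and> fps_convergent (arc_param n \<gamma>)"
proof -
 define E where "E = (LEAST e. \<exists>i. F $ i $ e \<noteq> 0)"
 have "\<exists>e i. F $ i $ e \<noteq> 0" using F0 by (metis fps_ext fps_zero_nth)
 then have "\<exists>i. F $ i $ E \<noteq> 0" unfolding E_def by (rule LeastI_ex)
 then obtain i where i: "F $ i $ E \<noteq> 0" by blast
 have low: "F $ i $ e = 0" if "e < E" for i e using that not_less_Least unfolding E_def by blast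
 define F1 where "F1 = Abs_fps (\<lambda>i. fps_shift E (F $ i))"
 have F1: "germ_convergent F1" by (rule germ_convergent_reindex[OF F, of _ 1 0 E]) (auto simp: F1_def)
 have FF1: "F = germ_y ^ E * F1"
 proof (rule fps_ext, rule fps_ext)
  fix i j show "F $ i $ j = (germ_y ^ E * F1) $ i $ j" using low by (auto simp: germ_y_def F1_def fps_X_power_mult_nth)
 qed
 define m where "m = (LEAST i. F1 $ i $ 0 \<noteq> 0)"
 have "\<exists>i. F1 $ i $ 0 \<noteq> 0" using i by (auto simp: F1_def)
 then have m: "F1 $ m $ 0 \<noteq> 0" unfolding m_def by (rule LeastI_ex)
 have mlow: "F1 $ i $ 0 = 0" if "i < m" for i using that not_less_Least unfolding m_def by blast
 obtain n C u where n: "0 < n" and C: "\<forall>c\<in>#C. fps_convergent c \<and> c $ 0 = 0"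
  and u: "germ_convergent u" "u $ 0 $ 0 \<noteq> 0" and eq: "ramify n F1 = u * rprod C"
  using newton_puiseux_regular[OF F1 mlow m] by blast
 let ?t = "twist (cis (2 * pi / real n))"
 let ?C = "image_mset (\<lambda>c. c oo ?t) C"
 have "cmap ?t (ramify n F1) = ramify n F1" using cmap_twist_ramify[OF n] cis_root_power[OF n, of 1] by simp
 then have teq: "cmap ?t u * rprod ?C = u * rprod C" unfolding eq by (simp add: cmap_mult cmap_rprod)
 have "?C = C" by (rule rprod_unique[of "cmap ?t u" 0 _ u 0]) (use teq u C in auto)
 then have CC: "?C = C" and "cmap ?t u = u" using teq by simp_all
 then obtain v where v: "u = ramify n v" using twist_invariant_imp_ramify[OF n] by metis
 have v': "v \<in> Units Cxy" using u germ_convergent_ramify_iff[OF n] ramify_nth_0_0[OF n] by (simp add: v Units_Cxy)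
 define \<Gamma> where "\<Gamma> = image_mset (arc_of_param n) C"
 have den: "arc_denom n \<gamma> \<and> fps_convergent (arc_param n \<gamma>)" if "\<gamma> \<in># \<Gamma>" for \<gamma>
  using that C n by (auto simp: \<Gamma>_def arc_denom_of_param)
 have "image_mset (arc_param n) \<Gamma> = C" using n by (simp add: \<Gamma>_def image_mset.compositionality comp_def)
 then have rp: "root_prod n \<Gamma> = rprod C" by (simp add: root_prod_eq_rprod)
 have "np_factorization F E \<Gamma>" unfolding np_factorization_def
 proof (intro conjI ballI bexI[OF _ v'] exI[of _ n])
  fix \<gamma> assume "\<gamma> \<in># \<Gamma>"
  then obtain c where c: "c \<in># C" "\<gamma> = arc_of_param n c" by (auto simp: \<Gamma>_def)
  then have "\<gamma> 0 = 0" using C arc_of_param_nth[OF n, of c 0] by simp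
  then show "is_arc \<gamma>" "0 < arc_order \<gamma>" using den[OF \<open>\<gamma> \<in># \<Gamma>\<close>] arc_denom_imp_is_arc arc_order_pos_iff by blast+
 next
  show "ramify n F = ramify n (v * germ_y ^ E) * root_prod n \<Gamma>" by (simp add: FF1 ramify_mult n eq rp v mult_ac)
 qed (use den n in auto)
 then show ?thesis using that n den by blast
qed

section \<open>Products over conjugation-stable multisets of arcs; branches\<close>

lemma arc_prod_eqI:
 assumes n: "0 < n" "\<And>\<gamma>. \<gamma> \<in># \<Gamma> \<Longrightarrow> arc_denom n \<gamma>" and P: "ramify n P = root_prod n \<Gamma>"
 shows "arc_prod \<Gamma> = P" unfolding arc_prod_def
proof (rule the_equality)
 show "\<exists>n>0. (\<forall>\<gamma>\<in>#\<Gamma>. arc_denom n \<gamma>) \<and> ramify n P = root_prod n \<Gamma>" using assms by blast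
next
 fix Q assume "\<exists>n>0. (\<forall>\<gamma>\<in>#\<Gamma>. arc_denom n \<gamma>) \<and> ramify n Q = root_prod n \<Gamma>"
 then obtain m where m: "0 < m" "\<forall>\<gamma>\<in>#\<Gamma>. arc_denom m \<gamma>" "ramify m Q = root_prod m \<Gamma>" by blast
 have "ramify (n * m) P = root_prod (n * m) \<Gamma>"
  using ramify_ramify[OF n(1) m(1), of P] root_prod_mult_den[OF n(1) m(1), of \<Gamma>] n P by simp
 moreover have "ramify (n * m) Q = root_prod (n * m) \<Gamma>"
  using ramify_ramify[OF m(1) n(1), of Q] root_prod_mult_den[OF m(1) n(1), of \<Gamma>] m by (simp add: mult.commute)
 ultimately show "Q = P" using ramify_inj[of "n * m"] n m by simp
qed

text \<open>Stability under a generator of the monodromy is what makes \<open>\<Prod>[x - \<gamma>(y)]\<close> a germ in \<open>x\<close> and \<open>y\<close>.\<close>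

definition conj_stable :: "arc multiset \<Rightarrow> bool" where
 "conj_stable \<Gamma> \<longleftrightarrow> image_mset (conj_arc 1) \<Gamma> = \<Gamma>"

lemma conj_stable_image:
 assumes "conj_stable \<Gamma>"
 shows "image_mset (conj_arc k) \<Gamma> = \<Gamma>"
proof (induction k)
 case (Suc k)
 have "conj_arc (Suc k) = conj_arc 1 \<circ> conj_arc k" by (auto simp: conj_arc_conj_arc)
 then have "image_mset (conj_arc (Suc k)) \<Gamma> = image_mset (conj_arc 1) (image_mset (conj_arc k) \<Gamma>)"
  by (simp add: image_mset.compositionality)
 then show ?case using Suc assms by (simp add: conj_stable_def)
qed (simp add: conj_arc_def)

lemma inj_conj_arc: "inj (conj_arc k)" using conj_arc_inj by (auto simp: inj_def)

lemma count_image_mset_inj: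
 assumes "inj f"
 shows "count (image_mset f A) (f x) = count A x" using injD[OF assms] by (induction A) auto

lemma count_conj_stable:
 assumes "conj_stable \<Gamma>"
 shows "count \<Gamma> (conj_arc k \<xi>) = count \<Gamma> \<xi>" by (subst conj_stable_image[OF assms, of k, symmetric])
   (rule count_image_mset_inj[OF inj_conj_arc])

lemma conj_stable_union: "conj_stable \<Gamma> \<Longrightarrow> conj_stable \<Delta> \<Longrightarrow> conj_stable (\<Gamma> + \<Delta>)" by (simp add: conj_stable_def)

lemma conj_stable_diff:
 assumes "conj_stable \<Gamma>" "conj_stable \<Delta>" "\<Delta> \<subseteq># \<Gamma>"
 shows "conj_stable (\<Gamma> - \<Delta>)" using assms by (simp add: conj_stable_def image_mset_Diff)

lemma conj_stable_np:
 assumes "np_factorization F E \<Gamma>"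
 shows "conj_stable \<Gamma>" using np_factorization_unique[OF np_factorization_conj[OF assms, of 1] assms]
 by (simp add: conj_stable_def)

lemma mset_arc_denom:
 assumes "\<And>\<gamma>. \<gamma> \<in># \<Gamma> \<Longrightarrow> is_arc \<gamma>"
 obtains n where "0 < n" "\<And>\<gamma>. \<gamma> \<in># \<Gamma> \<Longrightarrow> arc_denom n \<gamma>" using finite_arc_denom_common[of "set_mset \<Gamma>"] assms by blast

lemma ramify_arc_prod:
 assumes stable: "conj_stable \<Gamma>" and n: "0 < n" "\<And>\<gamma>. \<gamma> \<in># \<Gamma> \<Longrightarrow> arc_denom n \<gamma>"
 shows "ramify n (arc_prod \<Gamma>) = root_prod n \<Gamma>"
proof -
 have "image_mset (\<lambda>c. c oo twist (cis (2 * pi / real n))) (image_mset (arc_param n) \<Gamma>) =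
   image_mset (arc_param n) (image_mset (conj_arc 1) \<Gamma>)" unfolding image_mset.compositionality comp_def
  by (rule image_mset_cong) (simp add: arc_param_conj[OF n(1)])
 also have "\<dots> = image_mset (arc_param n) \<Gamma>" using stable by (simp add: conj_stable_def)
 finally obtain H where "root_prod n \<Gamma> = ramify n H"
  unfolding root_prod_eq_rprod using rprod_twist_descend[OF n(1)] by metis
 then show ?thesis using arc_prod_eqI[where P = H, OF n] by simp
qed

lemma arc_prod_convergent:
 assumes "conj_stable \<Gamma>" and n: "0 < n" "\<And>\<gamma>. \<gamma> \<in># \<Gamma> \<Longrightarrow> arc_denom n \<gamma>"
  and "\<And>\<gamma>. \<gamma> \<in># \<Gamma> \<Longrightarrow> fps_convergent (arc_param n \<gamma>)"
 shows "germ_convergent (arc_prod \<Gamma>)"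
proof -
 have "germ_convergent (root_prod n \<Gamma>)" unfolding root_prod_def
  by (intro germ_convergent_prod_mset germ_convergent_diff) (auto simp: assms)
 then show ?thesis using ramify_arc_prod[OF assms(1) n] germ_convergent_ramify_iff[OF n(1), of "arc_prod \<Gamma>"] by simp
qed

lemma arc_prod_union:
 assumes "conj_stable \<Gamma>" "conj_stable \<Delta>" "\<And>\<gamma>. \<gamma> \<in># \<Gamma> \<Longrightarrow> is_arc \<gamma>" "\<And>\<gamma>. \<gamma> \<in># \<Delta> \<Longrightarrow> is_arc \<gamma>"
 shows "arc_prod (\<Gamma> + \<Delta>) = arc_prod \<Gamma> * arc_prod \<Delta>"
proof -
 obtain n where n: "0 < n" "\<And>\<gamma>. \<gamma> \<in># \<Gamma> + \<Delta> \<Longrightarrow> arc_denom n \<gamma>" using mset_arc_denom[of "\<Gamma> + \<Delta>"] assms(3,4) by auto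
 show ?thesis by (rule arc_prod_eqI[OF n])
    (use n in \<open>simp_all add: ramify_mult ramify_arc_prod assms root_prod_eq_rprod rprod_union\<close>)
qed

lemma arc_prod_empty [simp]: "arc_prod {#} = 1" by (rule arc_prod_eqI[of 1]) (auto simp: root_prod_def)

text \<open>The root factors multiply to a germ in \<open>x\<close> and \<open>y\<close>, so the factorisation holds without ramification.\<close>

lemma np_factorization_iff:
 "np_factorization F E \<Gamma> \<longleftrightarrow> conj_stable \<Gamma> \<and> (\<forall>\<gamma>\<in>#\<Gamma>. is_arc \<gamma> \<and> \<gamma> 0 = 0) \<and>
   (\<exists>u\<in>Units Cxy. F = u * germ_y ^ E * arc_prod \<Gamma>)" (is "?L \<longleftrightarrow> ?R")
proof
 assume np: ?L
 then obtain u n where u: "u \<in> Units Cxy" and n: "0 < n" "\<And>\<gamma>. \<gamma> \<in># \<Gamma> \<Longrightarrow> arc_denom n \<gamma>"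
  and "ramify n F = ramify n (u * germ_y ^ E) * root_prod n \<Gamma>" unfolding np_factorization_def by blast
 then have "ramify n F = ramify n (u * germ_y ^ E * arc_prod \<Gamma>)"
  using ramify_arc_prod[OF conj_stable_np[OF np] n] by (simp add: ramify_mult)
 then show ?R using ramify_inj[OF n(1)] u conj_stable_np[OF np] np_factorization_arcs[OF np] by blast
next
 assume R: ?R
 then obtain u where u: "u \<in> Units Cxy" "F = u * germ_y ^ E * arc_prod \<Gamma>" by blast
 obtain n where n: "0 < n" "\<And>\<gamma>. \<gamma> \<in># \<Gamma> \<Longrightarrow> arc_denom n \<gamma>" using mset_arc_denom R by metis
 have "ramify n F = ramify n (u * germ_y ^ E) * root_prod n \<Gamma>"
  using R n ramify_arc_prod[of \<Gamma> n] by (simp add: u(2) ramify_mult)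
 then show ?L using u n R arc_order_pos_iff unfolding np_factorization_def by blast
qed

lemma np_factorization_ramify:
 assumes np: "np_factorization F E \<Gamma>" and N: "0 < N" "\<And>\<gamma>. \<gamma> \<in># \<Gamma> \<Longrightarrow> arc_denom N \<gamma>"
 obtains u where "u $ 0 $ 0 \<noteq> 0" "ramify N F = ramify N u * fps_const (fps_X ^ (N * E)) * root_prod N \<Gamma>"
proof -
 obtain u where "u \<in> Units Cxy" "F = u * germ_y ^ E * arc_prod \<Gamma>" using np unfolding np_factorization_iff by blast
 then show ?thesis using that[of u] N ramify_arc_prod[OF conj_stable_np[OF np] N]
  by (simp add: ramify_mult ramify_germ_y_power Units_Cxy)
qed

lemma np_factorization_arc_prod:
 "conj_stable \<Gamma> \<Longrightarrow> (\<And>\<gamma>. \<gamma> \<in># \<Gamma> \<Longrightarrow> is_arc \<gamma> \<and> \<gamma> 0 = 0) \<Longrightarrow> np_factorization (arc_prod \<Gamma>) 0 \<Gamma>"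
 unfolding np_factorization_iff by (auto simp: Units_Cxy intro!: exI[of _ 1])

lemma np_factorization_unit: "u \<in> Units Cxy \<Longrightarrow> np_factorization u 0 {#}"
 unfolding np_factorization_iff by (auto simp: conj_stable_def)

lemma np_factorization_mult:
 assumes F: "np_factorization F E \<Gamma>" and G: "np_factorization G E' \<Gamma>'"
 shows "np_factorization (F * G) (E + E') (\<Gamma> + \<Gamma>')"
proof -
 obtain u u' where u: "u \<in> Units Cxy" "F = u * germ_y ^ E * arc_prod \<Gamma>"
  "u' \<in> Units Cxy" "G = u' * germ_y ^ E' * arc_prod \<Gamma>'" using F G unfolding np_factorization_iff by blast
 have "F * G = u * u' * germ_y ^ (E + E') * arc_prod (\<Gamma> + \<Gamma>')"
  using F G unfolding np_factorization_iff by (simp add: u arc_prod_union power_add mult_ac)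
 moreover have "u * u' \<in> Units Cxy" using u by (simp add: Units_Cxy germ_convergent_mult germ_mult_nth_0_0)
 ultimately show ?thesis using F G unfolding np_factorization_iff by (auto intro: conj_stable_union)
qed

lemma rprod_const_term:
 assumes "\<forall>c\<in>#C. c $ 0 = 0"
 shows "rprod C $ i $ 0 = (if i = size C then 1 else 0)" using assms
proof (induction C arbitrary: i)
 case (add c C)
 then show ?case by (cases i) (simp_all add: left_diff_distrib)
qed simp

lemma arc_prod_const_term:
 assumes "conj_stable \<Gamma>" "\<And>\<gamma>. \<gamma> \<in># \<Gamma> \<Longrightarrow> is_arc \<gamma> \<and> \<gamma> 0 = 0"
 shows "arc_prod \<Gamma> $ i $ 0 = (if i = size \<Gamma> then 1 else 0)"
proof -
 obtain n where n: "0 < n" "\<And>\<gamma>. \<gamma> \<in># \<Gamma> \<Longrightarrow> arc_denom n \<gamma>" using mset_arc_denom assms(2) by metis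
 have "\<forall>c\<in>#image_mset (arc_param n) \<Gamma>. c $ 0 = 0" using assms(2) by auto
 then show ?thesis using rprod_const_term[of "image_mset (arc_param n) \<Gamma>" i] ramify_nth_0_0[OF n(1), of "arc_prod \<Gamma>" i]
   ramify_arc_prod[OF assms(1) n] by (simp add: root_prod_eq_rprod)
qed

lemma np_lowest_coeff:
 assumes np: "np_factorization F E \<Gamma>"
 shows "k < E \<Longrightarrow> F $ i $ k = 0" and "i < size \<Gamma> \<Longrightarrow> F $ i $ E = 0" and "F $ size \<Gamma> $ E \<noteq> 0"
proof -
 obtain u where u: "u \<in> Units Cxy" "F = fps_const (fps_X ^ E) * (u * arc_prod \<Gamma>)"
  using np unfolding np_factorization_iff by (auto simp: germ_y_def fps_const_power mult_ac)
 have "arc_prod \<Gamma> $ i $ 0 = (if i = size \<Gamma> then 1 else 0)" for i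
  using np unfolding np_factorization_iff by (intro arc_prod_const_term) auto
 then have "(u * arc_prod \<Gamma>) $ i $ 0 = (\<Sum>k=0..i. u $ k $ 0 * (if i - k = size \<Gamma> then 1 else 0))" for i
  by (simp add: fps_mult_nth fps_sum_nth)
 moreover have F: "F $ i $ k = (if k < E then 0 else (u * arc_prod \<Gamma>) $ i $ (k - E))" for i k
  by (simp only: u(2) fps_mult_left_const_nth fps_X_power_mult_nth)
 ultimately have *: "F $ i $ E = (\<Sum>k=0..i. u $ k $ 0 * (if i - k = size \<Gamma> then 1 else 0))" for i by simp
 show "k < E \<Longrightarrow> F $ i $ k = 0" by (simp add: F)
 show "i < size \<Gamma> \<Longrightarrow> F $ i $ E = 0" unfolding * by (intro sum.neutral) auto
 have "F $ size \<Gamma> $ E = (\<Sum>k=0..size \<Gamma>. if k = 0 then u $ 0 $ 0 else 0)" unfolding * by (intro sum.cong refl) auto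
 then show "F $ size \<Gamma> $ E \<noteq> 0" using u(1) by (simp add: Units_Cxy)
qed

subsection \<open>Orbits\<close>

definition orb :: "arc \<Rightarrow> arc set" where
 "orb \<xi> = range (\<lambda>k. conj_arc k \<xi>)"

lemma self_in_orb [simp]: "\<xi> \<in> orb \<xi>" unfolding orb_def using conj_arc_0 by (metis rangeI)

lemma conj_in_orb: "\<zeta> \<in> orb \<xi> \<Longrightarrow> conj_arc k \<zeta> \<in> orb \<xi>" by (auto simp: orb_def conj_arc_conj_arc)

lemma orb_eq:
 assumes "is_arc \<xi>" "\<zeta> \<in> orb \<xi>"
 shows "orb \<zeta> = orb \<xi>"
proof
 show "orb \<zeta> \<subseteq> orb \<xi>" using assms(2) by (auto simp: orb_def conj_arc_conj_arc)
next
 obtain k where "\<zeta> = conj_arc k \<xi>" using assms(2) by (auto simp: orb_def)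
 then obtain l where "\<xi> = conj_arc l \<zeta>" using conj_arc_inverse[OF assms(1)] by metis
 then show "orb \<xi> \<subseteq> orb \<zeta>" by (auto simp: orb_def conj_arc_conj_arc)
qed

lemma orb_eq_image:
 assumes n: "arc_denom n \<xi>"
 shows "orb \<xi> = (\<lambda>k. conj_arc k \<xi>) ` {..<n}" unfolding orb_def
proof (intro subset_antisym image_subsetI)
 fix k
 have "conj_arc k \<xi> = conj_arc (k mod n) (conj_arc (n * (k div n)) \<xi>)" by (simp add: conj_arc_conj_arc)
 then have "conj_arc k \<xi> = conj_arc (k mod n) \<xi>" using conj_arc_fix[OF n] by simp
 then show "conj_arc k \<xi> \<in> (\<lambda>k. conj_arc k \<xi>) ` {..<n}"
  using arc_denom_pos[OF n] by (intro image_eqI[of _ _ "k mod n"]) auto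
qed auto

lemma finite_orb: "is_arc \<xi> \<Longrightarrow> finite (orb \<xi>)"
 using orb_eq_image unfolding is_arc_def by (metis finite_imageI finite_lessThan)

lemma orb_arc:
 assumes "\<zeta> \<in> orb \<xi>"
 shows "is_arc \<zeta> \<longleftrightarrow> is_arc \<xi>" "arc_denom n \<zeta> \<longleftrightarrow> arc_denom n \<xi>" "\<zeta> e = 0 \<longleftrightarrow> \<xi> e = 0" using assms by (auto simp: orb_def)

lemma conj_stable_orb:
 assumes "is_arc \<xi>"
 shows "conj_stable (mset_set (orb \<xi>))"
proof -
 have sub: "conj_arc 1 ` orb \<xi> \<subseteq> orb \<xi>" using conj_in_orb by blast
 have "inj_on (conj_arc 1) (orb \<xi>)" using inj_conj_arc by (rule inj_on_subset) auto
 then have "conj_arc 1 ` orb \<xi> = orb \<xi>" using sub finite_orb[OF assms] by (simp add: endo_inj_surj)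
 then show ?thesis unfolding conj_stable_def using \<open>inj_on (conj_arc 1) (orb \<xi>)\<close> by (simp add: image_mset_mset_set)
qed

lemma orb_subset_stable:
 assumes "conj_stable \<Gamma>" "\<xi> \<in># \<Gamma>" "is_arc \<xi>"
 shows "mset_set (orb \<xi>) \<subseteq># \<Gamma>"
proof (rule mset_subset_eqI)
 fix \<zeta>
 show "count (mset_set (orb \<xi>)) \<zeta> \<le> count \<Gamma> \<zeta>"
 proof (cases "\<zeta> \<in> orb \<xi>")
  case True
  then obtain k where "\<zeta> = conj_arc k \<xi>" by (auto simp: orb_def)
  then have "count \<Gamma> \<zeta> = count \<Gamma> \<xi>" using count_conj_stable[OF assms(1)] by simp
  then have "1 \<le> count \<Gamma> \<zeta>" using assms(2) by simp
  then show ?thesis using True finite_orb[OF assms(3)] by simp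
 qed (simp add: finite_orb[OF assms(3)])
qed

definition branch :: "arc \<Rightarrow> germ" where
 "branch \<xi> = arc_prod (mset_set (orb \<xi>))"

lemma np_factorization_branch:
 assumes "is_arc \<xi>" "\<xi> 0 = 0"
 shows "np_factorization (branch \<xi>) 0 (mset_set (orb \<xi>))" unfolding branch_def
 by (rule np_factorization_arc_prod[OF conj_stable_orb[OF assms(1)]])
   (use assms finite_orb orb_arc in auto)

lemma fps_convergent_twist:
 assumes "norm z = 1" "fps_convergent f"
 shows "fps_convergent (f oo twist z)"
proof (rule germ_convergent_reindex[OF assms(2), of _ 1 0 0])
 fix i j show "fps_const (f oo twist z) $ i $ j = 0 \<or>
   norm (fps_const (f oo twist z) $ i $ j) \<le> 1 * norm (fps_const f $ (i + 0) $ (j + 0))"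
  by (cases i) (auto simp: compose_twist_nth norm_mult norm_power assms(1))
qed simp

lemma branch_convergent:
 assumes \<xi>: "arc_denom n \<xi>" "fps_convergent (arc_param n \<xi>)"
 shows "germ_convergent (branch \<xi>)" unfolding branch_def
proof (rule arc_prod_convergent)
 have arc: "is_arc \<xi>" using \<xi> arc_denom_imp_is_arc by blast
 show n: "0 < n" using \<xi> arc_denom_pos by blast
 show "conj_stable (mset_set (orb \<xi>))" by (rule conj_stable_orb[OF arc])
 fix \<gamma> assume "\<gamma> \<in># mset_set (orb \<xi>)"
 then have \<gamma>: "\<gamma> \<in> orb \<xi>" using finite_orb[OF arc] by simp
 then show "arc_denom n \<gamma>" using \<xi> orb_arc by blast
 obtain k where "\<gamma> = conj_arc k \<xi>" using \<gamma> by (auto simp: orb_def)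
 then show "fps_convergent (arc_param n \<gamma>)" using fps_convergent_twist[OF _ \<xi>(2)] by (simp add: arc_param_conj[OF n])
qed

text \<open>The orbit of one root gives a factor, whose cofactor is a unit and therefore has no further roots.\<close>

lemma irreducible_np_roots:
 assumes p: "p \<in> carrier Cxy" "ring_irreducible\<^bsub>Cxy\<^esub> p" and \<xi>: "\<xi> \<in> roots p"
 shows "np_roots p = mset_set (orb \<xi>)"
proof -
 interpret domain Cxy by (rule domain_Cxy)
 have p0: "p \<noteq> 0" using p by (auto simp: ring_irreducible_def)
 obtain E \<Gamma> n where np: "np_factorization p E \<Gamma>" and n: "0 < n"
  and \<Gamma>: "\<And>\<gamma>. \<gamma> \<in># \<Gamma> \<Longrightarrow> arc_denom n \<gamma> \<and> fps_convergent (arc_param n \<gamma>)" using newton_puiseux[of p] p p0 by auto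
 have roots: "np_roots p = \<Gamma>" by (rule np_roots_eq[OF np])
 have \<xi>\<Gamma>: "\<xi> \<in># \<Gamma>" using \<xi> roots by (simp add: roots_def)
 have arc: "is_arc \<xi>" "\<xi> 0 = 0" using np_factorization_arcs[OF np \<xi>\<Gamma>] by auto
 note st = conj_stable_np[OF np] and orb = conj_stable_orb[OF arc(1)]
 define \<Delta> where "\<Delta> = \<Gamma> - mset_set (orb \<xi>)"
 have sub: "mset_set (orb \<xi>) \<subseteq># \<Gamma>" by (rule orb_subset_stable[OF st \<xi>\<Gamma> arc(1)])
 then have \<Gamma>eq: "\<Gamma> = mset_set (orb \<xi>) + \<Delta>" by (simp add: \<Delta>_def)
 have st\<Delta>: "conj_stable \<Delta>" unfolding \<Delta>_def by (rule conj_stable_diff[OF st orb sub])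
 have \<Delta>: "arc_denom n \<gamma> \<and> fps_convergent (arc_param n \<gamma>)" "is_arc \<gamma> \<and> \<gamma> 0 = 0" if "\<gamma> \<in># \<Delta>" for \<gamma>
  using that \<Gamma> np_factorization_arcs[OF np] by (auto simp: \<Gamma>eq)
 have c1: "germ_convergent (branch \<xi>)" using branch_convergent \<Gamma>[OF \<xi>\<Gamma>] by blast
 have c2: "germ_convergent (arc_prod \<Delta>)" using arc_prod_convergent[OF st\<Delta> n] \<Delta> by blast
 obtain u where u: "u \<in> Units Cxy" and eq: "p = u * germ_y ^ E * arc_prod \<Gamma>"
  using np unfolding np_factorization_iff by blast
 have all: "arc_prod \<Gamma> = branch \<xi> * arc_prod \<Delta>" unfolding branch_def \<Gamma>eq
  by (rule arc_prod_union[OF orb st\<Delta>]) (use \<Delta> orb_arc(1)[where \<xi> = \<xi>] arc finite_orb[OF arc(1)] in auto)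
 define Q where "Q = u * germ_y ^ E * arc_prod \<Delta>"
 have "Q \<in> carrier Cxy" using u c2 by (simp add: Q_def Units_Cxy germ_convergent_mult germ_convergent_power)
 moreover have "p = Q * branch \<xi>" by (simp add: Q_def eq all mult_ac)
 ultimately have "Q \<in> Units Cxy \<or> branch \<xi> \<in> Units Cxy" using ring_irreducibleE(5)[OF p] c1 by simp
 moreover have "mset_set (orb \<xi>) \<noteq> {#}"
  using finite_orb[OF arc(1)] self_in_orb[of \<xi>] by (metis empty_iff mset_set_empty_iff)
 then have "branch \<xi> \<notin> Units Cxy"
  using np_factorization_unique[OF np_factorization_unit np_factorization_branch[OF arc]] by metis
 ultimately have "Q \<in> Units Cxy" by blast
 moreover have "np_factorization Q E \<Delta>" unfolding np_factorization_iff Q_def using st\<Delta> \<Delta> u by blast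
 ultimately have "\<Delta> = {#}" using np_factorization_unique np_factorization_unit by blast
 then show ?thesis using roots \<Gamma>eq by simp
qed

text \<open>
  Either of two factors has a stable multiset of roots. As these add up to a single orbit, one of them is
  empty, and a germ without roots and without a factor \<open>y\<close> is a unit.
\<close>

lemma branch_irreducible:
 assumes n: "arc_denom n \<xi>" and \<xi>: "fps_convergent (arc_param n \<xi>)" "\<xi> 0 = 0"
 shows "ring_irreducible\<^bsub>Cxy\<^esub> (branch \<xi>)"
proof -
 interpret domain Cxy by (rule domain_Cxy)
 have arc: "is_arc \<xi>" using n arc_denom_imp_is_arc by blast
 note npb = np_factorization_branch[OF arc \<xi>(2)]
 have c: "germ_convergent (branch \<xi>)" by (rule branch_convergent[OF n \<xi>(1)])
 have mem: "\<xi> \<in># mset_set (orb \<xi>)" using finite_orb[OF arc] by simp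
 have b0: "branch \<xi> \<noteq> 0" using np_lowest_coeff(3)[OF npb] by auto
 show ?thesis
 proof (rule ring_irreducibleI)
  show "branch \<xi> \<in> carrier Cxy - {\<zero>\<^bsub>Cxy\<^esub>}" using c b0 by simp
  show "branch \<xi> \<notin> Units Cxy"
   using np_factorization_unique[OF np_factorization_unit npb] mem by (metis empty_not_add_mset insert_DiffM)
  fix a b assume ab: "a \<in> carrier Cxy" "b \<in> carrier Cxy" "branch \<xi> = a \<otimes>\<^bsub>Cxy\<^esub> b"
  have "a \<noteq> 0" "b \<noteq> 0" using ab b0 by auto
  then obtain E1 A E2 B where A: "np_factorization a E1 A" and B: "np_factorization b E2 B"
   using newton_puiseux[of a] newton_puiseux[of b] ab(1,2) by (metis Cxy_simps(1) mem_Collect_eq)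
  have npab: "np_factorization (branch \<xi>) (E1 + E2) (A + B)" using np_factorization_mult[OF A B] ab(3) by simp
  have AB: "A + B = mset_set (orb \<xi>)" by (rule np_factorization_unique[OF npab npb])
  have "E1 + E2 = 0" using np_lowest_coeff(1)[OF npab, of 0] np_lowest_coeff(3)[OF npb] by blast
  moreover have "A = {#} \<or> B = {#}"
  proof (rule ccontr)
   assume "\<not> (A = {#} \<or> B = {#})"
   then obtain \<alpha> \<beta> where ab': "\<alpha> \<in># A" "\<beta> \<in># B" by blast
   have "\<xi> \<in># \<Theta>" if "conj_stable \<Theta>" "\<gamma> \<in># \<Theta>" "\<gamma> \<in># A + B" for \<Theta> \<gamma>
   proof -
    have "\<gamma> \<in> orb \<xi>" using that(3) AB finite_orb[OF arc] by simp
    then have \<gamma>: "orb \<gamma> = orb \<xi>" "is_arc \<gamma>" using orb_eq[OF arc] orb_arc(1) arc by blast+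
    then have "mset_set (orb \<xi>) \<subseteq># \<Theta>" using orb_subset_stable[OF that(1,2)] by simp
    then show ?thesis using mem by (rule mset_subset_eqD)
   qed
   then have "\<xi> \<in># A" "\<xi> \<in># B" using conj_stable_np[OF A] conj_stable_np[OF B] ab' by auto
   then have "1 + 1 \<le> count (A + B) \<xi>" unfolding count_union by (intro add_mono) auto
   then show False using finite_orb[OF arc] AB by simp
  qed
  ultimately show "a \<in> Units Cxy \<or> b \<in> Units Cxy" using A B unfolding np_factorization_iff by auto
 qed
qed

section \<open>The order of a germ along an arc\<close>

text \<open>Contact order as a real number; \<open>0\<close> when the arcs agree.\<close>

definition rcontact :: "arc \<Rightarrow> arc \<Rightarrow> real" where
 "rcontact \<xi> \<zeta> = real_of_ereal (contact \<xi> \<zeta>)"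

lemma rcontact_param:
 assumes "arc_denom n \<xi>" "arc_denom n \<zeta>"
 shows "real n * rcontact \<xi> \<zeta> = real (subdegree (arc_param n \<xi> - arc_param n \<zeta>))"
proof (cases "\<xi> = \<zeta>")
 case False
 then show ?thesis using contact_param[OF assms] arc_denom_pos[OF assms(1)] by (simp add: rcontact_def)
qed (simp add: rcontact_def)

lemma ereal_rcontact:
 assumes "is_arc \<xi>" "is_arc \<zeta>" "\<xi> \<noteq> \<zeta>"
 shows "contact \<xi> \<zeta> = ereal (rcontact \<xi> \<zeta>)"
 using contact_obtain[OF assms] unfolding rcontact_def by (metis real_of_ereal.simps(1))

lemma subdegree_prod_mset:
 fixes f :: "'b \<Rightarrow> 'a::idom fps"
 assumes "\<And>x. x \<in># A \<Longrightarrow> f x \<noteq> 0"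
 shows "subdegree (\<Prod>x\<in>#A. f x) = (\<Sum>x\<in>#A. subdegree (f x))" "(\<Prod>x\<in>#A. f x) \<noteq> 0"
proof -
 have "(\<Prod>x\<in>#A. f x) \<noteq> 0 \<and> subdegree (\<Prod>x\<in>#A. f x) = (\<Sum>x\<in>#A. subdegree (f x))" using assms by (induction A) auto
 then show "subdegree (\<Prod>x\<in>#A. f x) = (\<Sum>x\<in>#A. subdegree (f x))" "(\<Prod>x\<in>#A. f x) \<noteq> 0" by auto
qed

text \<open>Along \<open>\<xi>\<close> each factor \<open>x - \<gamma>\<close> contributes the contact order of \<open>\<xi>\<close> and \<open>\<gamma>\<close>.\<close>

lemma np_arc_ev:
 assumes np: "np_factorization F E \<Gamma>" and \<xi>: "is_arc \<xi>" "\<xi> 0 = 0" "\<xi> \<notin># \<Gamma>"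
  and n: "arc_denom n \<xi>"
 shows "arc_ev n \<xi> F \<noteq> 0"
  and "real (subdegree (arc_ev n \<xi> F)) = real n * (real E + (\<Sum>\<gamma>\<in>#\<Gamma>. rcontact \<xi> \<gamma>))"
proof -
 obtain k where k: "0 < k" "\<And>\<gamma>. \<gamma> \<in># \<Gamma> \<Longrightarrow> arc_denom k \<gamma>" using mset_arc_denom np_factorization_arcs[OF np] by metis
 have n0: "0 < n" by (rule arc_denom_pos[OF n])
 define N where "N = k * n"
 have N: "0 < N" using k n0 by (simp add: N_def)
 have d\<xi>: "arc_denom N \<xi>" using arc_denom_mult[OF n k(1)] by (simp add: N_def mult.commute)
 have d\<Gamma>: "arc_denom N \<gamma>" if "\<gamma> \<in># \<Gamma>" for \<gamma> using arc_denom_mult[OF k(2)[OF that] n0] by (simp add: N_def)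
 obtain u where u: "u $ 0 $ 0 \<noteq> 0" and eq: "ramify N F = ramify N u * fps_const (fps_X ^ (N * E)) * root_prod N \<Gamma>"
  by (rule np_factorization_ramify[OF np N d\<Gamma>])
 let ?x = "arc_param N \<xi>"
 have x0: "?x $ 0 = 0" using \<xi> by simp
 have e: "arc_ev N \<xi> F = ev ?x (ramify N u) * fps_X ^ (N * E) * (\<Prod>\<gamma>\<in>#\<Gamma>. ?x - arc_param N \<gamma>)"
  unfolding arc_ev_def eq by (simp add: ev_mult root_prod_def ev_prod_mset ev_diff ev_X \<xi>)
 have ne: "?x - arc_param N \<gamma> \<noteq> 0" if "\<gamma> \<in># \<Gamma>" for \<gamma> using arc_param_inj[OF d\<xi> d\<Gamma>[OF that]] that \<xi>(3) by auto
 note pr = subdegree_prod_mset[of \<Gamma> "\<lambda>\<gamma>. ?x - arc_param N \<gamma>", OF ne]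
 have u0: "ev ?x (ramify N u) $ 0 \<noteq> 0" by (rule ev_unit_neq_0) (use u x0 ramify_nth_0_0[OF N] in auto)
 then have u0': "ev ?x (ramify N u) \<noteq> 0" by auto
 have evne: "arc_ev N \<xi> F \<noteq> 0" using u0' pr(2) by (simp add: e)
 have "subdegree (arc_ev N \<xi> F) = N * E + (\<Sum>\<gamma>\<in>#\<Gamma>. subdegree (?x - arc_param N \<gamma>))"
  using u0 u0' pr by (simp add: e subdegree_eq_0)
 also have "real \<dots> = real N * (real E + (\<Sum>\<gamma>\<in>#\<Gamma>. rcontact \<xi> \<gamma>))"
 proof -
  have "real (\<Sum>\<gamma>\<in>#\<Gamma>. subdegree (?x - arc_param N \<gamma>)) = (\<Sum>\<gamma>\<in>#\<Gamma>. real N * rcontact \<xi> \<gamma>)"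
   using d\<Gamma> by (induction \<Gamma>) (auto simp: rcontact_param[OF d\<xi>])
  also have "\<dots> = real N * (\<Sum>\<gamma>\<in>#\<Gamma>. rcontact \<xi> \<gamma>)" by (induction \<Gamma>) (auto simp: distrib_left)
  finally show ?thesis by (simp add: distrib_left)
 qed
 finally have sN: "real (subdegree (arc_ev N \<xi> F)) = real N * (real E + (\<Sum>\<gamma>\<in>#\<Gamma>. rcontact \<xi> \<gamma>))" .
 have eN: "arc_ev N \<xi> F = arc_ev n \<xi> F oo fps_X ^ k" using arc_ev_mult_den[OF n \<xi>(2) k(1)] by (simp add: N_def mult.commute)
 then show "arc_ev n \<xi> F \<noteq> 0" using evne by auto
 have "subdegree (arc_ev N \<xi> F) = k * subdegree (arc_ev n \<xi> F)" unfolding eN using k by (simp add: fps_X_power_subdegree)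
 then have "real k * real (subdegree (arc_ev n \<xi> F)) = real k * (real n * (real E + (\<Sum>\<gamma>\<in>#\<Gamma>. rcontact \<xi> \<gamma>)))"
  using sN by (simp add: N_def mult.assoc)
 then show "real (subdegree (arc_ev n \<xi> F)) = real n * (real E + (\<Sum>\<gamma>\<in>#\<Gamma>. rcontact \<xi> \<gamma>))" using k by simp
qed

lemma np_arc_order:
 assumes "np_factorization F E \<Gamma>" "is_arc \<xi>" "\<xi> 0 = 0" "\<xi> \<notin># \<Gamma>"
 shows "arc_order (subst_arc F \<xi>) = ereal (real E + (\<Sum>\<gamma>\<in>#\<Gamma>. rcontact \<xi> \<gamma>))"
  and "subst_arc F \<xi> \<noteq> (\<lambda>_. 0)"
proof -
 obtain n where n: "arc_denom n \<xi>" using assms(2) is_arc_def by blast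
 note e = np_arc_ev[OF assms n]
 have n0: "0 < n" by (rule arc_denom_pos[OF n])
 show "arc_order (subst_arc F \<xi>) = ereal (real E + (\<Sum>\<gamma>\<in>#\<Gamma>. rcontact \<xi> \<gamma>))"
  unfolding subst_arc_eq[OF n assms(3)] arc_order_of_param[OF n0 e(1)] e(2) using n0 by simp
 show "subst_arc F \<xi> \<noteq> (\<lambda>_. 0)" unfolding subst_arc_eq[OF n assms(3)] using arc_of_param_eq_0_iff[OF n0] e(1) by blast
qed

section \<open>Intersection multiplicities\<close>

definition ideal2 :: "germ \<Rightarrow> germ \<Rightarrow> germ set" where
 "ideal2 F G = {F * u + G * v | u v. germ_convergent u \<and> germ_convergent v}"

lemma ideal2I: "germ_convergent u \<Longrightarrow> germ_convergent v \<Longrightarrow> F * u + G * v \<in> ideal2 F G" by (auto simp: ideal2_def)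

lemma ideal2_add:
 assumes "a \<in> ideal2 F G" "b \<in> ideal2 F G"
 shows "a + b \<in> ideal2 F G"
proof -
 obtain u v u' v' where *: "a = F * u + G * v" "b = F * u' + G * v'" "germ_convergent u"
  "germ_convergent v" "germ_convergent u'" "germ_convergent v'" using assms by (auto simp: ideal2_def)
 have "a + b = F * (u + u') + G * (v + v')" by (simp add: * algebra_simps)
 then show ?thesis using ideal2I * germ_convergent_add by metis
qed

lemma ideal2_mult:
 assumes "a \<in> ideal2 F G" "germ_convergent r"
 shows "r * a \<in> ideal2 F G"
proof -
 obtain u v where *: "a = F * u + G * v" "germ_convergent u" "germ_convergent v" using assms by (auto simp: ideal2_def)
 have "r * a = F * (r * u) + G * (r * v)" by (simp add: * algebra_simps)
 then show ?thesis using ideal2I * germ_convergent_mult assms(2) by metis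
qed

lemma ideal2_generators:
 "F \<in> ideal2 F G" "G \<in> ideal2 F G" using ideal2I[of 1 0 F G] ideal2I[of 0 1 F G] by simp_all

lemma ideal2_carrier:
 "germ_convergent F \<Longrightarrow> germ_convergent G \<Longrightarrow> a \<in> ideal2 F G \<Longrightarrow> germ_convergent a"
 by (auto simp: ideal2_def intro!: germ_convergent_add germ_convergent_mult)

lemma a_inv_Cxy: "germ_convergent F \<Longrightarrow> \<ominus>\<^bsub>Cxy\<^esub> F = - F"
proof -
 interpret domain Cxy by (rule domain_Cxy)
 assume "germ_convergent F"
 then show ?thesis by (intro minus_equality) auto
qed

lemma ideal_ideal2:
 assumes "germ_convergent F" "germ_convergent G"
 shows "ideal (ideal2 F G) Cxy"
proof -
 interpret domain Cxy by (rule domain_Cxy)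
 show ?thesis
 proof (rule idealI)
  show "subgroup (ideal2 F G) (add_monoid Cxy)"
  proof (rule add.subgroupI)
   show "ideal2 F G \<subseteq> carrier Cxy" using ideal2_carrier[OF assms] by auto
   show "ideal2 F G \<noteq> {}" using ideal2_generators by blast
   fix a assume a: "a \<in> ideal2 F G"
   have "- a \<in> ideal2 F G" using ideal2_mult[OF a, of "-1"] by simp
   then show "\<ominus>\<^bsub>Cxy\<^esub> a \<in> ideal2 F G" using ideal2_carrier[OF assms a] by (simp add: a_inv_Cxy)
  next
   fix a b assume "a \<in> ideal2 F G" "b \<in> ideal2 F G"
   then show "a \<oplus>\<^bsub>Cxy\<^esub> b \<in> ideal2 F G" by (simp add: ideal2_add)
  qed
  show "x \<otimes>\<^bsub>Cxy\<^esub> a \<in> ideal2 F G" "a \<otimes>\<^bsub>Cxy\<^esub> x \<in> ideal2 F G"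
   if "a \<in> ideal2 F G" "x \<in> carrier Cxy" for a x using ideal2_mult[OF that(1), of x] that(2) by (simp_all add: mult.commute)
 qed (rule ring_axioms)
qed

lemma Idl_Cxy:
 assumes "germ_convergent F" "germ_convergent G"
 shows "Idl\<^bsub>Cxy\<^esub> {F, G} = ideal2 F G"
proof -
 interpret domain Cxy by (rule domain_Cxy)
 show ?thesis
 proof
  show "Idl\<^bsub>Cxy\<^esub> {F, G} \<subseteq> ideal2 F G" by (rule genideal_minimal[OF ideal_ideal2[OF assms]]) (simp add: ideal2_generators)
 next
  interpret I: ideal "Idl\<^bsub>Cxy\<^esub> {F, G}" Cxy by (rule genideal_ideal) (use assms in auto)
  have "F \<in> Idl\<^bsub>Cxy\<^esub> {F, G}" "G \<in> Idl\<^bsub>Cxy\<^esub> {F, G}" using genideal_self[of "{F, G}"] assms by auto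
  then show "ideal2 F G \<subseteq> Idl\<^bsub>Cxy\<^esub> {F, G}" unfolding ideal2_def using I.I_r_closed I.a_closed by auto
 qed
qed

text \<open>Linear independence and generation over \<open>\<complex>\<close> modulo a set \<open>I\<close> of germs.\<close>

definition lin :: "(nat \<Rightarrow> germ) \<Rightarrow> nat \<Rightarrow> (nat \<Rightarrow> complex) \<Rightarrow> germ" where
 "lin b s c = (\<Sum>i<s. germ_const (c i) * b i)"

definition indep_mod :: "germ set \<Rightarrow> nat \<Rightarrow> (nat \<Rightarrow> germ) \<Rightarrow> bool" where
 "indep_mod I s b \<longleftrightarrow> (\<forall>i<s. germ_convergent (b i)) \<and> (\<forall>c. lin b s c \<in> I \<longrightarrow> (\<forall>i<s. c i = 0))"

definition spans_mod :: "germ set \<Rightarrow> nat \<Rightarrow> (nat \<Rightarrow> germ) \<Rightarrow> bool" where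
 "spans_mod I s b \<longleftrightarrow> (\<forall>i<s. germ_convergent (b i)) \<and> (\<forall>r. germ_convergent r \<longrightarrow> (\<exists>c. r - lin b s c \<in> I))"

definition has_codim :: "germ set \<Rightarrow> nat \<Rightarrow> bool" where
 "has_codim I s \<longleftrightarrow> (\<exists>b. indep_mod I s b \<and> spans_mod I s b)"

lemma lin_convergent: "(\<And>i. i < s \<Longrightarrow> germ_convergent (b i)) \<Longrightarrow> germ_convergent (lin b s c)"
 unfolding lin_def by (auto intro!: germ_convergent_sum germ_convergent_mult)

lemma subfield_consts: "subfield (range germ_const) Cxy"
proof -
 interpret domain Cxy by (rule domain_Cxy)
 have c: "germ_const a + germ_const b = germ_const (a + b)" "germ_const a * germ_const b = germ_const (a * b)"
  "- germ_const a = germ_const (- a)" "1 = germ_const 1" "0 = germ_const 0" for a b by (simp_all add: germ_const_def)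
 show ?thesis
 proof (rule subfieldI)
  show "subcring (range germ_const) Cxy"
  proof (rule subcringI)
   show "subring (range germ_const) Cxy" by (rule subringI) (auto simp: a_inv_Cxy c)
   fix a b assume "a \<in> range germ_const" "b \<in> range germ_const"
   then show "a \<otimes>\<^bsub>Cxy\<^esub> b = b \<otimes>\<^bsub>Cxy\<^esub> a" by (simp add: mult.commute)
  qed
  show "Units (Cxy\<lparr>carrier := range germ_const\<rparr>) = range germ_const - {\<zero>\<^bsub>Cxy\<^esub>}"
  proof (intro subset_antisym subsetI)
   fix a assume "a \<in> Units (Cxy\<lparr>carrier := range germ_const\<rparr>)"
   then show "a \<in> range germ_const - {\<zero>\<^bsub>Cxy\<^esub>}" by (auto simp: Units_def)
  next
   fix a assume "a \<in> range germ_const - {\<zero>\<^bsub>Cxy\<^esub>}"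
   then obtain z where z: "a = germ_const z" "z \<noteq> 0" by (auto simp: c(5))
   then have "germ_const (1 / z) * a = 1" "a * germ_const (1 / z) = 1" by (simp_all add: c(2,4))
   then show "a \<in> Units (Cxy\<lparr>carrier := range germ_const\<rparr>)" using z by (auto simp: Units_def)
  qed
 qed
qed

lemma combine_Cxy:
 "ring.combine Cxy (map f xs) (map b xs) = (\<Sum>x\<leftarrow>xs. f x * b x)"
proof -
 interpret domain Cxy by (rule domain_Cxy)
 show ?thesis by (induction xs) auto
qed

lemma combine_Quot:
 assumes I: "ideal I Cxy" and b: "\<And>i. i < s \<Longrightarrow> germ_convergent (b i)"
 shows "ring.combine (Cxy Quot I) (map (\<lambda>i. I +>\<^bsub>Cxy\<^esub> germ_const (c i)) [0..<s])
  (map (\<lambda>i. I +>\<^bsub>Cxy\<^esub> b i) [0..<s]) = I +>\<^bsub>Cxy\<^esub> lin b s c"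
proof -
 interpret ring_hom_ring Cxy "Cxy Quot I" "(+>\<^bsub>Cxy\<^esub>) I" by (rule ideal.rcos_ring_hom_ring[OF I])
 have "S.combine (map ((+>\<^bsub>Cxy\<^esub>) I) (map (\<lambda>i. germ_const (c i)) [0..<s])) (map ((+>\<^bsub>Cxy\<^esub>) I) (map b [0..<s])) =
  I +>\<^bsub>Cxy\<^esub> R.combine (map (\<lambda>i. germ_const (c i)) [0..<s]) (map b [0..<s])" by (rule combine_hom) (use b in auto)
 then show ?thesis by (simp add: combine_Cxy lin_def comp_def interv_sum_list_conv_sum_set_nat lessThan_atLeast0)
qed

lemma coset_eq_iff:
 assumes I: "ideal I Cxy" and "germ_convergent a" "germ_convergent b"
 shows "I +>\<^bsub>Cxy\<^esub> a = I +>\<^bsub>Cxy\<^esub> b \<longleftrightarrow> a - b \<in> I"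
proof -
 interpret ideal I Cxy by (rule I)
 have "(a \<ominus>\<^bsub>Cxy\<^esub> b \<in> I) = (I +>\<^bsub>Cxy\<^esub> a = I +>\<^bsub>Cxy\<^esub> b)" by (rule quotient_eq_iff_same_a_r_cos[OF I]) (use assms in auto)
 then show ?thesis using assms by (simp add: a_minus_def a_inv_Cxy)
qed

lemma zero_Quot: "\<zero>\<^bsub>Cxy Quot I\<^esub> = I" by (simp add: FactRing_def)

context
 fixes I :: "germ set"
 assumes I: "ideal I Cxy"
begin

interpretation ideal I Cxy by (rule I)

interpretation h: ring_hom_ring Cxy "Cxy Quot I" "(+>\<^bsub>Cxy\<^esub>) I" by (rule rcos_ring_hom_ring)

lemma coset_eq_I_iff: "germ_convergent a \<Longrightarrow> I +>\<^bsub>Cxy\<^esub> a = I \<longleftrightarrow> a \<in> I"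
 using coset_eq_iff[OF I, of a 0] h.hom_zero zero_Quot by simp

lemma subfield_Quot:
 assumes "1 \<notin> I"
 shows "subfield ((\<lambda>c. I +>\<^bsub>Cxy\<^esub> germ_const c) ` UNIV) (Cxy Quot I)"
proof -
 have "\<one>\<^bsub>Cxy Quot I\<^esub> \<noteq> \<zero>\<^bsub>Cxy Quot I\<^esub>" using assms coset_eq_I_iff[of 1] h.hom_one zero_Quot by simp
 then have "subfield ((+>\<^bsub>Cxy\<^esub>) I ` range germ_const) (Cxy Quot I)" by (rule h.img_is_subfield(2)[OF subfield_consts])
 then show ?thesis by (simp add: image_image)
qed

lemma coset_in_carrier: "germ_convergent a \<Longrightarrow> I +>\<^bsub>Cxy\<^esub> a \<in> carrier (Cxy Quot I)" using h.hom_closed by simp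

lemma carrier_Quot:
 assumes "q \<in> carrier (Cxy Quot I)"
 obtains r where "germ_convergent r" "q = I +>\<^bsub>Cxy\<^esub> r" using assms that by (auto simp: FactRing_def A_RCOSETS_def')

lemma independent_Quot:
 assumes "1 \<notin> I" and ind: "indep_mod I s b"
 shows "ring.independent (Cxy Quot I) ((\<lambda>c. I +>\<^bsub>Cxy\<^esub> germ_const c) ` UNIV) (map (\<lambda>i. I +>\<^bsub>Cxy\<^esub> b i) [0..<s])"
proof (rule ccontr)
 let ?K = "(\<lambda>c. I +>\<^bsub>Cxy\<^esub> germ_const c) ` UNIV" and ?U = "map (\<lambda>i. I +>\<^bsub>Cxy\<^esub> b i) [0..<s]"
 have b: "germ_convergent (b i)" if "i < s" for i using ind that by (auto simp: indep_mod_def)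
 assume dep: "\<not> ?thesis"
 have "set ?U \<subseteq> carrier (Cxy Quot I)" using b coset_in_carrier by auto
 then obtain Ks where Ks: "length Ks = length ?U" "h.S.combine Ks ?U = \<zero>\<^bsub>Cxy Quot I\<^esub>" "set Ks \<subseteq> ?K"
  "set Ks \<noteq> {\<zero>\<^bsub>Cxy Quot I\<^esub>}" using h.S.dependent_imp_non_trivial_combine[OF subfield_Quot[OF assms(1)] _ dep] by metis
 have "\<forall>i. \<exists>c. i < s \<longrightarrow> Ks ! i = I +>\<^bsub>Cxy\<^esub> germ_const c" using Ks(1,3) nth_mem by fastforce
 then obtain c where c: "\<And>i. i < s \<Longrightarrow> Ks ! i = I +>\<^bsub>Cxy\<^esub> germ_const (c i)" by metis
 have KsM: "Ks = map (\<lambda>i. I +>\<^bsub>Cxy\<^esub> germ_const (c i)) [0..<s]" by (rule nth_equalityI) (use Ks(1) c in auto)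
 have "I +>\<^bsub>Cxy\<^esub> lin b s c = I" using Ks(2) combine_Quot[OF I b, where c = c] zero_Quot by (simp add: KsM)
 then have "lin b s c \<in> I" using coset_eq_I_iff lin_convergent b by blast
 then have c0: "c i = 0" if "i < s" for i using ind that by (auto simp: indep_mod_def)
 have "0 \<in> I" using additive_subgroup.zero_closed is_additive_subgroup by fastforce
 then have I0: "I +>\<^bsub>Cxy\<^esub> germ_const 0 = I" using coset_eq_I_iff[of 0] by (simp add: germ_const_def)
 show False
 proof (cases "s = 0")
  case True
  then show False using dep h.S.independent.li_Nil by simp
 next
  case False
  then have "set Ks = {I}" using c0 I0 by (auto simp: KsM)
  then show False using Ks(4) zero_Quot by simp
 qed
qed

lemma dimension_Quot:
 assumes "1 \<notin> I" and b: "indep_mod I s b" "spans_mod I s b"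
 shows "ring.dimension (Cxy Quot I) s ((\<lambda>c. I +>\<^bsub>Cxy\<^esub> germ_const c) ` UNIV) (carrier (Cxy Quot I))"
proof -
 let ?K = "(\<lambda>c. I +>\<^bsub>Cxy\<^esub> germ_const c) ` UNIV" and ?U = "map (\<lambda>i. I +>\<^bsub>Cxy\<^esub> b i) [0..<s]"
 have cb: "germ_convergent (b i)" if "i < s" for i using b that by (auto simp: indep_mod_def)
 have U: "set ?U \<subseteq> carrier (Cxy Quot I)" using cb coset_in_carrier by auto
 note K = subfield_Quot[OF assms(1)]
 have "carrier (Cxy Quot I) \<subseteq> h.S.Span ?K ?U"
 proof
  fix q assume "q \<in> carrier (Cxy Quot I)"
  then obtain r where r: "germ_convergent r" "q = I +>\<^bsub>Cxy\<^esub> r" by (rule carrier_Quot)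
  obtain c where "r - lin b s c \<in> I" using b(2) r(1) by (auto simp: spans_mod_def)
  then have "q = h.S.combine (map (\<lambda>i. I +>\<^bsub>Cxy\<^esub> germ_const (c i)) [0..<s]) ?U"
   using coset_eq_iff[OF I r(1) lin_convergent[of s b c]] cb r(2) combine_Quot[OF I cb] by simp
  then show "q \<in> h.S.Span ?K ?U"
   unfolding h.S.Span_eq_combine_set[OF K U] by (auto intro!: exI[of _ "map (\<lambda>i. I +>\<^bsub>Cxy\<^esub> germ_const (c i)) [0..<s]"])
 qed
 moreover have "h.S.Span ?K ?U \<subseteq> carrier (Cxy Quot I)" by (rule h.S.Span_in_carrier) (use K U in \<open>auto dest: subfieldE(3)\<close>)
 ultimately have "h.S.dimension (length ?U) ?K (carrier (Cxy Quot I))"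
  using h.S.dimensionI[OF K independent_Quot[OF assms(1) b(1)]] by blast
 then show ?thesis by simp
qed

lemma one_in_ideal_codim:
 assumes "1 \<in> I" "indep_mod I s b"
 shows "s = 0"
proof (rule ccontr)
 assume "s \<noteq> 0"
 define c :: "nat \<Rightarrow> complex" where "c i = (if i = 0 then 1 else 0)" for i
 have "germ_convergent (lin b s c)" using assms(2) by (auto simp: indep_mod_def intro: lin_convergent)
 then have "lin b s c \<in> I" using I_r_closed[OF assms(1), of "lin b s c"] by simp
 then have "c 0 = 0" using assms(2) \<open>s \<noteq> 0\<close> by (auto simp: indep_mod_def)
 then show False by (simp add: c_def)
qed

lemma indep_mod_le_codim:
 assumes "has_codim I D" "indep_mod I s b"
 shows "s \<le> D"
proof (cases "1 \<in> I")
 case True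
 then show ?thesis using one_in_ideal_codim[OF True assms(2)] by simp
next
 case False
 obtain b' where b': "indep_mod I D b'" "spans_mod I D b'" using assms(1) by (auto simp: has_codim_def)
 have cb: "germ_convergent (b i)" if "i < s" for i using assms(2) that by (auto simp: indep_mod_def)
 have "length (map (\<lambda>i. I +>\<^bsub>Cxy\<^esub> b i) [0..<s]) \<le> D"
  by (rule h.S.independent_length_le_dimension[OF subfield_Quot[OF False] dimension_Quot[OF False b']
     independent_Quot[OF False assms(2)]]) (use cb coset_in_carrier in auto)
 then show ?thesis by simp
qed

text \<open>
  If \<open>1 \<in> I\<close> the quotient is the zero ring, where the constants do not form a field and the dimension
  formulas do not apply; its dimension is \<open>0\<close> by inspection.
\<close>

lemma has_codim_dim:
 assumes "has_codim I s"
 shows "(if ring.finite_dimension (Cxy Quot I) ((\<lambda>c. I +>\<^bsub>Cxy\<^esub> germ_const c) ` UNIV) (carrier (Cxy Quot I))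
  then enat (ring.dim (Cxy Quot I) ((\<lambda>c. I +>\<^bsub>Cxy\<^esub> germ_const c) ` UNIV) (carrier (Cxy Quot I))) else \<infinity>) = enat s"
proof (cases "1 \<in> I")
 case False
 obtain b where b: "indep_mod I s b" "spans_mod I s b" using assms by (auto simp: has_codim_def)
 note d = dimension_Quot[OF False b]
 have "h.S.finite_dimension ((\<lambda>c. I +>\<^bsub>Cxy\<^esub> germ_const c) ` UNIV) (carrier (Cxy Quot I))"
  using h.S.finite_dimensionI[OF d] .
 moreover have "h.S.dim ((\<lambda>c. I +>\<^bsub>Cxy\<^esub> germ_const c) ` UNIV) (carrier (Cxy Quot I)) = s"
  using d h.S.dimension_is_inj[OF subfield_Quot[OF False]] unfolding h.S.dim_def by blast
 ultimately show ?thesis by simp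
next
 case True
 let ?K = "(\<lambda>c. I +>\<^bsub>Cxy\<^esub> germ_const c) ` UNIV"
 have s: "s = 0" using assms one_in_ideal_codim[OF True] by (auto simp: has_codim_def)
 have all: "a \<in> I" if "germ_convergent a" for a using I_r_closed[OF True, of a] that by simp
 have car: "carrier (Cxy Quot I) = {I}"
 proof (intro subset_antisym subsetI)
  fix q assume "q \<in> carrier (Cxy Quot I)"
  then obtain r where "germ_convergent r" "q = I +>\<^bsub>Cxy\<^esub> r" by (rule carrier_Quot)
  then show "q \<in> {I}" using coset_eq_I_iff all by simp
 next
  fix q assume "q \<in> {I}"
  then show "q \<in> carrier (Cxy Quot I)" using h.S.zero_closed zero_Quot by simp
 qed
 have K: "?K = {I}" using coset_eq_I_iff all by auto
 have ne: "I \<in> E" if "h.S.dimension n ?K E" for n E using that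
 proof (induction rule: h.S.dimension.induct)
  case (zero_dim K)
  then show ?case using zero_Quot by simp
 next
  case (Suc_dim v E n K)
  then show ?case using car by simp
 qed
 have "n = 0" if "h.S.dimension n ?K (carrier (Cxy Quot I))" for n using that
 proof (cases rule: h.S.dimension.cases)
  case (Suc_dim v E m)
  then show ?thesis using ne[of m E] car by auto
 qed
 moreover have "h.S.dimension 0 ?K (carrier (Cxy Quot I))" using h.S.dimension.zero_dim[of ?K] by (simp add: car zero_Quot)
 ultimately show ?thesis using s unfolding h.S.dim_def h.S.finite_dimension_def by (auto intro!: the_equality)
qed

end

lemma int_mult_eq:
 assumes "germ_convergent F" "germ_convergent G" "has_codim (ideal2 F G) s"
 shows "int_mult F G = enat s" unfolding int_mult_def Let_def Idl_Cxy[OF assms(1,2)]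
 by (rule has_codim_dim[OF ideal_ideal2[OF assms(1,2)] assms(3)])

subsection \<open>Additivity, linear factors and descent\<close>

lemma germ_const_mult: "germ_const a * germ_const b = germ_const (a * b)"
 and germ_const_minus: "germ_const (- a) = - germ_const a"
 and germ_const_1 [simp]: "germ_const 1 = 1" by (simp_all add: germ_const_def)

lemma lin_cong: "(\<And>i. i < s \<Longrightarrow> b i = b' i) \<Longrightarrow> (\<And>i. i < s \<Longrightarrow> c i = c' i) \<Longrightarrow> lin b s c = lin b' s c'" by (simp add: lin_def)

lemma sum_add_split: "(\<Sum>i<k + l. f i) = (\<Sum>i<k. f i) + (\<Sum>i<l. f (k + i))" for f :: "nat \<Rightarrow> 'a::comm_monoid_add"
 by (induction l) (simp_all add: add.assoc)

text \<open>
  If \<open>F\<close> and \<open>A\<close> have no common factor, multiplication by \<open>A\<close> gives an exact sequence \<open>0 \<rightarrow> \<O>/(F, B) \<rightarrow>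
  \<O>/(F, A B) \<rightarrow> \<O>/(F, A) \<rightarrow> 0\<close>.
\<close>

lemma has_codim_product:
 assumes conv: "germ_convergent F" "germ_convergent A" "germ_convergent B"
  and cancel: "\<And>u w. germ_convergent u \<Longrightarrow> germ_convergent w \<Longrightarrow> F * u = A * w \<Longrightarrow>
   \<exists>w'. germ_convergent w' \<and> u = A * w'"
  and A0: "A \<noteq> 0" and kA: "has_codim (ideal2 F A) k" and lB: "has_codim (ideal2 F B) l"
 shows "has_codim (ideal2 F (A * B)) (k + l)"
proof -
 obtain a where a: "indep_mod (ideal2 F A) k a" "spans_mod (ideal2 F A) k a" using kA by (auto simp: has_codim_def)
 obtain b where b: "indep_mod (ideal2 F B) l b" "spans_mod (ideal2 F B) l b" using lB by (auto simp: has_codim_def)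
 have ca: "germ_convergent (a i)" if "i < k" for i using a that by (auto simp: indep_mod_def)
 have cb: "germ_convergent (b i)" if "i < l" for i using b that by (auto simp: indep_mod_def)
 define e where "e i = (if i < k then a i else A * b (i - k))" for i
 have ce: "germ_convergent (e i)" if "i < k + l" for i
  using that ca cb conv by (auto simp: e_def intro!: germ_convergent_mult)
 have lin_e: "lin e (k + l) c = lin a k c + A * lin b l (\<lambda>i. c (k + i))" for c
  unfolding lin_def sum_add_split sum_distrib_left by (simp add: e_def mult_ac)
 have "indep_mod (ideal2 F (A * B)) (k + l) e" unfolding indep_mod_def
 proof (intro conjI allI impI)
  fix c i assume *: "lin e (k + l) c \<in> ideal2 F (A * B)" and i: "i < k + l"
  then obtain u v where u: "germ_convergent u" "germ_convergent v"
   and eq: "lin a k c + A * lin b l (\<lambda>i. c (k + i)) = F * u + A * B * v" by (auto simp: ideal2_def lin_e)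
  have cl: "germ_convergent (lin b l (\<lambda>i. c (k + i)))" using cb by (rule lin_convergent)
  have "lin a k c = F * u + A * (B * v - lin b l (\<lambda>i. c (k + i)))" using eq by (simp add: algebra_simps)
  then have "lin a k c \<in> ideal2 F A"
   using ideal2I[OF u(1)] u conv cl by (simp add: germ_convergent_diff germ_convergent_mult)
  then have c0: "c i = 0" if "i < k" for i using a that by (auto simp: indep_mod_def)
  then have "lin a k c = 0" by (simp add: lin_def germ_const_def)
  then have "F * u = A * (lin b l (\<lambda>i. c (k + i)) - B * v)" using eq by (simp add: algebra_simps)
  moreover have "germ_convergent (lin b l (\<lambda>i. c (k + i)) - B * v)"
   by (intro germ_convergent_diff germ_convergent_mult cl conv u)
  ultimately obtain w where w: "germ_convergent w" "u = A * w" using cancel[OF u(1)] by blast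
  have "A * lin b l (\<lambda>i. c (k + i)) = A * (F * w + B * v)" using eq \<open>lin a k c = 0\<close> w by (simp add: algebra_simps)
  then have "lin b l (\<lambda>i. c (k + i)) = F * w + B * v" using A0 by simp
  then have "lin b l (\<lambda>i. c (k + i)) \<in> ideal2 F B" using ideal2I w u by simp
  then have c1: "c (k + i) = 0" if "i < l" for i using b that by (auto simp: indep_mod_def)
  show "c i = 0" using c0[of i] c1[of "i - k"] i by (cases "i < k") auto
 qed (rule ce)
 moreover have "spans_mod (ideal2 F (A * B)) (k + l) e" unfolding spans_mod_def
 proof (intro conjI allI impI)
  fix r assume r: "germ_convergent r"
  obtain c where "r - lin a k c \<in> ideal2 F A" using a r by (auto simp: spans_mod_def)
  then obtain u v where u: "germ_convergent u" "germ_convergent v" and 1: "r - lin a k c = F * u + A * v"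
   by (auto simp: ideal2_def)
  obtain d where "v - lin b l d \<in> ideal2 F B" using b u by (auto simp: spans_mod_def)
  then obtain u' v' where u': "germ_convergent u'" "germ_convergent v'" and 2: "v - lin b l d = F * u' + B * v'"
   by (auto simp: ideal2_def)
  define c' where "c' i = (if i < k then c i else d (i - k))" for i
  have "lin a k c' = lin a k c" by (rule lin_cong) (auto simp: c'_def)
  then have "r - lin e (k + l) c' = F * u + A * v - A * lin b l d" using 1 by (simp add: lin_e c'_def algebra_simps)
  also have "\<dots> = F * u + A * (v - lin b l d)" by (simp add: algebra_simps)
  also have "\<dots> = F * (u + A * u') + A * B * v'" by (simp add: 2 algebra_simps)
  finally show "\<exists>c. r - lin e (k + l) c \<in> ideal2 F (A * B)" using ideal2I[of "u + A * u'" v' F "A * B"] u u' conv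
   by (auto intro!: exI[of _ c'] simp: germ_convergent_add germ_convergent_mult)
 qed (rule ce)
 ultimately show ?thesis by (auto simp: has_codim_def)
qed

text \<open>Substituting \<open>\<gamma>\<close> for \<open>x\<close> identifies the quotient by \<open>x - \<gamma>\<close> with the convergent series in \<open>y\<close>.\<close>

lemma has_codim_linear:
 assumes F: "germ_convergent F" and \<gamma>: "fps_convergent \<gamma>" "\<gamma> $ 0 = 0" and ne: "ev \<gamma> F \<noteq> 0"
 shows "has_codim (ideal2 F (fps_X - fps_const \<gamma>)) (subdegree (ev \<gamma> F))"
proof -
 define d where "d = subdegree (ev \<gamma> F)"
 let ?L = "fps_X - fps_const \<gamma>"
 have evL: "ev \<gamma> ?L = 0" by (simp add: ev_diff ev_X \<gamma>)
 have mem: "G \<in> ideal2 F ?L \<longleftrightarrow> (\<forall>i<d. ev \<gamma> G $ i = 0)" if G: "germ_convergent G" for G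
 proof
  assume "G \<in> ideal2 F ?L"
  then obtain u v where "G = F * u + ?L * v" by (auto simp: ideal2_def)
  then have eG: "ev \<gamma> G = ev \<gamma> F * ev \<gamma> u" by (simp add: ev_add ev_mult \<gamma> evL)
  show "\<forall>i<d. ev \<gamma> G $ i = 0"
  proof (intro allI impI)
   fix i assume i: "i < d"
   have "ev \<gamma> F $ j = 0" if "j \<le> i" for j by (rule nth_less_subdegree_zero) (use i that d_def in linarith)
   then show "ev \<gamma> G $ i = 0" unfolding eG fps_mult_nth by (intro sum.neutral) auto
  qed
 next
  assume low: "\<forall>i<d. ev \<gamma> G $ i = 0"
  define h where "h = fps_shift d (ev \<gamma> G)"
  define w where "w = fps_shift d (ev \<gamma> F)"
  have h: "ev \<gamma> G = h * fps_X ^ d" unfolding h_def by (rule fps_ext) (use low in \<open>auto simp: fps_X_power_mult_right_nth\<close>)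
  have w: "ev \<gamma> F = w * fps_X ^ d" unfolding w_def d_def by (rule subdegree_decompose)
  have w0: "w $ 0 \<noteq> 0" using ne by (simp add: w_def d_def)
  have cw: "fps_convergent w" "fps_convergent h" unfolding w_def h_def
   by (rule fps_convergent_shift, rule linear_division[OF F \<gamma>], assumption)
     (rule fps_convergent_shift, rule linear_division[OF G \<gamma>], assumption)
  define e where "e = h * inverse w"
  have ce: "fps_convergent e" unfolding e_def using cw w0 by (intro fps_convergent_mult fps_convergent_inverse)
  have "ev \<gamma> F * e = (w * inverse w) * (h * fps_X ^ d)" by (simp add: w e_def mult_ac)
  also have "w * inverse w = 1" using w0 by (simp add: inverse_mult_eq_1')
  finally have "ev \<gamma> (G - F * fps_const e) = 0" by (simp add: ev_diff ev_mult \<gamma> h)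
  moreover have "germ_convergent (G - F * fps_const e)" using G F ce by (intro germ_convergent_diff germ_convergent_mult)
  ultimately obtain Q where "germ_convergent Q" "G - F * fps_const e = ?L * Q"
   using linear_division[OF _ \<gamma>] by (metis add.right_neutral fps_const_0_eq_0)
  then show "G \<in> ideal2 F ?L" using ideal2I[OF ce, of Q F ?L] by (metis add.commute diff_add_cancel)
 qed
 define b where "b i = germ_y ^ i" for i
 have cb: "germ_convergent (b i)" for i by (simp add: b_def germ_convergent_power)
 have cl: "germ_convergent (lin b s c)" for s c using cb by (rule lin_convergent)
 have evl: "ev \<gamma> (lin b s c) = (\<Sum>i<s. fps_const (c i) * fps_X ^ i)" for s c unfolding lin_def ev_sum
  by (intro sum.cong) (simp_all add: ev_mult \<gamma> b_def germ_const_def germ_y_def)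
 have evl_nth: "ev \<gamma> (lin b d c) $ i = c i" if "i < d" for c i
  unfolding evl fps_sum_nth using that by (simp add: sum.delta' if_distrib cong: if_cong)
 have "indep_mod (ideal2 F ?L) d b" unfolding indep_mod_def using cb cl mem evl_nth by metis
 moreover have "spans_mod (ideal2 F ?L) d b" unfolding spans_mod_def
 proof (intro conjI allI impI)
  fix r assume r: "germ_convergent r"
  have "r - lin b d (\<lambda>i. ev \<gamma> r $ i) \<in> ideal2 F ?L"
   using mem[OF germ_convergent_diff[OF r cl]] by (simp add: ev_diff evl_nth)
  then show "\<exists>c. r - lin b d c \<in> ideal2 F ?L" by blast
 qed (rule cb)
 ultimately show ?thesis unfolding d_def[symmetric] has_codim_def by blast
qed

lemma has_codim_rprod:
 assumes F: "germ_convergent F"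
  and C: "\<And>c. c \<in># C \<Longrightarrow> fps_convergent c \<and> c $ 0 = 0 \<and> ev c F \<noteq> 0"
 shows "has_codim (ideal2 F (rprod C)) (\<Sum>c\<in>#C. subdegree (ev c F))" using C
proof (induction C)
 case empty
 have "r \<in> ideal2 F 1" if "germ_convergent r" for r using ideal2I[of 0 r F 1] that by simp
 then have "indep_mod (ideal2 F 1) 0 (\<lambda>_. 0)" "spans_mod (ideal2 F 1) 0 (\<lambda>_. 0)"
  by (auto simp: indep_mod_def spans_mod_def lin_def)
 then show ?case by (auto simp: has_codim_def)
next
 case (add c C)
 have c: "fps_convergent c" "c $ 0 = 0" "ev c F \<noteq> 0" using add.prems by auto
 have cC: "germ_convergent (rprod C)" unfolding rprod_def using add.prems
  by (intro germ_convergent_prod_mset germ_convergent_diff) auto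
 have "has_codim (ideal2 F ((fps_X - fps_const c) * rprod C)) (subdegree (ev c F) + (\<Sum>c\<in>#C. subdegree (ev c F)))"
 proof (rule has_codim_product[OF F _ cC])
  fix u w assume u: "germ_convergent u" and "F * u = (fps_X - fps_const c) * w"
  then have "ev c F * ev c u = ev c ((fps_X - fps_const c) * w)" using ev_mult[OF c(2), of F u] by simp
  then have "ev c u = 0" using c by (simp add: ev_mult ev_diff ev_X)
  then show "\<exists>w'. germ_convergent w' \<and> u = (fps_X - fps_const c) * w'"
   using linear_division[OF u c(1,2)] by (metis add.right_neutral fps_const_0_eq_0)
 next
  show "germ_convergent (fps_X - fps_const c)" using c by (intro germ_convergent_diff) auto
 next
  show "has_codim (ideal2 F (rprod C)) (\<Sum>c\<in>#C. subdegree (ev c F))" using add by auto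
 qed (use has_codim_linear[OF F c] fps_X_minus_const_neq_0 in auto)
 then show ?case by simp
qed

text \<open>The part of \<open>G(x, t)\<close> with exponents of \<open>t\<close> congruent to \<open>i\<close> modulo \<open>n\<close>, as a germ in \<open>y = t\<^sup>n\<close>.\<close>

definition section_part :: "nat \<Rightarrow> nat \<Rightarrow> germ \<Rightarrow> germ" where
 "section_part n i G = Abs_fps (\<lambda>a. Abs_fps (\<lambda>b. G $ a $ (n * b + i)))"

lemma section_part_nth [simp]: "section_part n i G $ a $ b = G $ a $ (n * b + i)" by (simp add: section_part_def)

lemma section_part_add: "section_part n i (G + H) = section_part n i G + section_part n i H"
 by (rule fps_ext, rule fps_ext) simp

lemma section_part_sum: "section_part n i (sum f A) = (\<Sum>x\<in>A. section_part n i (f x))"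
 by (induction A rule: infinite_finite_induct) (auto simp: section_part_add intro!: fps_ext)

lemma section_part_convergent:
 assumes n: "0 < n" and G: "germ_convergent G"
 shows "germ_convergent (section_part n i G)"
proof -
 have "germ_convergent (ramify n (section_part n i G))" by (rule germ_convergent_reindex[OF G, of _ 1 0 i])
    (auto simp: ramify_eq_cmap fps_compose_X_power_nth[OF n])
 then show ?thesis using germ_convergent_ramify_iff[OF n] by simp
qed

lemma section_part_ramify_mult:
 assumes n: "0 < n" and i: "i < n"
 shows "section_part n i (ramify n F * G) = F * section_part n i G"
proof (rule fps_ext, rule fps_ext)
 fix a b
 have inner: "((F $ p oo fps_X ^ n) * G $ q) $ (n * b + i) = (F $ p * section_part n i G $ q) $ b" for p q
 proof -
  have "((F $ p oo fps_X ^ n) * G $ q) $ (n * b + i) =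
    (\<Sum>j\<in>{0..n * b + i}. (if n dvd j then F $ p $ (j div n) else 0) * G $ q $ (n * b + i - j))"
   by (simp add: fps_mult_nth fps_compose_X_power_nth[OF n])
  also have "\<dots> = (\<Sum>j\<in>(\<lambda>j. n * j) ` {0..b}. (if n dvd j then F $ p $ (j div n) else 0) * G $ q $ (n * b + i - j))"
  proof (rule sum.mono_neutral_right)
   show "(\<lambda>j. n * j) ` {0..b} \<subseteq> {0..n * b + i}" by (auto intro!: trans_le_add1 mult_le_mono2)
   show "\<forall>j\<in>{0..n * b + i} - (\<lambda>j. n * j) ` {0..b}.
     (if n dvd j then F $ p $ (j div n) else 0) * G $ q $ (n * b + i - j) = 0"
   proof
    fix j assume j: "j \<in> {0..n * b + i} - (\<lambda>j. n * j) ` {0..b}"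
    have "\<not> n dvd j"
    proof
     assume "n dvd j"
     then obtain l where l: "j = n * l" by auto
     then have "n * l < n * (b + 1)" using j i by (simp add: algebra_simps)
     then have "l < b + 1" using nat_mult_less_cancel1[OF n] by blast
     then have "l \<le> b" by simp
     then show False using j l by auto
    qed
    then show "(if n dvd j then F $ p $ (j div n) else 0) * G $ q $ (n * b + i - j) = 0" by simp
   qed
  qed simp
  also have "\<dots> = (\<Sum>j\<in>{0..b}. F $ p $ j * G $ q $ (n * b + i - n * j))"
   using n by (subst sum.reindex) (auto simp: inj_on_def)
  also have "\<dots> = (\<Sum>j\<in>{0..b}. F $ p $ j * G $ q $ (n * (b - j) + i))" by (intro sum.cong refl) (simp add: diff_mult_distrib2)
  finally show ?thesis by (simp add: fps_mult_nth)
 qed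
 show "section_part n i (ramify n F * G) $ a $ b = (F * section_part n i G) $ a $ b"
  by (simp add: fps_mult_nth[of _ _ a] fps_sum_nth ramify_eq_cmap inner)
qed

lemma section_part_y_ramify:
 assumes "0 < n" "i < n" "j < n"
 shows "section_part n i (germ_y ^ j * ramify n H) = (if i = j then H else 0)"
proof (rule fps_ext, rule fps_ext)
 fix a b
 have "(germ_y ^ j * ramify n H) $ a $ (n * b + i) = (if j \<le> n * b + i then ramify n H $ a $ (n * b + i - j) else 0)"
  by (simp add: germ_y_def fps_X_power_mult_nth not_less)
 also have "\<dots> = (if i = j then H $ a $ b else 0)"
 proof (cases "j \<le> n * b + i \<and> n dvd (n * b + i - j)")
  case True
  then have "(n * b + i) mod n = j mod n" by (metis mod_eq_dvd_iff_nat)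
  then have "i = j" using assms by simp
  then show ?thesis using assms by (simp add: ramify_eq_cmap fps_compose_X_power_nth)
 next
  case False
  then have "i \<noteq> j" by auto
  then show ?thesis using False assms(1) by (auto simp: ramify_eq_cmap fps_compose_X_power_nth)
 qed
 finally show "section_part n i (germ_y ^ j * ramify n H) $ a $ b = (if i = j then H else 0) $ a $ b" by simp
qed

lemma section_part_decompose:
 assumes n: "0 < n"
 shows "G = (\<Sum>i<n. germ_y ^ i * ramify n (section_part n i G))"
proof (rule fps_ext, rule fps_ext)
 fix a k
 have summand: "(germ_y ^ i * ramify n (section_part n i G)) $ a $ k = (if i = k mod n then G $ a $ k else 0)"
  if "i < n" for i
 proof -
  have "(germ_y ^ i * ramify n (section_part n i G)) $ a $ k =
   (if i \<le> k \<and> n dvd (k - i) then G $ a $ (n * ((k - i) div n) + i) else 0)"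
   using n by (auto simp: germ_y_def fps_X_power_mult_nth ramify_eq_cmap fps_compose_X_power_nth)
  also have "\<dots> = (if i = k mod n then G $ a $ k else 0)"
  proof (cases "i \<le> k \<and> n dvd (k - i)")
   case True
   then have "k mod n = i mod n" by (metis mod_eq_dvd_iff_nat)
   then show ?thesis using True that by simp
  next
   case False
   have "i \<noteq> k mod n"
   proof
    assume "i = k mod n"
    then have "i \<le> k" "n dvd (k - i)" by (auto simp: minus_mod_eq_mult_div)
    then show False using False by simp
   qed
   then show ?thesis using False by auto
  qed
  finally show ?thesis .
 qed
 have "(\<Sum>i<n. germ_y ^ i * ramify n (section_part n i G)) $ a $ k =
  (\<Sum>i<n. if i = k mod n then G $ a $ k else 0)" by (simp add: fps_sum_nth summand)
 also have "\<dots> = G $ a $ k" using n by (simp add: sum.delta')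
 finally show "G $ a $ k = (\<Sum>i<n. germ_y ^ i * ramify n (section_part n i G)) $ a $ k" by simp
qed

lemma ramify_lin:
 assumes "0 < n"
 shows "ramify n (lin b s c) = lin (\<lambda>i. ramify n (b i)) s c"
proof -
 have "ramify n (sum f A) = (\<Sum>x\<in>A. ramify n (f x))" for f :: "nat \<Rightarrow> germ" and A
  by (induction A rule: infinite_finite_induct) (auto simp: ramify_eq_cmap cmap_add)
 then show ?thesis using assms by (simp add: lin_def ramify_mult) (simp add: germ_const_def ramify_eq_cmap)
qed

lemma ideal2_ramify_iff:
 assumes n: "0 < n"
 shows "r \<in> ideal2 F P \<longleftrightarrow> ramify n r \<in> ideal2 (ramify n F) (ramify n P)"
proof
 assume "r \<in> ideal2 F P"
 then obtain u v where "r = F * u + P * v" "germ_convergent u" "germ_convergent v" by (auto simp: ideal2_def)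
 then have "ramify n r = ramify n F * ramify n u + ramify n P * ramify n v"
  using n by (simp add: ramify_mult[symmetric]) (simp add: ramify_eq_cmap cmap_add)
 then show "ramify n r \<in> ideal2 (ramify n F) (ramify n P)"
  using ideal2I germ_convergent_ramify_iff[OF n] \<open>germ_convergent u\<close> \<open>germ_convergent v\<close> by simp
next
 assume "ramify n r \<in> ideal2 (ramify n F) (ramify n P)"
 then obtain u v where uv: "ramify n r = ramify n F * u + ramify n P * v" "germ_convergent u" "germ_convergent v"
  by (auto simp: ideal2_def)
 have "r = section_part n 0 (ramify n r)" using section_part_y_ramify[of n 0 0 r] n by simp
 also have "\<dots> = F * section_part n 0 u + P * section_part n 0 v"
  unfolding uv(1) section_part_add using section_part_ramify_mult[OF n n] by simp
 finally show "r \<in> ideal2 F P" using ideal2I section_part_convergent[OF n] uv(2,3) by metis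
qed

text \<open>
  \<open>\<complex>{x,t}\<close> is free over \<open>\<complex>{x,y}\<close>, \<open>y = t\<^sup>n\<close>, with basis \<open>1, t, \<dots>, t\<^sup>n\<^sup>-\<^sup>1\<close>, so codimensions are multiplied by
  \<open>n\<close>. A maximal family that is independent modulo the smaller ideal exists because independence is
  inherited by the larger ring, where the codimension is finite.
\<close>

lemma has_codim_descend:
 assumes n: "0 < n" and F: "germ_convergent F" and P: "germ_convergent P"
  and D: "has_codim (ideal2 (ramify n F) (ramify n P)) D"
 obtains s where "has_codim (ideal2 F P) s" "n * s = D"
proof -
 let ?I = "ideal2 F P" and ?J = "ideal2 (ramify n F) (ramify n P)"
 have conv: "germ_convergent (ramify n F)" "germ_convergent (ramify n P)" using germ_convergent_ramify_iff[OF n] F P by auto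
 note J = ideal_ideal2[OF conv]
 have bound: "s \<le> D" if "indep_mod ?I s b" for s b
 proof (rule indep_mod_le_codim[OF J D])
  show "indep_mod ?J s (\<lambda>i. ramify n (b i))"
   using that ideal2_ramify_iff[OF n, of _ F P] germ_convergent_ramify_iff[OF n] ramify_lin[OF n, of b s]
   by (simp add: indep_mod_def)
 qed
 define s where "s = (GREATEST s. \<exists>b. indep_mod ?I s b)"
 have ex0: "\<exists>b. indep_mod ?I 0 b" by (auto simp: indep_mod_def)
 have "\<exists>b. indep_mod ?I s b"
  unfolding s_def by (rule GreatestI_nat[where P = "\<lambda>s. \<exists>b. indep_mod ?I s b", OF ex0]) (use bound in blast)
 then obtain b where b: "indep_mod ?I s b" by blast
 have max: "\<not> indep_mod ?I (Suc s) b'" for b'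
 proof
  assume "indep_mod ?I (Suc s) b'"
  then have "Suc s \<le> s" unfolding s_def by (intro Greatest_le_nat[where P = "\<lambda>s. \<exists>b. indep_mod ?I s b"]) (use bound in auto)
  then show False by simp
 qed
 have cb: "germ_convergent (b i)" if "i < s" for i using b that by (auto simp: indep_mod_def)
 have "spans_mod ?I s b" unfolding spans_mod_def
 proof (intro conjI allI impI)
  fix r assume r: "germ_convergent r"
  define b' where "b' i = (if i < s then b i else r)" for i
  have lin': "lin b' (Suc s) c = lin b s c + germ_const (c s) * r" for c by (simp add: lin_def b'_def)
  have "germ_convergent (b' i)" for i using cb r by (simp add: b'_def)
  then obtain c i where c: "lin b' (Suc s) c \<in> ?I" "i < Suc s" "c i \<noteq> 0" using max[of b'] by (auto simp: indep_mod_def)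
  have cs: "c s \<noteq> 0"
  proof
   assume c0: "c s = 0"
   then have "lin b s c \<in> ?I" using c(1) by (simp add: lin' germ_const_def)
   then have "c i = 0" if "i < s" for i using b that by (auto simp: indep_mod_def)
   then show False using c c0 by (metis less_antisym)
  qed
  have "germ_const (1 / c s) * (lin b s c + germ_const (c s) * r) \<in> ?I"
   using ideal2_mult[OF c(1), of "germ_const (1 / c s)"] by (simp add: lin')
  also have "germ_const (1 / c s) * (lin b s c + germ_const (c s) * r) = r - lin b s (\<lambda>i. - c i / c s)"
   using cs by (simp add: lin_def distrib_left sum_distrib_left sum_negf germ_const_mult germ_const_minus
     mult.assoc[symmetric])
  finally show "\<exists>c. r - lin b s c \<in> ?I" by blast
 qed (rule cb)
 then have cod: "has_codim ?I s" using b by (auto simp: has_codim_def)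
 define e where "e l = germ_y ^ (l mod n) * ramify n (b (l div n))" for l
 have ce: "germ_convergent (e l)" if "l < n * s" for l
 proof -
  have "l div n < s" using that by (simp add: less_mult_imp_div_less mult.commute)
  then show ?thesis unfolding e_def
   using cb germ_convergent_ramify_iff[OF n] by (intro germ_convergent_mult germ_convergent_power) auto
 qed
 have lin_e: "lin e (n * s) c = (\<Sum>i<n. germ_y ^ i * ramify n (lin b s (\<lambda>j. c (n * j + i))))" for c
 proof -
  have "lin e (n * s) c = (\<Sum>j<s. \<Sum>i<n. germ_const (c (n * j + i)) * e (n * j + i))"
  proof (unfold lin_def, induction s)
   case (Suc s)
   then show ?case by (simp only: mult_Suc_right add.commute[of n] sum_add_split sum.lessThan_Suc)
  qed simp
  also have "\<dots> = (\<Sum>j<s. \<Sum>i<n. germ_y ^ i * (germ_const (c (n * j + i)) * ramify n (b j)))"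
   by (intro sum.cong refl) (simp add: e_def mult_ac)
  also have "\<dots> = (\<Sum>i<n. \<Sum>j<s. germ_y ^ i * (germ_const (c (n * j + i)) * ramify n (b j)))" by (rule sum.swap)
  also have "\<dots> = (\<Sum>i<n. germ_y ^ i * ramify n (lin b s (\<lambda>j. c (n * j + i))))"
   unfolding ramify_lin[OF n] unfolding lin_def sum_distrib_left ..
  finally show ?thesis .
 qed
 have sect: "section_part n i (lin e (n * s) c) = lin b s (\<lambda>j. c (n * j + i))" if "i < n" for i c
 proof -
  have "section_part n i (lin e (n * s) c) = (\<Sum>k<n. if i = k then lin b s (\<lambda>j. c (n * j + k)) else 0)"
   unfolding lin_e section_part_sum by (intro sum.cong refl) (use section_part_y_ramify[OF n that] in auto)
  then show ?thesis using that by simp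
 qed
 have "indep_mod ?J (n * s) e" unfolding indep_mod_def
 proof (intro conjI allI impI)
  fix c l assume "lin e (n * s) c \<in> ?J" and l: "l < n * s"
  then obtain u v where uv: "lin e (n * s) c = ramify n F * u + ramify n P * v"
   "germ_convergent u" "germ_convergent v" by (auto simp: ideal2_def)
  have i: "l mod n < n" using n by simp
  have "lin b s (\<lambda>j. c (n * j + l mod n)) = F * section_part n (l mod n) u + P * section_part n (l mod n) v"
   unfolding sect[OF i, symmetric] uv(1) section_part_add section_part_ramify_mult[OF n i] ..
  then have "lin b s (\<lambda>j. c (n * j + l mod n)) \<in> ?I" using ideal2I section_part_convergent[OF n] uv(2,3) by metis
  moreover have "l div n < s" using l by (simp add: less_mult_imp_div_less mult.commute)
  ultimately have "c (n * (l div n) + l mod n) = 0" using b unfolding indep_mod_def by blast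
  then show "c l = 0" by simp
 qed (rule ce)
 moreover have "spans_mod ?J (n * s) e" unfolding spans_mod_def
 proof (intro conjI allI impI)
  fix r assume r: "germ_convergent r"
  have "\<forall>i. \<exists>c. section_part n i r - lin b s c \<in> ?I"
   using \<open>spans_mod ?I s b\<close> section_part_convergent[OF n r] by (auto simp: spans_mod_def)
  then obtain d where d: "\<And>i. section_part n i r - lin b s (d i) \<in> ?I" by metis
  define c where "c l = d (l mod n) (l div n)" for l
  have "r - lin e (n * s) c = (\<Sum>i<n. germ_y ^ i * ramify n (section_part n i r)) -
    (\<Sum>i<n. germ_y ^ i * ramify n (lin b s (d i)))" unfolding lin_e section_part_decompose[OF n, of r, symmetric]
   by (auto simp: c_def intro!: sum.cong)
  also have "\<dots> = (\<Sum>i<n. germ_y ^ i * ramify n (section_part n i r - lin b s (d i)))"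
   by (simp add: sum_subtractf right_diff_distrib ramify_eq_cmap cmap_diff)
  also have "\<dots> \<in> ?J"
  proof -
   have mem: "germ_y ^ i * ramify n (section_part n i r - lin b s (d i)) \<in> ?J" for i
    using ideal2_mult ideal2_ramify_iff[OF n] d germ_convergent_power germ_convergent_y by metis
   have "0 \<in> ?J" using ideal2I[of 0 0] by simp
   have "(\<Sum>i\<in>A. germ_y ^ i * ramify n (section_part n i r - lin b s (d i))) \<in> ?J" if "finite A" for A
    using that by (induction A) (auto intro: ideal2_add mem \<open>0 \<in> ?J\<close>)
   then show ?thesis by simp
  qed
  finally show "\<exists>c. r - lin e (n * s) c \<in> ?J" by blast
 qed (rule ce)
 ultimately have "has_codim ?J (n * s)" by (auto simp: has_codim_def)
 then have "enat (n * s) = enat D" using int_mult_eq[OF conv] D by metis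
 then show ?thesis using that cod by simp
qed

text \<open>
  After ramification the product splits into linear factors, to which additivity applies; descent divides by \<open>n\<close>.
\<close>

theorem int_mult_arc_prod:
 assumes F: "germ_convergent F" and \<Gamma>: "conj_stable \<Gamma>" and n: "0 < n"
  and arcs: "\<And>\<gamma>. \<gamma> \<in># \<Gamma> \<Longrightarrow> arc_denom n \<gamma> \<and> \<gamma> 0 = 0 \<and> fps_convergent (arc_param n \<gamma>)"
  and ne: "\<And>\<gamma>. \<gamma> \<in># \<Gamma> \<Longrightarrow> arc_ev n \<gamma> F \<noteq> 0"
 obtains s where "int_mult F (arc_prod \<Gamma>) = enat s"
  "n * s = (\<Sum>\<gamma>\<in>#\<Gamma>. subdegree (arc_ev n \<gamma> F))"
proof -
 have den: "\<And>\<gamma>. \<gamma> \<in># \<Gamma> \<Longrightarrow> arc_denom n \<gamma>" using arcs by blast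
 have P: "germ_convergent (arc_prod \<Gamma>)" using arc_prod_convergent[OF \<Gamma> n den] arcs by blast
 have rP: "ramify n (arc_prod \<Gamma>) = rprod (image_mset (arc_param n) \<Gamma>)"
  using ramify_arc_prod[OF \<Gamma> n den] by (simp add: root_prod_eq_rprod)
 have "has_codim (ideal2 (ramify n F) (rprod (image_mset (arc_param n) \<Gamma>)))
   (\<Sum>c\<in>#image_mset (arc_param n) \<Gamma>. subdegree (ev c (ramify n F)))"
  by (rule has_codim_rprod) (use F n germ_convergent_ramify_iff arcs ne in \<open>auto simp: arc_ev_def\<close>)
 then have "has_codim (ideal2 (ramify n F) (ramify n (arc_prod \<Gamma>))) (\<Sum>\<gamma>\<in>#\<Gamma>. subdegree (arc_ev n \<gamma> F))"
  by (simp add: rP arc_ev_def image_mset.compositionality comp_def)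
 from has_codim_descend[OF n F P this] show ?thesis using int_mult_eq[OF F P] that by metis
qed

section \<open>The tree of contact orders\<close>

lemma conj_stable_set:
 assumes "finite S" "conj_stable (mset_set S)"
 shows "conj_arc k ` S = S"
proof -
 have "set_mset (image_mset (conj_arc k) (mset_set S)) = S" using conj_stable_image[OF assms(2), of k] assms(1) by simp
 then show ?thesis using assms(1) by simp
qed

definition conj_bar :: "nat \<Rightarrow> bar \<Rightarrow> bar" where
 "conj_bar k B = (conj_arc k ` fst B, snd B)"

lemma conj_bar_simps [simp]: "fst (conj_bar k B) = conj_arc k ` fst B" "snd (conj_bar k B) = snd B"
 by (simp_all add: conj_bar_def)

lemma trunk_height_conj: "trunk_height (conj_arc k ` T) = trunk_height T" by (simp add: trunk_height_def image_image)

lemma trunks_on_conj: "trunks_on (conj_bar k B) = (\<lambda>T. conj_arc k ` T) ` trunks_on B"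
proof -
 have "{\<mu> \<in> conj_arc k ` fst B. contact (conj_arc k \<kappa>) \<mu> > ereal (snd B)} =
   conj_arc k ` {\<mu> \<in> fst B. contact \<kappa> \<mu> > ereal (snd B)}" for \<kappa> by auto
 then show ?thesis unfolding trunks_on_def setcompr_eq_image by (simp add: image_image)
qed

lemma fps_convergent_finite_support:
 assumes n: "0 < n" and \<xi>: "\<And>e. h \<le> e \<Longrightarrow> \<xi> e = 0"
 shows "fps_convergent (arc_param n \<xi>)"
proof (rule germ_convergent_bounded[of 1 "nat \<lceil>real n * h\<rceil>"])
 fix i j :: nat assume ij: "1 \<le> i \<or> nat \<lceil>real n * h\<rceil> \<le> j"
 show "fps_const (arc_param n \<xi>) $ i $ j = 0"
 proof (cases i)
  case 0
  then have "real n * h \<le> real j" using ij by linarith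
  then have "h \<le> real j / real n" using n by (simp add: field_simps)
  then show ?thesis using 0 \<xi> by simp
 qed simp
qed

locale mero_pair =
 fixes f g :: germ and E1 E2 :: nat
 assumes setting: "mero_setting f g E1 E2"
begin

abbreviation "R \<equiv> tree_roots f g"

lemma germ_convergent_fg: "germ_convergent f" "germ_convergent g" using setting by (auto simp: mero_setting_def)

lemma np_fg:
 "np_factorization f E1 (mset_set (roots f))" "np_factorization g E2 (mset_set (roots g))"
 and finite_roots: "finite (roots f)" "finite (roots g)"
 and roots_disjoint: "roots f \<inter> roots g = {}"
 and R_nonempty: "R \<noteq> {}"
proof -
 obtain \<alpha>s \<beta>s where *: "np_factorization f E1 (mset \<alpha>s)" "np_factorization g E2 (mset \<beta>s)"
  "distinct (\<alpha>s @ \<beta>s)" "length (\<alpha>s @ \<beta>s) \<ge> 1" using setting by (auto simp: mero_setting_def)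
 have r: "roots f = set \<alpha>s" "roots g = set \<beta>s" using np_roots_eq[OF *(1)] np_roots_eq[OF *(2)] by (simp_all add: roots_def)
 have "mset \<alpha>s = mset_set (roots f)" "mset \<beta>s = mset_set (roots g)" using *(3) r by (simp_all add: mset_set_set)
 then show "np_factorization f E1 (mset_set (roots f))" "np_factorization g E2 (mset_set (roots g))"
  using *(1,2) by simp_all
 show "finite (roots f)" "finite (roots g)" "roots f \<inter> roots g = {}" "R \<noteq> {}"
  using r * by (auto simp: tree_roots_def Suc_le_eq)
qed

lemma finite_R: "finite R" using finite_roots by (simp add: tree_roots_def)

lemma R_arc: "\<kappa> \<in> R \<Longrightarrow> is_arc \<kappa>" and R_0: "\<kappa> \<in> R \<Longrightarrow> \<kappa> 0 = 0"
 using np_factorization_arcs[OF np_fg(1)] np_factorization_arcs[OF np_fg(2)] finite_roots by (auto simp: tree_roots_def)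

lemma conj_roots: "conj_arc k ` roots f = roots f" "conj_arc k ` roots g = roots g" "conj_arc k ` R = R"
proof -
 show *: "conj_arc k ` roots f = roots f" "conj_arc k ` roots g = roots g"
  using conj_stable_set conj_stable_np[OF np_fg(1)] conj_stable_np[OF np_fg(2)] finite_roots by blast+
 show "conj_arc k ` R = R" using * by (simp add: tree_roots_def image_Un)
qed

subsection \<open>Bars\<close>

definition above :: "bar \<Rightarrow> arc \<Rightarrow> bool" where
 "above B \<xi> \<longleftrightarrow> (\<forall>e<snd B. \<xi> e = bar_arc B e)"

lemma bar_arc_ge: "snd B \<le> e \<Longrightarrow> bar_arc B e = 0" by (simp add: bar_arc_def arc_trunc_def)

lemma climbs_iff: "climbs \<xi> B a \<longleftrightarrow> is_arc \<xi> \<and> above B \<xi> \<and> \<xi> (snd B) = a" unfolding climbs_def above_def bar_arc_at_def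
 by (auto simp: le_less)

text \<open>
  The roots of a trunk on a bar agree up to its height. The next height is the least of their contact
  orders, so they agree below it, and any root agreeing with one of them below it belongs to the trunk.
\<close>

lemma bar_facts:
 assumes "B \<in> bars f g"
 shows "fst B \<noteq> {} \<and> 0 \<le> snd B \<and> (\<forall>\<kappa>\<in>fst B. fst B = {\<mu> \<in> R. \<forall>e<snd B. \<mu> e = \<kappa> e}) \<and>
  (snd B = 0 \<longrightarrow> fst B = R) \<and> (snd B \<noteq> 0 \<longrightarrow> (\<exists>\<kappa>\<in>fst B. \<exists>\<mu>\<in>fst B. \<kappa> (snd B) \<noteq> \<mu> (snd B)))" using assms
proof (induction rule: bars.induct)
 case ground
 have "\<mu> e = \<kappa> e" if "\<mu> \<in> R" "\<kappa> \<in> R" "e < 0" for \<mu> \<kappa> e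
  using is_arc_nonneg[OF R_arc[OF that(1)], of e] is_arc_nonneg[OF R_arc[OF that(2)], of e] that(3) by fastforce
 then show ?case using R_nonempty by auto
next
 case (top B T h)
 let ?h0 = "snd B"
 obtain \<kappa>0 where \<kappa>0: "\<kappa>0 \<in> fst B" and T: "T = {\<mu> \<in> fst B. contact \<kappa>0 \<mu> > ereal ?h0}"
  using top.hyps(2) by (auto simp: trunks_on_def)
 have sub: "fst B \<subseteq> R" using top.IH \<kappa>0 by blast
 have T': "T = {\<mu> \<in> fst B. \<forall>e\<le>?h0. \<mu> e = \<kappa>0 e}"
 proof -
  have "ereal ?h0 < contact \<kappa>0 \<mu> \<longleftrightarrow> (\<forall>e\<le>?h0. \<mu> e = \<kappa>0 e)" if "\<mu> \<in> fst B" for \<mu>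
   using contact_gt_iff[of \<kappa>0 \<mu> ?h0] R_arc sub \<kappa>0 that by (auto simp: eq_commute)
  then show ?thesis unfolding T by blast
 qed
 have \<kappa>T: "\<kappa>0 \<in> T" using \<kappa>0 T' by simp
 have TR: "T \<subseteq> R" using sub T' by auto
 have finT: "finite T" using finite_R TR finite_subset by blast
 have ht: "ereal h \<le> contact \<kappa> \<mu>" if "\<kappa> \<in> T" "\<mu> \<in> T" for \<kappa> \<mu> unfolding top.hyps(3)[symmetric] trunk_height_def
  by (rule INF_lower2[OF that(1)], rule INF_lower[OF that(2)])
 have attained: "\<exists>x\<in>T. (INF x\<in>T. F x) = F x" for F :: "arc \<Rightarrow> ereal"
 proof -
  have "F ` T \<noteq> {}" using \<kappa>T by blast
  then have "Inf (F ` T) \<in> F ` T" using cInf_eq_Min[of "F ` T"] Min_in[of "F ` T"] finT by simp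
  then show ?thesis by (rule imageE) blast
 qed
 obtain \<kappa> where \<kappa>: "\<kappa> \<in> T" "ereal h = (INF \<mu>\<in>T. contact \<kappa> \<mu>)"
  using attained[of "\<lambda>\<kappa>. INF \<mu>\<in>T. contact \<kappa> \<mu>"] top.hyps(3) unfolding trunk_height_def by auto
 obtain \<mu> where "\<mu> \<in> T" "ereal h = contact \<kappa> \<mu>" using attained[of "contact \<kappa>"] \<kappa>(2) by auto
 note \<kappa>\<mu> = \<kappa>(1) this
 have "\<kappa> \<noteq> \<mu>" using \<kappa>\<mu>(3) by auto
 moreover have "is_arc \<kappa>" "is_arc \<mu>" using R_arc TR \<kappa>\<mu>(1,2) by auto
 ultimately obtain h' where "\<kappa> h' \<noteq> \<mu> h'" "contact \<kappa> \<mu> = ereal h'" using contact_obtain by metis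
 then have ne: "\<kappa> h \<noteq> \<mu> h" using \<kappa>\<mu>(3) by simp
 have "\<kappa> e = \<mu> e" if "e \<le> ?h0" for e using \<kappa>\<mu>(1,2) that T' by auto
 then have h0: "?h0 < h" using ne by (meson not_le)
 have "T = {\<mu> \<in> R. \<forall>e<h. \<mu> e = \<kappa> e}" if \<kappa>: "\<kappa> \<in> T" for \<kappa>
 proof (intro subset_antisym subsetI CollectI conjI allI impI)
  fix \<mu> assume \<mu>: "\<mu> \<in> T"
  then show "\<mu> \<in> R" using TR by auto
  fix e assume "e < h"
  then show "\<mu> e = \<kappa> e" using ht[OF \<mu> \<kappa>] contact_ge_iff by blast
 next
  fix \<mu> assume "\<mu> \<in> {\<mu> \<in> R. \<forall>e<h. \<mu> e = \<kappa> e}"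
  then have \<mu>: "\<mu> \<in> R" "\<And>e. e < h \<Longrightarrow> \<mu> e = \<kappa> e" by auto
  have "\<kappa> \<in> fst B" and \<kappa>e: "\<And>e. e \<le> ?h0 \<Longrightarrow> \<kappa> e = \<kappa>0 e" using \<kappa> T' by auto
  then have "\<mu> \<in> fst B" using top.IH \<mu> h0 by fastforce
  then show "\<mu> \<in> T" using \<mu>(2) h0 \<kappa>e T' by fastforce
 qed
 moreover have "0 \<le> h" "h \<noteq> 0" using h0 top.IH by auto
 ultimately show ?case using \<kappa>T \<kappa>\<mu>(1,2) ne by auto
qed

context
 fixes B assumes B: "B \<in> bars f g"
begin

lemma bar_nonempty: "fst B \<noteq> {}" and bar_height_nonneg: "0 \<le> snd B"
 and bar_ground: "snd B = 0 \<Longrightarrow> B = (R, 0)" using bar_facts[OF B] by (auto intro: prod_eqI)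

lemma bar_arc_member: "\<kappa> \<in> fst B \<Longrightarrow> e < snd B \<Longrightarrow> \<kappa> e = bar_arc B e"
proof -
 assume "\<kappa> \<in> fst B" "e < snd B"
 moreover have "(SOME \<kappa>. \<kappa> \<in> fst B) \<in> fst B" using bar_nonempty by (simp add: some_in_eq)
 ultimately show ?thesis using bar_facts[OF B] by (auto simp: bar_arc_def arc_trunc_def)
qed

lemma bar_members: "fst B = {\<mu> \<in> R. above B \<mu>}"
proof -
 obtain \<kappa> where \<kappa>: "\<kappa> \<in> fst B" using bar_nonempty by blast
 then have "fst B = {\<mu> \<in> R. \<forall>e<snd B. \<mu> e = \<kappa> e}" using bar_facts[OF B] by blast
 then show ?thesis using bar_arc_member[OF \<kappa>] by (auto simp: above_def)
qed

lemma bar_subset: "fst B \<subseteq> R" and finite_bar: "finite (fst B)" using bar_members finite_R by auto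

lemma bar_arc_is_trunc:
 assumes "\<kappa> \<in> fst B"
 shows "bar_arc B = arc_trunc (snd B) \<kappa>"
proof
 fix e show "bar_arc B e = arc_trunc (snd B) \<kappa> e"
  using bar_arc_member[OF assms, of e] bar_arc_ge[of B e] by (cases "e < snd B") (simp_all add: arc_trunc_def)
qed

lemma bar_arc_denom:
 assumes "\<kappa> \<in> fst B" "arc_denom n \<kappa>"
 shows "arc_denom n (bar_arc B)"
 using assms unfolding bar_arc_is_trunc[OF assms(1)] by (auto simp: arc_denom_def arc_trunc_def)

lemma bar_arc_arc: "is_arc (bar_arc B)" and bar_arc_0: "bar_arc B 0 = 0"
proof -
 obtain \<kappa> where \<kappa>: "\<kappa> \<in> fst B" using bar_nonempty by blast
 then have \<kappa>R: "is_arc \<kappa>" "\<kappa> 0 = 0" using R_arc R_0 bar_subset by auto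
 then obtain n where "arc_denom n \<kappa>" by (auto simp: is_arc_def)
 then show "is_arc (bar_arc B)" using bar_arc_denom[OF \<kappa>] arc_denom_imp_is_arc by blast
 show "bar_arc B 0 = 0" using \<kappa>R bar_arc_is_trunc[OF \<kappa>] by (simp add: arc_trunc_def)
qed

lemma bar_arc_convergent: "0 < n \<Longrightarrow> fps_convergent (arc_param n (bar_arc B))"
 using fps_convergent_finite_support[of n "snd B"] bar_arc_ge by blast

lemma contact_gt_bar_iff:
 assumes "\<kappa> \<in> fst B" "\<mu> \<in> fst B"
 shows "ereal (snd B) < contact \<kappa> \<mu> \<longleftrightarrow> \<kappa> (snd B) = \<mu> (snd B)"
proof -
 have "\<kappa> e = \<mu> e" if "e < snd B" for e using bar_arc_member[OF assms(1) that] bar_arc_member[OF assms(2) that] by simp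
 moreover have "is_arc \<kappa>" "is_arc \<mu>" using R_arc bar_subset assms by auto
 ultimately show ?thesis unfolding contact_gt_iff[OF \<open>is_arc \<kappa>\<close> \<open>is_arc \<mu>\<close>] by (metis le_less)
qed

lemma trunks_on_eq: "trunks_on B = (\<lambda>c. {\<mu> \<in> fst B. \<mu> (snd B) = c}) ` (\<lambda>\<kappa>. \<kappa> (snd B)) ` fst B"
proof -
 have "{\<mu> \<in> fst B. contact \<kappa> \<mu> > ereal (snd B)} = {\<mu> \<in> fst B. \<mu> (snd B) = \<kappa> (snd B)}" if "\<kappa> \<in> fst B" for \<kappa>
  using contact_gt_bar_iff[OF that] by auto
 then show ?thesis unfolding trunks_on_def by (auto simp: image_iff)
qed

lemma trunk_point_eq:
 assumes "\<kappa> \<in> fst B"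
 shows "trunk_point B {\<mu> \<in> fst B. \<mu> (snd B) = \<kappa> (snd B)} = \<kappa> (snd B)"
 unfolding trunk_point_def using assms by (intro the_equality) auto

lemma trunk_points: "trunk_point B ` trunks_on B = (\<lambda>\<kappa>. \<kappa> (snd B)) ` fst B"
 unfolding trunks_on_eq image_image using trunk_point_eq by (intro image_cong) auto

lemma finite_trunks: "finite (trunks_on B)" using finite_bar by (simp add: trunks_on_eq)

lemma leaves_iff: "leaves \<xi> B a \<longleftrightarrow> is_arc \<xi> \<and> above B \<xi> \<and> \<xi> (snd B) = a \<and> (\<forall>\<kappa>\<in>fst B. \<kappa> (snd B) \<noteq> a)"
 unfolding leaves_def climbs_iff trunk_points by (auto simp: image_iff)

lemma bar_height_exponent:
 assumes "0 < n" "\<And>\<kappa>. \<kappa> \<in> fst B \<Longrightarrow> arc_denom n \<kappa>"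
 obtains m :: nat where "snd B = real m / real n"
proof (cases "snd B = 0")
 case True
 then show ?thesis using that[of 0] by simp
next
 case False
 then obtain \<kappa> \<mu> where "\<kappa> \<in> fst B" "\<mu> \<in> fst B" "\<kappa> (snd B) \<noteq> \<mu> (snd B)" using bar_facts[OF B] by blast
 then obtain \<nu> where \<nu>: "\<nu> \<in> fst B" "\<nu> (snd B) \<noteq> 0" by metis
 then obtain m :: nat where "snd B = real m / real n" using assms(2)[OF \<nu>(1)] unfolding arc_denom_def by blast
 then show ?thesis by (rule that)
qed

lemma bar_arc_at_denom:
 assumes "0 < n" "\<And>\<kappa>. \<kappa> \<in> fst B \<Longrightarrow> arc_denom n \<kappa>"
 shows "arc_denom n (bar_arc_at B a)"
proof -
 obtain m where m: "snd B = real m / real n" using bar_height_exponent[OF assms] by metis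
 obtain \<kappa> where "\<kappa> \<in> fst B" using bar_nonempty by blast
 then have "arc_denom n (bar_arc B)" using bar_arc_denom assms(2) by blast
 then show ?thesis using m by (auto simp: arc_denom_def bar_arc_at_def)
qed

lemma bar_denom: obtains n where "0 < n" "\<And>\<kappa>. \<kappa> \<in> fst B \<Longrightarrow> arc_denom n \<kappa>"
 using finite_arc_denom_common[OF finite_bar] R_arc bar_subset by blast

lemma is_arc_bar_arc_at: "is_arc (bar_arc_at B a)" using bar_denom bar_arc_at_denom arc_denom_imp_is_arc by metis

lemma bar_arc_at_convergent: "0 < n \<Longrightarrow> fps_convergent (arc_param n (bar_arc_at B a))"
 by (rule fps_convergent_finite_support[of n "snd B + 1"]) (auto simp: bar_arc_at_def bar_arc_ge)

lemma above_bar_arc_at: "above B (bar_arc_at B a)" by (simp add: above_def bar_arc_at_def)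

lemma leaves_bar_arc_at: "leaves (bar_arc_at B a) B a \<longleftrightarrow> (\<forall>\<kappa>\<in>fst B. \<kappa> (snd B) \<noteq> a)"
 by (simp add: leaves_iff is_arc_bar_arc_at above_bar_arc_at) (simp add: bar_arc_at_def)

lemma bar_arc_at_0: "0 < snd B \<Longrightarrow> bar_arc_at B a 0 = 0" using bar_arc_0 by (simp add: bar_arc_at_def)

lemma above_0: "0 < snd B \<Longrightarrow> above B \<xi> \<Longrightarrow> \<xi> 0 = 0" using bar_arc_0 by (simp add: above_def)

end

lemma bar_arc_at_inj:
 assumes B: "B \<in> bars f g" "B' \<in> bars f g" and h: "snd B = snd B'" and eq: "bar_arc_at B a = bar_arc_at B' a'"
 shows "B = B'" "a = a'"
proof -
 have "bar_arc B e = bar_arc B' e" if "e < snd B" for e using fun_cong[OF eq, of e] that h by (simp add: bar_arc_at_def)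
 then have "above B = above B'" by (auto simp: above_def h)
 then show "B = B'" using bar_members[OF B(1)] bar_members[OF B(2)] h by (simp add: prod_eqI)
 show "a = a'" using fun_cong[OF eq, of "snd B"] h by (simp add: bar_arc_at_def)
qed

lemma above_same_height:
 assumes "B \<in> bars f g" "B' \<in> bars f g" "snd B = snd B'" "above B \<xi>" "above B' \<xi>"
 shows "B = B'"
proof -
 have "above B = above B'" using assms(3-5) by (auto simp: above_def)
 then show ?thesis using bar_members[OF assms(1)] bar_members[OF assms(2)] assms(3) by (simp add: prod_eqI)
qed

text \<open>
  If an arc leaves two bars, a root over the higher one follows the arc beyond the lower one, so a trunk
  grows there.
\<close>

lemma leaves_unique:
 assumes B: "B \<in> bars f g" "B' \<in> bars f g" and l: "leaves \<xi> B a" "leaves \<xi> B' a'"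
 shows "B = B'" "a = a'"
proof -
 have *: "\<not> snd C < snd D" if C: "C \<in> bars f g" "leaves \<xi> C c" and D: "D \<in> bars f g" "leaves \<xi> D d" for C D c d
 proof
  assume lt: "snd C < snd D"
  obtain \<kappa> where \<kappa>: "\<kappa> \<in> fst D" using bar_nonempty[OF D(1)] by blast
  have "\<kappa> e = \<xi> e" if "e \<le> snd C" for e
   using bar_arc_member[OF D(1) \<kappa>] D(2) lt that by (auto simp: leaves_iff[OF D(1)] above_def)
  then have "above C \<kappa>" "\<kappa> (snd C) = c" using C(2) by (auto simp: leaves_iff[OF C(1)] above_def)
  moreover have "\<kappa> \<in> R" using \<kappa> bar_subset[OF D(1)] by auto
  ultimately have "\<kappa> \<in> fst C" "\<kappa> (snd C) = c" using bar_members[OF C(1)] by auto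
  then show False using C(2) by (auto simp: leaves_iff[OF C(1)])
 qed
 have "snd B = snd B'" using *[OF B(1) l(1) B(2) l(2)] *[OF B(2) l(2) B(1) l(1)] by simp
 then show BB: "B = B'" using above_same_height[OF B] l by (auto simp: leaves_iff[OF B(1)] leaves_iff[OF B(2)])
 show "a = a'" using l unfolding BB leaves_iff[OF B(2)] by simp
qed

lemma leaves_not_root:
 assumes B: "B \<in> bars f g" and l: "leaves \<xi> B a"
 shows "\<xi> \<notin> R"
proof
 assume "\<xi> \<in> R"
 then have "\<xi> \<in> fst B" using l bar_members[OF B] by (auto simp: leaves_iff[OF B])
 then show False using l by (auto simp: leaves_iff[OF B])
qed

lemma truncation_eq:
 assumes B: "B \<in> bars f g" and l: "leaves \<xi> B a"
 shows "truncation f g \<xi> = bar_arc_at B a"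
proof -
 have "(THE \<zeta>. \<exists>B\<in>bars f g. \<exists>a. leaves \<xi> B a \<and> \<zeta> = bar_arc_at B a) = bar_arc_at B a"
  using assms leaves_unique by (intro the_equality) blast+
 then show ?thesis using leaves_not_root[OF assms] by (simp add: truncation_def)
qed

subsection \<open>The orders of \<open>f\<close> and \<open>g\<close> along a bar\<close>

lemma contact_below:
 assumes "\<And>e. e < h \<Longrightarrow> \<alpha> e = \<alpha>' e" "\<And>e. e < h \<Longrightarrow> \<beta> e = \<beta>' e" "e0 < h" "\<alpha> e0 \<noteq> \<beta> e0"
  and "is_arc \<alpha>" "is_arc \<beta>"
 shows "contact \<alpha> \<beta> = contact \<alpha>' \<beta>'"
proof -
 have "\<alpha> \<noteq> \<beta>" using assms(4) by auto
 then obtain c where c: "\<alpha> c \<noteq> \<beta> c" "\<And>e. e < c \<Longrightarrow> \<alpha> e = \<beta> e" "contact \<alpha> \<beta> = ereal c"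
  using contact_obtain[OF assms(5,6)] by metis
 have "c \<le> e0" using c(2)[of e0] assms(4) by force
 then have "contact \<alpha>' \<beta>' = ereal c" using c assms(1-3) by (intro contact_eqI) auto
 then show ?thesis using c(3) by simp
qed

lemma rcontact_not_above:
 assumes arcs: "is_arc \<kappa>" "is_arc \<alpha>" and ab: "above B \<kappa>" "above B \<xi>" "\<not> above B \<alpha>"
 shows "rcontact \<xi> \<alpha> = rcontact \<kappa> \<alpha>"
proof -
 obtain e0 where e0: "e0 < snd B" "\<alpha> e0 \<noteq> bar_arc B e0" using ab by (auto simp: above_def)
 have "contact \<kappa> \<alpha> = contact \<xi> \<alpha>"
 proof (rule contact_below[OF _ _ e0(1) _ arcs])
  show "\<kappa> e0 \<noteq> \<alpha> e0" using ab(1) e0 by (simp add: above_def)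
 qed (use ab in \<open>simp_all add: above_def\<close>)
 then show ?thesis by (simp add: rcontact_def)
qed

lemma rcontact_above:
 assumes B: "B \<in> bars f g" and l: "leaves \<xi> B a" and \<kappa>: "\<kappa> \<in> fst B" and \<alpha>: "\<alpha> \<in> R"
 shows "rcontact \<xi> \<alpha> = (if \<alpha> \<in> fst B then snd B else rcontact \<kappa> \<alpha>)"
proof (cases "\<alpha> \<in> fst B")
 case True
 have "contact \<xi> \<alpha> = ereal (snd B)"
 proof (rule contact_eqI)
  show "\<xi> (snd B) \<noteq> \<alpha> (snd B)" using l True by (auto simp: leaves_iff[OF B])
  fix e assume "e < snd B"
  then show "\<xi> e = \<alpha> e" using bar_arc_member[OF B True] l by (auto simp: leaves_iff[OF B] above_def)
 qed
 then show ?thesis using True by (simp add: rcontact_def)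
next
 case False
 have "is_arc \<kappa>" "is_arc \<alpha>" "above B \<kappa>" "above B \<xi>" "\<not> above B \<alpha>"
  using \<alpha> \<kappa> l False bar_members[OF B] leaves_iff[OF B] R_arc by auto
 then show ?thesis using False rcontact_not_above[of \<kappa> \<alpha> B \<xi>] by simp
qed

text \<open>
  The arc has contact \<open>h\<close> with the roots above the bar, and with the others the same contact as the bar.
\<close>

lemma np_order_leaving:
 assumes B: "B \<in> bars f g" and h: "0 < snd B" and l: "leaves \<xi> B a" and \<kappa>: "\<kappa> \<in> fst B"
  and np: "np_factorization F E (mset_set S)" and S: "S \<subseteq> R"
 shows "arc_order (subst_arc F \<xi>) = ereal (real E + (\<Sum>\<alpha>\<in>S. if \<alpha> \<in> fst B then snd B else rcontact \<kappa> \<alpha>))"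
  "subst_arc F \<xi> \<noteq> (\<lambda>_. 0)"
  "arc_denom n \<xi> \<Longrightarrow> arc_ev n \<xi> F \<noteq> 0 \<and> real (subdegree (arc_ev n \<xi> F)) =
   real n * (real E + (\<Sum>\<alpha>\<in>S. if \<alpha> \<in> fst B then snd B else rcontact \<kappa> \<alpha>))"
proof -
 have finS: "finite S" using S finite_R finite_subset by blast
 have \<xi>: "is_arc \<xi>" "\<xi> 0 = 0" using l above_0[OF B h] by (auto simp: leaves_iff[OF B])
 have "\<xi> \<notin># mset_set S" using leaves_not_root[OF B l] S finS by auto
 note o = np_arc_order[OF np \<xi> this] and ev = np_arc_ev[OF np \<xi> this]
 have s: "(\<Sum>\<gamma>\<in>#mset_set S. rcontact \<xi> \<gamma>) = (\<Sum>\<alpha>\<in>S. if \<alpha> \<in> fst B then snd B else rcontact \<kappa> \<alpha>)"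
  using rcontact_above[OF B l \<kappa>] S by (simp add: sum_unfold_sum_mset[symmetric] subset_iff cong: sum.cong)
 show "arc_order (subst_arc F \<xi>) = ereal (real E + (\<Sum>\<alpha>\<in>S. if \<alpha> \<in> fst B then snd B else rcontact \<kappa> \<alpha>))"
  "subst_arc F \<xi> \<noteq> (\<lambda>_. 0)" using o by (simp_all add: s)
 show "arc_denom n \<xi> \<Longrightarrow> arc_ev n \<xi> F \<noteq> 0 \<and> real (subdegree (arc_ev n \<xi> F)) =
   real n * (real E + (\<Sum>\<alpha>\<in>S. if \<alpha> \<in> fst B then snd B else rcontact \<kappa> \<alpha>))" using ev by (simp add: s)
qed

lemma np_nu:
 assumes B: "B \<in> bars f g" and h: "0 < snd B" and \<kappa>: "\<kappa> \<in> fst B"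
  and np: "np_factorization F E (mset_set S)" and S: "S \<subseteq> R"
 shows "nu F B = real E + (\<Sum>\<alpha>\<in>S. if \<alpha> \<in> fst B then snd B else rcontact \<kappa> \<alpha>)"
proof -
 let ?v = "real E + (\<Sum>\<alpha>\<in>S. if \<alpha> \<in> fst B then snd B else rcontact \<kappa> \<alpha>)"
 let ?Z = "(\<lambda>\<kappa>. \<kappa> (snd B)) ` fst B"
 have "\<forall>\<^sub>F z in at 0. z \<notin> ?Z"
 proof -
  have "\<forall>\<^sub>F z in at (0 :: complex). z \<notin> A" if "finite A" for A
   using that by induction (auto simp: eventually_conj_iff eventually_neq_at_within)
  then show ?thesis using finite_bar[OF B] by blast
 qed
 then have ev: "\<forall>\<^sub>F z in at 0. arc_order (subst_arc F (bar_arc_at B z)) = ereal ?v"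
 proof eventually_elim
  case (elim z)
  then have "leaves (bar_arc_at B z) B z" using leaves_bar_arc_at[OF B] by auto
  then show ?case using np_order_leaving(1)[OF B h _ \<kappa> np S] by blast
 qed
 show ?thesis unfolding nu_def
 proof (rule the_equality)
  show "\<forall>\<^sub>F z in at 0. arc_order (subst_arc F (bar_arc_at B z)) = ereal ?v" by (rule ev)
 next
  fix v assume "\<forall>\<^sub>F z in at 0. arc_order (subst_arc F (bar_arc_at B z)) = ereal v"
  with ev have "\<forall>\<^sub>F z in at (0 :: complex). v = ?v" by eventually_elim auto
  then show "v = ?v" by simp
 qed
qed

lemma order_leaving:
 assumes B: "B \<in> bars f g" and h: "0 < snd B" and l: "leaves \<xi> B a"
 shows "subst_arc f \<xi> \<noteq> (\<lambda>_. 0)" "subst_arc g \<xi> \<noteq> (\<lambda>_. 0)"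
  "arc_denom n \<xi> \<Longrightarrow> arc_ev n \<xi> f \<noteq> 0 \<and> real (subdegree (arc_ev n \<xi> f)) = real n * nu f B"
  "arc_denom n \<xi> \<Longrightarrow> arc_ev n \<xi> g \<noteq> 0 \<and> real (subdegree (arc_ev n \<xi> g)) = real n * nu g B"
proof -
 obtain \<kappa> where \<kappa>: "\<kappa> \<in> fst B" using bar_nonempty[OF B] by blast
 have S: "roots f \<subseteq> R" "roots g \<subseteq> R" by (auto simp: tree_roots_def)
 note 1 = np_order_leaving[OF B h l \<kappa> np_fg(1) S(1)] and 2 = np_order_leaving[OF B h l \<kappa> np_fg(2) S(2)]
 show "subst_arc f \<xi> \<noteq> (\<lambda>_. 0)" "subst_arc g \<xi> \<noteq> (\<lambda>_. 0)" using 1 2 by blast+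
 show "arc_denom n \<xi> \<Longrightarrow> arc_ev n \<xi> f \<noteq> 0 \<and> real (subdegree (arc_ev n \<xi> f)) = real n * nu f B"
  using 1(3) np_nu[OF B h \<kappa> np_fg(1) S(1)] by simp
 show "arc_denom n \<xi> \<Longrightarrow> arc_ev n \<xi> g \<noteq> 0 \<and> real (subdegree (arc_ev n \<xi> g)) = real n * nu g B"
  using 2(3) np_nu[OF B h \<kappa> np_fg(2) S(2)] by simp
qed

subsection \<open>Conjugate bars\<close>

lemma conj_bar_in_bars: "B \<in> bars f g \<Longrightarrow> conj_bar k B \<in> bars f g"
proof (induction rule: bars.induct)
 case ground
 then show ?case using bars.ground[of f g] conj_roots(3)[of k] by (simp add: conj_bar_def)
next
 case (top B T h)
 have "conj_arc k ` T \<in> trunks_on (conj_bar k B)" using top by (simp add: trunks_on_conj)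
 then show ?case using bars.top[OF top.IH, of "conj_arc k ` T" h] top by (simp add: conj_bar_def trunk_height_conj)
qed

lemma bar_arc_conj:
 assumes "B \<in> bars f g"
 shows "bar_arc (conj_bar k B) = conj_arc k (bar_arc B)"
proof -
 obtain \<kappa> where \<kappa>: "\<kappa> \<in> fst B" using bar_nonempty[OF assms] by blast
 have "bar_arc (conj_bar k B) = arc_trunc (snd B) (conj_arc k \<kappa>)"
  using bar_arc_is_trunc[OF conj_bar_in_bars[OF assms], of "conj_arc k \<kappa>" k] \<kappa> by simp
 then show ?thesis unfolding bar_arc_is_trunc[OF assms \<kappa>] by (auto simp: arc_trunc_def conj_arc_def)
qed

lemma bar_arc_at_conj:
 assumes "B \<in> bars f g"
 shows "conj_arc k (bar_arc_at B a) = bar_arc_at (conj_bar k B) (cis (2 * pi * real k * snd B) * a)"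
 using bar_arc_conj[OF assms, of k] by (auto simp: bar_arc_at_def conj_arc_def fun_eq_iff)

lemma above_conj:
 assumes "B \<in> bars f g"
 shows "above (conj_bar k B) (conj_arc k \<xi>) \<longleftrightarrow> above B \<xi>"
 by (simp add: above_def bar_arc_conj[OF assms]) (simp add: conj_arc_def)

lemma leaves_conj:
 assumes B: "B \<in> bars f g"
 shows "leaves (conj_arc k \<xi>) (conj_bar k B) (cis (2 * pi * real k * snd B) * a) \<longleftrightarrow> leaves \<xi> B a"
 unfolding leaves_iff[OF B] leaves_iff[OF conj_bar_in_bars[OF B]] by (simp add: above_conj[OF B]) (simp add: conj_arc_def)

lemma nu_conj:
 assumes B: "B \<in> bars f g" and h: "0 < snd B"
 shows "nu f (conj_bar k B) = nu f B" "nu g (conj_bar k B) = nu g B"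
proof -
 obtain \<kappa> where \<kappa>: "\<kappa> \<in> fst B" using bar_nonempty[OF B] by blast
 have *: "nu F (conj_bar k B) = nu F B"
  if np: "np_factorization F E (mset_set S)" and S: "S \<subseteq> R" and st: "conj_arc k ` S = S" for F E S
 proof -
  have "nu F (conj_bar k B) = real E + (\<Sum>\<alpha>\<in>S. if \<alpha> \<in> conj_arc k ` fst B then snd B else rcontact (conj_arc k \<kappa>) \<alpha>)"
   using np_nu[OF conj_bar_in_bars[OF B], of k "conj_arc k \<kappa>" F E S] h \<kappa> np S by (simp cong: if_cong)
  also have "(\<Sum>\<alpha>\<in>S. if \<alpha> \<in> conj_arc k ` fst B then snd B else rcontact (conj_arc k \<kappa>) \<alpha>) =
   (\<Sum>\<alpha>\<in>conj_arc k ` S. if \<alpha> \<in> conj_arc k ` fst B then snd B else rcontact (conj_arc k \<kappa>) \<alpha>)" by (simp add: st)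
  also have "\<dots> = (\<Sum>\<alpha>\<in>S. if \<alpha> \<in> fst B then snd B else rcontact \<kappa> \<alpha>)" using inj_on_subset[OF inj_conj_arc]
   by (subst sum.reindex) (auto simp: inj_image_mem_iff[OF inj_conj_arc] rcontact_def intro!: sum.cong)
  finally show ?thesis using np_nu[OF B h \<kappa> np S] by simp
 qed
 show "nu f (conj_bar k B) = nu f B" "nu g (conj_bar k B) = nu g B"
  using *[OF np_fg(1)] *[OF np_fg(2)] conj_roots by (auto simp: tree_roots_def)
qed

lemma roots_branch: "is_arc \<xi> \<Longrightarrow> \<xi> 0 = 0 \<Longrightarrow> roots (branch \<xi>) = orb \<xi>"
 using np_roots_eq[OF np_factorization_branch] finite_orb by (simp add: roots_def)

text \<open>
  Conjugate bars are conjugate by a power of the monodromy: the roots of an irreducible germ form one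
  orbit, and conversely the minimal polynomial of \<open>\<lambda>\<^sub>B\<close> is an irreducible germ.
\<close>

lemma conj_rel_iff:
 assumes B: "B \<in> bars f g"
 shows "(B, B') \<in> conj_rel f g \<longleftrightarrow> (\<exists>k. B' = conj_bar k B)"
proof
 assume "(B, B') \<in> conj_rel f g"
 then obtain p \<xi> \<zeta> where B': "B' \<in> bars f g" and h: "snd B = snd B'"
  and p: "p \<in> carrier Cxy" "ring_irreducible\<^bsub>Cxy\<^esub> p"
  and \<xi>: "\<xi> \<in> roots p" "above B \<xi>" and \<zeta>: "\<zeta> \<in> roots p" "above B' \<zeta>" unfolding conj_rel_def climbs_iff by blast
 have np: "np_roots p = mset_set (orb \<xi>)" by (rule irreducible_np_roots[OF p \<xi>(1)])
 have "\<zeta> \<in> orb \<xi>"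
 proof (rule ccontr)
  assume "\<zeta> \<notin> orb \<xi>"
  then have "\<zeta> \<notin># mset_set (orb \<xi>)" by (metis elem_mset_set mset_set.infinite empty_iff set_mset_empty)
  then show False using \<zeta>(1) np by (simp add: roots_def)
 qed
 then obtain k where k: "\<zeta> = conj_arc k \<xi>" by (auto simp: orb_def)
 have "above (conj_bar k B) \<zeta>" using above_conj[OF B] \<xi>(2) k by simp
 then have "B' = conj_bar k B" using above_same_height[OF B' conj_bar_in_bars[OF B]] h \<zeta>(2) by simp
 then show "\<exists>k. B' = conj_bar k B" ..
next
 assume "\<exists>k. B' = conj_bar k B"
 then obtain k where k: "B' = conj_bar k B" ..
 let ?\<xi> = "bar_arc B"
 obtain n where n: "arc_denom n ?\<xi>" using bar_arc_arc[OF B] is_arc_def by blast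
 have c: "fps_convergent (arc_param n ?\<xi>)" by (rule bar_arc_convergent[OF B arc_denom_pos[OF n]])
 have r: "roots (branch ?\<xi>) = orb ?\<xi>" by (rule roots_branch[OF bar_arc_arc[OF B] bar_arc_0[OF B]])
 have "climbs ?\<xi> B 0" using bar_arc_arc[OF B] by (simp add: climbs_iff above_def bar_arc_ge)
 moreover have "climbs (conj_arc k ?\<xi>) B' 0"
  using bar_arc_arc[OF B] by (simp add: climbs_iff k above_def bar_arc_conj[OF B] bar_arc_ge)
 moreover have "conj_arc k ?\<xi> \<in> orb ?\<xi>" by (simp add: conj_in_orb)
 ultimately show "(B, B') \<in> conj_rel f g" unfolding conj_rel_def
  using B conj_bar_in_bars[OF B] k r branch_irreducible[OF n c bar_arc_0[OF B]] branch_convergent[OF n c]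
  by (auto intro!: bexI[of _ "branch ?\<xi>"]) (metis self_in_orb)+
qed

lemma conj_class_obtain:
 assumes "\<BB> \<in> conj_classes f g"
 obtains B where "B \<in> bars f g" "\<BB> = range (\<lambda>k. conj_bar k B)"
proof -
 obtain B where B: "B \<in> bars f g" "\<BB> = conj_rel f g `` {B}" using assms by (auto simp: conj_classes_def quotient_def)
 then have "\<BB> = range (\<lambda>k. conj_bar k B)" using conj_rel_iff[OF B(1)] by auto
 then show ?thesis using that B by blast
qed

end

section \<open>The Jacobian along a bar\<close>

lemma germ_convergent_scale:
 assumes F: "germ_convergent F" and G: "\<And>i j. norm (G $ i $ j) \<le> 2 ^ (i + j) * norm (F $ i $ j)"
 shows "germ_convergent G"
proof -
 obtain r C where r: "r > 0" and C: "gbound r r C F" using F germ_convergent_iff by blast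
 have "gsum D (r / 2) (r / 2) G \<le> C" if D: "finite D" for D
 proof -
  have "gsum D (r / 2) (r / 2) G \<le> gsum D r r F" unfolding gsum_def
  proof (intro sum_mono, goal_cases)
   case (1 p)
   obtain i j where p: "p = (i, j)" by fastforce
   have "norm (G $ i $ j) * (r / 2) ^ i * (r / 2) ^ j \<le> 2 ^ (i + j) * norm (F $ i $ j) * ((r / 2) ^ i * (r / 2) ^ j)"
    unfolding mult.assoc[of "norm (G $ i $ j)"] using r G by (intro mult_right_mono) auto
   also have "\<dots> = norm (F $ i $ j) * r ^ i * r ^ j" by (simp add: power_add power_divide)
   finally show ?case unfolding p prod.case .
  qed
  also have "\<dots> \<le> C" using C D by (auto simp: gbound_def)
  finally show ?thesis .
 qed
 then show ?thesis using r germ_convergentI[of "r / 2" "r / 2"] by (auto simp: gbound_def)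
qed

lemma Suc_le_power2: "real (Suc n) \<le> 2 ^ n" by (induction n) auto

lemma germ_convergent_deriv_x:
 assumes "germ_convergent F"
 shows "germ_convergent (deriv_x F)"
proof (rule germ_convergent_scale[OF germ_convergent_shift[OF assms, of 1]])
 fix i j
 have "of_nat (i + 1) * F $ (i + 1) = fps_const (of_nat (i + 1)) * F $ (i + 1)" by (simp only: fps_of_nat)
 then have "norm (deriv_x F $ i $ j) = real (Suc i) * norm (F $ Suc i $ j)"
  by (simp add: deriv_x_def norm_mult del: of_nat_Suc)
 also have "\<dots> \<le> 2 ^ (i + j) * norm (F $ Suc i $ j)"
  by (intro mult_right_mono order_trans[OF Suc_le_power2 power_increasing]) auto
 finally show "norm (deriv_x F $ i $ j) \<le> 2 ^ (i + j) * norm (fps_shift 1 F $ i $ j)" by simp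
qed

lemma germ_convergent_deriv_y:
 assumes "germ_convergent F"
 shows "germ_convergent (deriv_y F)"
proof -
 have "germ_convergent (Abs_fps (\<lambda>i. fps_shift 1 (F $ i)))" by (rule germ_convergent_reindex[OF assms, of _ 1 0 1]) auto
 then show ?thesis
 proof (rule germ_convergent_scale)
  fix i j
  have "norm (deriv_y F $ i $ j) = real (Suc j) * norm (F $ i $ Suc j)" by (simp add: deriv_y_def norm_mult del: of_nat_Suc)
  also have "\<dots> \<le> 2 ^ (i + j) * norm (F $ i $ Suc j)"
   by (intro mult_right_mono order_trans[OF Suc_le_power2 power_increasing]) auto
  finally show "norm (deriv_y F $ i $ j) \<le> 2 ^ (i + j) * norm (Abs_fps (\<lambda>i. fps_shift 1 (F $ i)) $ i $ j)" by simp
 qed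
qed

lemma germ_convergent_jacobian:
 "germ_convergent F \<Longrightarrow> germ_convergent G \<Longrightarrow> germ_convergent (jacobian F G)" unfolding jacobian_def
 by (intro germ_convergent_diff germ_convergent_mult germ_convergent_deriv_x germ_convergent_deriv_y)

subsection \<open>Chain rule\<close>

text \<open>The chain rule for an arbitrary derivation \<open>D\<close>, which will be \<open>d/dt\<close> and \<open>d/dz\<close>.\<close>

lemma ev_derivation:
 fixes X :: "'a::comm_ring_1 fps"
 assumes X: "X $ 0 = 0"
  and add: "\<And>a b. \<delta> (a + b) = \<delta> a + \<delta> b"
  and leibniz: "\<And>a b. \<delta> (a * b) = a * \<delta> b + \<delta> a * b"
  and local: "\<And>a b k. (\<And>i. i \<le> Suc k \<Longrightarrow> a $ i = b $ i) \<Longrightarrow> \<delta> a $ k = \<delta> b $ k"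
 shows "\<delta> (ev X G) = ev X (fps_deriv G) * \<delta> X + ev X (Abs_fps (\<lambda>i. \<delta> (G $ i)))"
proof (rule fps_ext)
 fix k
 have 0: "\<delta> 0 = 0" using add[of 0 0] by simp
 have 1: "\<delta> 1 = 0" using leibniz[of 1 1] by simp
 have sum: "\<delta> (sum f A) = (\<Sum>x\<in>A. \<delta> (f x))" for f :: "nat \<Rightarrow> 'a fps" and A
  by (induction A rule: infinite_finite_induct) (auto simp: add 0)
 have power: "\<delta> (X ^ Suc i) = of_nat (Suc i) * X ^ i * \<delta> X" for i
 proof (induction i)
  case (Suc i)
  have "\<delta> (X ^ Suc (Suc i)) = X * \<delta> (X ^ Suc i) + \<delta> X * X ^ Suc i" unfolding power_Suc[of X "Suc i"] by (rule leibniz)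
  then show ?case unfolding Suc.IH by (simp add: algebra_simps)
 qed simp
 let ?n = "Suc k"
 have "\<delta> (ev X G) $ k = \<delta> (\<Sum>i\<le>?n. G $ i * X ^ i) $ k" by (rule local) (simp add: ev_nth[OF X])
 also have "\<delta> (\<Sum>i\<le>?n. G $ i * X ^ i) = (\<Sum>i\<le>?n. G $ i * \<delta> (X ^ i)) + (\<Sum>i\<le>?n. \<delta> (G $ i) * X ^ i)"
  by (simp only: sum leibniz sum.distrib)
 also have "(\<Sum>i\<le>?n. G $ i * \<delta> (X ^ i)) = (\<Sum>i\<le>k. fps_deriv G $ i * X ^ i) * \<delta> X"
  unfolding sum.atMost_Suc_shift power sum_distrib_right by (simp add: 1 mult_ac)
 also have "((\<Sum>i\<le>k. fps_deriv G $ i * X ^ i) * \<delta> X + (\<Sum>i\<le>?n. \<delta> (G $ i) * X ^ i)) $ k =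
   (ev X (fps_deriv G) * \<delta> X) $ k + ev X (Abs_fps (\<lambda>i. \<delta> (G $ i))) $ k"
 proof -
  have "((\<Sum>i\<le>k. fps_deriv G $ i * X ^ i) * \<delta> X) $ k = (ev X (fps_deriv G) * \<delta> X) $ k"
   by (rule fps_mult_nth_cong) (simp_all add: ev_nth[OF X])
  moreover have "(\<Sum>i\<le>?n. \<delta> (G $ i) * X ^ i) $ k = ev X (Abs_fps (\<lambda>i. \<delta> (G $ i))) $ k"
   using ev_nth[OF X, of k ?n "Abs_fps (\<lambda>i. \<delta> (G $ i))"] by simp
  ultimately show ?thesis by simp
 qed
 finally show "\<delta> (ev X G) $ k = (ev X (fps_deriv G) * \<delta> X + ev X (Abs_fps (\<lambda>i. \<delta> (G $ i)))) $ k" by simp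
qed

subsection \<open>Series with polynomial coefficients\<close>

definition lift :: "complex fps \<Rightarrow> complex poly fps" where
 "lift a = Abs_fps (\<lambda>k. [:a $ k:])"

lemma lift_nth [simp]: "lift a $ k = [:a $ k:]" by (simp add: lift_def)

lemma pCons_0_sum: "[:sum f A:] = (\<Sum>x\<in>A. [:f x:])"
 by (rule poly_eqI) (simp add: Polynomial.coeff_sum coeff_pCons split: nat.split)

lemma lift_add: "lift (a + b) = lift a + lift b"
 and lift_diff: "lift (a - b) = lift a - lift b"
 and lift_mult: "lift (a * b) = lift a * lift b" by (simp_all add: fps_eq_iff fps_mult_nth pCons_0_sum mult.commute)

lemma lift_0 [simp]: "lift 0 = 0" and lift_1 [simp]: "lift 1 = 1" by (simp_all add: fps_eq_iff fps_one_nth)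

lemma lift_sum: "lift (sum f A) = (\<Sum>x\<in>A. lift (f x))" by (induction A rule: infinite_finite_induct) (auto simp: lift_add)

lemma lift_X_power: "lift (fps_X ^ n) = fps_X ^ n" by (simp add: fps_eq_iff fps_X_power_nth)

definition lift_germ :: "germ \<Rightarrow> complex poly fps fps" where
 "lift_germ G = Abs_fps (\<lambda>i. lift (G $ i))"

lemma lift_germ_nth [simp]: "lift_germ G $ i = lift (G $ i)" by (simp add: lift_germ_def)

lemma lift_germ_diff: "lift_germ (F - G) = lift_germ F - lift_germ G"
 and lift_germ_mult: "lift_germ (F * G) = lift_germ F * lift_germ G"
 by (simp_all add: fps_eq_iff[where 'a = "complex poly fps"] lift_diff fps_mult_nth[where 'a = "complex poly fps"]
   fps_mult_nth[where 'a = "complex fps"] lift_sum lift_mult)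

lemma lift_germ_const: "lift_germ (fps_const a) = fps_const (lift a)"
proof (rule fps_ext)
 fix i show "lift_germ (fps_const a) $ i = fps_const (lift a) $ i" by (cases i) auto
qed

lemma lift_germ_X: "lift_germ fps_X = fps_X"
proof (rule fps_ext)
 fix i show "lift_germ fps_X $ i = fps_X $ i" by (cases "i = 1") (auto simp: fps_X_def)
qed

lemma lift_germ_rprod: "lift_germ (rprod C) = (\<Prod>c\<in>#C. fps_X - fps_const (lift c))"
proof (induction C)
 case empty
 show ?case using lift_germ_const[of 1] by simp
qed (simp add: lift_germ_mult lift_germ_diff lift_germ_X lift_germ_const)

text \<open>The lowest term in \<open>t\<close>, with a polynomial in the parameter \<open>z\<close> as its coefficient.\<close>

definition lead :: "complex poly fps \<Rightarrow> nat \<Rightarrow> complex poly \<Rightarrow> bool" where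
 "lead H d p \<longleftrightarrow> p \<noteq> 0 \<and> H $ d = p \<and> (\<forall>k<d. H $ k = 0)"

lemma lead_subdegree: "lead H d p \<Longrightarrow> subdegree H = d" unfolding lead_def by (intro subdegreeI) auto

lemma lead_unique: "lead H d p \<Longrightarrow> lead H e q \<Longrightarrow> d = e \<and> p = q"
 using lead_subdegree[of H d p] lead_subdegree[of H e q] by (auto simp: lead_def)

lemma lead_mult:
 assumes "lead H d p" "lead K e q"
 shows "lead (H * K) (d + e) (p * q)"
proof -
 have s: "subdegree H = d" "subdegree K = e" using assms lead_subdegree by blast+
 have "H \<noteq> 0" "K \<noteq> 0" using assms by (auto simp: lead_def)
 then have "subdegree (H * K) = d + e" using s by simp
 then have "(H * K) $ k = 0" if "k < d + e" for k using that by (intro nth_less_subdegree_zero) simp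
 moreover have "(H * K) $ (d + e) = p * q" using nth_subdegree_mult[of H K] s assms by (simp add: lead_def)
 ultimately show ?thesis using assms by (simp add: lead_def)
qed

lemma lead_X_power: "lead (fps_X ^ n) n 1" by (simp add: lead_def fps_X_power_nth)

definition dz :: "complex poly fps \<Rightarrow> complex poly fps" where
 "dz H = Abs_fps (\<lambda>k. pderiv (H $ k))"

lemma dz_nth [simp]: "dz H $ k = pderiv (H $ k)" by (simp add: dz_def)

lemma pderiv_sum: "pderiv (sum f A) = (\<Sum>x\<in>A. pderiv (f x))"
 by (induction A rule: infinite_finite_induct) (auto simp: pderiv_add)

lemma dz_add: "dz (a + b) = dz a + dz b"
 and dz_mult: "dz (a * b) = a * dz b + dz a * b"
 by (simp_all add: fps_eq_iff pderiv_add fps_mult_nth pderiv_sum pderiv_mult sum.distrib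
   mult.commute[of "pderiv _"])

text \<open>
  The operators \<open>t d/dt\<close> and \<open>d/dz\<close> do not lower the order in \<open>t\<close>. The two leading contributions may
  cancel, so the coefficient computed here can be \<open>0\<close>.
\<close>

lemma wronskian_nth:
 assumes A: "lead A a P" and C: "lead C b Q"
 defines "W \<equiv> fps_X * fps_deriv A * dz C - dz A * (fps_X * fps_deriv C)"
 shows "k < a + b \<Longrightarrow> W $ k = 0"
  and "W $ (a + b) = of_nat a * P * pderiv Q - of_nat b * pderiv P * Q"
proof -
 have X: "(fps_X * fps_deriv H) $ k = of_nat k * H $ k" for H :: "complex poly fps" and k by (cases k) auto
 have prod: "(H * K) $ k = (if k = a + b then H $ a * K $ b else 0)"
  if "\<And>i. i < a \<Longrightarrow> H $ i = 0" "\<And>i. i < b \<Longrightarrow> K $ i = 0" "k \<le> a + b" for H K :: "complex poly fps" and k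
 proof -
  have "(H * K) $ k = (\<Sum>i=0..k. H $ i * K $ (k - i))" by (rule fps_mult_nth)
  also have "\<dots> = (\<Sum>i=0..k. if i = a \<and> k = a + b then H $ a * K $ b else 0)"
  proof (intro sum.cong refl)
   fix i assume "i \<in> {0..k}"
   show "H $ i * K $ (k - i) = (if i = a \<and> k = a + b then H $ a * K $ b else 0)"
   proof (cases "i < a")
    case False
    then have "k - i < b \<or> (i = a \<and> k = a + b)" using \<open>k \<le> a + b\<close> \<open>i \<in> {0..k}\<close> by (cases "i = a") auto
    then show ?thesis using \<open>k \<le> a + b\<close> False that(2)[of "k - i"] \<open>i \<in> {0..k}\<close>
     by (cases "k - i = b \<and> i = a") auto
   qed (use that in auto)
  qed
  also have "\<dots> = (if k = a + b then H $ a * K $ b else 0)" by (simp add: sum.delta)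
  finally show ?thesis .
 qed
 have A0: "A $ i = 0" if "i < a" for i using A that by (simp add: lead_def)
 have C0: "C $ i = 0" if "i < b" for i using C that by (simp add: lead_def)
 have W: "W $ k = (if k = a + b then of_nat a * P * pderiv Q - of_nat b * pderiv P * Q else 0)" if k: "k \<le> a + b" for k
 proof -
  have "(fps_X * fps_deriv A * dz C) $ k = (if k = a + b then of_nat a * P * pderiv Q else 0)"
   using prod[of "fps_X * fps_deriv A" "dz C" k] A C k A0 C0 by (simp add: X lead_def)
  moreover have "(dz A * (fps_X * fps_deriv C)) $ k = (if k = a + b then of_nat b * pderiv P * Q else 0)"
   using prod[of "dz A" "fps_X * fps_deriv C" k] A C k A0 C0 by (simp add: X lead_def mult_ac)
  ultimately show ?thesis by (simp add: W_def)
 qed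
 show "k < a + b \<Longrightarrow> W $ k = 0" and "W $ (a + b) = of_nat a * P * pderiv Q - of_nat b * pderiv P * Q" using W by simp_all
qed

lemma order_prod_linear:
 fixes a :: complex
 shows "order a (\<Prod>x\<in>#A. [:- r x, 1:]) = size {#x \<in># A. r x = a#}" "(\<Prod>x\<in>#A. [:- r x, 1:]) \<noteq> 0"
proof -
 have "(\<Prod>x\<in>#A. [:- r x, 1:]) \<noteq> 0 \<and> order a (\<Prod>x\<in>#A. [:- r x, 1:]) = size {#x \<in># A. r x = a#}"
 proof (induction A)
  case (add x A)
  have "order a [:- r x, 1:] = (if r x = a then 1 else 0)" using order_power_n_n[of a 1] by (auto intro: order_0I)
  moreover have "[:- r x, 1:] * (\<Prod>x\<in>#A. [:- r x, 1:]) \<noteq> 0" using add.IH by (simp del: mult_pCons_left)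
  ultimately show ?case using add.IH by (simp add: order_mult del: mult_pCons_left)
 qed (auto simp: order_0I)
 then show "order a (\<Prod>x\<in>#A. [:- r x, 1:]) = size {#x \<in># A. r x = a#}" "(\<Prod>x\<in>#A. [:- r x, 1:]) \<noteq> 0" by auto
qed

lemma pderiv_prod_linear:
 fixes z :: complex
 assumes "\<And>x. x \<in># A \<Longrightarrow> r x \<noteq> z"
 shows "poly (pderiv (\<Prod>x\<in>#A. [:- r x, 1:])) z = poly (\<Prod>x\<in>#A. [:- r x, 1:]) z * (\<Sum>x\<in>#A. 1 / (z - r x))" using assms
proof (induction A)
 case (add x A)
 then have "z - r x \<noteq> 0" by auto
 have IH: "poly (pderiv (\<Prod>x\<in>#A. [:- r x, 1:])) z = poly (\<Prod>x\<in>#A. [:- r x, 1:]) z * (\<Sum>x\<in>#A. 1 / (z - r x))" using add by simp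
 have "poly (pderiv ([:- r x, 1:] * (\<Prod>x\<in>#A. [:- r x, 1:]))) z =
   (z - r x) * (poly (\<Prod>x\<in>#A. [:- r x, 1:]) z * (\<Sum>x\<in>#A. 1 / (z - r x))) + poly (\<Prod>x\<in>#A. [:- r x, 1:]) z"
  unfolding pderiv_mult poly_add poly_mult IH by (simp add: pderiv_pCons)
 also have "\<dots> = (z - r x) * poly (\<Prod>x\<in>#A. [:- r x, 1:]) z * (1 / (z - r x) + (\<Sum>x\<in>#A. 1 / (z - r x)))"
  using \<open>z - r x \<noteq> 0\<close> by (simp add: distrib_left)
 finally show ?case by (simp del: mult_pCons_left)
qed simp

lemma poly_prod_linear_neq_0:
 fixes z :: complex
 assumes "\<And>x. x \<in># A \<Longrightarrow> r x \<noteq> z"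
 shows "poly (\<Prod>x\<in>#A. [:- r x, 1:]) z \<noteq> 0" using assms by (induction A) auto

subsection \<open>Counting polar roots\<close>

lemma ramify_deriv_x: "fps_deriv (ramify N F) = ramify N (deriv_x F)"
proof (rule fps_ext)
 fix i
 have "of_nat (i + 1) * (F $ (i + 1) oo fps_X ^ N) = (of_nat (i + 1) * F $ (i + 1)) oo fps_X ^ N"
  by (simp add: fps_const_mult_apply_left fps_compose_add_distrib[symmetric] fps_eq_iff fps_compose_nth
    sum_distrib_left mult_ac flip: fps_of_nat)
 then show "fps_deriv (ramify N F) $ i = ramify N (deriv_x F) $ i" by (simp add: ramify_eq_cmap deriv_x_def)
qed

lemma lift_of_nat: "lift (of_nat k) = of_nat k" by (induction k) (simp_all add: lift_add)

lemma lift_deriv: "fps_deriv (lift a) = lift (fps_deriv a)" by (simp add: fps_eq_iff of_nat_poly)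

lemma lift_germ_deriv: "fps_deriv (lift_germ G) = lift_germ (fps_deriv G)"
 by (rule fps_ext) (simp add: lift_mult lift_of_nat lift_add)

lemma dz_lift: "dz (lift a) = 0" by (simp add: fps_eq_iff pderiv_pCons)

context mero_pair
begin

context
 fixes B N m
 assumes B: "bar_arc B 0 = 0" and N: "0 < N" and denB: "arc_denom N (bar_arc B)"
  and m: "snd B = real m / real N" "0 < m"
begin

text \<open>The line \<open>x = \<lambda>\<^sub>B(y) + z y\<^sup>h\<close>, with \<open>y = t\<^sup>N\<close> and \<open>h = m / N\<close>.\<close>

definition bar_line :: "complex poly fps" where
 "bar_line = lift (arc_param N (bar_arc B)) + fps_const [:0, 1:] * fps_X ^ m"

definition on_bar :: "germ \<Rightarrow> complex poly fps" where
 "on_bar F = ev bar_line (lift_germ (ramify N F))"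

lemma bar_line_0: "bar_line $ 0 = 0" using m B by (simp add: bar_line_def)

lemma bar_line_nth: "(bar_line - lift (arc_param N \<gamma>)) $ k =
  [:bar_arc B (real k / real N) - \<gamma> (real k / real N):] + (if k = m then [:0, 1:] else 0)" by (simp add: bar_line_def)

lemma lead_root_above:
 assumes "above B \<gamma>"
 shows "lead (bar_line - lift (arc_param N \<gamma>)) m [:- \<gamma> (snd B), 1:]" unfolding lead_def
proof (intro conjI allI impI)
 show "(bar_line - lift (arc_param N \<gamma>)) $ m = [:- \<gamma> (snd B), 1:]"
  unfolding bar_line_nth using bar_arc_ge[of B "snd B"] m by simp
 fix k assume k: "k < m"
 then have "real k / real N < snd B" using N m by (simp add: divide_strict_right_mono)
 then show "(bar_line - lift (arc_param N \<gamma>)) $ k = 0" unfolding bar_line_nth using assms k by (simp add: above_def)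
qed simp

lemma lead_root_not_above:
 assumes \<gamma>: "arc_denom N \<gamma>" "\<not> above B \<gamma>"
 obtains d c where "c \<noteq> 0" "lead (bar_line - lift (arc_param N \<gamma>)) d [:c:]"
  "real d = real N * rcontact (bar_arc B) \<gamma>"
proof -
 let ?a = "arc_param N (bar_arc B) - arc_param N \<gamma>"
 obtain e where e: "e < snd B" "\<gamma> e \<noteq> bar_arc B e" using \<gamma>(2) by (auto simp: above_def)
 then have ne: "bar_arc B \<noteq> \<gamma>" by auto
 then have a0: "?a \<noteq> 0" using arc_param_inj[OF denB \<gamma>(1)] by auto
 have "\<gamma> e \<noteq> 0 \<or> bar_arc B e \<noteq> 0" using e by auto
 then obtain k :: nat where k: "e = real k / real N" using denB \<gamma>(1) unfolding arc_denom_def by blast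
 have "subdegree ?a \<le> k" using e k by (intro subdegree_leI) simp
 also have "k < m" using e k m N by (simp add: divide_less_cancel)
 finally have dm: "subdegree ?a < m" .
 define d where "d = subdegree ?a"
 have ad: "?a $ d \<noteq> 0" unfolding d_def by (rule nth_subdegree_nonzero[OF a0])
 have "lead (bar_line - lift (arc_param N \<gamma>)) d [:?a $ d:]" unfolding lead_def
 proof (intro conjI allI impI)
  show "[:?a $ d:] \<noteq> 0" using ad by (metis pCons_eq_0_iff)
  show "(bar_line - lift (arc_param N \<gamma>)) $ d = [:?a $ d:]" unfolding bar_line_nth using dm by (simp add: d_def)
  fix k assume k: "k < d"
  then have "?a $ k = 0" unfolding d_def by (rule nth_less_subdegree_zero)
  then show "(bar_line - lift (arc_param N \<gamma>)) $ k = 0" unfolding bar_line_nth using k dm by (simp add: d_def)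
 qed
 moreover note ad
 moreover have "real d = real N * rcontact (bar_arc B) \<gamma>" using rcontact_param[OF denB \<gamma>(1)] by (simp add: d_def)
 ultimately show ?thesis by (intro that)
qed

text \<open>A factor \<open>x - \<gamma>\<close> contributes \<open>z - \<gamma>(h)\<close> if \<open>\<gamma>\<close> lies above the bar, and a constant otherwise.\<close>

lemma lead_on_bar:
 assumes den: "\<And>\<gamma>. \<gamma> \<in># \<Gamma> \<Longrightarrow> arc_denom N \<gamma>" and u: "u $ 0 $ 0 \<noteq> 0"
  and F: "ramify N F = ramify N u * fps_const (fps_X ^ (N * E)) * root_prod N \<Gamma>"
 obtains c D where "c \<noteq> 0"
  "lead (on_bar F) D (smult c (\<Prod>\<gamma>\<in>#filter_mset (above B) \<Gamma>. [:- \<gamma> (snd B), 1:]))"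
  "real D = real N * (real E + (\<Sum>\<gamma>\<in>#\<Gamma>. if above B \<gamma> then snd B else rcontact (bar_arc B) \<gamma>))"
proof -
 have "\<exists>c D. c \<noteq> 0 \<and> lead (\<Prod>\<gamma>\<in>#\<Gamma>. bar_line - lift (arc_param N \<gamma>)) D
   (smult c (\<Prod>\<gamma>\<in>#filter_mset (above B) \<Gamma>. [:- \<gamma> (snd B), 1:])) \<and>
  real D = real N * (\<Sum>\<gamma>\<in>#\<Gamma>. if above B \<gamma> then snd B else rcontact (bar_arc B) \<gamma>)" using den
 proof (induction \<Gamma>)
  case empty
  show ?case by (intro exI[of _ 1] exI[of _ 0]) (simp add: lead_def)
 next
  case (add \<gamma> \<Gamma>)
  then obtain c D where cD: "c \<noteq> 0" "lead (\<Prod>\<gamma>\<in>#\<Gamma>. bar_line - lift (arc_param N \<gamma>)) D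
   (smult c (\<Prod>\<gamma>\<in>#filter_mset (above B) \<Gamma>. [:- \<gamma> (snd B), 1:]))"
   "real D = real N * (\<Sum>\<gamma>\<in>#\<Gamma>. if above B \<gamma> then snd B else rcontact (bar_arc B) \<gamma>)" by auto
  show ?case
  proof (cases "above B \<gamma>")
   case True
   have "lead (\<Prod>\<gamma>\<in>#add_mset \<gamma> \<Gamma>. bar_line - lift (arc_param N \<gamma>)) (m + D)
    (smult c (\<Prod>\<gamma>\<in>#filter_mset (above B) (add_mset \<gamma> \<Gamma>). [:- \<gamma> (snd B), 1:]))"
    using lead_mult[OF lead_root_above[OF True] cD(2)] True by (simp only: mult_smult_right
     image_mset_add_mset prod_mset.add_mset filter_mset_add_mset if_True simp_thms)
   moreover have "real (m + D) = real N * (\<Sum>\<gamma>\<in>#add_mset \<gamma> \<Gamma>. if above B \<gamma> then snd B else rcontact (bar_arc B) \<gamma>)"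
    using cD(3) True m N by (simp add: distrib_left)
   ultimately show ?thesis using cD(1) by blast
  next
   case False
   obtain d c' where d: "c' \<noteq> 0" "lead (bar_line - lift (arc_param N \<gamma>)) d [:c':]"
    "real d = real N * rcontact (bar_arc B) \<gamma>"
   proof -
    have "arc_denom N \<gamma>" using add.prems by simp
    from lead_root_not_above[OF this False] show ?thesis using that by metis
   qed
   have "lead (\<Prod>\<gamma>\<in>#add_mset \<gamma> \<Gamma>. bar_line - lift (arc_param N \<gamma>)) (d + D)
    (smult (c * c') (\<Prod>\<gamma>\<in>#filter_mset (above B) (add_mset \<gamma> \<Gamma>). [:- \<gamma> (snd B), 1:]))"
    using lead_mult[OF d(2) cD(2)] False by simp
   moreover have "real (d + D) = real N * (\<Sum>\<gamma>\<in>#add_mset \<gamma> \<Gamma>. if above B \<gamma> then snd B else rcontact (bar_arc B) \<gamma>)"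
    using cD(3) False d(3) by (simp add: distrib_left)
   moreover have "c * c' \<noteq> 0" using cD(1) d(1) by simp
   ultimately show ?thesis by blast
  qed
 qed
 then obtain c D where cD: "c \<noteq> 0" "lead (\<Prod>\<gamma>\<in>#\<Gamma>. bar_line - lift (arc_param N \<gamma>)) D
   (smult c (\<Prod>\<gamma>\<in>#filter_mset (above B) \<Gamma>. [:- \<gamma> (snd B), 1:]))"
  "real D = real N * (\<Sum>\<gamma>\<in>#\<Gamma>. if above B \<gamma> then snd B else rcontact (bar_arc B) \<gamma>)" by blast
 have "on_bar F = ev bar_line (lift_germ (ramify N u)) * fps_X ^ (N * E) * (\<Prod>\<gamma>\<in>#\<Gamma>. bar_line - lift (arc_param N \<gamma>))"
  unfolding on_bar_def F lift_germ_mult root_prod_eq_rprod lift_germ_rprod lift_germ_const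
  by (simp add: ev_mult bar_line_0 ev_prod_mset ev_diff ev_X lift_X_power image_mset.compositionality comp_def)
 moreover have "lead (ev bar_line (lift_germ (ramify N u))) 0 [:u $ 0 $ 0:]"
  using u ramify_nth_0_0[OF N] by (simp add: lead_def ev_def)
 ultimately have "lead (on_bar F) (0 + N * E + D) ([:u $ 0 $ 0:] * 1 * smult c (\<Prod>\<gamma>\<in>#filter_mset (above B) \<Gamma>. [:- \<gamma> (snd B), 1:]))"
  using lead_mult[OF lead_mult[OF _ lead_X_power] cD(2)] by (simp only:)
 moreover have "[:u $ 0 $ 0:] * 1 * smult c P = smult (u $ 0 $ 0 * c) P" for P by (simp add: mult.commute)
 moreover have "real (0 + N * E + D) = real N * (real E + (\<Sum>\<gamma>\<in>#\<Gamma>. if above B \<gamma> then snd B else rcontact (bar_arc B) \<gamma>))"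
  using cD(3) by (simp add: distrib_left)
 ultimately show ?thesis using that[of "u $ 0 $ 0 * c" "0 + N * E + D"] cD(1) u by simp
qed

lemma deriv_on_bar:
 "fps_deriv (on_bar F) = on_bar (deriv_x F) * fps_deriv bar_line +
   on_bar (deriv_y F) * (of_nat N * fps_X ^ (N - 1))"
 "dz (on_bar F) = on_bar (deriv_x F) * fps_X ^ m"
proof -
 let ?G = "lift_germ (ramify N F)"
 have dx: "fps_deriv ?G = lift_germ (ramify N (deriv_x F))" by (simp only: lift_germ_deriv ramify_deriv_x)
 have dy: "Abs_fps (\<lambda>i. fps_deriv (?G $ i)) = lift_germ (ramify N (deriv_y F)) * fps_const (of_nat N * fps_X ^ (N - 1))"
 proof (rule fps_ext)
  fix i
  have "fps_deriv (F $ i oo fps_X ^ N) = (fps_deriv (F $ i) oo fps_X ^ N) * (of_nat N * fps_X ^ (N - 1))"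
   using N by (simp add: fps_compose_deriv fps_deriv_power fps_of_nat)
  then show "Abs_fps (\<lambda>i. fps_deriv (?G $ i)) $ i = (lift_germ (ramify N (deriv_y F)) * fps_const (of_nat N * fps_X ^ (N - 1))) $ i"
   by (simp add: lift_deriv ramify_eq_cmap deriv_y_def lift_mult lift_of_nat lift_X_power)
 qed
 have "fps_deriv (ev bar_line ?G) = ev bar_line (fps_deriv ?G) * fps_deriv bar_line + ev bar_line (Abs_fps (\<lambda>i. fps_deriv (?G $ i)))"
  by (rule ev_derivation) (auto simp: bar_line_0 algebra_simps)
 then show "fps_deriv (on_bar F) = on_bar (deriv_x F) * fps_deriv bar_line +
   on_bar (deriv_y F) * (of_nat N * fps_X ^ (N - 1))" unfolding dx dy on_bar_def by (simp add: ev_mult bar_line_0)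
 have dzl: "dz bar_line = fps_X ^ m"
 proof -
  have "dz (fps_const [:0, 1:] * fps_X ^ m) = fps_X ^ m" by (simp add: fps_eq_iff fps_X_power_nth pderiv_pCons)
  then show ?thesis by (simp add: bar_line_def dz_add dz_lift)
 qed
 have "Abs_fps (\<lambda>i. dz (?G $ i)) = 0" by (rule fps_ext) (simp add: dz_lift)
 moreover have "dz (ev bar_line ?G) = ev bar_line (fps_deriv ?G) * dz bar_line + ev bar_line (Abs_fps (\<lambda>i. dz (?G $ i)))"
  by (rule ev_derivation) (auto simp: bar_line_0 dz_add dz_mult)
 ultimately show "dz (on_bar F) = on_bar (deriv_x F) * fps_X ^ m" unfolding dx dzl on_bar_def by simp
qed

text \<open>By the chain rule, as on the line \<open>\<partial>x/\<partial>z = t\<^sup>m\<close>, \<open>\<partial>y/\<partial>z = 0\<close> and \<open>t \<partial>y/\<partial>t = N t\<^sup>N\<close>.\<close>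

lemma on_bar_jacobian:
 "fps_X * fps_deriv (on_bar f) * dz (on_bar g) - dz (on_bar f) * (fps_X * fps_deriv (on_bar g)) =
   of_nat N * fps_X ^ (N + m) * on_bar (jacobian f g)"
proof -
 have J: "on_bar (jacobian f g) = on_bar (deriv_y f) * on_bar (deriv_x g) - on_bar (deriv_x f) * on_bar (deriv_y g)"
  unfolding on_bar_def jacobian_def
  using N by (simp add: ramify_eq_cmap cmap_diff cmap_mult lift_germ_diff lift_germ_mult ev_diff ev_mult bar_line_0)
 have X: "fps_X ^ (N + m) = fps_X * fps_X ^ (N - 1) * (fps_X ^ m :: complex poly fps)"
  using N by (metis power_Suc power_add Suc_diff_1)
 show ?thesis unfolding deriv_on_bar J X by (simp add: algebra_simps)
qed

end

text \<open>
  A trunk contributes once for each of its roots, which gives the logarithmic derivatives of the leading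
  terms of \<open>f\<close> and \<open>g\<close>.
\<close>

lemma mero_fun_roots:
 assumes B: "B \<in> bars f g"
 shows "mero_fun f g B z = of_real (nu f B) * (\<Sum>\<beta>\<in>fst B \<inter> roots g. 1 / (z - \<beta> (snd B))) -
  of_real (nu g B) * (\<Sum>\<alpha>\<in>fst B \<inter> roots f. 1 / (z - \<alpha> (snd B)))"
proof -
 let ?h = "snd B"
 let ?T = "\<lambda>c. {\<mu> \<in> fst B. \<mu> ?h = c}"
 let ?C = "(\<lambda>\<kappa>. \<kappa> ?h) ` fst B"
 have inj: "inj_on ?T ?C" by (auto simp: inj_on_def)
 have grp: "(\<Sum>c\<in>?C. of_nat (card (?T c \<inter> S)) / (z - c)) = (\<Sum>\<beta>\<in>fst B \<inter> S. 1 / (z - \<beta> ?h))" for S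
 proof -
  have "(\<Sum>\<beta>\<in>fst B \<inter> S. 1 / (z - \<beta> ?h)) = (\<Sum>c\<in>?C. \<Sum>\<beta>\<in>{x \<in> fst B \<inter> S. x ?h = c}. 1 / (z - \<beta> ?h))"
   using finite_bar[OF B] by (intro sum.group[symmetric]) auto
  also have "\<dots> = (\<Sum>c\<in>?C. of_nat (card (?T c \<inter> S)) / (z - c))"
  proof (intro sum.cong refl)
   fix c
   have "{x \<in> fst B \<inter> S. x ?h = c} = ?T c \<inter> S" by auto
   then show "(\<Sum>\<beta>\<in>{x \<in> fst B \<inter> S. x ?h = c}. 1 / (z - \<beta> ?h)) = of_nat (card (?T c \<inter> S)) / (z - c)" by simp
  qed
  finally show ?thesis ..
 qed
 have "mero_fun f g B z = (\<Sum>c\<in>?C. of_real (Delta f g B (?T c)) / (z - c))"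
  unfolding mero_fun_def trunks_on_eq[OF B] sum.reindex[OF inj] comp_def using trunk_point_eq[OF B] by (intro sum.cong) auto
 also have "\<dots> = (\<Sum>c\<in>?C. of_real (nu f B) * (of_nat (card (?T c \<inter> roots g)) / (z - c)) -
   of_real (nu g B) * (of_nat (card (?T c \<inter> roots f)) / (z - c)))"
  by (intro sum.cong refl) (simp add: Delta_def diff_divide_distrib)
 also have "\<dots> = of_real (nu f B) * (\<Sum>\<beta>\<in>fst B \<inter> roots g. 1 / (z - \<beta> ?h)) -
  of_real (nu g B) * (\<Sum>\<alpha>\<in>fst B \<inter> roots f. 1 / (z - \<alpha> ?h))" by (simp only: sum_subtractf sum_distrib_left[symmetric] grp)
 finally show ?thesis .
qed

lemma inj_trunk_point:
 assumes B: "B \<in> bars f g"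
 shows "inj_on (trunk_point B) (trunks_on B)"
proof (rule inj_onI)
 fix T T' assume "T \<in> trunks_on B" "T' \<in> trunks_on B" and eq: "trunk_point B T = trunk_point B T'"
 then obtain \<kappa> \<mu> where "\<kappa> \<in> fst B" "T = {\<nu> \<in> fst B. \<nu> (snd B) = \<kappa> (snd B)}"
  "\<mu> \<in> fst B" "T' = {\<nu> \<in> fst B. \<nu> (snd B) = \<mu> (snd B)}" unfolding trunks_on_eq[OF B] by auto
 then show "T = T'" using eq trunk_point_eq[OF B] by simp
qed

text \<open>The terms of the other trunks are regular at the point.\<close>

lemma mero_fun_pole:
 assumes B: "B \<in> bars f g" and T0: "T0 \<in> trunks_on B" "Delta f g B T0 \<noteq> 0"
 defines "c \<equiv> trunk_point B T0"
 obtains S G where "open S" "c \<in> S" "G holomorphic_on S" "G c \<noteq> 0" "S - {c} = - (\<lambda>\<kappa>. \<kappa> (snd B)) ` fst B"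
  "\<And>z. z \<in> S \<Longrightarrow> z \<noteq> c \<Longrightarrow> mero_fun f g B z = G z / (z - c)"
proof -
 let ?p = "trunk_point B" and ?D = "\<lambda>T. complex_of_real (Delta f g B T)"
 define G where "G z = ?D T0 + (\<Sum>T\<in>trunks_on B - {T0}. ?D T * (z - c) / (z - ?p T))" for z
 define S where "S = - (?p ` (trunks_on B - {T0}))"
 show ?thesis
 proof (rule that)
  show "open S" using finite_trunks[OF B] unfolding S_def by (intro open_Compl finite_imp_closed) auto
  show "c \<in> S" using inj_onD[OF inj_trunk_point[OF B]] T0(1) unfolding S_def c_def by blast
  show "G holomorphic_on S" unfolding G_def S_def by (intro holomorphic_intros) auto
  show "G c \<noteq> 0" using T0(2) by (simp add: G_def)
  show "S - {c} = - (\<lambda>\<kappa>. \<kappa> (snd B)) ` fst B" unfolding trunk_points[OF B, symmetric] S_def c_def using T0(1) by blast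
  fix z assume z: "z \<in> S" "z \<noteq> c"
  have "mero_fun f g B z = ?D T0 / (z - c) + (\<Sum>T\<in>trunks_on B - {T0}. ?D T / (z - ?p T))"
   unfolding mero_fun_def c_def by (rule sum.remove[OF finite_trunks[OF B] T0(1)])
  also have "\<dots> = G z / (z - c)" unfolding G_def add_divide_distrib sum_divide_distrib using z by simp
  finally show "mero_fun f g B z = G z / (z - c)" .
 qed
qed

lemma mero_fun_not_zero:
 assumes B: "B \<in> bars f g" and nc: "noncollinear_bar f g B"
 obtains z where "z \<notin> (\<lambda>\<kappa>. \<kappa> (snd B)) ` fst B" "mero_fun f g B z \<noteq> 0"
proof -
 obtain T0 where T0: "T0 \<in> trunks_on B" "Delta f g B T0 \<noteq> 0"
  using nc by (auto simp: noncollinear_bar_def noncollinear_points_def)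
 define c where "c = trunk_point B T0"
 obtain S G where S: "open S" "c \<in> S" and G: "G holomorphic_on S" "G c \<noteq> 0"
  and eq: "S - {c} = - (\<lambda>\<kappa>. \<kappa> (snd B)) ` fst B" "\<And>z. z \<in> S \<Longrightarrow> z \<noteq> c \<Longrightarrow> mero_fun f g B z = G z / (z - c)"
  using mero_fun_pole[OF B T0] unfolding c_def by metis
 have "isCont G c" using G(1) S holomorphic_on_imp_continuous_on continuous_on_eq_continuous_at by blast
 then have "\<forall>\<^sub>F z in at c. G z \<noteq> 0" using G(2) unfolding isCont_def by (rule tendsto_imp_eventually_ne)
 then have "\<forall>\<^sub>F z in at c. G z \<noteq> 0 \<and> z \<in> S - {c}" using eventually_at_in_open[OF S] by (rule eventually_conj)
 then obtain z where z: "G z \<noteq> 0" "z \<in> S - {c}" using eventually_happens'[OF at_neq_bot] by blast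
 have "z \<notin> (\<lambda>\<kappa>. \<kappa> (snd B)) ` fst B" using z(2) unfolding eq(1) by blast
 then show ?thesis using that eq(2)[of z] z by auto
qed

lemma zorder_mero_fun:
 assumes B: "B \<in> bars f g" and PQ: "poly PQ a \<noteq> 0" and K: "K \<noteq> 0"
  and eq: "\<And>z. z \<notin> (\<lambda>\<kappa>. \<kappa> (snd B)) ` fst B \<Longrightarrow> poly PQ z * mero_fun f g B z = poly K z"
  and a: "a \<notin> (\<lambda>\<kappa>. \<kappa> (snd B)) ` fst B"
 shows "zero_mult f g B a = order a K"
proof -
 let ?C = "(\<lambda>\<kappa>. \<kappa> (snd B)) ` fst B"
 obtain q where q: "K = [:- a, 1:] ^ order a K * q" "\<not> [:- a, 1:] dvd q" using order_decomp[OF K] by blast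
 have qa: "poly q a \<noteq> 0" using q(2) by (simp add: poly_eq_0_iff_dvd)
 define S where "S = - (?C \<union> {z. poly PQ z = 0})"
 have "PQ \<noteq> 0" using PQ by auto
 then have "finite (?C \<union> {z. poly PQ z = 0})" using finite_bar[OF B] poly_roots_finite by auto
 then have "open S" unfolding S_def by (intro open_Compl finite_imp_closed)
 have "zorder (mero_fun f g B) a = int (order a K)"
 proof (rule zorder_eqI[OF \<open>open S\<close>, of a "\<lambda>z. poly q z / poly PQ z"])
  show "a \<in> S" using a PQ by (simp add: S_def)
  show "(\<lambda>z. poly q z / poly PQ z) holomorphic_on S" by (intro holomorphic_intros) (auto simp: S_def)
  show "poly q a / poly PQ a \<noteq> 0" using qa PQ by simp
  fix w assume w: "w \<in> S" "w \<noteq> a"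
  then have "mero_fun f g B w = poly K w / poly PQ w" using eq[of w] by (simp add: S_def field_simps)
  also have "poly K w = (w - a) ^ order a K * poly q w" by (subst q(1)) (simp add: poly_power)
  finally show "mero_fun f g B w = poly q w / poly PQ w * (w - a) powi int (order a K)" by simp
 qed
 then show ?thesis by (simp add: zero_mult_def)
qed

text \<open>
  The leading coefficient \<open>K\<close> of the Jacobian on the line is, up to constants, the product of all \<open>z -
  \<kappa>(h)\<close> over the tree roots above the bar times the rational function. It is also the product of all \<open>z -
  \<gamma>(h)\<close> over the roots \<open>\<gamma>\<close> of the Jacobian above the bar. The orders at \<open>a\<close> agree.
\<close>

theorem polar_count:
 assumes B: "B \<in> bars f g" and h: "0 < snd B" and nc: "noncollinear_bar f g B"
 shows "jacobian f g \<noteq> 0"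
  and "(\<And>\<kappa>. \<kappa> \<in> fst B \<Longrightarrow> \<kappa> (snd B) \<noteq> a) \<Longrightarrow>
   size {#\<gamma> \<in># np_roots (jacobian f g). leaves \<gamma> B a#} = zero_mult f g B a"
proof -
 let ?J = "jacobian f g" and ?h = "snd B"
 define c1 where "c1 = filter_mset (above B) (mset_set (roots f))"
 define c2 where "c2 = filter_mset (above B) (mset_set (roots g))"
 have c12: "c1 = mset_set (fst B \<inter> roots f)" "c2 = mset_set (fst B \<inter> roots g)"
 proof -
  have "{\<gamma> \<in> roots f. above B \<gamma>} = fst B \<inter> roots f" "{\<gamma> \<in> roots g. above B \<gamma>} = fst B \<inter> roots g"
   unfolding bar_members[OF B] by (auto simp: tree_roots_def)
  then show "c1 = mset_set (fst B \<inter> roots f)" "c2 = mset_set (fst B \<inter> roots g)"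
   using finite_roots by (simp_all add: c1_def c2_def)
 qed
 define Pf where "Pf = (\<Prod>\<gamma>\<in>#c1. [:- \<gamma> ?h, 1:])"
 define Pg where "Pg = (\<Prod>\<gamma>\<in>#c2. [:- \<gamma> ?h, 1:])"
 have key: "\<exists>K c. K \<noteq> 0 \<and> c \<noteq> 0 \<and> (\<forall>z. z \<notin> (\<lambda>\<kappa>. \<kappa> ?h) ` fst B \<longrightarrow> poly (smult c (Pf * Pg)) z * mero_fun f g B z = poly K z) \<and>
   (\<exists>D. lead (of_nat N * fps_X ^ (N + m) * on_bar B N m ?J) D K)"
  if N: "0 < N" "\<And>\<kappa>. \<kappa> \<in> R \<Longrightarrow> arc_denom N \<kappa>" and denB: "arc_denom N (bar_arc B)" and m: "?h = real m / real N" "0 < m" for N m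
 proof -
  note ctx = bar_arc_0[OF B] N(1) denB m
  have denf: "\<And>\<gamma>. \<gamma> \<in># mset_set (roots f) \<Longrightarrow> arc_denom N \<gamma>" and deng: "\<And>\<gamma>. \<gamma> \<in># mset_set (roots g) \<Longrightarrow> arc_denom N \<gamma>"
   using N(2) finite_roots by (auto simp: tree_roots_def)
  obtain uf where uf: "uf $ 0 $ 0 \<noteq> 0" "ramify N f = ramify N uf * fps_const (fps_X ^ (N * E1)) * root_prod N (mset_set (roots f))"
   by (rule np_factorization_ramify[OF np_fg(1) N(1) denf])
  obtain ug where ug: "ug $ 0 $ 0 \<noteq> 0" "ramify N g = ramify N ug * fps_const (fps_X ^ (N * E2)) * root_prod N (mset_set (roots g))"
   by (rule np_factorization_ramify[OF np_fg(2) N(1) deng])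
  obtain cf a where cf: "cf \<noteq> 0" "lead (on_bar B N m f) a (smult cf Pf)"
   "real a = real N * (real E1 + (\<Sum>\<gamma>\<in>#mset_set (roots f). if above B \<gamma> then ?h else rcontact (bar_arc B) \<gamma>))"
   by (rule lead_on_bar[OF ctx denf uf, folded c1_def, folded Pf_def])
  obtain cg b where cg: "cg \<noteq> 0" "lead (on_bar B N m g) b (smult cg Pg)"
   "real b = real N * (real E2 + (\<Sum>\<gamma>\<in>#mset_set (roots g). if above B \<gamma> then ?h else rcontact (bar_arc B) \<gamma>))"
   by (rule lead_on_bar[OF ctx deng ug, folded c2_def, folded Pg_def])
  obtain \<kappa> where \<kappa>: "\<kappa> \<in> fst B" using bar_nonempty[OF B] by blast
  have nuN: "real N * (real E + (\<Sum>\<gamma>\<in>#mset_set S. if above B \<gamma> then ?h else rcontact (bar_arc B) \<gamma>)) = real N * nu F B"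
   if np: "np_factorization F E (mset_set S)" and S: "S \<subseteq> R" for F E S
  proof -
   have "(if above B \<alpha> then ?h else rcontact (bar_arc B) \<alpha>) = (if \<alpha> \<in> fst B then ?h else rcontact \<kappa> \<alpha>)"
    if "\<alpha> \<in> S" for \<alpha>
   proof -
    have \<alpha>: "\<alpha> \<in> R" using that S by auto
    have "above B \<kappa>" "is_arc \<kappa>" using \<kappa> bar_members[OF B] R_arc by auto
    moreover have "above B (bar_arc B)" by (simp add: above_def)
    ultimately have "\<not> above B \<alpha> \<Longrightarrow> rcontact (bar_arc B) \<alpha> = rcontact \<kappa> \<alpha>"
     using rcontact_not_above[of \<kappa> \<alpha> B "bar_arc B"] R_arc[OF \<alpha>] by blast
    then show ?thesis using \<alpha> bar_members[OF B] by auto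
   qed
   then have "(\<Sum>\<gamma>\<in>#mset_set S. if above B \<gamma> then ?h else rcontact (bar_arc B) \<gamma>) = (\<Sum>\<alpha>\<in>S. if \<alpha> \<in> fst B then ?h else rcontact \<kappa> \<alpha>)"
    by (simp add: sum_unfold_sum_mset[symmetric] cong: sum.cong)
   then show ?thesis using np_nu[OF B h \<kappa> np S] by simp
  qed
  have ab: "real a = real N * nu f B" "real b = real N * nu g B"
   using cf(3) cg(3) nuN[OF np_fg(1)] nuN[OF np_fg(2)] by (auto simp: tree_roots_def)
  \<comment> \<open>the lowest coefficient of the Wronskian of \<open>f\<close> and \<open>g\<close>\<close>
  define K where "K = of_nat a * smult cf Pf * pderiv (smult cg Pg) - of_nat b * pderiv (smult cf Pf) * smult cg Pg"
  have eqK: "poly (smult (of_nat N * cf * cg) (Pf * Pg)) z * mero_fun f g B z = poly K z"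
   if z: "z \<notin> (\<lambda>\<kappa>. \<kappa> ?h) ` fst B" for z
  proof -
   have ne: "\<And>x. x \<in># c1 \<Longrightarrow> x ?h \<noteq> z" "\<And>x. x \<in># c2 \<Longrightarrow> x ?h \<noteq> z" using z finite_bar[OF B] by (auto simp: c12)
   have d: "poly (pderiv Pf) z = poly Pf z * (\<Sum>\<alpha>\<in>fst B \<inter> roots f. 1 / (z - \<alpha> ?h))"
    "poly (pderiv Pg) z = poly Pg z * (\<Sum>\<alpha>\<in>fst B \<inter> roots g. 1 / (z - \<alpha> ?h))"
    using pderiv_prod_linear[of c1 "\<lambda>x. x ?h" z] pderiv_prod_linear[of c2 "\<lambda>x. x ?h" z] ne
    by (simp_all add: Pf_def Pg_def c12 sum_unfold_sum_mset)
   have "of_nat a = complex_of_real (real N * nu f B)" "of_nat b = complex_of_real (real N * nu g B)" by (simp_all flip: ab)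
   then show ?thesis unfolding K_def mero_fun_roots[OF B] by (simp add: pderiv_smult of_nat_poly d algebra_simps)
  qed
  obtain z0 where z0: "z0 \<notin> (\<lambda>\<kappa>. \<kappa> ?h) ` fst B" "mero_fun f g B z0 \<noteq> 0" by (rule mero_fun_not_zero[OF B nc])
  have "poly Pf z0 \<noteq> 0" "poly Pg z0 \<noteq> 0" unfolding Pf_def Pg_def
   by (rule poly_prod_linear_neq_0; use z0(1) finite_bar[OF B] in \<open>auto simp: c12\<close>)+
  then have "poly K z0 \<noteq> 0" using eqK[OF z0(1)] z0(2) cf(1) cg(1) N(1) by auto
  then have K0: "K \<noteq> 0" by auto
  have "lead (of_nat N * fps_X ^ (N + m) * on_bar B N m ?J) (a + b) K" unfolding on_bar_jacobian[OF ctx, symmetric] lead_def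
   using wronskian_nth[OF cf(2) cg(2)] K0 by (auto simp: K_def)
  then show ?thesis using K0 eqK cf(1) cg(1) N(1) by (intro exI[of _ K] exI[of _ "of_nat N * cf * cg"]) auto
 qed
 have ex: "\<exists>N m. (\<forall>\<gamma>\<in>A. arc_denom N \<gamma>) \<and> 0 < N \<and> (\<forall>\<kappa>\<in>R. arc_denom N \<kappa>) \<and> arc_denom N (bar_arc B) \<and>
   ?h = real m / real N \<and> 0 < m" if A: "finite A" "\<And>\<gamma>. \<gamma> \<in> A \<Longrightarrow> is_arc \<gamma>" for A
 proof -
  obtain N where N: "0 < N" "\<And>\<kappa>. \<kappa> \<in> A \<union> R \<Longrightarrow> arc_denom N \<kappa>"
   using finite_arc_denom_common[of "A \<union> R"] A finite_R R_arc by blast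
  have denN: "\<And>\<kappa>. \<kappa> \<in> fst B \<Longrightarrow> arc_denom N \<kappa>" using N(2) bar_members[OF B] by blast
  obtain \<kappa> where \<kappa>: "\<kappa> \<in> fst B" using bar_nonempty[OF B] by blast
  obtain m where "?h = real m / real N" using bar_height_exponent[OF B N(1) denN] by metis
  moreover from this have "0 < m" using h by (cases m) auto
  moreover have "arc_denom N (bar_arc B)" by (rule bar_arc_denom[OF B \<kappa> denN[OF \<kappa>]])
  ultimately show ?thesis using N by blast
 qed
 show J0: "?J \<noteq> 0"
 proof
  assume J0: "?J = 0"
  obtain N m where N: "0 < N" "\<And>\<kappa>. \<kappa> \<in> R \<Longrightarrow> arc_denom N \<kappa>" "arc_denom N (bar_arc B)" "?h = real m / real N" "0 < m"
   using ex[of "{}"] by auto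
  obtain K D where "K \<noteq> 0" "lead (of_nat N * fps_X ^ (N + m) * on_bar B N m ?J) D K" using key[OF N] by blast
  moreover have "on_bar B N m ?J = 0" unfolding on_bar_def[OF bar_arc_0[OF B] N(1,3-5)] J0
   by (simp add: ramify_eq_cmap lift_germ_def ev_def fps_eq_iff)
  ultimately show False by (simp add: lead_def)
 qed
 assume a: "\<And>\<kappa>. \<kappa> \<in> fst B \<Longrightarrow> \<kappa> ?h \<noteq> a"
 obtain EJ \<Gamma> where np: "np_factorization ?J EJ \<Gamma>"
  using newton_puiseux[OF germ_convergent_jacobian[OF germ_convergent_fg] J0] by metis
 obtain N m where den: "\<And>\<gamma>. \<gamma> \<in># \<Gamma> \<Longrightarrow> arc_denom N \<gamma>"
  and N: "0 < N" "\<And>\<kappa>. \<kappa> \<in> R \<Longrightarrow> arc_denom N \<kappa>" "arc_denom N (bar_arc B)" "?h = real m / real N" "0 < m"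
  using ex[of "set_mset \<Gamma>"] np_factorization_arcs(1)[OF np] by blast
 obtain K c D where K: "K \<noteq> 0" "c \<noteq> 0"
  "\<And>z. z \<notin> (\<lambda>\<kappa>. \<kappa> ?h) ` fst B \<Longrightarrow> poly (smult c (Pf * Pg)) z * mero_fun f g B z = poly K z"
  "lead (of_nat N * fps_X ^ (N + m) * on_bar B N m ?J) D K" using key[OF N] by blast
 obtain u where u: "u $ 0 $ 0 \<noteq> 0" "ramify N ?J = ramify N u * fps_const (fps_X ^ (N * EJ)) * root_prod N \<Gamma>"
  by (rule np_factorization_ramify[OF np N(1) den])
 let ?PJ = "\<Prod>\<gamma>\<in>#filter_mset (above B) \<Gamma>. [:- \<gamma> ?h, 1:]"
 obtain cJ DJ where cJ: "cJ \<noteq> 0" "lead (on_bar B N m ?J) DJ (smult cJ ?PJ)"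
  by (rule lead_on_bar[OF bar_arc_0[OF B] N(1,3-5) den u])
 have "lead (of_nat N) 0 (of_nat N)" using N(1) by (simp add: lead_def)
 then have "lead (of_nat N * fps_X ^ (N + m) * on_bar B N m ?J) (0 + (N + m) + DJ) (of_nat N * 1 * smult cJ ?PJ)"
  by (intro lead_mult lead_X_power cJ)
 then have "K = of_nat N * 1 * smult cJ ?PJ" using lead_unique K(4) by blast
 then have "K = smult (of_nat N * cJ) ?PJ" by (simp add: of_nat_poly mult.commute)
 then have "order a K = size {#\<gamma> \<in># filter_mset (above B) \<Gamma>. \<gamma> ?h = a#}"
  using order_prod_linear(1)[of a "\<lambda>\<gamma>. \<gamma> ?h" "filter_mset (above B) \<Gamma>"] N(1) cJ(1) by (simp add: order_smult)
 also have "{#\<gamma> \<in># filter_mset (above B) \<Gamma>. \<gamma> ?h = a#} = {#\<gamma> \<in># \<Gamma>. leaves \<gamma> B a#}" unfolding filter_filter_mset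
  using np_factorization_arcs[OF np] a by (intro filter_mset_cong refl) (auto simp: leaves_iff[OF B])
 also have "\<Gamma> = np_roots ?J" using np_roots_eq[OF np] by simp
 finally have "order a K = size {#\<gamma> \<in># np_roots ?J. leaves \<gamma> B a#}" .
 moreover have "zero_mult f g B a = order a K"
 proof (rule zorder_mero_fun[OF B _ K(1) K(3)])
  have "poly Pf a \<noteq> 0" "poly Pg a \<noteq> 0" unfolding Pf_def Pg_def
   by (rule poly_prod_linear_neq_0; use a finite_bar[OF B] in \<open>auto simp: c12\<close>)+
  then show "poly (smult c (Pf * Pg)) a \<noteq> 0" using K(2) by simp
  show "a \<notin> (\<lambda>\<kappa>. \<kappa> ?h) ` fst B" using a by auto
 qed auto
 ultimately show "size {#\<gamma> \<in># np_roots ?J. leaves \<gamma> B a#} = zero_mult f g B a" by simp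
qed

end

subsection \<open>The polar factor of a class of conjugate bars\<close>

lemma int_mult_arc_prod_const:
 assumes F: "germ_convergent F" and \<Gamma>: "conj_stable \<Gamma>" and n: "0 < n"
  and arcs: "\<And>\<gamma>. \<gamma> \<in># \<Gamma> \<Longrightarrow> arc_denom n \<gamma> \<and> \<gamma> 0 = 0 \<and> fps_convergent (arc_param n \<gamma>)"
  and v: "\<And>\<gamma>. \<gamma> \<in># \<Gamma> \<Longrightarrow> arc_ev n \<gamma> F \<noteq> 0 \<and> real (subdegree (arc_ev n \<gamma> F)) = real n * v"
 shows "ereal_of_enat (int_mult F (arc_prod \<Gamma>)) = ereal (v * real (size \<Gamma>))"
proof -
 obtain s where s: "int_mult F (arc_prod \<Gamma>) = enat s"
  "n * s = (\<Sum>\<gamma>\<in>#\<Gamma>. subdegree (arc_ev n \<gamma> F))" using int_mult_arc_prod[OF F \<Gamma> n arcs] v by blast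
 have "real n * real s = real (\<Sum>\<gamma>\<in>#\<Gamma>. subdegree (arc_ev n \<gamma> F))" by (metis of_nat_mult s(2))
 also have "\<dots> = (\<Sum>\<gamma>\<in>#\<Gamma>. real (subdegree (arc_ev n \<gamma> F)))"
  by (simp add: of_nat_sum_mset image_mset.compositionality comp_def)
 also have "\<dots> = (\<Sum>\<gamma>\<in>#\<Gamma>. real n * v)" using v by (metis (mono_tags, lifting) image_mset_cong)
 also have "\<dots> = real n * (v * real (size \<Gamma>))" by simp
 finally have "real s = v * real (size \<Gamma>)" using n by simp
 then show ?thesis using s(1) by simp
qed

context mero_pair
begin

lemma zero_mult_noncollinear:
 assumes B: "B \<in> bars f g" and T0: "T0 \<in> trunks_on B" "Delta f g B T0 \<noteq> 0"
 shows "zero_mult f g B (trunk_point B T0) = 0"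
proof -
 define c where "c = trunk_point B T0"
 obtain S G where S: "open S" "c \<in> S" "G holomorphic_on S" "G c \<noteq> 0"
  and eq: "\<And>z. z \<in> S \<Longrightarrow> z \<noteq> c \<Longrightarrow> mero_fun f g B z = G z / (z - c)" using mero_fun_pole[OF B T0] unfolding c_def by metis
 have "zorder (mero_fun f g B) c = -1" by (rule zorder_eqI[OF S]) (simp add: eq field_simps)
 then show ?thesis by (simp add: zero_mult_def c_def)
qed

text \<open>
  The rational function has a pole at a non-collinear point, so zeros outside the collinear points avoid
  all trunks.
\<close>

lemma pure_zeros_eq:
 assumes B: "B \<in> bars f g"
 shows "pure_zeros f g B = {a. 0 < zero_mult f g B a \<and> (\<forall>\<kappa>\<in>fst B. \<kappa> (snd B) \<noteq> a)}"
proof -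
 have "a \<in> collinear_points f g B \<longleftrightarrow> a \<in> trunk_point B ` trunks_on B" if "0 < zero_mult f g B a" for a
  using zero_mult_noncollinear[OF B] that unfolding collinear_points_def by fastforce
 then show ?thesis unfolding pure_zeros_def trunk_points[OF B] by (auto simp: image_iff)
qed

lemma finite_class:
 assumes B: "B \<in> bars f g"
 shows "finite (range (\<lambda>k. conj_bar k B))"
proof (rule finite_subset)
 show "range (\<lambda>k. conj_bar k B) \<subseteq> Pow R \<times> {snd B}"
  using bar_subset[OF conj_bar_in_bars[OF B]] by (force intro!: image_subsetI simp: conj_bar_def)
 show "finite (Pow R \<times> {snd B})" using finite_R by simp
qed

lemma conj_bar_add: "conj_bar j (conj_bar k B) = conj_bar (j + k) B"
 by (simp add: conj_bar_def image_image conj_arc_conj_arc)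

lemma class_range:
 assumes B: "B \<in> bars f g"
 shows "range (\<lambda>k. conj_bar k (conj_bar l B)) = range (\<lambda>k. conj_bar k B)"
proof -
 obtain n where n: "0 < n" "\<And>\<kappa>. \<kappa> \<in> fst B \<Longrightarrow> arc_denom n \<kappa>" using bar_denom[OF B] by metis
 have "conj_arc (n * l) ` fst B = id ` fst B" using n(2) conj_arc_fix[of n _ "n * l"] by (intro image_cong) auto
 then have "conj_bar (n * l) B = B" by (simp add: conj_bar_def prod_eq_iff)
 moreover have "n * l = (n * l - l) + l" using n(1) by simp
 ultimately have inv: "conj_bar (n * l - l) (conj_bar l B) = B" by (metis conj_bar_add)
 show ?thesis
 proof (intro subset_antisym image_subsetI)
  fix k
  show "conj_bar k (conj_bar l B) \<in> range (\<lambda>k. conj_bar k B)" by (simp add: conj_bar_add)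
  have "conj_bar k B = conj_bar (k + (n * l - l)) (conj_bar l B)" by (metis conj_bar_add inv)
  then show "conj_bar k B \<in> range (\<lambda>k. conj_bar k (conj_bar l B))" by blast
 qed
qed

context
 fixes B \<BB> assumes B: "B \<in> bars f g" and \<BB>: "\<BB> = range (\<lambda>k. conj_bar k B)"
  and h: "0 < snd B" and nc: "noncollinear_class f g \<BB>"
begin

lemma class_bars: "C \<in> \<BB> \<Longrightarrow> C \<in> bars f g" and class_height: "C \<in> \<BB> \<Longrightarrow> snd C = snd B"
 and class_noncollinear: "C \<in> \<BB> \<Longrightarrow> noncollinear_bar f g C"
 and class_nu: "C \<in> \<BB> \<Longrightarrow> nu f C = nu f B" "C \<in> \<BB> \<Longrightarrow> nu g C = nu g B"
 using conj_bar_in_bars[OF B] nc nu_conj[OF B h] by (auto simp: \<BB> noncollinear_class_def)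

lemma self_in_class: "B \<in> \<BB>"
proof -
 have "conj_bar 0 B = B" by (simp add: conj_bar_def prod_eq_iff)
 then show ?thesis unfolding \<BB> by (metis rangeI)
qed

lemma conj_in_class: "C \<in> \<BB> \<Longrightarrow> conj_bar k C \<in> \<BB>" by (auto simp: \<BB> conj_bar_add)

lemma nu_class_eq: "nu_class f \<BB> = nu f B" "nu_class g \<BB> = nu g B"
proof -
 show "nu_class f \<BB> = nu f B" unfolding nu_class_def
 proof (rule the_equality)
  show "\<forall>C\<in>\<BB>. nu f C = nu f B" using class_nu(1) by blast
 qed (metis self_in_class)
 show "nu_class g \<BB> = nu g B" unfolding nu_class_def
 proof (rule the_equality)
  show "\<forall>C\<in>\<BB>. nu g C = nu g B" using class_nu(2) by blast
 qed (metis self_in_class)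
qed

lemma jacobian_nonzero: "jacobian f g \<noteq> 0" by (rule polar_count(1)[OF B h class_noncollinear[OF self_in_class]])

lemma class_polar_eq:
 "class_polar_roots f g \<BB> = {#\<gamma> \<in># np_roots (jacobian f g). \<exists>C\<in>\<BB>. \<exists>a. leaves \<gamma> C a#}"
 unfolding class_polar_roots_def polar_roots_def filter_filter_mset
 using order_leaving(1,2)[OF class_bars] class_height h by (intro filter_mset_cong refl) metis

lemma class_polar_leaves:
 assumes "\<gamma> \<in># class_polar_roots f g \<BB>"
 obtains C a where "C \<in> \<BB>" "leaves \<gamma> C a" "truncation f g \<gamma> = bar_arc_at C a"
 using assms truncation_eq[OF class_bars] unfolding class_polar_eq by auto

lemma polar_np:
 obtains E n where "np_factorization (jacobian f g) E (np_roots (jacobian f g))" "0 < n"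
  "\<And>\<gamma>. \<gamma> \<in># np_roots (jacobian f g) \<Longrightarrow> arc_denom n \<gamma> \<and> fps_convergent (arc_param n \<gamma>)"
 using newton_puiseux[OF germ_convergent_jacobian[OF germ_convergent_fg] jacobian_nonzero] np_roots_eq by metis

lemma filter_image_inj:
 assumes "\<And>x. x \<in># M \<Longrightarrow> P (F x) = P x"
 shows "image_mset F (filter_mset P M) = filter_mset P (image_mset F M)" using assms by (induction M) auto

lemma class_polar_stable: "conj_stable (class_polar_roots f g \<BB>)"
proof -
 obtain E n where np: "np_factorization (jacobian f g) E (np_roots (jacobian f g))" using polar_np by metis
 have leav: "leaves (conj_arc 1 \<gamma>) (conj_bar 1 C) (cis (2 * pi * real 1 * snd C) * a)" if "C \<in> \<BB>" "leaves \<gamma> C a" for \<gamma> C a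
  using that leaves_conj[OF class_bars[OF that(1)], of 1] by blast
 have "(\<exists>C\<in>\<BB>. \<exists>a. leaves (conj_arc 1 \<gamma>) C a) \<longleftrightarrow> (\<exists>C\<in>\<BB>. \<exists>a. leaves \<gamma> C a)"
  if "\<gamma> \<in># np_roots (jacobian f g)" for \<gamma>
 proof
  assume "\<exists>C\<in>\<BB>. \<exists>a. leaves \<gamma> C a"
  then show "\<exists>C\<in>\<BB>. \<exists>a. leaves (conj_arc 1 \<gamma>) C a" using leav conj_in_class by blast
 next
  assume "\<exists>C\<in>\<BB>. \<exists>a. leaves (conj_arc 1 \<gamma>) C a"
  then obtain C a where C: "C \<in> \<BB>" "leaves (conj_arc 1 \<gamma>) C a" by blast
  have "is_arc \<gamma>" using np_factorization_arcs[OF np that] by blast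
  then obtain d where d: "arc_denom d \<gamma>" by (auto simp: is_arc_def)
  have "conj_arc (d - 1) (conj_arc 1 \<gamma>) = \<gamma>"
   using conj_arc_fix[OF d, of d] arc_denom_pos[OF d] by (simp add: conj_arc_conj_arc)
  then have "leaves \<gamma> (conj_bar (d - 1) C) (cis (2 * pi * real (d - 1) * snd C) * a)"
   using leaves_conj[OF class_bars[OF C(1)], of "d - 1" "conj_arc 1 \<gamma>" a] C(2) by metis
  then show "\<exists>C\<in>\<BB>. \<exists>a. leaves \<gamma> C a" using conj_in_class[OF C(1)] by blast
 qed
 then have "image_mset (conj_arc 1) (class_polar_roots f g \<BB>) =
   {#\<gamma> \<in># image_mset (conj_arc 1) (np_roots (jacobian f g)). \<exists>C\<in>\<BB>. \<exists>a. leaves \<gamma> C a#}"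
  unfolding class_polar_eq using filter_image_inj[where P = "\<lambda>\<gamma>. \<exists>C\<in>\<BB>. \<exists>a. leaves \<gamma> C a" and F = "conj_arc 1"] by blast
 also have "image_mset (conj_arc 1) (np_roots (jacobian f g)) = np_roots (jacobian f g)"
  using conj_stable_np[OF np] by (simp add: conj_stable_def)
 finally show ?thesis unfolding conj_stable_def class_polar_eq .
qed

abbreviation "truncated \<equiv> image_mset (truncation f g) (class_polar_roots f g \<BB>)"

lemma truncated_stable: "conj_stable truncated"
proof -
 have "conj_arc 1 (truncation f g \<gamma>) = truncation f g (conj_arc 1 \<gamma>)" if \<gamma>: "\<gamma> \<in># class_polar_roots f g \<BB>" for \<gamma>
 proof -
  obtain C a where C: "C \<in> \<BB>" "leaves \<gamma> C a" "truncation f g \<gamma> = bar_arc_at C a" by (rule class_polar_leaves[OF \<gamma>])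
  have "truncation f g (conj_arc 1 \<gamma>) = bar_arc_at (conj_bar 1 C) (cis (2 * pi * real 1 * snd C) * a)"
   using C(2) leaves_conj[OF class_bars[OF C(1)], of 1]
   by (intro truncation_eq[OF conj_bar_in_bars[OF class_bars[OF C(1)]]]) blast
  then show ?thesis using bar_arc_at_conj[OF class_bars[OF C(1)], of 1 a] C(3) by simp
 qed
 then have "image_mset (conj_arc 1) truncated = image_mset (truncation f g) (image_mset (conj_arc 1) (class_polar_roots f g \<BB>))"
  unfolding image_mset.compositionality by (intro image_mset_cong) simp
 then show ?thesis using class_polar_stable by (simp add: conj_stable_def)
qed

lemma truncated_set: "\<zeta> \<in># truncated \<Longrightarrow> \<exists>C\<in>\<BB>. \<exists>a. \<zeta> = bar_arc_at C a \<and> (\<forall>\<kappa>\<in>fst C. \<kappa> (snd C) \<noteq> a)"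
proof -
 assume "\<zeta> \<in># truncated"
 then obtain \<gamma> where \<gamma>: "\<gamma> \<in># class_polar_roots f g \<BB>" "\<zeta> = truncation f g \<gamma>" by auto
 obtain C a where "C \<in> \<BB>" "leaves \<gamma> C a" "truncation f g \<gamma> = bar_arc_at C a" by (rule class_polar_leaves[OF \<gamma>(1)])
 then show ?thesis using \<gamma>(2) leaves_iff[OF class_bars] by blast
qed

text \<open>
  The arc \<open>\<lambda>\<^sub>C + a y\<^sup>h\<close> determines \<open>C\<close> and \<open>a\<close>, so its multiplicity is the number of polar roots leaving
  \<open>C\<close> at \<open>a\<close>.
\<close>

lemma count_truncated:
 assumes C: "C \<in> \<BB>" and a: "\<forall>\<kappa>\<in>fst C. \<kappa> (snd C) \<noteq> a"
 shows "count truncated (bar_arc_at C a) = zero_mult f g C a"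
proof -
 have "truncation f g \<gamma> = bar_arc_at C a \<longleftrightarrow> leaves \<gamma> C a" if \<gamma>: "\<gamma> \<in># class_polar_roots f g \<BB>" for \<gamma>
 proof
  assume eq: "truncation f g \<gamma> = bar_arc_at C a"
  obtain D b where D: "D \<in> \<BB>" "leaves \<gamma> D b" "truncation f g \<gamma> = bar_arc_at D b" by (rule class_polar_leaves[OF \<gamma>])
  have "snd D = snd C" "bar_arc_at D b = bar_arc_at C a" using D(3) eq class_height[OF D(1)] class_height[OF C] by simp_all
  note DC = bar_arc_at_inj[OF class_bars[OF D(1)] class_bars[OF C] this]
  have "D = C" "b = a" by (fact DC)+
  then show "leaves \<gamma> C a" using D by simp
 qed (rule truncation_eq[OF class_bars[OF C]])
 then have "count truncated (bar_arc_at C a) = size {#\<gamma> \<in># class_polar_roots f g \<BB>. leaves \<gamma> C a#}"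
  by (simp add: count_conv_size_mset filter_mset_image_mset eq_commute cong: filter_mset_cong)
 also have "{#\<gamma> \<in># class_polar_roots f g \<BB>. leaves \<gamma> C a#} = {#\<gamma> \<in># np_roots (jacobian f g). leaves \<gamma> C a#}"
  unfolding class_polar_eq filter_filter_mset using C by (intro filter_mset_cong) auto
 also have "size \<dots> = zero_mult f g C a"
  using a class_height[OF C] h by (intro polar_count(2)[OF class_bars[OF C] _ class_noncollinear[OF C]]) auto
 finally show ?thesis .
qed

lemma set_truncated: "set_mset truncated = (\<lambda>(C, a). bar_arc_at C a) ` Sigma \<BB> (pure_zeros f g)"
proof (intro subset_antisym subsetI)
 fix \<zeta> assume \<zeta>: "\<zeta> \<in># truncated"
 then obtain C a where C: "C \<in> \<BB>" "\<zeta> = bar_arc_at C a" "\<forall>\<kappa>\<in>fst C. \<kappa> (snd C) \<noteq> a" using truncated_set by blast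
 then have "0 < zero_mult f g C a" using \<zeta> count_truncated by (metis count_greater_zero_iff)
 then have "(C, a) \<in> Sigma \<BB> (pure_zeros f g)" using C pure_zeros_eq[OF class_bars] by simp
 then show "\<zeta> \<in> (\<lambda>(C, a). bar_arc_at C a) ` Sigma \<BB> (pure_zeros f g)" using C(2) by (intro rev_image_eqI) auto
next
 fix \<zeta> assume "\<zeta> \<in> (\<lambda>(C, a). bar_arc_at C a) ` Sigma \<BB> (pure_zeros f g)"
 then obtain p where p: "p \<in> Sigma \<BB> (pure_zeros f g)" "\<zeta> = (case p of (C, a) \<Rightarrow> bar_arc_at C a)" by (rule imageE) blast
 obtain C a where pp: "p = (C, a)" by (cases p)
 have C: "C \<in> \<BB>" "a \<in> pure_zeros f g C" "\<zeta> = bar_arc_at C a" using p unfolding pp by auto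
 then have "0 < zero_mult f g C a" "\<forall>\<kappa>\<in>fst C. \<kappa> (snd C) \<noteq> a" using pure_zeros_eq[OF class_bars[OF C(1)]] by auto
 then show "\<zeta> \<in># truncated" using count_truncated[OF C(1)] C(3) by (metis count_greater_zero_iff)
qed

lemma inj_bar_arc_at: "inj_on (\<lambda>(C, a). bar_arc_at C a) (Sigma \<BB> A)"
proof (rule inj_onI)
 fix p q assume *: "p \<in> Sigma \<BB> A" "q \<in> Sigma \<BB> A" "(case p of (C, a) \<Rightarrow> bar_arc_at C a) = (case q of (C, a) \<Rightarrow> bar_arc_at C a)"
 obtain C a D b where pq: "p = (C, a)" "q = (D, b)" by (cases p, cases q)
 have CD: "C \<in> \<BB>" "D \<in> \<BB>" "bar_arc_at C a = bar_arc_at D b" using * unfolding pq by auto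
 then show "p = q" unfolding pq using bar_arc_at_inj[OF class_bars class_bars] class_height by auto
qed

lemma finite_pure_zeros:
 assumes C: "C \<in> \<BB>"
 shows "finite (pure_zeros f g C)"
proof -
 have "finite ((\<lambda>(C, a). bar_arc_at C a) ` Sigma \<BB> (pure_zeros f g))" unfolding set_truncated[symmetric] by simp
 then have "finite (Sigma \<BB> (pure_zeros f g))" by (rule finite_imageD[OF _ inj_bar_arc_at])
 moreover have "pure_zeros f g C \<subseteq> snd ` Sigma \<BB> (pure_zeros f g)" using C by force
 ultimately show ?thesis using finite_surj by blast
qed

lemma size_class_polar: "size (class_polar_roots f g \<BB>) = mero_mult_class f g \<BB>"
proof -
 have "size (class_polar_roots f g \<BB>) = size truncated" by simp
 also have "\<dots> = (\<Sum>\<zeta>\<in>set_mset truncated. count truncated \<zeta>)" by (rule size_multiset_overloaded_eq)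
 also have "\<dots> = (\<Sum>p\<in>Sigma \<BB> (pure_zeros f g). count truncated (case p of (C, a) \<Rightarrow> bar_arc_at C a))"
  unfolding set_truncated sum.reindex[OF inj_bar_arc_at] by (simp add: comp_def)
 also have "\<dots> = (\<Sum>(C, a)\<in>Sigma \<BB> (pure_zeros f g). zero_mult f g C a)"
  using count_truncated pure_zeros_eq[OF class_bars] by (intro sum.cong refl) auto
 also have "\<dots> = (\<Sum>C\<in>\<BB>. \<Sum>a\<in>pure_zeros f g C. zero_mult f g C a)"
  using finite_class[OF B] finite_pure_zeros by (intro sum.Sigma[symmetric]) (auto simp: \<BB>)
 finally show ?thesis by (simp add: mero_mult_class_def mero_mult_def)
qed

lemma truncated_convergent:
 obtains n where "0 < n" "\<And>\<zeta>. \<zeta> \<in># truncated \<Longrightarrow> arc_denom n \<zeta> \<and> \<zeta> 0 = 0 \<and> fps_convergent (arc_param n \<zeta>)"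
proof -
 have arc: "is_arc \<zeta>" if "\<zeta> \<in># truncated" for \<zeta> using truncated_set[OF that] is_arc_bar_arc_at[OF class_bars] by blast
 obtain n where n: "0 < n" "\<And>\<zeta>. \<zeta> \<in># truncated \<Longrightarrow> arc_denom n \<zeta>" using mset_arc_denom[OF arc] by metis
 have "\<zeta> 0 = 0 \<and> fps_convergent (arc_param n \<zeta>)" if "\<zeta> \<in># truncated" for \<zeta>
  using truncated_set[OF that] bar_arc_at_convergent[OF class_bars n(1)] bar_arc_at_0[OF class_bars] class_height h by metis
 then show ?thesis using that n by blast
qed

lemma int_mult_class:
 assumes Fv: "(F, v) \<in> {(f, nu f B), (g, nu g B), (f * g, nu f B + nu g B)}"
  and \<Gamma>: "conj_stable \<Gamma>" and sz: "size \<Gamma> = mero_mult_class f g \<BB>" and n: "0 < n"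
  and arcs: "\<And>\<gamma>. \<gamma> \<in># \<Gamma> \<Longrightarrow> arc_denom n \<gamma> \<and> fps_convergent (arc_param n \<gamma>) \<and> (\<exists>C\<in>\<BB>. \<exists>a. leaves \<gamma> C a)"
 shows "ereal_of_enat (int_mult F (arc_prod \<Gamma>)) = ereal (v * real (mero_mult_class f g \<BB>))" unfolding sz[symmetric]
proof (rule int_mult_arc_prod_const[OF _ \<Gamma> n])
 show "germ_convergent F" using Fv germ_convergent_fg by (auto intro: germ_convergent_mult)
 fix \<xi> assume "\<xi> \<in># \<Gamma>"
 then obtain C a where \<xi>: "C \<in> \<BB>" "leaves \<xi> C a" "arc_denom n \<xi>" "fps_convergent (arc_param n \<xi>)" using arcs by blast
 have C: "C \<in> bars f g" "0 < snd C" using \<xi>(1) class_bars class_height h by auto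
 show arc: "arc_denom n \<xi> \<and> \<xi> 0 = 0 \<and> fps_convergent (arc_param n \<xi>)" using above_0[OF C] \<xi> leaves_iff[OF C(1)] by blast
 have 1: "arc_ev n \<xi> f \<noteq> 0 \<and> real (subdegree (arc_ev n \<xi> f)) = real n * nu f B"
  "arc_ev n \<xi> g \<noteq> 0 \<and> real (subdegree (arc_ev n \<xi> g)) = real n * nu g B"
  using order_leaving(3,4)[OF C \<xi>(2,3)] class_nu \<xi>(1) by auto
 then have "arc_ev n \<xi> (f * g) \<noteq> 0 \<and> real (subdegree (arc_ev n \<xi> (f * g))) = real n * (nu f B + nu g B)"
  using arc arc_ev_mult[OF n] by (simp add: algebra_simps)
 then show "arc_ev n \<xi> F \<noteq> 0 \<and> real (subdegree (arc_ev n \<xi> F)) = real n * v" using Fv 1 by blast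
qed

lemma int_mult_factors:
 assumes Fv: "(F, v) \<in> {(f, nu f B), (g, nu g B), (f * g, nu f B + nu g B)}"
 shows "ereal_of_enat (int_mult F (polar_factor f g \<BB>)) = ereal (v * real (mero_mult_class f g \<BB>))"
  and "ereal_of_enat (int_mult F (truncated_factor f g \<BB>)) = ereal (v * real (mero_mult_class f g \<BB>))"
proof -
 obtain E n where n: "0 < n" "\<And>\<gamma>. \<gamma> \<in># np_roots (jacobian f g) \<Longrightarrow> arc_denom n \<gamma> \<and> fps_convergent (arc_param n \<gamma>)"
  using polar_np by metis
 show "ereal_of_enat (int_mult F (polar_factor f g \<BB>)) = ereal (v * real (mero_mult_class f g \<BB>))"
  unfolding polar_factor_def
  by (rule int_mult_class[OF Fv class_polar_stable size_class_polar n(1)]) (use n(2) in \<open>auto simp: class_polar_eq\<close>)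
 obtain n where n: "0 < n" "\<And>\<zeta>. \<zeta> \<in># truncated \<Longrightarrow> arc_denom n \<zeta> \<and> \<zeta> 0 = 0 \<and> fps_convergent (arc_param n \<zeta>)"
  using truncated_convergent by metis
 have "\<And>\<gamma>. \<gamma> \<in># truncated \<Longrightarrow> arc_denom n \<gamma> \<and> fps_convergent (arc_param n \<gamma>) \<and> (\<exists>C\<in>\<BB>. \<exists>a. leaves \<gamma> C a)"
  using n(2) truncated_set leaves_bar_arc_at[OF class_bars] by blast
 then show "ereal_of_enat (int_mult F (truncated_factor f g \<BB>)) = ereal (v * real (mero_mult_class f g \<BB>))"
  unfolding truncated_factor_def using size_class_polar by (intro int_mult_class[OF Fv truncated_stable _ n(1)]) simp_all
qed

end

end

subsection \<open>The ground bar\<close>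

lemma eventually_nonzero_series:
 assumes F: "germ_convergent F" and k: "F $ i0 $ k \<noteq> 0"
 shows "\<forall>\<^sub>F z in at 0. (\<Sum>i. F $ i $ k * z ^ i) \<noteq> 0"
proof -
 define c where "c = Abs_fps (\<lambda>i. F $ i $ k)"
 obtain r where r: "r > 0" "(\<lambda>(i, j). norm (F $ i $ j) * r ^ i * r ^ j) summable_on UNIV"
  using F by (auto simp: germ_convergent_def)
 have "(\<lambda>(i, j). norm (F $ i $ j) * r ^ i * r ^ j) summable_on range (\<lambda>i. (i, k))"
  by (rule summable_on_subset_banach[OF r(2)]) simp
 then have "(\<lambda>i. norm (F $ i $ k) * r ^ i * r ^ k) summable_on UNIV"
  by (subst (asm) summable_on_reindex) (auto simp: inj_on_def comp_def)
 then have "summable (\<lambda>i. norm (F $ i $ k) * r ^ i * r ^ k)"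
  using r(1) by (subst (asm) summable_on_UNIV_nonneg_real_iff) auto
 then have "summable (\<lambda>i. norm (F $ i $ k) * r ^ i * r ^ k / r ^ k)" by (rule summable_divide)
 then have "summable (\<lambda>i. norm (F $ i $ k * of_real r ^ i))" using r(1) by (simp add: norm_mult norm_power)
 then have "ereal (norm (complex_of_real r)) \<le> conv_radius (fps_nth c)"
  by (intro conv_radius_geI) (simp add: c_def summable_norm_cancel)
 then have "0 < fps_conv_radius c" using r(1) unfolding fps_conv_radius_def
  by (metis abs_of_pos ereal_less(2) less_le_trans norm_of_real)
 then have "eval_fps c has_laurent_expansion fps_to_fls c"
  by (intro has_laurent_expansion_fps) (simp add: has_fps_expansion_def)
 moreover have "fps_to_fls c \<noteq> 0" using k by (auto simp: c_def fps_eq_iff)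
 ultimately have "\<forall>\<^sub>F z in at 0. eval_fps c z \<noteq> 0" using has_laurent_expansion_nonzero_imp_eventually_nonzero by blast
 then show ?thesis by (simp add: eval_fps_def c_def)
qed

lemma subst_const:
 assumes F: "\<And>i k. k < E \<Longrightarrow> F $ i $ k = 0" and ne: "(\<Sum>i. F $ i $ E * z ^ i) \<noteq> 0"
 shows "arc_order (subst_arc F ((\<lambda>_. 0)(0 := z))) = ereal (real E)"
proof -
 let ?\<xi> = "(\<lambda>_. 0)(0 := z) :: arc"
 have den: "arc_denom 1 ?\<xi>" by (auto simp: arc_denom_def intro: exI[of _ 0])
 then have d: "arc_den ?\<xi> = 1" unfolding arc_den_def by (intro Least_equality) (auto simp: arc_denom_def)
 have p: "arc_param 1 ?\<xi> = fps_const z" by (simp add: fps_eq_iff arc_param_def)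
 let ?\<phi> = "Abs_fps (\<lambda>k. \<Sum>i. F $ i $ k * z ^ i)"
 have s: "subst_arc F ?\<xi> = arc_of_param 1 ?\<phi>"
  unfolding subst_arc_def d Let_def p by (simp add: fps_const_power fps_mult_right_const_nth)
 have "?\<phi> \<noteq> 0" using ne by (auto simp: fps_eq_iff)
 moreover have "subdegree ?\<phi> = E" using F ne by (intro subdegreeI) auto
 ultimately show ?thesis unfolding s by (subst arc_order_of_param) auto
qed

context mero_pair
begin

lemma ground_arc_at: "bar_arc_at (R, 0) z = (\<lambda>_. 0)(0 := z)"
proof -
 have B: "(R, 0) \<in> bars f g" by (rule bars.ground)
 have "bar_arc (R, 0) e = 0" for e using is_arc_nonneg[OF bar_arc_arc[OF B], of e] bar_arc_ge[of "(R, 0)" e] by fastforce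
 then show ?thesis by (auto simp: bar_arc_at_def fun_eq_iff)
qed

text \<open>
  For the ground bar the arcs are the constants \<open>z\<close>, which do not pass through the origin. Small \<open>z \<noteq> 0\<close>
 are not zeros of the coefficient of \<open>y\<^sup>E\<close>, a convergent series in \<open>z\<close>.
\<close>

lemma nu_ground:
 assumes "germ_convergent F" and np: "np_factorization F E \<Gamma>"
 shows "nu F (R, 0) = real E"
proof -
 have ev: "\<forall>\<^sub>F z in at 0. arc_order (subst_arc F (bar_arc_at (R, 0) z)) = ereal (real E)"
  using eventually_nonzero_series[OF assms(1) np_lowest_coeff(3)[OF np]]
 proof eventually_elim
  case (elim z)
  show ?case unfolding ground_arc_at by (rule subst_const[OF np_lowest_coeff(1)[OF np] elim])
 qed
 show ?thesis unfolding nu_def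
 proof (rule the_equality)
  show "\<forall>\<^sub>F z in at 0. arc_order (subst_arc F (bar_arc_at (R, 0) z)) = ereal (real E)" by (rule ev)
 next
  fix v assume "\<forall>\<^sub>F z in at 0. arc_order (subst_arc F (bar_arc_at (R, 0) z)) = ereal v"
  with ev have "\<forall>\<^sub>F z in at (0 :: complex). v = real E" by eventually_elim auto
  then show "v = real E" by simp
 qed
qed

lemma roots_at_0: "(\<lambda>\<kappa>. \<kappa> 0) ` R = {0}"
proof -
 have "(\<lambda>\<kappa>. \<kappa> 0) ` R = (\<lambda>\<kappa>. 0) ` R" by (rule image_cong) (simp_all add: R_0)
 also have "\<dots> = {0}" using R_nonempty by (simp add: image_constant_conv)
 finally show ?thesis .
qed

lemma ground_trunks: "trunks_on (R, 0) = {R}"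
proof -
 have "{\<mu> \<in> R. \<mu> 0 = 0} = R" using R_0 by blast
 then show ?thesis unfolding trunks_on_eq[OF bars.ground] by (simp add: roots_at_0)
qed

lemma ground_Delta: "Delta f g (R, 0) R = real E1 * real (card (roots g)) - real E2 * real (card (roots f))"
proof -
 have "R \<inter> roots g = roots g" "R \<inter> roots f = roots f" by (auto simp: tree_roots_def)
 then show ?thesis
  unfolding Delta_def using nu_ground[OF germ_convergent_fg(1) np_fg(1)] nu_ground[OF germ_convergent_fg(2) np_fg(2)] by simp
qed

text \<open>Any other two exponents with sum \<open>(p + q, E + E')\<close> meet a vanishing coefficient.\<close>

lemma mult_lowest:
 fixes A B :: germ
 assumes A: "\<And>i k. k < E \<Longrightarrow> A $ i $ k = 0" "\<And>i. i < p \<Longrightarrow> A $ i $ E = 0"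
  and B: "\<And>i k. k < E' \<Longrightarrow> B $ i $ k = 0" "\<And>i. i < q \<Longrightarrow> B $ i $ E' = 0"
 shows "(A * B) $ (p + q) $ (E + E') = A $ p $ E * B $ q $ E'"
proof -
 have "(A * B) $ (p + q) $ (E + E') = (\<Sum>i=0..p + q. \<Sum>k=0..E + E'. A $ i $ k * B $ (p + q - i) $ (E + E' - k))"
  by (simp add: fps_mult_nth fps_sum_nth)
 also have "\<dots> = (\<Sum>i=0..p + q. \<Sum>k=0..E + E'. if k = E then if i = p then A $ p $ E * B $ q $ E' else 0 else 0)"
 proof (intro sum.cong refl)
  fix i k assume "i \<in> {0..p + q}" "k \<in> {0..E + E'}"
  then consider "k < E" | "E + E' - k < E'" | "k = E" "i < p" | "k = E" "p + q - i < q" | "k = E" "i = p" by fastforce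
  then show "A $ i $ k * B $ (p + q - i) $ (E + E' - k) = (if k = E then if i = p then A $ p $ E * B $ q $ E' else 0 else 0)"
   using A B by cases auto
 qed
 finally show ?thesis by simp
qed

text \<open>
  With \<open>c x\<^sup>p y\<^bsup>E1\<^esup>\<close> and \<open>d x\<^sup>q y\<^bsup>E2\<^esup>\<close> the lowest terms of \<open>f\<close> and \<open>g\<close>, that of \<open>x y J\<close> is
  \<open>(E1 q - E2 p) c d x\<^sup>p\<^sup>+\<^sup>q y\<^bsup>E1 + E2\<^esup>\<close>.
\<close>

lemma ground_jacobian_nonzero:
 assumes ne: "E1 * card (roots g) \<noteq> E2 * card (roots f)"
 shows "jacobian f g \<noteq> 0"
proof
 let ?p = "card (roots f)" and ?q = "card (roots g)"
 have X: "(fps_X * deriv_x F) $ i $ k = of_nat i * F $ i $ k"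
  and Y: "(germ_y * deriv_y F) $ i $ k = of_nat k * F $ i $ k" for F i k
  by (cases i; simp add: deriv_x_def flip: fps_of_nat) (cases k; simp add: deriv_y_def germ_y_mult_nth)
 note low = np_lowest_coeff[OF np_fg(1)] np_lowest_coeff[OF np_fg(2)]
 assume "jacobian f g = 0"
 then have J: "(germ_y * deriv_y f) * (fps_X * deriv_x g) = (fps_X * deriv_x f) * (germ_y * deriv_y g)"
  by (simp add: jacobian_def mult_ac)
 have "of_nat E1 * f $ ?p $ E1 * (of_nat ?q * g $ ?q $ E2) =
   ((germ_y * deriv_y f) * (fps_X * deriv_x g)) $ (?p + ?q) $ (E1 + E2)"
  by (subst mult_lowest) (simp_all only: X Y, simp_all add: low)
 also have "\<dots> = of_nat ?p * f $ ?p $ E1 * (of_nat E2 * g $ ?q $ E2)"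
  unfolding J by (subst mult_lowest) (simp_all only: X Y, simp_all add: low)
 finally have "of_nat (E1 * ?q) = (of_nat (E2 * ?p) :: complex)" using low(3,6) by (simp add: mult_ac)
 then show False using ne by (simp only: of_nat_eq_iff)
qed

context
 assumes nc: "noncollinear_bar f g (R, 0)"
begin

lemma ground_Delta_ne: "Delta f g (R, 0) R \<noteq> 0"
 using nc by (auto simp: noncollinear_bar_def noncollinear_points_def ground_trunks)

text \<open>
  Polar roots have positive order, so they climb over the ground bar at \<open>0\<close>, where the main trunk grows.
\<close>

lemma ground_class_polar: "class_polar_roots f g {(R, 0)} = {#}"
proof -
 have "real (E1 * card (roots g)) \<noteq> real (E2 * card (roots f))" using ground_Delta_ne unfolding ground_Delta by simp
 then have J: "jacobian f g \<noteq> 0" using ground_jacobian_nonzero by (metis of_nat_eq_iff)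
 obtain E \<Gamma> where np: "np_factorization (jacobian f g) E \<Gamma>"
  using newton_puiseux[OF germ_convergent_jacobian[OF germ_convergent_fg] J] by metis
 have "\<not> leaves \<gamma> (R, 0) a" if \<gamma>: "\<gamma> \<in># np_roots (jacobian f g)" for \<gamma> a
 proof
  assume "leaves \<gamma> (R, 0) a"
  then have "\<gamma> 0 \<notin> (\<lambda>\<kappa>. \<kappa> 0) ` R" unfolding leaves_iff[OF bars.ground] by fastforce
  then show False using np_factorization_arcs(2)[OF np] \<gamma> np_roots_eq[OF np] roots_at_0 by simp
 qed
 then show ?thesis unfolding class_polar_roots_def polar_roots_def by (auto simp: filter_mset_eq_conv)
qed

lemma ground_mero_mult: "mero_mult_class f g {(R, 0)} = 0"
proof -
 have "zero_mult f g (R, 0) a = 0" if a: "a \<noteq> 0" for a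
 proof -
  have tp: "trunk_point (R, 0) R = 0"
  proof -
   have "trunk_point (R, 0) ` {R} = (\<lambda>\<kappa>. \<kappa> 0) ` R" using trunk_points[OF bars.ground] by (simp add: ground_trunks)
   then show ?thesis unfolding roots_at_0 by simp
  qed
  have "zorder (mero_fun f g (R, 0)) a = 0"
  proof (rule zorder_eqI[of "- {0}" a "mero_fun f g (R, 0)"])
   show "mero_fun f g (R, 0) holomorphic_on - {0}"
    unfolding mero_fun_def ground_trunks by (auto simp: tp intro!: holomorphic_intros)
   show "mero_fun f g (R, 0) a \<noteq> 0" using ground_Delta_ne a by (simp add: mero_fun_def ground_trunks tp)
  qed (use a in auto)
  then show ?thesis by (simp add: zero_mult_def)
 qed
 moreover have "\<not> (\<forall>\<kappa>\<in>R. \<kappa> 0 \<noteq> 0)" using roots_at_0 by blast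
 ultimately have "\<not> (0 < zero_mult f g (R, 0) a \<and> (\<forall>\<kappa>\<in>R. \<kappa> 0 \<noteq> a))" for a by (cases "a = 0") simp_all
 then have "pure_zeros f g (R, 0) = {}" unfolding pure_zeros_eq[OF bars.ground] by simp
 then show ?thesis by (simp add: mero_mult_class_def mero_mult_def)
qed

lemma ground_factors:
 "polar_factor f g {(R, 0)} = 1" "truncated_factor f g {(R, 0)} = 1"
 by (simp_all add: polar_factor_def truncated_factor_def ground_class_polar)

end

lemma int_mult_1: "germ_convergent F \<Longrightarrow> int_mult F 1 = 0"
proof -
 assume F: "germ_convergent F"
 obtain s where "int_mult F (arc_prod {#}) = enat s" "1 * s = (\<Sum>\<gamma>\<in>#{#}. subdegree (arc_ev 1 \<gamma> F))"
  by (rule int_mult_arc_prod[OF F, of "{#}" 1]) (auto simp: conj_stable_def)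
 then show ?thesis by (simp add: zero_enat_def)
qed

theorem class_int_mult:
 assumes \<BB>: "\<BB> \<in> conj_classes f g" and nc: "noncollinear_class f g \<BB>"
  and Fv: "(F, v) \<in> {(f, nu_class f \<BB>), (g, nu_class g \<BB>), (f * g, nu_class f \<BB> + nu_class g \<BB>)}"
 shows "int_mult F (truncated_factor f g \<BB>) = int_mult F (polar_factor f g \<BB>) \<and>
  ereal_of_enat (int_mult F (polar_factor f g \<BB>)) = ereal (v * real (mero_mult_class f g \<BB>))"
proof -
 obtain B where B: "B \<in> bars f g" "\<BB> = range (\<lambda>k. conj_bar k B)" using conj_class_obtain[OF \<BB>] by blast
 show ?thesis
 proof (cases "snd B = 0")
  case True
  then have BR: "B = (R, 0)" by (rule bar_ground[OF B(1)])
  have b: "\<BB> = {(R, 0)}" unfolding B(2) BR using conj_roots(3) by (auto simp: conj_bar_def)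
  have nc': "noncollinear_bar f g (R, 0)" using nc by (simp add: noncollinear_class_def b)
  have "int_mult F 1 = 0" using Fv germ_convergent_fg by (auto intro: int_mult_1 germ_convergent_mult)
  then show ?thesis unfolding b ground_factors[OF nc'] ground_mero_mult[OF nc'] by simp
 next
  case False
  then have h: "0 < snd B" using bar_height_nonneg[OF B(1)] by simp
  have "x = y" if "ereal_of_enat x = ereal z" "ereal_of_enat y = ereal z" for x y z using that by (cases x; cases y) auto
  then show ?thesis using int_mult_factors[OF B h nc Fv[unfolded nu_class_eq[OF B h nc]]] by blast
 qed
qed

end

section \<open>Characteristic exponents\<close>

lemma arc_denom_iff: "arc_denom n \<xi> \<longleftrightarrow> 0 < n \<and> (\<forall>e. \<xi> e \<noteq> 0 \<longrightarrow> 0 \<le> e \<and> real n * e \<in> \<int>)"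
proof -
 have "(\<exists>k::nat. e = real k / real n) \<longleftrightarrow> 0 \<le> e \<and> real n * e \<in> \<int>" if n: "0 < n" for e
 proof
  assume "0 \<le> e \<and> real n * e \<in> \<int>"
  then have "real n * e \<in> \<nat>" by (simp add: Nats_altdef2)
  then obtain k :: nat where "real n * e = real k" by (auto elim: Nats_cases)
  then have "e = real k / real n" using n by (simp add: field_simps)
  then show "\<exists>k::nat. e = real k / real n" ..
 qed (use n in auto)
 then show ?thesis unfolding arc_denom_def by blast
qed

lemma arc_denom_gcd:
 assumes "arc_denom m \<xi>" "arc_denom n \<xi>"
 shows "arc_denom (gcd m n) \<xi>"
proof -
 have "real (gcd m n) * e \<in> \<int>" if "real m * e \<in> \<int>" "real n * e \<in> \<int>" for e
 proof -
  obtain a b where ab: "a * int m + b * int n = gcd (int m) (int n)" using bezout_int by metis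
  have "real_of_int (a * int m + b * int n) * e = of_int a * (real m * e) + of_int b * (real n * e)"
   by (simp add: algebra_simps)
  also have "\<dots> \<in> \<int>" by (rule Ints_add[OF Ints_mult[OF Ints_of_int that(1)] Ints_mult[OF Ints_of_int that(2)]])
  also have "real_of_int (a * int m + b * int n) = real (gcd m n)" unfolding ab by (metis gcd_int_int_eq of_int_of_nat_eq)
  finally show ?thesis .
 qed
 then show ?thesis using assms unfolding arc_denom_iff by (auto intro: gcd_pos_nat[THEN iffD2])
qed

lemma arc_denom_iff_dvd:
 assumes \<xi>: "is_arc \<xi>"
 shows "arc_denom n \<xi> \<longleftrightarrow> 0 < n \<and> arc_den \<xi> dvd n"
proof
 assume n: "arc_denom n \<xi>"
 note d = arc_den[OF \<xi>]
 have "arc_den \<xi> \<le> gcd (arc_den \<xi>) n" using arc_denom_gcd[OF d n] unfolding arc_den_def by (rule Least_le)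
 then have "gcd (arc_den \<xi>) n = arc_den \<xi>" using gcd_le1_nat[of "arc_den \<xi>" n] arc_denom_pos[OF d] by linarith
 then have "arc_den \<xi> dvd n" by (metis gcd_dvd2)
 then show "0 < n \<and> arc_den \<xi> dvd n" using arc_denom_pos[OF n] by simp
qed (use arc_denom_dvd[OF arc_den[OF \<xi>]] in blast)

lemma conj_arc_eq_self_iff:
 assumes \<xi>: "is_arc \<xi>"
 shows "conj_arc k \<xi> = \<xi> \<longleftrightarrow> arc_den \<xi> dvd k"
proof
 assume eq: "conj_arc k \<xi> = \<xi>"
 show "arc_den \<xi> dvd k"
 proof (cases "k = 0")
  case False
  have "real k * e \<in> \<int>" if "\<xi> e \<noteq> 0" for e
  proof -
   have "cis (2 * pi * real k * e) * \<xi> e = \<xi> e" using fun_cong[OF eq, of e] by (simp add: conj_arc_def)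
   then have "cis (2 * pi * (real k * e)) = 1" using that by (simp add: mult.assoc)
   then show ?thesis by (simp only: cis_2pi_eq_1_iff)
  qed
  then have "arc_denom k \<xi>" using False is_arc_nonneg[OF \<xi>] by (simp add: arc_denom_iff)
  then show ?thesis by (simp add: arc_denom_iff_dvd[OF \<xi>])
 qed simp
qed (rule conj_arc_fix[OF arc_den[OF \<xi>]])

lemma card_orb:
 assumes \<xi>: "is_arc \<xi>"
 shows "card (orb \<xi>) = arc_den \<xi>"
proof -
 let ?d = "arc_den \<xi>"
 have "orb \<xi> = (\<lambda>k. conj_arc k \<xi>) ` {..<?d}" by (rule orb_eq_image[OF arc_den[OF \<xi>]])
 moreover have "inj_on (\<lambda>k. conj_arc k \<xi>) {..<?d}"
 proof (rule linorder_inj_onI)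
  fix k l assume kl: "k < l" "k \<in> {..<?d}" "l \<in> {..<?d}"
  show "conj_arc k \<xi> \<noteq> conj_arc l \<xi>"
  proof
   assume "conj_arc k \<xi> = conj_arc l \<xi>"
   then have "conj_arc k \<xi> = conj_arc k (conj_arc (l - k) \<xi>)" using kl by (simp add: conj_arc_conj_arc)
   then have "?d dvd l - k" using conj_arc_inj conj_arc_eq_self_iff[OF \<xi>] by metis
   then show False using kl by (auto dest: dvd_imp_le)
  qed
 qed auto
 ultimately show ?thesis by (simp add: card_image)
qed

lemma contact_eq_iff:
 assumes "is_arc \<xi>" "is_arc \<zeta>"
 shows "contact \<xi> \<zeta> = ereal h \<longleftrightarrow> \<xi> h \<noteq> \<zeta> h \<and> (\<forall>e<h. \<xi> e = \<zeta> e)"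
proof
 assume c: "contact \<xi> \<zeta> = ereal h"
 then have "\<xi> \<noteq> \<zeta>" by auto
 then obtain h' where "\<xi> h' \<noteq> \<zeta> h'" "\<And>e. e < h' \<Longrightarrow> \<xi> e = \<zeta> e" "contact \<xi> \<zeta> = ereal h'"
  using contact_obtain[OF assms] by metis
 then show "\<xi> h \<noteq> \<zeta> h \<and> (\<forall>e<h. \<xi> e = \<zeta> e)" using c by simp
qed (auto intro: contact_eqI)

lemma is_arc_trunc: "is_arc \<xi> \<Longrightarrow> is_arc (arc_trunc h \<xi>)" unfolding is_arc_def arc_denom_def arc_trunc_def by metis

text \<open>
  The \<open>k\<close>-th conjugate agrees with \<open>\<xi>\<close> below \<open>h\<close> iff \<open>k\<close> is a multiple of the denominator of the terms
  below \<open>h\<close>. So the denominator grows at \<open>h\<close> iff some conjugate separates from \<open>\<xi>\<close> there.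
\<close>

lemma char_exponents_eq:
 assumes \<xi>: "is_arc \<xi>"
 shows "char_exponents \<xi> = {h. \<exists>k. contact \<xi> (conj_arc k \<xi>) = ereal h}"
proof -
 have "\<xi> h \<noteq> 0 \<and> h * real (arc_den (arc_trunc h \<xi>)) \<notin> \<int> \<longleftrightarrow> (\<exists>k. contact \<xi> (conj_arc k \<xi>) = ereal h)" for h
 proof -
  let ?d = "arc_den (arc_trunc h \<xi>)"
  have "contact \<xi> (conj_arc k \<xi>) = ereal h \<longleftrightarrow> \<xi> h \<noteq> 0 \<and> real k * h \<notin> \<int> \<and> ?d dvd k" for k
  proof -
   have "(\<forall>e<h. \<xi> e = conj_arc k \<xi> e) \<longleftrightarrow> conj_arc k (arc_trunc h \<xi>) = arc_trunc h \<xi>"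
    by (auto simp: fun_eq_iff conj_arc_def arc_trunc_def)
   also have "\<dots> \<longleftrightarrow> ?d dvd k" by (rule conj_arc_eq_self_iff[OF is_arc_trunc[OF \<xi>]])
   finally have 1: "(\<forall>e<h. \<xi> e = conj_arc k \<xi> e) \<longleftrightarrow> ?d dvd k" .
   have "\<xi> h \<noteq> conj_arc k \<xi> h \<longleftrightarrow> \<xi> h \<noteq> 0 \<and> cis (2 * pi * (real k * h)) \<noteq> 1" by (auto simp: conj_arc_def mult.assoc)
   then show ?thesis unfolding cis_2pi_eq_1_iff using contact_eq_iff[of \<xi> "conj_arc k \<xi>" h] \<xi> 1 by auto
  qed
  moreover have "(\<exists>k. real k * h \<notin> \<int> \<and> ?d dvd k) \<longleftrightarrow> h * real ?d \<notin> \<int>"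
  proof
   assume "\<exists>k. real k * h \<notin> \<int> \<and> ?d dvd k"
   then obtain q where q: "real (?d * q) * h \<notin> \<int>" by auto
   show "h * real ?d \<notin> \<int>"
   proof
    assume "h * real ?d \<in> \<int>"
    then have "real q * (h * real ?d) \<in> \<int>" by (rule Ints_mult[OF Ints_of_nat])
    moreover have "real q * (h * real ?d) = real (?d * q) * h" by simp
    ultimately show False using q by metis
   qed
  next
   assume "h * real ?d \<notin> \<int>"
   then have "real ?d * h \<notin> \<int> \<and> ?d dvd ?d" by (simp add: mult.commute)
   then show "\<exists>k. real k * h \<notin> \<int> \<and> ?d dvd k" by blast
  qed
  ultimately show ?thesis by blast
 qed
 then show ?thesis unfolding char_exponents_def by simp
qed

lemma char_exponents_conj:
 assumes \<xi>: "is_arc \<xi>"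
 shows "char_exponents (conj_arc k \<xi>) = char_exponents \<xi>"
proof -
 have "conj_arc j (conj_arc k \<xi>) = conj_arc k (conj_arc j \<xi>)" for j by (simp add: conj_arc_conj_arc add.commute)
 then show ?thesis using \<xi> by (simp add: char_exponents_eq)
qed

lemma char_exponents_orb: "is_arc \<xi> \<Longrightarrow> \<zeta> \<in> orb \<xi> \<Longrightarrow> char_exponents \<zeta> = char_exponents \<xi>"
 unfolding orb_def using char_exponents_conj by blast

lemma char_exponents_arc_order:
 assumes \<xi>: "is_arc \<xi>" "\<xi> 0 = 0"
 shows "arc_order \<xi> < 1 \<longleftrightarrow> (\<exists>h\<in>char_exponents \<xi>. h < 1)"
proof
 assume lt: "arc_order \<xi> < 1"
 then have "\<xi> \<noteq> (\<lambda>_. 0)" by auto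
 then obtain h where h: "\<xi> h \<noteq> 0" "\<And>e. e < h \<Longrightarrow> \<xi> e = 0" "arc_order \<xi> = ereal h" using arc_order_obtain[OF \<xi>(1)] by metis
 have "h < 1" using lt h(3) by simp
 moreover have "0 < h" using is_arc_nonneg[OF \<xi>(1) h(1)] \<xi>(2) h(1) by (cases "h = 0") auto
 moreover have "arc_den (arc_trunc h \<xi>) = 1"
 proof -
  have "arc_trunc h \<xi> = (\<lambda>_. 0)" using h(2) by (auto simp: arc_trunc_def)
  then show ?thesis unfolding arc_den_def by (intro Least_equality) (auto simp: arc_denom_def)
 qed
 moreover have "h \<notin> \<int>" if "0 < h" "h < 1" using that by (auto elim!: Ints_cases)
 ultimately show "\<exists>h\<in>char_exponents \<xi>. h < 1" using h(1) by (intro bexI[of _ h]) (auto simp: char_exponents_def)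
next
 assume "\<exists>h\<in>char_exponents \<xi>. h < 1"
 then obtain h where h: "\<xi> h \<noteq> 0" "h < 1" by (auto simp: char_exponents_def)
 have "arc_order \<xi> \<le> ereal h" by (rule arc_order_le) (rule h(1))
 also have "\<dots> < 1" using h(2) by simp
 finally show "arc_order \<xi> < 1" .
qed

definition ord_at :: "complex fps \<Rightarrow> nat \<Rightarrow> bool" where
 "ord_at F k \<longleftrightarrow> F $ k \<noteq> 0 \<and> (\<forall>j<k. F $ j = 0)"

text \<open>For \<open>\<omega> = exp(2 \<pi> i k / n)\<close>, the series \<open>\<phi>(\<omega> t)\<close> parametrises the \<open>k\<close>-th conjugate of \<open>\<phi>\<close>.\<close>

lemma char_exponents_param:
 assumes n: "arc_denom n \<xi>"
 shows "char_exponents \<xi> = {real k / real n | k. \<exists>\<omega>. \<omega> ^ n = 1 \<and> ord_at ((arc_param n \<xi> oo twist \<omega>) - arc_param n \<xi>) k}"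
proof -
 have \<xi>: "is_arc \<xi>" using n arc_denom_imp_is_arc by blast
 note n0 = arc_denom_pos[OF n]
 let ?\<omega> = "\<lambda>k. cis (2 * pi * real k / real n)"
 have ord: "ord_at F j \<longleftrightarrow> F \<noteq> 0 \<and> subdegree F = j" for F j
 proof
  assume "ord_at F j"
  then have F: "F $ j \<noteq> 0" "\<And>i. i < j \<Longrightarrow> F $ i = 0" unfolding ord_at_def by blast+
  then have "subdegree F = j" by (rule subdegreeI)
  moreover have "F \<noteq> 0" using F(1) by auto
  ultimately show "F \<noteq> 0 \<and> subdegree F = j" by blast
 next
  assume "F \<noteq> 0 \<and> subdegree F = j"
  then have F: "F \<noteq> 0" "j = subdegree F" by simp_all
  then show "ord_at F j" unfolding ord_at_def F(2) using nth_less_subdegree_zero nth_subdegree_nonzero by blast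
 qed
 have 1: "contact \<xi> (conj_arc k \<xi>) = ereal h \<longleftrightarrow> (\<exists>j. h = real j / real n \<and> ord_at ((arc_param n \<xi> oo twist (?\<omega> k)) - arc_param n \<xi>) j)" for k h
 proof -
  have eq: "arc_param n \<xi> oo twist (?\<omega> k) = arc_param n (conj_arc k \<xi>)" by (rule arc_param_conj[OF n0, symmetric])
  have den: "arc_denom n (conj_arc k \<xi>)" using n by simp
  show ?thesis
  proof (cases "conj_arc k \<xi> = \<xi>")
   case False
   then have "arc_param n (conj_arc k \<xi>) - arc_param n \<xi> \<noteq> 0" using arc_param_inj[OF den n] by auto
   then show ?thesis
    unfolding eq ord contact_param[OF n den False[symmetric]] subdegree_minus_commute[of "arc_param n \<xi>"] by auto
  qed (simp add: eq ord)
 qed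
 have 2: "(\<exists>k. P (?\<omega> k)) \<longleftrightarrow> (\<exists>\<omega>. \<omega> ^ n = 1 \<and> P \<omega>)" for P
 proof
  assume "\<exists>\<omega>. \<omega> ^ n = 1 \<and> P \<omega>"
  then obtain \<omega> where \<omega>: "\<omega> ^ n = 1" "P \<omega>" by blast
  have "{z. z ^ n = 1} = ?\<omega> ` {0..<n}"
   using Complex.bij_betw_roots_unity[OF n0] by (simp add: bij_betw_def atLeast0LessThan)
  then have "\<omega> \<in> ?\<omega> ` {0..<n}" using \<omega>(1) by blast
  then show "\<exists>k. P (?\<omega> k)" using \<omega>(2) by blast
 qed (use cis_root_power[OF n0] in blast)
 have "(\<exists>k. contact \<xi> (conj_arc k \<xi>) = ereal h) \<longleftrightarrow>
   (\<exists>j. h = real j / real n \<and> (\<exists>k. ord_at ((arc_param n \<xi> oo twist (?\<omega> k)) - arc_param n \<xi>) j))" for h unfolding 1 by blast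
 then show ?thesis unfolding char_exponents_eq[OF \<xi>]
  using 2[of "\<lambda>\<omega>. ord_at ((arc_param n \<xi> oo twist \<omega>) - arc_param n \<xi>) j" for j] by auto
qed

section \<open>The Puiseux characteristic of a branch\<close>

subsection \<open>Congruences of power series\<close>

definition vanish :: "nat \<Rightarrow> complex fps \<Rightarrow> bool" where
 "vanish N F \<longleftrightarrow> (\<forall>j<N. F $ j = 0)"

lemma ord_at_iff: "ord_at F k \<longleftrightarrow> vanish k F \<and> \<not> vanish (Suc k) F" by (auto simp: ord_at_def vanish_def less_Suc_eq)

lemma vanish_uminus [simp]: "vanish N (- F) \<longleftrightarrow> vanish N F" by (simp add: vanish_def)

lemma vanish_mult: "vanish N F \<Longrightarrow> vanish N (F * G)" unfolding vanish_def by (auto simp: fps_mult_nth intro!: sum.neutral)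

lemma vanish_mult_unit:
 assumes "G $ 0 \<noteq> 0"
 shows "vanish N (F * G) \<longleftrightarrow> vanish N F"
proof
 assume "vanish N (F * G)"
 then have "vanish N (F * G * inverse G)" by (rule vanish_mult)
 moreover have "F * G * inverse G = F" using assms by (simp add: mult.assoc inverse_mult_eq_1')
 ultimately show "vanish N F" by simp
qed (rule vanish_mult)

lemma vanish_X_power_mult: "vanish (m + N) (fps_X ^ m * F) \<longleftrightarrow> vanish N F"
proof
 assume v: "vanish (m + N) (fps_X ^ m * F)"
 show "vanish N F" unfolding vanish_def
 proof (intro allI impI)
  fix j assume "j < N"
  then have "(fps_X ^ m * F) $ (m + j) = 0" using v by (simp add: vanish_def)
  then show "F $ j = 0" by (simp add: fps_X_power_mult_nth)
 qed
qed (auto simp: vanish_def fps_X_power_mult_nth)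

lemma vanish_compose_right:
 assumes "T $ 0 = 0" "vanish N F"
 shows "vanish N (F oo T)" using assms unfolding vanish_def fps_compose_nth by (auto intro!: sum.neutral)

lemma vanish_power_diff: "vanish N (A - B) \<Longrightarrow> vanish N (A ^ k - B ^ k)" unfolding power_diff_sumr2 by (rule vanish_mult)

lemma vanish_compose_left:
 assumes "vanish N (A - B)"
 shows "vanish N ((T oo A) - (T oo B))"
proof -
 have "(A ^ i) $ j = (B ^ i) $ j" if "j < N" for i j using vanish_power_diff[OF assms, of i] that by (simp add: vanish_def)
 then show ?thesis by (simp add: vanish_def fps_compose_nth)
qed

lemma vanish_power_diff_iff:
 assumes "A $ 0 = B $ 0" "A $ 0 \<noteq> 0" "0 < k"
 shows "vanish N (A ^ k - B ^ k) \<longleftrightarrow> vanish N (A - B)" unfolding power_diff_sumr2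
proof (rule vanish_mult_unit)
 have "(\<Sum>i<k. B ^ (k - Suc i) * A ^ i) $ 0 = (\<Sum>i<k. (B $ 0) ^ (k - Suc i) * (A $ 0) ^ i)"
  by (simp add: fps_sum_nth fps_power_zeroth)
 also have "\<dots> = of_nat k * (A $ 0) ^ (k - 1)" using assms(1) by (simp add: power_add[symmetric])
 finally show "(\<Sum>i<k. B ^ (k - Suc i) * A ^ i) $ 0 \<noteq> 0" using assms by simp
qed

lemma twist_compose_mult: "(F * G) oo twist z = (F oo twist z) * (G oo twist z)" by (rule fps_compose_mult_distrib) simp

lemma X_power_twist: "fps_X ^ m oo twist z = fps_const (z ^ m) * fps_X ^ m"
 by (rule fps_ext) (simp add: compose_twist_nth fps_X_power_nth)

text \<open>The congruence \<open>S(\<omega> t) \<equiv> \<omega> S(t)\<close> modulo \<open>t\<^sup>N\<^sup>+\<^sup>1\<close> passes to the inverse series.\<close>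

lemma vanish_inverse_series:
 assumes S: "S = fps_X * w" and T: "T = fps_X * v" and inv: "S oo T = fps_X" "T oo S = fps_X"
  and \<omega>: "\<omega> \<noteq> 0" and van: "vanish N ((w oo twist \<omega>) - w)"
 shows "vanish N ((v oo twist \<omega>) - v)"
proof -
 let ?c = "fps_const \<omega>"
 have S0: "S $ 0 = 0" and T0: "T $ 0 = 0" by (simp_all add: S T)
 have tw: "fps_X oo twist \<omega> = twist \<omega>" by simp
 have tw': "twist \<omega> oo T = ?c * T"
  unfolding twist_def fps_const_mult_apply_left[symmetric] by (simp add: T0 fps_X_fps_compose_startby0)
 let ?A = "S oo twist \<omega>" and ?B = "?c * S"
 have "?A - ?B = ?c * (fps_X ^ 1 * ((w oo twist \<omega>) - w))"
  unfolding S twist_compose_mult by (simp add: twist_def algebra_simps)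
 then have "vanish (1 + N) (?A - ?B)" using van vanish_X_power_mult[of 1 N] by (simp add: vanish_mult mult.commute[of ?c])
 then have "vanish (1 + N) (((T oo ?A) - (T oo ?B)) oo T)" by (intro vanish_compose_right T0 vanish_compose_left)
 moreover have "T oo ?A = twist \<omega>" by (simp add: fps_compose_assoc[OF twist_nth_0 S0] inv)
 moreover have "(T oo ?B) oo T = T oo twist \<omega>"
 proof -
  have "(T oo ?B) oo T = T oo (?B oo T)" using S0 T0 by (simp add: fps_compose_assoc)
  also have "?B oo T = twist \<omega>" using T0 by (simp add: fps_compose_mult_distrib inv twist_def)
  finally show ?thesis .
 qed
 ultimately have "vanish (1 + N) (?c * T - (T oo twist \<omega>))" by (simp add: fps_compose_sub_distrib tw')
 moreover have "?c * T - (T oo twist \<omega>) = fps_X ^ 1 * - (((v oo twist \<omega>) - v) * ?c)"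
  unfolding T twist_compose_mult by (simp add: twist_def algebra_simps)
 ultimately have "vanish N (- (((v oo twist \<omega>) - v) * ?c))" using vanish_X_power_mult[of 1 N] by simp
 then show ?thesis using vanish_mult_unit[of ?c] \<omega> by simp
qed

text \<open>If \<open>w\<^sup>m = u\<close>, then \<open>v\<close> comes from the inverse \<open>t v\<close> of the series \<open>t w\<close>.\<close>

lemma inversion_param:
 fixes u :: "complex fps"
 assumes u: "u $ 0 \<noteq> 0" and m: "0 < m"
 obtains v where "v $ 0 \<noteq> 0" "(fps_X ^ m * u) oo (fps_X * v) = fps_X ^ m"
  "\<And>\<omega> N. \<omega> \<noteq> 0 \<Longrightarrow> vanish N ((u oo twist \<omega>) - u) \<longleftrightarrow> vanish N ((v oo twist \<omega>) - v)"
proof -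
 obtain w where w: "w ^ m = u" "w $ 0 \<noteq> 0"
 proof -
  obtain k where k: "m = Suc k" using m gr0_conv_Suc by blast
  have "exp (Ln (u $ 0) / of_nat m) ^ m = u $ 0" using m u by (simp flip: exp_of_nat_mult)
  then obtain z where z: "z ^ m = u $ 0" by blast
  define r where "r = (\<lambda>(_::nat) (_::complex). z)"
  have "r (Suc k) (u $ 0) ^ Suc k = u $ 0" using z by (simp add: r_def k)
  then have "fps_radical r (Suc k) u ^ Suc k = u" using power_radical[OF u, of r k] by blast
  moreover from this have "fps_radical r (Suc k) u $ 0 \<noteq> 0" using u by (metis fps_power_zeroth power_0_Suc)
  ultimately show ?thesis using that k by blast
 qed
 define S where "S = fps_X * w"
 have S: "S $ 0 = 0" "S $ 1 \<noteq> 0" using w(2) by (simp_all add: S_def)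
 define T where "T = fps_inv S"
 have inv: "T oo S = fps_X" "S oo T = fps_X" unfolding T_def using S by (simp_all add: fps_inv fps_inv_right)
 have T0: "T $ 0 = 0" by (simp add: T_def fps_inv_def)
 define v where "v = fps_shift 1 T"
 have T: "T = fps_X * v" using T0 by (simp add: v_def fps_eq_iff)
 have "v $ 0 \<noteq> 0"
 proof
  assume "v $ 0 = 0"
  then have "T $ 1 = 0" by (simp add: v_def)
  moreover have "(S oo T) $ 1 = S $ 1 * T $ 1" using T0 by (simp add: fps_compose_nth)
  ultimately show False using inv(2) by simp
 qed
 moreover have "(fps_X ^ m * u) oo T = fps_X ^ m"
 proof -
  have "fps_X ^ m * u = S ^ m" by (simp add: S_def w(1) power_mult_distrib)
  then show ?thesis by (simp add: fps_compose_power[OF T0, symmetric] inv)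
 qed
 moreover have "vanish N ((u oo twist \<omega>) - u) \<longleftrightarrow> vanish N ((v oo twist \<omega>) - v)" if \<omega>: "\<omega> \<noteq> 0" for \<omega> N
 proof -
  have "(u oo twist \<omega>) = (w oo twist \<omega>) ^ m" unfolding w(1)[symmetric] by (rule fps_compose_power[symmetric]) simp
  then have "vanish N ((u oo twist \<omega>) - u) \<longleftrightarrow> vanish N ((w oo twist \<omega>) ^ m - w ^ m)" using w(1) by simp
  also have "\<dots> \<longleftrightarrow> vanish N ((w oo twist \<omega>) - w)"
   by (rule vanish_power_diff_iff) (use w(2) m in \<open>auto simp: compose_twist_nth\<close>)
  also have "\<dots> \<longleftrightarrow> vanish N ((v oo twist \<omega>) - v)"
   using vanish_inverse_series[OF S_def T inv(2,1) \<omega>] vanish_inverse_series[OF T S_def inv(1,2) \<omega>] by blast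
  finally show ?thesis .
 qed
 ultimately show ?thesis unfolding T by (rule that)
qed

definition twist_orders :: "nat \<Rightarrow> complex fps \<Rightarrow> nat set" where
 "twist_orders n \<phi> = {k. \<exists>\<omega>. \<omega> ^ n = 1 \<and> ord_at ((\<phi> oo twist \<omega>) - \<phi>) k}"

lemma ord_at_X_power_mult: "ord_at (fps_X ^ m * F) j \<longleftrightarrow> (\<exists>k. j = m + k \<and> ord_at F k)"
proof
 assume o: "ord_at (fps_X ^ m * F) j"
 then have "\<not> j < m" by (auto simp: ord_at_def fps_X_power_mult_nth)
 then obtain k where k: "j = m + k" by (metis le_add_diff_inverse not_less)
 have "vanish (m + k) (fps_X ^ m * F)" "\<not> vanish (m + Suc k) (fps_X ^ m * F)" using o by (simp_all add: ord_at_iff k)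
 then have "ord_at F k" unfolding ord_at_iff vanish_X_power_mult by blast
 then show "\<exists>k. j = m + k \<and> ord_at F k" using k by blast
next
 assume "\<exists>k. j = m + k \<and> ord_at F k"
 then obtain k where k: "j = m + k" "ord_at F k" by blast
 have "vanish (m + k) (fps_X ^ m * F)" "\<not> vanish (m + Suc k) (fps_X ^ m * F)"
  using k(2) unfolding ord_at_iff vanish_X_power_mult by auto
 then show "ord_at (fps_X ^ m * F) j" by (simp add: ord_at_iff k(1))
qed

text \<open>A rotation by \<open>\<omega>\<close> with \<open>\<omega>\<^sup>m \<noteq> 1\<close> changes the leading term, any other one acts on \<open>u\<close> alone.\<close>

lemma twist_orders_X_power_mult:
 assumes u: "u $ 0 \<noteq> 0"
 shows "j \<in> twist_orders n (fps_X ^ m * u) \<longleftrightarrow> (j = m \<and> (\<exists>\<omega>::complex. \<omega> ^ n = 1 \<and> \<omega> ^ m \<noteq> 1)) \<or>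
  (\<exists>k. j = m + k \<and> (\<exists>\<omega>. \<omega> ^ n = 1 \<and> \<omega> ^ m = 1 \<and> ord_at ((u oo twist \<omega>) - u) k))"
proof -
 have D: "(fps_X ^ m * u oo twist \<omega>) - fps_X ^ m * u = fps_X ^ m * (fps_const (\<omega> ^ m) * (u oo twist \<omega>) - u)" for \<omega>
  unfolding twist_compose_mult X_power_twist by (simp add: algebra_simps)
 have o: "ord_at (fps_const (\<omega> ^ m) * (u oo twist \<omega>) - u) k \<longleftrightarrow> k = 0" if "\<omega> ^ m \<noteq> 1" for \<omega> k
 proof -
  have "(fps_const (\<omega> ^ m) * (u oo twist \<omega>) - u) $ 0 = (\<omega> ^ m - 1) * u $ 0" by (simp add: compose_twist_nth algebra_simps)
  then have "(fps_const (\<omega> ^ m) * (u oo twist \<omega>) - u) $ 0 \<noteq> 0" using u that by simp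
  then show ?thesis unfolding ord_at_def by (metis less_nat_zero_code neq0_conv)
 qed
 have "j \<in> twist_orders n (fps_X ^ m * u) \<longleftrightarrow> (\<exists>\<omega>. \<omega> ^ n = 1 \<and>
   (if \<omega> ^ m = 1 then (\<exists>k. j = m + k \<and> ord_at ((u oo twist \<omega>) - u) k) else j = m))"
 proof -
  have "ord_at ((fps_X ^ m * u oo twist \<omega>) - fps_X ^ m * u) j \<longleftrightarrow>
    (if \<omega> ^ m = 1 then (\<exists>k. j = m + k \<and> ord_at ((u oo twist \<omega>) - u) k) else j = m)" for \<omega>
   unfolding D ord_at_X_power_mult using o[of \<omega>] by auto
  then show ?thesis by (simp add: twist_orders_def)
 qed
 moreover have "(\<exists>\<omega>. \<omega> ^ n = 1 \<and> (if \<omega> ^ m = 1 then Q \<omega> else j = m)) \<longleftrightarrow>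
   (j = m \<and> (\<exists>\<omega>::complex. \<omega> ^ n = 1 \<and> \<omega> ^ m \<noteq> 1)) \<or> (\<exists>\<omega>. \<omega> ^ n = 1 \<and> \<omega> ^ m = 1 \<and> Q \<omega>)" for Q :: "complex \<Rightarrow> bool"
  by (auto split: if_splits)
 ultimately show ?thesis by (simp only:) blast
qed

subsection \<open>Exchanging the coordinates\<close>

lemma irreducible_swap:
 assumes "p \<in> carrier Cxy" "ring_irreducible\<^bsub>Cxy\<^esub> p"
 shows "germ_swap p \<in> carrier Cxy" "ring_irreducible\<^bsub>Cxy\<^esub> (germ_swap p)"
proof -
 interpret domain Cxy by (rule domain_Cxy)
 have units: "F \<in> Units Cxy \<longleftrightarrow> germ_swap F \<in> Units Cxy" for F by (simp add: Units_Cxy germ_convergent_swap)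
 show c: "germ_swap p \<in> carrier Cxy" using assms(1) by (simp add: germ_convergent_swap)
 show "ring_irreducible\<^bsub>Cxy\<^esub> (germ_swap p)"
 proof (rule ring_irreducibleI)
  show "germ_swap p \<in> carrier Cxy - {\<zero>\<^bsub>Cxy\<^esub>}" using c assms(2) by (simp add: germ_swap_0 ring_irreducible_def)
  show "germ_swap p \<notin> Units Cxy" using ring_irreducibleE(4)[OF assms] units by blast
  fix a b assume ab: "a \<in> carrier Cxy" "b \<in> carrier Cxy" "germ_swap p = a \<otimes>\<^bsub>Cxy\<^esub> b"
  have "p = germ_swap a * germ_swap b" using ab(3) by (metis Cxy_simps(2) germ_swap_mult germ_swap_swap)
  then have "germ_swap a \<in> Units Cxy \<or> germ_swap b \<in> Units Cxy"
   using ring_irreducibleE(5)[OF assms, of "germ_swap a" "germ_swap b"] ab by (simp add: germ_convergent_swap)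
  then show "a \<in> Units Cxy \<or> b \<in> Units Cxy" using units by blast
 qed
qed

lemma ev_cmap_swap:
 assumes A: "A $ 0 = 0" and B: "B $ 0 = 0"
 shows "ev A (cmap B p) = ev B (cmap A (germ_swap p))"
proof -
 have *: "ev A (cmap B p) $ k = (\<Sum>i\<le>k. \<Sum>j\<le>k. p $ i $ j * (B ^ j * A ^ i) $ k)" if A: "A $ 0 = 0" and B: "B $ 0 = 0" for A B p k
 proof -
  have c: "(p $ i oo B) $ l = (\<Sum>j\<le>k. p $ i $ j * (B ^ j) $ l)" if "l \<le> k" for i l
  proof -
   have "(p $ i oo B) $ l = (\<Sum>j=0..l. p $ i $ j * (B ^ j) $ l)" by (simp add: fps_compose_nth)
   also have "\<dots> = (\<Sum>j\<le>k. p $ i $ j * (B ^ j) $ l)"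
    using that startsby_zero_power_prefix[OF B] by (intro sum.mono_neutral_left) auto
   finally show ?thesis .
  qed
  have "ev A (cmap B p) $ k = (\<Sum>i\<le>k. \<Sum>l=0..k. (p $ i oo B) $ l * (A ^ i) $ (k - l))" by (simp add: ev_def fps_mult_nth)
  also have "\<dots> = (\<Sum>i\<le>k. \<Sum>l=0..k. \<Sum>j\<le>k. p $ i $ j * ((B ^ j) $ l * (A ^ i) $ (k - l)))"
   by (intro sum.cong refl) (simp add: c sum_distrib_right mult.assoc)
  also have "\<dots> = (\<Sum>i\<le>k. \<Sum>j\<le>k. \<Sum>l=0..k. p $ i $ j * ((B ^ j) $ l * (A ^ i) $ (k - l)))" by (intro sum.cong refl sum.swap)
  finally show ?thesis by (simp add: fps_mult_nth sum_distrib_left)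
 qed
 show ?thesis
 proof (rule fps_ext)
  fix k
  have "ev A (cmap B p) $ k = (\<Sum>i\<le>k. \<Sum>j\<le>k. p $ i $ j * (B ^ j * A ^ i) $ k)" by (rule *[OF A B])
  also have "\<dots> = (\<Sum>j\<le>k. \<Sum>i\<le>k. p $ i $ j * (B ^ j * A ^ i) $ k)" by (rule sum.swap)
  also have "\<dots> = ev B (cmap A (germ_swap p)) $ k" unfolding *[OF B A] by (simp add: mult.commute)
  finally show "ev A (cmap B p) $ k = ev B (cmap A (germ_swap p)) $ k" .
 qed
qed

subsection \<open>Reading off the characteristic from a root\<close>

lemma ramify_branch:
 assumes n: "arc_denom n \<xi>"
 shows "ramify n (branch \<xi>) = rprod (image_mset (arc_param n) (mset_set (orb \<xi>)))"
proof -
 have arc: "is_arc \<xi>" using n arc_denom_imp_is_arc by blast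
 show ?thesis unfolding branch_def root_prod_eq_rprod[symmetric]
  by (rule ramify_arc_prod[OF conj_stable_orb[OF arc] arc_denom_pos[OF n]])
    (use finite_orb[OF arc] n orb_arc in auto)
qed

lemma branch_const_term:
 assumes \<xi>: "is_arc \<xi>" "\<xi> 0 = 0"
 shows "branch \<xi> $ i $ 0 = (if i = arc_den \<xi> then 1 else 0)"
proof -
 have "\<zeta> \<in># mset_set (orb \<xi>) \<Longrightarrow> is_arc \<zeta> \<and> \<zeta> 0 = 0" for \<zeta> using finite_orb[OF \<xi>(1)] orb_arc(1,3)[of \<zeta> \<xi>] \<xi> by simp
 then show ?thesis using arc_prod_const_term[OF conj_stable_orb[OF \<xi>(1)]] card_orb[OF \<xi>(1)] by (simp add: branch_def)
qed

lemma rprod_weight: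
 assumes "\<forall>c\<in>#C. \<forall>j<N. c $ j = 0" "rprod C $ i $ j \<noteq> 0"
 shows "N * size C \<le> N * i + j" using assms
proof (induction C arbitrary: i j)
 case (add c C)
 have "(case i of 0 \<Rightarrow> 0 | Suc i' \<Rightarrow> rprod C $ i' $ j) \<noteq> 0 \<or> (c * rprod C $ i) $ j \<noteq> 0"
  using add.prems(2) by (auto simp: left_diff_distrib split: nat.splits)
 then show ?case
 proof
  assume "(case i of 0 \<Rightarrow> 0 | Suc i' \<Rightarrow> rprod C $ i' $ j) \<noteq> 0"
  then obtain i' where i': "i = Suc i'" "rprod C $ i' $ j \<noteq> 0" by (auto split: nat.splits)
  then show ?thesis using add.IH[of i' j] add.prems(1) by simp
 next
  assume "(c * rprod C $ i) $ j \<noteq> 0"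
  then obtain a where a: "a \<le> j" "c $ a \<noteq> 0" "rprod C $ i $ (j - a) \<noteq> 0"
   unfolding fps_mult_nth by (force elim: sum.not_neutral_contains_not_neutral)
  have "N \<le> a" using add.prems(1) a(2) by (metis not_less union_single_eq_member)
  moreover have "N * size C \<le> N * i + (j - a)" using add.IH[of i "j - a"] add.prems(1) a(3) by simp
  ultimately show ?thesis using a(1) by simp
 qed
qed simp

lemma germ_multI:
 assumes "F $ i $ j \<noteq> 0" "m = i + j" "\<And>i j. F $ i $ j \<noteq> 0 \<Longrightarrow> m \<le> i + j"
 shows "germ_mult F = m" unfolding germ_mult_def
proof (rule Least_equality)
 show "\<exists>i\<le>m. F $ i $ (m - i) \<noteq> 0" using assms(1,2) by (intro exI[of _ i]) simp
 fix k assume "\<exists>i\<le>k. F $ i $ (k - i) \<noteq> 0"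
 then show "m \<le> k" using assms(3) by force
qed

lemma roots_orb: "is_arc \<xi> \<Longrightarrow> np_roots F = mset_set (orb \<xi>) \<Longrightarrow> roots F = orb \<xi>" using finite_orb by (simp add: roots_def)

lemma the_char_exponents:
 assumes \<xi>: "is_arc \<xi>" and "roots F = orb \<xi>"
 shows "(THE C. \<forall>\<zeta>\<in>roots F. char_exponents \<zeta> = C) = char_exponents \<xi>" unfolding assms(2)
proof (rule the_equality)
 show "\<forall>\<zeta>\<in>orb \<xi>. char_exponents \<zeta> = char_exponents \<xi>" using char_exponents_orb[OF \<xi>] by blast
qed (use self_in_orb in blast)

context
 fixes \<xi> :: arc
 assumes \<xi>: "is_arc \<xi>" "\<xi> 0 = 0"
begin

text \<open>
  If \<open>\<xi>\<close> has order at least \<open>1\<close>, all monomials of the branch have degree at least its degree in \<open>x\<close>. That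
  is its multiplicity then, and the coordinates are not exchanged.
\<close>

lemma puiseux_char_regular:
 assumes ord: "\<not> arc_order \<xi> < 1"
 shows "puiseux_char (branch \<xi>) = char_exponents \<xi>"
proof -
 let ?n = "arc_den \<xi>"
 note n = arc_den[OF \<xi>(1)]
 note n0 = arc_denom_pos[OF n]
 have small: "\<zeta> e = 0" if "\<zeta> \<in> orb \<xi>" "e < 1" for \<zeta> e
 proof -
  have "ereal 1 \<le> arc_order \<xi>" using ord by (simp add: one_ereal_def not_less)
  then have "\<xi> e = 0" using that(2) arc_order_ge_iff by blast
  then show ?thesis using orb_arc(3)[OF that(1)] by blast
 qed
 have "germ_mult (branch \<xi>) = ?n"
 proof (rule germ_multI)
  show "branch \<xi> $ ?n $ 0 \<noteq> 0" by (simp add: branch_const_term[OF \<xi>])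
  fix i j assume "branch \<xi> $ i $ j \<noteq> 0"
  then have "ramify ?n (branch \<xi>) $ i $ (?n * j) \<noteq> 0" using n0 by (simp add: ramify_def fps_compose_X_power_nth)
  then have ne: "rprod (image_mset (arc_param ?n) (mset_set (orb \<xi>))) $ i $ (?n * j) \<noteq> 0" unfolding ramify_branch[OF n] .
  have "\<forall>c\<in>#image_mset (arc_param ?n) (mset_set (orb \<xi>)). \<forall>j<?n. c $ j = 0" using small finite_orb[OF \<xi>(1)] n0 by auto
  from rprod_weight[OF this ne] have "?n * ?n \<le> ?n * i + ?n * j" using card_orb[OF \<xi>(1)] by simp
  then have "?n * ?n \<le> ?n * (i + j)" by (simp add: distrib_left)
  then show "?n \<le> i + j" using n0 by simp
 qed simp
 then show ?thesis using the_char_exponents[OF \<xi>(1) roots_orb[OF \<xi>(1) np_roots_eq[OF np_factorization_branch[OF \<xi>]]]]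
  by (simp add: puiseux_char_def branch_const_term[OF \<xi>])
qed

text \<open>
  If \<open>\<xi> = y\<^sup>m\<^sup>/\<^sup>n (c + \<dots>)\<close> with \<open>m < n\<close>, the curve \<open>x = t\<^sup>m u(t)\<close>, \<open>y = t\<^sup>n\<close> has after reparametrisation by
  \<open>s = t u\<^sup>1\<^sup>/\<^sup>m\<close> the form \<open>x = s\<^sup>m\<close>, \<open>y = s\<^sup>n v(s)\<^sup>n\<close>. Rotations by a common root of unity act on \<open>u\<close> and \<open>v\<^sup>n\<close> in
  the same way, so the characteristic exponents of the exchanged branch are those of \<open>\<xi>\<close>, transformed by
  the inversion formula.
\<close>

lemma puiseux_char_swap:
 assumes ord: "arc_order \<xi> < 1" and conv: "fps_convergent (arc_param (arc_den \<xi>) \<xi>)"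
 defines "n \<equiv> arc_den \<xi>"
 obtains m where "0 < m" "m < n" "real m / real n \<in> char_exponents \<xi>"
  "\<And>c. c \<in> char_exponents \<xi> \<Longrightarrow> real m / real n \<le> c"
  "puiseux_char (branch \<xi>) = {real j / real m | j. (j = n \<and> (\<exists>\<omega>::complex. \<omega> ^ m = 1 \<and> \<omega> ^ n \<noteq> 1)) \<or>
    (\<exists>k>0. j = n + k \<and> real (m + k) / real n \<in> char_exponents \<xi>)}"
proof -
 define \<phi> where "\<phi> = arc_param n \<xi>"
 define m where "m = subdegree \<phi>"
 define p where "p = branch \<xi>"
 note n = arc_den[OF \<xi>(1), folded n_def]
 note n0 = arc_denom_pos[OF n]
 have \<xi>0: "\<xi> \<noteq> (\<lambda>_. 0)" using ord by auto
 have \<phi>0: "\<phi> \<noteq> 0"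
 proof
  assume "\<phi> = 0"
  then have "arc_of_param n 0 = \<xi>" using arc_of_param_param[OF n] by (simp add: \<phi>_def)
  then show False using \<xi>0 arc_of_param_eq_0_iff[OF n0] by metis
 qed
 have o: "arc_order \<xi> = ereal (real m / real n)" unfolding m_def \<phi>_def by (rule arc_order_param[OF n \<xi>0])
 have mn: "m < n" using ord n0 unfolding o by (simp add: one_ereal_def field_simps)
 have m0: "0 < m"
 proof (rule ccontr)
  assume "\<not> 0 < m"
  then have "\<phi> $ 0 \<noteq> 0" using nth_subdegree_nonzero[OF \<phi>0] by (simp add: m_def)
  then show False using \<xi>(2) by (simp add: \<phi>_def)
 qed
 define u where "u = fps_shift m \<phi>"
 have u: "u $ 0 \<noteq> 0" using nth_subdegree_nonzero[OF \<phi>0] by (simp add: u_def m_def)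
 have \<phi>: "\<phi> = fps_X ^ m * u" unfolding u_def m_def by (metis subdegree_decompose mult.commute)
 obtain v where v: "v $ 0 \<noteq> 0" "(fps_X ^ m * u) oo (fps_X * v) = fps_X ^ m"
  "\<And>\<omega> N. \<omega> \<noteq> 0 \<Longrightarrow> vanish N ((u oo twist \<omega>) - u) \<longleftrightarrow> vanish N ((v oo twist \<omega>) - v)" using inversion_param[OF u m0] by metis
 define T where "T = fps_X * v"
 define \<eta> where "\<eta> = T ^ n"
 \<comment> \<open>a root of the exchanged branch\<close>
 define \<psi> where "\<psi> = arc_of_param m \<eta>"
 have T0: "T $ 0 = 0" by (simp add: T_def)
 have \<eta>0: "\<eta> $ 0 = 0" using T0 n0 by (simp add: \<eta>_def fps_power_zeroth)
 have \<psi>: "arc_denom m \<psi>" "is_arc \<psi>" "arc_param m \<psi> = \<eta>"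
  unfolding \<psi>_def using arc_denom_of_param[OF m0] arc_denom_imp_is_arc m0 by (blast, blast, simp)
 have \<psi>0: "\<psi> 0 = 0" using arc_of_param_nth[OF m0, of \<eta> 0] \<eta>0 by (simp add: \<psi>_def)
 have \<xi>root: "\<xi> \<in># mset_set (orb \<xi>)" using finite_orb[OF \<xi>(1)] by simp
 have "ev \<phi> (ramify n p) = 0"
 proof -
  have \<phi>z: "\<phi> $ 0 = 0" using \<xi>(2) by (simp add: \<phi>_def)
  obtain C where C: "image_mset (arc_param n) (mset_set (orb \<xi>)) = add_mset \<phi> C"
   using \<xi>root unfolding \<phi>_def by (metis image_mset_add_mset mset_add)
  show ?thesis unfolding p_def ramify_branch[OF n] C rprod_def by (simp add: ev_mult[OF \<phi>z] ev_diff ev_X[OF \<phi>z])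
 qed
 then have "ev \<phi> (ramify n p) oo T = 0" by simp
 moreover have "ev \<phi> (ramify n p) oo T = ev (fps_X ^ m) (cmap \<eta> p)"
 proof -
  have Xn: "fps_X ^ n oo T = \<eta>" unfolding \<eta>_def fps_compose_power[OF T0, symmetric] using T0 by (simp add: fps_X_fps_compose_startby0)
  have "ev \<phi> (ramify n p) oo T = ev (\<phi> oo T) (cmap T (cmap (fps_X ^ n) p))"
   using \<xi>(2) by (simp add: ev_cmap[OF _ T0] ramify_eq_cmap \<phi>_def)
  then show ?thesis using n0 v(2) unfolding \<phi> T_def[symmetric] by (simp add: cmap_cmap[OF _ T0] Xn)
 qed
 moreover have "ev (fps_X ^ m) (cmap \<eta> p) = arc_ev m \<psi> (germ_swap p)"
  unfolding arc_ev_def \<psi>(3) ramify_eq_cmap using m0 \<eta>0 by (intro ev_cmap_swap) auto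
 ultimately have ev0: "arc_ev m \<psi> (germ_swap p) = 0" by simp
 have irr: "p \<in> carrier Cxy" "ring_irreducible\<^bsub>Cxy\<^esub> p"
  unfolding p_def using branch_convergent[OF n] branch_irreducible[OF n] conv \<xi>(2) by (simp_all add: n_def)
 note sw = irreducible_swap[OF irr]
 have "germ_swap p \<noteq> 0" using sw(2) by (auto simp: ring_irreducible_def)
 then obtain E \<Gamma> where np: "np_factorization (germ_swap p) E \<Gamma>"
  using newton_puiseux[of "germ_swap p"] sw(1) by (metis Cxy_simps(1) mem_Collect_eq)
 have "\<psi> \<in># \<Gamma>" using np_arc_ev(1)[OF np \<psi>(2) \<psi>0 _ \<psi>(1)] ev0 by blast
 then have "\<psi> \<in> roots (germ_swap p)" using np_roots_eq[OF np] by (simp add: roots_def)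
 then have r: "roots (germ_swap p) = orb \<psi>" using irreducible_np_roots[OF sw] roots_orb[OF \<psi>(2)] by blast
 have pm: "p $ germ_mult p $ 0 = 0"
 proof -
  let ?z = "(\<lambda>_. 0) :: arc"
  have den: "arc_denom 1 ?z" by (simp add: arc_denom_def)
  have "contact ?z \<xi> = ereal (real m / real n)" using o by (simp add: contact_def arc_order_def)
  moreover have "conj_arc k ?z = ?z" for k by (simp add: conj_arc_def)
  ultimately have "rcontact ?z (conj_arc k \<xi>) = real m / real n" for k
   using contact_conj[of k ?z \<xi>] by (simp only: rcontact_def real_of_ereal.simps)
  then have c: "rcontact ?z \<zeta> = real m / real n" if "\<zeta> \<in> orb \<xi>" for \<zeta> using that unfolding orb_def by blast
  have "?z \<notin> orb \<xi>" using c[of ?z] m0 n0 by (auto simp: rcontact_def)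
  then have "?z \<notin># mset_set (orb \<xi>)" using finite_orb[OF \<xi>(1)] by simp
  note e = np_arc_ev[OF np_factorization_branch[OF \<xi>] arc_denom_imp_is_arc[OF den] refl this den]
  have "real (subdegree (arc_ev 1 ?z p)) = real n * (real m / real n)"
   unfolding p_def e(2) sum_unfold_sum_mset[symmetric] using c card_orb[OF \<xi>(1)] by (simp add: n_def)
  then have "subdegree (arc_ev 1 ?z p) = m" using n0 by simp
  then have "arc_ev 1 ?z p $ m \<noteq> 0" using nth_subdegree_nonzero[OF e(1)] by (simp add: p_def)
  moreover have "arc_param 1 ?z = 0" by (simp add: fps_eq_iff)
  moreover have "ev 0 G = G $ 0" for G :: germ by (simp add: ev_def fps_eq_iff sum.atMost_shift)
  ultimately have "p $ 0 $ m \<noteq> 0" by (simp add: arc_ev_def ramify_eq_cmap)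
  then have "germ_mult p \<le> m" unfolding germ_mult_def by (intro Least_le exI[of _ 0]) simp
  then show ?thesis using mn by (simp add: p_def branch_const_term[OF \<xi>] n_def)
 qed
 have pc: "puiseux_char p = char_exponents \<psi>" unfolding puiseux_char_def using the_char_exponents[OF \<psi>(2) r] pm by simp
 have ord_uv: "ord_at ((u oo twist \<omega>) - u) k \<longleftrightarrow> ord_at ((v ^ n oo twist \<omega>) - v ^ n) k" if "\<omega> \<noteq> 0" for \<omega> k
 proof -
  have "vanish N ((v ^ n oo twist \<omega>) - v ^ n) \<longleftrightarrow> vanish N ((v oo twist \<omega>) - v)" for N
   unfolding fps_compose_power[OF twist_nth_0, symmetric]
   by (rule vanish_power_diff_iff) (use v(1) n0 in \<open>auto simp: compose_twist_nth\<close>)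
  then show ?thesis using v(3)[OF that] by (simp add: ord_at_iff)
 qed
 have ne0: "\<omega> \<noteq> 0" if "\<omega> ^ m = 1" for \<omega> :: complex using that m0 by (auto simp: power_0_left)
 have \<eta>: "\<eta> = fps_X ^ n * v ^ n" by (simp add: \<eta>_def T_def power_mult_distrib)
 have CE\<xi>: "c \<in> char_exponents \<xi> \<longleftrightarrow> (\<exists>j\<in>twist_orders n \<phi>. c = real j / real n)" for c
  unfolding char_exponents_param[OF n] twist_orders_def \<phi>_def by blast
 have CE\<psi>: "char_exponents \<psi> = {real j / real m | j. j \<in> twist_orders m \<eta>}"
  unfolding char_exponents_param[OF \<psi>(1)] twist_orders_def \<psi>(3) by blast
 have CE\<xi>': "real j / real n \<in> char_exponents \<xi> \<longleftrightarrow> j \<in> twist_orders n \<phi>" for j unfolding CE\<xi> using n0 by auto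
 have k0: "\<not> ord_at ((u oo twist \<omega>) - u) 0" for \<omega> by (simp add: ord_at_def compose_twist_nth)
 note t\<phi> = twist_orders_X_power_mult[OF u, of _ n m, folded \<phi>]
 have "v ^ n $ 0 \<noteq> 0" using v(1) by (simp add: fps_power_zeroth)
 note t\<eta> = twist_orders_X_power_mult[OF this, of _ m n, folded \<eta>]
 show ?thesis
 proof (rule that[OF m0 mn])
  have "\<exists>\<omega>::complex. \<omega> ^ n = 1 \<and> \<omega> ^ m \<noteq> 1"
  proof -
   have "cis (2 * pi * real 1 / real n) ^ n = 1" by (rule cis_root_power[OF n0])
   moreover have "cis (2 * pi * real 1 / real n) ^ m \<noteq> 1"
    using cis_2pi_eq_1_iff[of "real m / real n"] real_div_in_Ints_iff[OF n0, of m] mn m0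
    by (auto simp: Complex.DeMoivre algebra_simps dest: dvd_imp_le)
   ultimately show ?thesis by blast
  qed
  then show "real m / real n \<in> char_exponents \<xi>" unfolding CE\<xi>' t\<phi> by blast
  fix c assume "c \<in> char_exponents \<xi>"
  then obtain j where j: "j \<in> twist_orders n \<phi>" "c = real j / real n" unfolding CE\<xi> by blast
  have "m \<le> j" using j(1) unfolding t\<phi> by auto
  then show "real m / real n \<le> c" using j(2) n0 by (simp add: divide_right_mono)
 next
  have "(\<exists>k. j = n + k \<and> (\<exists>\<omega>. \<omega> ^ m = 1 \<and> \<omega> ^ n = 1 \<and> ord_at ((v ^ n oo twist \<omega>) - v ^ n) k)) \<longleftrightarrow>
   (\<exists>k>0. j = n + k \<and> real (m + k) / real n \<in> char_exponents \<xi>)" for j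
  proof -
   have "(\<exists>\<omega>. \<omega> ^ m = 1 \<and> \<omega> ^ n = 1 \<and> ord_at ((v ^ n oo twist \<omega>) - v ^ n) k) \<longleftrightarrow>
    0 < k \<and> real (m + k) / real n \<in> char_exponents \<xi>" for k
   proof -
    have "(\<exists>\<omega>. \<omega> ^ m = 1 \<and> \<omega> ^ n = 1 \<and> ord_at ((v ^ n oo twist \<omega>) - v ^ n) k) \<longleftrightarrow>
     (\<exists>\<omega>. \<omega> ^ n = 1 \<and> \<omega> ^ m = 1 \<and> ord_at ((u oo twist \<omega>) - u) k)" using ord_uv ne0 by metis
    also have "\<dots> \<longleftrightarrow> 0 < k \<and> m + k \<in> twist_orders n \<phi>" unfolding t\<phi> using k0 by (cases "k = 0") auto
    finally show ?thesis unfolding CE\<xi>' .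
   qed
   then show ?thesis by blast
  qed
  then show "puiseux_char (branch \<xi>) = {real j / real m | j. (j = n \<and> (\<exists>\<omega>::complex. \<omega> ^ m = 1 \<and> \<omega> ^ n \<noteq> 1)) \<or>
    (\<exists>k>0. j = n + k \<and> real (m + k) / real n \<in> char_exponents \<xi>)}" unfolding pc[unfolded p_def] CE\<psi> t\<eta> by simp
 qed
qed

end

text \<open>
  In either case the Puiseux characteristic has been expressed by the denominator and the characteristic
  exponents, and \<open>\<xi>\<close> has order less than \<open>1\<close> iff one of the latter is less than \<open>1\<close>.
\<close>

theorem puiseux_char_eq:
 assumes \<xi>: "is_arc \<xi>" "\<xi> 0 = 0" "fps_convergent (arc_param (arc_den \<xi>) \<xi>)"
  and \<zeta>: "is_arc \<zeta>" "\<zeta> 0 = 0" "fps_convergent (arc_param (arc_den \<zeta>) \<zeta>)"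
  and d: "arc_den \<xi> = arc_den \<zeta>" and c: "char_exponents \<xi> = char_exponents \<zeta>"
 shows "puiseux_char (branch \<xi>) = puiseux_char (branch \<zeta>)"
proof (cases "arc_order \<xi> < 1")
 case False
 then have "\<not> arc_order \<zeta> < 1" using c by (simp add: char_exponents_arc_order[OF \<xi>(1,2)] char_exponents_arc_order[OF \<zeta>(1,2)])
 then show ?thesis using puiseux_char_regular[OF \<xi>(1,2) False] puiseux_char_regular[OF \<zeta>(1,2)] c by simp
next
 case True
 then have o: "arc_order \<zeta> < 1" using c by (simp add: char_exponents_arc_order[OF \<xi>(1,2)] char_exponents_arc_order[OF \<zeta>(1,2)])
 obtain m where m: "0 < m" "m < arc_den \<xi>" "real m / real (arc_den \<xi>) \<in> char_exponents \<xi>"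
  "\<And>c. c \<in> char_exponents \<xi> \<Longrightarrow> real m / real (arc_den \<xi>) \<le> c"
  "puiseux_char (branch \<xi>) = {real j / real m | j. (j = arc_den \<xi> \<and> (\<exists>\<omega>::complex. \<omega> ^ m = 1 \<and> \<omega> ^ arc_den \<xi> \<noteq> 1)) \<or>
    (\<exists>k>0. j = arc_den \<xi> + k \<and> real (m + k) / real (arc_den \<xi>) \<in> char_exponents \<xi>)}"
  using puiseux_char_swap[OF \<xi>(1,2) True \<xi>(3)] by blast
 obtain m' where m': "0 < m'" "m' < arc_den \<zeta>" "real m' / real (arc_den \<zeta>) \<in> char_exponents \<zeta>"
  "\<And>c. c \<in> char_exponents \<zeta> \<Longrightarrow> real m' / real (arc_den \<zeta>) \<le> c"
  "puiseux_char (branch \<zeta>) = {real j / real m' | j. (j = arc_den \<zeta> \<and> (\<exists>\<omega>::complex. \<omega> ^ m' = 1 \<and> \<omega> ^ arc_den \<zeta> \<noteq> 1)) \<or>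
    (\<exists>k>0. j = arc_den \<zeta> + k \<and> real (m' + k) / real (arc_den \<zeta>) \<in> char_exponents \<zeta>)}"
  using puiseux_char_swap[OF \<zeta>(1,2) o \<zeta>(3)] by blast
 have "real m / real (arc_den \<xi>) = real m' / real (arc_den \<xi>)"
  using m(4)[OF m'(3)[folded c]] m'(4)[OF m(3)[unfolded c]] unfolding d by (rule antisym)
 then have "m = m'" using m(2) by simp
 then show ?thesis using m(5) m'(5) c d by simp
qed

section \<open>Equisingularity of products over arcs\<close>

definition conv_arc :: "arc \<Rightarrow> bool" where
 "conv_arc \<xi> \<longleftrightarrow> is_arc \<xi> \<and> \<xi> 0 = 0 \<and> (\<forall>n. arc_denom n \<xi> \<longrightarrow> fps_convergent (arc_param n \<xi>))"

lemma conv_arcD: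
 assumes "conv_arc \<xi>"
 shows "is_arc \<xi>" "\<xi> 0 = 0" "arc_denom n \<xi> \<Longrightarrow> fps_convergent (arc_param n \<xi>)" using assms by (auto simp: conv_arc_def)

lemma branch_carrier:
 assumes "conv_arc \<xi>"
 shows "branch \<xi> \<in> carrier Cxy" "ring_irreducible\<^bsub>Cxy\<^esub> (branch \<xi>)"
 using branch_convergent[OF arc_den] branch_irreducible[OF arc_den] conv_arcD[OF assms]
  arc_den by (auto simp: Cxy_simps)

lemma branch_not_associated:
 assumes \<xi>: "conv_arc \<xi>" and \<zeta>: "conv_arc \<zeta>" and ne: "orb \<xi> \<noteq> orb \<zeta>"
 shows "\<not> branch \<xi> \<sim>\<^bsub>Cxy\<^esub> branch \<zeta>"
proof
 assume "branch \<xi> \<sim>\<^bsub>Cxy\<^esub> branch \<zeta>"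
 then obtain c where c: "c \<in> carrier Cxy" "branch \<zeta> = branch \<xi> * c" by (auto simp: associated_def factor_def)
 have "branch \<zeta> \<noteq> 0" using branch_carrier(2)[OF \<zeta>] by (auto simp: ring_irreducible_def)
 then have "c \<noteq> 0" using c(2) by auto
 then obtain E C where C: "np_factorization c E C" using newton_puiseux[of c] c(1) by (metis Cxy_simps(1) mem_Collect_eq)
 have "mset_set (orb \<zeta>) = mset_set (orb \<xi>) + C"
  using np_factorization_unique[OF np_factorization_branch[OF conv_arcD(1,2)[OF \<zeta>]]]
   np_factorization_mult[OF np_factorization_branch[OF conv_arcD(1,2)[OF \<xi>]] C] c(2) by metis
 moreover have "\<xi> \<in># mset_set (orb \<xi>)" using finite_orb[OF conv_arcD(1)[OF \<xi>]] by simp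
 ultimately have "\<xi> \<in># mset_set (orb \<zeta>)" by simp
 then have "\<xi> \<in> orb \<zeta>" using finite_orb[OF conv_arcD(1)[OF \<zeta>]] by simp
 then show False using orb_eq[OF conv_arcD(1)[OF \<zeta>]] ne by blast
qed

lemma conv_arc_orb:
 assumes "conv_arc \<xi>" "\<zeta> \<in> orb \<xi>"
 shows "conv_arc \<zeta>"
proof -
 obtain k where k: "\<zeta> = conj_arc k \<xi>" using assms(2) by (auto simp: orb_def)
 have "fps_convergent (arc_param n \<zeta>)" if n: "arc_denom n \<zeta>" for n
 proof -
  have "fps_convergent (arc_param n \<xi>)" using conv_arcD(3)[OF assms(1)] n k by simp
  then show ?thesis using fps_convergent_twist by (simp add: k arc_param_conj[OF arc_denom_pos[OF n]])
 qed
 moreover have "is_arc \<zeta>" "\<zeta> 0 = 0" using conv_arcD(1,2)[OF assms(1)] by (auto simp: k)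
 ultimately show ?thesis by (simp add: conv_arc_def)
qed

lemma int_mult_branches:
 assumes \<xi>: "conv_arc \<xi>" and \<zeta>: "conv_arc \<zeta>" and ne: "orb \<xi> \<noteq> orb \<zeta>"
 obtains s where "int_mult (branch \<xi>) (branch \<zeta>) = enat s"
  "real s = (\<Sum>\<beta>\<in>orb \<zeta>. \<Sum>\<alpha>\<in>orb \<xi>. rcontact \<beta> \<alpha>)"
proof -
 define n where "n = arc_den \<zeta>"
 have n: "arc_denom n \<zeta>" unfolding n_def by (rule arc_den[OF conv_arcD(1)[OF \<zeta>]])
 note n0 = arc_denom_pos[OF n]
 have fin: "finite (orb \<xi>)" "finite (orb \<zeta>)" using finite_orb conv_arcD(1) \<xi> \<zeta> by blast+
 have disj: "\<beta> \<notin> orb \<xi>" if "\<beta> \<in> orb \<zeta>" for \<beta>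
  using that orb_eq[OF conv_arcD(1)[OF \<zeta>]] orb_eq[OF conv_arcD(1)[OF \<xi>]] ne by blast
 note np = np_factorization_branch[OF conv_arcD(1,2)[OF \<xi>]]
 have o: "arc_ev n \<beta> (branch \<xi>) \<noteq> 0 \<and> real (subdegree (arc_ev n \<beta> (branch \<xi>))) = real n * (\<Sum>\<alpha>\<in>orb \<xi>. rcontact \<beta> \<alpha>)"
  if \<beta>: "\<beta> \<in> orb \<zeta>" for \<beta>
 proof -
  have "is_arc \<beta>" "\<beta> 0 = 0" using conv_arcD(1,2)[OF conv_arc_orb[OF \<zeta> \<beta>]] .
  moreover have "\<beta> \<notin># mset_set (orb \<xi>)" using disj[OF \<beta>] fin by simp
  moreover have "arc_denom n \<beta>" using orb_arc(2)[OF \<beta>] n by blast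
  ultimately show ?thesis using np_arc_ev[OF np, of \<beta> n] by (simp add: sum_unfold_sum_mset)
 qed
 obtain s where s: "int_mult (branch \<xi>) (arc_prod (mset_set (orb \<zeta>))) = enat s"
  "n * s = (\<Sum>\<gamma>\<in>#mset_set (orb \<zeta>). subdegree (arc_ev n \<gamma> (branch \<xi>)))"
 proof (rule int_mult_arc_prod[of "branch \<xi>" "mset_set (orb \<zeta>)" n])
  show "germ_convergent (branch \<xi>)" using branch_carrier(1)[OF \<xi>] by simp
  show "conj_stable (mset_set (orb \<zeta>))" by (rule conj_stable_orb[OF conv_arcD(1)[OF \<zeta>]])
  fix \<beta> assume "\<beta> \<in># mset_set (orb \<zeta>)"
  then have \<beta>: "\<beta> \<in> orb \<zeta>" using fin by simp
  have "arc_denom n \<beta>" using orb_arc(2)[OF \<beta>] n by blast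
  then show "arc_denom n \<beta> \<and> \<beta> 0 = 0 \<and> fps_convergent (arc_param n \<beta>)"
   using conv_arcD(2,3)[OF conv_arc_orb[OF \<zeta> \<beta>]] by blast
  show "arc_ev n \<beta> (branch \<xi>) \<noteq> 0" using o[OF \<beta>] by blast
 qed (rule n0)
 have "real n * real s = (\<Sum>\<beta>\<in>orb \<zeta>. real (subdegree (arc_ev n \<beta> (branch \<xi>))))"
  using arg_cong[OF s(2), of real] by (simp add: sum_unfold_sum_mset[symmetric])
 also have "\<dots> = real n * (\<Sum>\<beta>\<in>orb \<zeta>. \<Sum>\<alpha>\<in>orb \<xi>. rcontact \<beta> \<alpha>)" using o by (simp add: sum_distrib_left)
 finally have "real s = (\<Sum>\<beta>\<in>orb \<zeta>. \<Sum>\<alpha>\<in>orb \<xi>. rcontact \<beta> \<alpha>)" using n0 by simp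
 then show ?thesis using that s(1) by (simp add: branch_def)
qed

lemma in_repeat_mset: "\<gamma> \<in># repeat_mset k M \<Longrightarrow> \<gamma> \<in># M" by (induction k) auto

lemma conj_stable_repeat: "conj_stable M \<Longrightarrow> conj_stable (repeat_mset k M)" by (induction k) (auto simp: conj_stable_def)

lemma arc_prod_repeat:
 assumes "conj_stable M" "\<And>\<gamma>. \<gamma> \<in># M \<Longrightarrow> is_arc \<gamma>"
 shows "arc_prod (repeat_mset k M) = arc_prod M ^ k"
proof (induction k)
 case (Suc k)
 have "arc_prod (M + repeat_mset k M) = arc_prod M * arc_prod (repeat_mset k M)"
  using assms by (intro arc_prod_union conj_stable_repeat) (auto dest: in_repeat_mset)
 then show ?case using Suc by simp
qed simp

lemma arc_prod_sum:
 assumes "finite I" "\<And>i. i \<in> I \<Longrightarrow> conj_stable (M i)" "\<And>i \<gamma>. i \<in> I \<Longrightarrow> \<gamma> \<in># M i \<Longrightarrow> is_arc \<gamma>"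
 shows "arc_prod (\<Sum>i\<in>I. M i) = (\<Prod>i\<in>I. arc_prod (M i)) \<and> conj_stable (\<Sum>i\<in>I. M i)" using assms
proof (induction I rule: finite_induct)
 case empty
 then show ?case by (simp add: conj_stable_def)
next
 case (insert i I)
 then have IH: "arc_prod (\<Sum>i\<in>I. M i) = (\<Prod>i\<in>I. arc_prod (M i))" "conj_stable (\<Sum>i\<in>I. M i)" by auto
 have "arc_prod (M i + (\<Sum>i\<in>I. M i)) = arc_prod (M i) * arc_prod (\<Sum>i\<in>I. M i)"
  using insert IH by (intro arc_prod_union) (auto simp: set_mset_sum)
 moreover have "conj_stable (M i + (\<Sum>i\<in>I. M i))" using insert IH(2) by (intro conj_stable_union) auto
 ultimately show ?case using insert IH by simp
qed

lemma orb_subset_mset: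
 assumes "conj_stable T" "\<xi> \<in># T"
 shows "orb \<xi> \<subseteq> set_mset T"
proof
 fix \<zeta> assume "\<zeta> \<in> orb \<xi>"
 then obtain k where "\<zeta> = conj_arc k \<xi>" by (auto simp: orb_def)
 then show "\<zeta> \<in># T" using count_conj_stable[OF assms(1)] assms(2) by (metis count_greater_zero_iff)
qed

lemma count_orb:
 assumes "conj_stable T" "\<zeta> \<in> orb \<xi>"
 shows "count T \<zeta> = count T \<xi>" using assms(2) count_conj_stable[OF assms(1)] by (auto simp: orb_def)

lemma branch_decomp_arc_prod:
 assumes T: "conj_stable T" "\<And>\<xi>. \<xi> \<in># T \<Longrightarrow> conv_arc \<xi>"
  and r: "\<And>i. i < k \<Longrightarrow> r i \<in># T" "bij_betw (\<lambda>i. orb (r i)) {..<k} (orb ` set_mset T)"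
 shows "branch_decomp (arc_prod T) k (\<lambda>i. branch (r i)) (\<lambda>i. count T (r i))"
proof -
 have inj: "orb (r i) \<noteq> orb (r j)" if "i < k" "j < k" "i \<noteq> j" for i j
  using bij_betw_imp_inj_on[OF r(2)] that by (auto simp: inj_on_def)
 have fin: "finite (orb (r i))" if "i < k" for i using finite_orb conv_arcD(1) T(2) r(1) that by blast
 have "T = (\<Sum>i<k. repeat_mset (count T (r i)) (mset_set (orb (r i))))"
 proof (rule multiset_eqI)
  fix \<xi>
  have c: "count (\<Sum>i<k. repeat_mset (count T (r i)) (mset_set (orb (r i)))) \<xi> =
    (\<Sum>i<k. if \<xi> \<in> orb (r i) then count T \<xi> else 0)"
   unfolding count_sum using fin count_orb[OF T(1)] by (intro sum.cong) auto
  show "count T \<xi> = count (\<Sum>i<k. repeat_mset (count T (r i)) (mset_set (orb (r i)))) \<xi>"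
  proof (cases "\<xi> \<in># T")
   case True
   then obtain j where j: "j < k" "orb \<xi> = orb (r j)" using bij_betw_imp_surj_on[OF r(2)] by blast
   have "\<xi> \<in> orb (r i) \<longleftrightarrow> i = j" if "i < k" for i
   proof
    assume "\<xi> \<in> orb (r i)"
    then have "orb \<xi> = orb (r i)" by (rule orb_eq[OF conv_arcD(1)[OF T(2)[OF r(1)[OF that]]]])
    then show "i = j" using inj[OF that j(1)] j(2) by metis
   qed (use self_in_orb[of \<xi>] j(2) in simp)
   then have "(\<Sum>i<k. if \<xi> \<in> orb (r i) then count T \<xi> else 0) = (\<Sum>i<k. if i = j then count T \<xi> else 0)"
    by (intro sum.cong) auto
   then show ?thesis unfolding c using j(1) by simp
  next
   case False
   then have "\<not> \<xi> \<in> orb (r i)" if "i < k" for i using orb_subset_mset[OF T(1) r(1)[OF that]] by blast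
   then show ?thesis unfolding c using False by (simp add: not_in_iff)
  qed
 qed
 then have "arc_prod T = arc_prod (\<Sum>i<k. repeat_mset (count T (r i)) (mset_set (orb (r i))))" by simp
 also have "\<dots> = (\<Prod>i<k. arc_prod (repeat_mset (count T (r i)) (mset_set (orb (r i)))))"
 proof -
  have "conj_stable (repeat_mset (count T (r i)) (mset_set (orb (r i))))" if "i \<in> {..<k}" for i
   using conj_stable_repeat conj_stable_orb conv_arcD(1) T(2) r(1) that by blast
  moreover have "is_arc \<gamma>" if "i \<in> {..<k}" "\<gamma> \<in># repeat_mset (count T (r i)) (mset_set (orb (r i)))" for i \<gamma>
  proof -
   have "\<gamma> \<in> orb (r i)" using that fin by (auto dest: in_repeat_mset)
   then show ?thesis using orb_arc(1) conv_arcD(1) T(2) r(1) that(1) by blast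
  qed
  ultimately show ?thesis using arc_prod_sum[of "{..<k}" "\<lambda>i. repeat_mset (count T (r i)) (mset_set (orb (r i)))"] by blast
 qed
 also have "\<dots> = (\<Prod>i<k. branch (r i) ^ count T (r i))"
 proof (rule prod.cong)
  fix i assume i: "i \<in> {..<k}"
  have arc: "is_arc (r i)" using conv_arcD(1) T(2) r(1) i by blast
  show "arc_prod (repeat_mset (count T (r i)) (mset_set (orb (r i)))) = branch (r i) ^ count T (r i)"
   unfolding branch_def using conj_stable_orb[OF arc] orb_arc(1) arc fin[of i] i by (intro arc_prod_repeat) auto
 qed simp
 finally have prod: "arc_prod T = 1 * (\<Prod>i<k. branch (r i) ^ count T (r i))" by simp
 have "germ_convergent 1" using arc_prod_convergent[of "{#}" 1] by (simp add: conj_stable_def)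
 then have one: "1 \<in> Units Cxy" by (simp add: Units_Cxy)
 show ?thesis unfolding branch_decomp_def
 proof (intro conjI allI impI)
  fix i assume i: "i < k"
  show "branch (r i) \<in> carrier Cxy" "ring_irreducible\<^bsub>Cxy\<^esub> (branch (r i))" using branch_carrier T(2) r(1) i by blast+
  show "0 < count T (r i)" using r(1)[OF i] by simp
 next
  fix i j assume "i < k" "j < k" "i \<noteq> j"
  then show "\<not> branch (r i) \<sim>\<^bsub>Cxy\<^esub> branch (r j)" using branch_not_associated T(2) r(1) inj by blast
 next
  show "\<exists>u\<in>Units Cxy. arc_prod T = u * (\<Prod>i<k. branch (r i) ^ count T (r i))" using prod one by blast
 qed
qed

text \<open>
  The branches are the orbits of the roots with their multiplicities, and the intersection number of two
  branches is the sum of the contact orders of their roots.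
\<close>

theorem equisingular_arc_prod:
 assumes T: "conj_stable T" "\<And>\<xi>. \<xi> \<in># T \<Longrightarrow> conv_arc \<xi>"
  and T': "conj_stable T'" "\<And>\<xi>. \<xi> \<in># T' \<Longrightarrow> conv_arc \<xi>"
  and \<Psi>: "bij_betw \<Psi> (orb ` set_mset T) (orb ` set_mset T')"
  and same: "\<And>\<xi> \<xi>'. \<xi> \<in># T \<Longrightarrow> \<xi>' \<in># T' \<Longrightarrow> \<Psi> (orb \<xi>) = orb \<xi>' \<Longrightarrow>
   count T \<xi> = count T' \<xi>' \<and> arc_den \<xi> = arc_den \<xi>' \<and> char_exponents \<xi> = char_exponents \<xi>'"
  and sums: "\<And>A B. A \<in> orb ` set_mset T \<Longrightarrow> B \<in> orb ` set_mset T \<Longrightarrow> A \<noteq> B \<Longrightarrow>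
   (\<Sum>\<beta>\<in>B. \<Sum>\<alpha>\<in>A. rcontact \<beta> \<alpha>) = (\<Sum>\<beta>\<in>\<Psi> B. \<Sum>\<alpha>\<in>\<Psi> A. rcontact \<beta> \<alpha>)"
 shows "zariski_equisingular (arc_prod T) (arc_prod T')"
proof -
 let ?O = "orb ` set_mset T" and ?O' = "orb ` set_mset T'"
 define k where "k = card ?O"
 obtain e where e: "bij_betw e {..<k} ?O" using ex_bij_betw_nat_finite[of ?O] by (auto simp: k_def atLeast0LessThan)
 have "\<exists>r. \<forall>i<k. r i \<in># T \<and> orb (r i) = e i"
  using bij_betwE[OF e] by (intro choice) (auto simp: image_iff, metis lessThan_iff)
 then obtain r where r: "\<And>i. i < k \<Longrightarrow> r i \<in># T" "\<And>i. i < k \<Longrightarrow> orb (r i) = e i" by blast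
 have e': "bij_betw (\<lambda>i. \<Psi> (e i)) {..<k} ?O'" using bij_betw_trans[OF e \<Psi>] by (simp add: comp_def)
 have "\<exists>r. \<forall>i<k. r i \<in># T' \<and> orb (r i) = \<Psi> (e i)"
  using bij_betwE[OF e'] by (intro choice) (auto simp: image_iff, metis lessThan_iff)
 then obtain r' where r': "\<And>i. i < k \<Longrightarrow> r' i \<in># T'" "\<And>i. i < k \<Longrightarrow> orb (r' i) = \<Psi> (e i)" by blast
 have b: "bij_betw (\<lambda>i. orb (r i)) {..<k} ?O" using e r(2) by (subst bij_betw_cong[of _ _ e]) auto
 have b': "bij_betw (\<lambda>i. orb (r' i)) {..<k} ?O'" using e' r'(2) by (subst bij_betw_cong[of _ _ "\<lambda>i. \<Psi> (e i)"]) auto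
 have s: "count T (r i) = count T' (r' i) \<and> arc_den (r i) = arc_den (r' i) \<and> char_exponents (r i) = char_exponents (r' i)"
  if "i < k" for i using same[OF r(1)[OF that] r'(1)[OF that]] r(2)[OF that] r'(2)[OF that] by simp
 have d: "branch_decomp (arc_prod T) k (\<lambda>i. branch (r i)) (\<lambda>i. count T (r i))" by (rule branch_decomp_arc_prod[OF T r(1) b])
 have d': "branch_decomp (arc_prod T') k (\<lambda>i. branch (r' i)) (\<lambda>i. count T (r i))"
 proof -
  have "branch_decomp (arc_prod T') k (\<lambda>i. branch (r' i)) (\<lambda>i. count T' (r' i))"
   by (rule branch_decomp_arc_prod[OF T' r'(1) b'])
  then show ?thesis using s by (simp add: branch_decomp_def)
 qed
 have pc: "puiseux_char (branch (r i)) = puiseux_char (branch (r' i))" if i: "i < k" for i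
 proof -
  note c = T(2)[OF r(1)[OF i]] and c' = T'(2)[OF r'(1)[OF i]]
  show ?thesis using s[OF i] conv_arcD(3)[OF c arc_den[OF conv_arcD(1)[OF c]]]
    conv_arcD(3)[OF c' arc_den[OF conv_arcD(1)[OF c']]]
   by (intro puiseux_char_eq conv_arcD(1,2)[OF c] conv_arcD(1,2)[OF c']) auto
 qed
 have im: "int_mult (branch (r i)) (branch (r j)) = int_mult (branch (r' i)) (branch (r' j))"
  if i: "i < k" and j: "j < k" and ij: "i \<noteq> j" for i j
 proof -
  have ne: "orb (r i) \<noteq> orb (r j)" using bij_betw_imp_inj_on[OF b] i j ij by (auto simp: inj_on_def)
  have ne': "orb (r' i) \<noteq> orb (r' j)" using bij_betw_imp_inj_on[OF b'] i j ij by (auto simp: inj_on_def)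
  obtain s where s: "int_mult (branch (r i)) (branch (r j)) = enat s"
   "real s = (\<Sum>\<beta>\<in>orb (r j). \<Sum>\<alpha>\<in>orb (r i). rcontact \<beta> \<alpha>)"
   by (rule int_mult_branches[OF T(2)[OF r(1)[OF i]] T(2)[OF r(1)[OF j]] ne])
  obtain s' where s': "int_mult (branch (r' i)) (branch (r' j)) = enat s'"
   "real s' = (\<Sum>\<beta>\<in>orb (r' j). \<Sum>\<alpha>\<in>orb (r' i). rcontact \<beta> \<alpha>)"
   by (rule int_mult_branches[OF T'(2)[OF r'(1)[OF i]] T'(2)[OF r'(1)[OF j]] ne'])
  have "real s = real s'" unfolding s(2) s'(2) using sums[of "orb (r i)" "orb (r j)"] ne r(1)[OF i] r(1)[OF j]
   unfolding r(2)[OF i] r(2)[OF j] r'(2)[OF i] r'(2)[OF j] by (metis imageI r(2)[OF i] r(2)[OF j])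
  then show ?thesis using s(1) s'(1) by simp
 qed
 show ?thesis unfolding zariski_equisingular_def using d d' pc im by blast
qed

lemma bij_by_key:
 fixes key :: "'a \<Rightarrow> 'c" and key' :: "'b \<Rightarrow> 'c"
 assumes "finite A" "finite B" "\<And>c. card {a \<in> A. key a = c} = card {b \<in> B. key' b = c}"
 obtains \<Psi> where "bij_betw \<Psi> A B" "\<And>a. a \<in> A \<Longrightarrow> key' (\<Psi> a) = key a"
proof -
 have "\<exists>\<Psi>. bij_betw \<Psi> {a \<in> A. key a = c} {b \<in> B. key' b = c}" for c using assms by (intro finite_same_card_bij) auto
 then obtain \<Psi> where \<Psi>: "\<And>c. bij_betw (\<Psi> c) {a \<in> A. key a = c} {b \<in> B. key' b = c}" by metis
 have m: "\<Psi> (key a) a \<in> B \<and> key' (\<Psi> (key a) a) = key a" if "a \<in> A" for a using bij_betwE[OF \<Psi>[of "key a"]] that by blast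
 have "bij_betw (\<lambda>a. \<Psi> (key a) a) A B"
 proof (intro bij_betw_imageI inj_onI subset_antisym image_subsetI subsetI)
  fix a a' assume a: "a \<in> A" "a' \<in> A" "\<Psi> (key a) a = \<Psi> (key a') a'"
  then have k: "key a = key a'" using m by metis
  then show "a = a'" using a inj_onD[OF bij_betw_imp_inj_on[OF \<Psi>[of "key a"]]] by simp
 next
  fix b assume b: "b \<in> B"
  then have "b \<in> \<Psi> (key' b) ` {a \<in> A. key a = key' b}" using bij_betw_imp_surj_on[OF \<Psi>[of "key' b"]] by blast
  then obtain a where "a \<in> A" "key a = key' b" "b = \<Psi> (key' b) a" by blast
  then show "b \<in> (\<lambda>a. \<Psi> (key a) a) ` A" by (intro image_eqI[of _ _ a]) simp_all
 qed (use m in blast)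
 then show ?thesis using that m by blast
qed

section \<open>The truncated polar factor\<close>

text \<open>The denominator of \<open>\<lambda>\<^sub>B + a y\<^sup>h\<close> with \<open>a \<noteq> 0\<close>, if \<open>d\<close> is that of \<open>\<lambda>\<^sub>B\<close>.\<close>

definition extended_den :: "nat \<Rightarrow> real \<Rightarrow> nat" where
 "extended_den d h = (LEAST n. 0 < n \<and> d dvd n \<and> real n * h \<in> \<int>)"

text \<open>
  How many of the orbits with \<open>M\<close> elements altogether have \<open>s\<close> elements, if all have \<open>d\<close> or \<open>D\<close> and, for
  \<open>d < D\<close>, at most one has \<open>d\<close>: this one exists iff \<open>M\<close> is not a multiple of \<open>D\<close>.
\<close>

definition orbit_number :: "nat \<Rightarrow> nat \<Rightarrow> nat \<Rightarrow> nat \<Rightarrow> nat" where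
 "orbit_number d D M s = (if s = d then if D = d then M div d else M mod D div d else if s = D then M div D else 0)"

lemma orbit_number_eq:
 assumes fin: "finite A" and d: "0 < d" "d \<le> D"
  and size: "\<And>a. a \<in> A \<Longrightarrow> sz a = d \<or> sz a = D"
  and one: "D \<noteq> d \<Longrightarrow> card {a \<in> A. sz a = d} \<le> 1"
 shows "card {a \<in> A. sz a = s} = orbit_number d D (\<Sum>a\<in>A. sz a) s"
proof (cases "D = d")
 case True
 then have sz: "\<And>a. a \<in> A \<Longrightarrow> sz a = d" using size by blast
 then have "(\<Sum>a\<in>A. sz a) = card A * d" by simp
 moreover have "{a \<in> A. sz a = s} = (if s = d then A else {})" using sz by auto
 ultimately show ?thesis using d(1) True by (simp add: orbit_number_def)
next
 case False
 let ?S = "{a \<in> A. sz a = d}" and ?L = "{a \<in> A. sz a = D}"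
 have "A = ?S \<union> ?L" "?S \<inter> ?L = {}" using size False by auto
 then have "(\<Sum>a\<in>A. sz a) = (\<Sum>a\<in>?S. sz a) + (\<Sum>a\<in>?L. sz a)"
  using fin by (metis (no_types, lifting) finite_Un sum.union_disjoint)
 also have "\<dots> = card ?S * d + card ?L * D" by simp
 finally have M: "(\<Sum>a\<in>A. sz a) = card ?S * d + card ?L * D" .
 have S: "card ?S * d < D"
 proof -
  have "card ?S * d \<le> 1 * d" using one[OF False] by (rule mult_right_mono) simp
  then show ?thesis using d(2) False by linarith
 qed
 have "(card ?S * d + card ?L * D) mod D = card ?S * d" "(card ?S * d + card ?L * D) div D = card ?L" using S by simp_all
 moreover have "card {a \<in> A. sz a = s} = 0" if "s \<noteq> d" "s \<noteq> D"
 proof -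
  have "{a \<in> A. sz a = s} = {}" using size that by auto
  then show ?thesis by (simp only: card.empty)
 qed
 ultimately show ?thesis unfolding M orbit_number_def using d(1) False by (cases "s = d"; cases "s = D") simp_all
qed

context mero_pair
begin

context
 fixes B \<BB> assumes B: "B \<in> bars f g" and \<BB>: "\<BB> = range (\<lambda>k. conj_bar k B)"
  and h: "0 < snd B" and nc: "noncollinear_class f g \<BB>"
begin

private lemmas cls = class_bars[OF B \<BB> h nc] class_height[OF B \<BB> h nc]

private abbreviation "T \<equiv> image_mset (truncation f g) (class_polar_roots f g \<BB>)"

private lemma ob: "C \<in> \<BB> \<Longrightarrow> \<exists>k. C = conj_bar k B" unfolding \<BB> by blast

private lemma finite_\<BB>: "finite \<BB>" unfolding \<BB> by (rule finite_class[OF B])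

lemma class_unique: "C \<in> \<BB> \<Longrightarrow> D \<in> \<BB> \<Longrightarrow> above C \<alpha> \<Longrightarrow> above D \<alpha> \<Longrightarrow> C = D"
 using above_same_height[OF cls(1) cls(1)] cls(2) by metis

lemma bar_arc_class_inj: "inj_on bar_arc \<BB>"
proof (rule inj_onI)
 fix C D assume C: "C \<in> \<BB>" "D \<in> \<BB>" "bar_arc C = bar_arc D"
 have "above C (bar_arc C)" "above D (bar_arc C)" unfolding above_def using C(3) by simp_all
 then show "C = D" by (rule class_unique[OF C(1,2)])
qed

text \<open>The class thus corresponds to the conjugates of \<open>\<lambda>\<^sub>B\<close>, whose number is the denominator of \<open>\<lambda>\<^sub>B\<close>.\<close>

lemma bar_arc_class: "bar_arc ` \<BB> = orb (bar_arc B)" unfolding orb_def \<BB> image_image bar_arc_conj[OF B] ..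

lemma arc_den_class:
 assumes C: "C \<in> \<BB>"
 shows "arc_den (bar_arc C) = card \<BB>"
proof -
 have "bar_arc C \<in> orb (bar_arc B)" using C bar_arc_class by blast
 then have "orb (bar_arc C) = orb (bar_arc B)" by (rule orb_eq[OF bar_arc_arc[OF B]])
 then have "arc_den (bar_arc C) = card (bar_arc ` \<BB>)" using card_orb[OF bar_arc_arc[OF cls(1)[OF C]]] bar_arc_class by simp
 then show ?thesis using card_image[OF bar_arc_class_inj] by simp
qed

lemma card_class_pos: "0 < card \<BB>" using finite_\<BB> self_in_class[OF B \<BB> h nc] card_gt_0_iff by blast

lemma arc_denom_bar_arc_at:
 assumes C: "C \<in> \<BB>"
 shows "arc_denom n (bar_arc_at C a) \<longleftrightarrow> 0 < n \<and> card \<BB> dvd n \<and> (a \<noteq> 0 \<longrightarrow> real n * snd B \<in> \<int>)"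
proof -
 have s: "snd C = snd B" by (rule cls(2)[OF C])
 have "arc_denom n (bar_arc_at C a) \<longleftrightarrow> arc_denom n (bar_arc C) \<and> (a \<noteq> 0 \<longrightarrow> real n * snd B \<in> \<int>)"
  unfolding arc_denom_iff bar_arc_at_def s using h bar_arc_ge[of C "snd B"] s by auto
 then show ?thesis using arc_denom_iff_dvd[OF bar_arc_arc[OF cls(1)[OF C]]] arc_den_class[OF C] by auto
qed

lemma arc_den_bar_arc_at:
 assumes C: "C \<in> \<BB>"
 shows "arc_den (bar_arc_at C a) = (if a = 0 then card \<BB> else extended_den (card \<BB>) (snd B))"
proof (cases "a = 0")
 case True
 have "bar_arc_at C 0 = bar_arc C" using bar_arc_ge[of C "snd C"] by (auto simp: bar_arc_at_def)
 then show ?thesis using True arc_den_class[OF C] by simp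
next
 case False
 then show ?thesis by (simp add: arc_den_def arc_denom_bar_arc_at[OF C] extended_den_def)
qed

lemma extended_den_class:
 "card \<BB> \<le> extended_den (card \<BB>) (snd B)"
 "extended_den (card \<BB>) (snd B) = card \<BB> \<longleftrightarrow> snd B * real (card \<BB>) \<in> \<int>"
proof -
 let ?d = "card \<BB>" and ?D = "extended_den (card \<BB>) (snd B)"
 note self = self_in_class[OF B \<BB> h nc]
 have "arc_denom ?D (bar_arc_at B 1)"
  using arc_den[OF is_arc_bar_arc_at[OF B], of 1] arc_den_bar_arc_at[OF self, of 1] by simp
 then have D: "0 < ?D" "?d dvd ?D" "real ?D * snd B \<in> \<int>" using arc_denom_bar_arc_at[OF self] by auto
 show "?d \<le> ?D" using D by (simp add: dvd_imp_le)
 show "?D = ?d \<longleftrightarrow> snd B * real ?d \<in> \<int>"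
 proof
  assume "?D = ?d" then show "snd B * real ?d \<in> \<int>" using D(3) by (simp add: mult.commute)
 next
  assume "snd B * real ?d \<in> \<int>"
  then have "?D \<le> ?d" using card_class_pos unfolding extended_den_def by (intro Least_le) (simp add: mult.commute)
  then show "?D = ?d" using \<open>?d \<le> ?D\<close> by simp
 qed
qed

text \<open>The term \<open>a y\<^sup>h\<close> is characteristic iff it enlarges the denominator.\<close>

lemma char_exponents_bar_arc_at:
 assumes C: "C \<in> \<BB>"
 shows "char_exponents (bar_arc_at C a) = char_exponents (bar_arc B) \<union>
  (if arc_den (bar_arc_at C a) = card \<BB> then {} else {snd B})"
proof -
 have s: "snd C = snd B" by (rule cls(2)[OF C])
 have t1: "arc_trunc e (bar_arc_at C a) = arc_trunc e (bar_arc C)" if "e \<le> snd B" for e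
  using that s by (auto simp: arc_trunc_def bar_arc_at_def)
 have t2: "arc_trunc (snd B) (bar_arc C) = bar_arc C" using s bar_arc_ge[of C] by (auto simp: arc_trunc_def)
 have e: "e \<in> char_exponents (bar_arc_at C a) \<longleftrightarrow>
   e \<in> char_exponents (bar_arc C) \<or> (e = snd B \<and> a \<noteq> 0 \<and> snd B * real (card \<BB>) \<notin> \<int>)" for e
 proof (cases e "snd B" rule: linorder_cases)
  case less
  then have "bar_arc_at C a e = bar_arc C e" using s by (simp add: bar_arc_at_def)
  then show ?thesis using less t1[of e] by (simp add: char_exponents_def)
 next
  case equal
  have "bar_arc C (snd B) = 0" using bar_arc_ge[of C "snd B"] s by simp
  then show ?thesis using equal t1[of "snd B"] t2 arc_den_class[OF C] s by (simp add: char_exponents_def bar_arc_at_def)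
 next
  case greater
  then have "bar_arc C e = 0" "bar_arc_at C a e = 0" using bar_arc_ge[of C e] s by (simp_all add: bar_arc_at_def)
  then show ?thesis using greater by (simp add: char_exponents_def)
 qed
 have "bar_arc C \<in> orb (bar_arc B)" using C bar_arc_class by blast
 then have "char_exponents (bar_arc C) = char_exponents (bar_arc B)" by (rule char_exponents_orb[OF bar_arc_arc[OF B]])
 moreover have "arc_den (bar_arc_at C a) \<noteq> card \<BB> \<longleftrightarrow> a \<noteq> 0 \<and> snd B * real (card \<BB>) \<notin> \<int>"
  using arc_den_bar_arc_at[OF C, of a] extended_den_class(2) by simp
 ultimately show ?thesis using e by auto
qed

text \<open>
  The contact order of distinct arcs \<open>\<lambda>\<^sub>C + a y\<^sup>h\<close> and \<open>\<lambda>\<^sub>D + b y\<^sup>h\<close>, which does not depend on \<open>a\<close> and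
  \<open>b\<close>; over a single bar it is the height.
\<close>

definition bar_contact :: "bar \<Rightarrow> bar \<Rightarrow> real" where
 "bar_contact C D = (if C = D then snd C else rcontact (bar_arc C) (bar_arc D))"

lemma class_differ:
 assumes "C \<in> \<BB>" "D \<in> \<BB>" "C \<noteq> D"
 obtains e where "e < snd B" "bar_arc C e \<noteq> bar_arc D e"
proof -
 have "bar_arc C \<noteq> bar_arc D" using inj_onD[OF bar_arc_class_inj] assms by blast
 then obtain e where e: "bar_arc C e \<noteq> bar_arc D e" by blast
 moreover have "e < snd B"
 proof (rule ccontr)
  assume "\<not> e < snd B"
  then have "bar_arc C e = 0" "bar_arc D e = 0" using bar_arc_ge[of C e] bar_arc_ge[of D e] cls(2)[OF assms(1)] cls(2)[OF assms(2)] by simp_all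
  then show False using e by simp
 qed
 ultimately show ?thesis using that by blast
qed

lemma rcontact_class_above:
 assumes C: "C \<in> \<BB>" "D \<in> \<BB>" "C \<noteq> D" and ab: "above C \<alpha>" "above D \<beta>" and arcs: "is_arc \<alpha>" "is_arc \<beta>"
 shows "rcontact \<alpha> \<beta> = bar_contact C D"
proof -
 obtain e where e: "e < snd B" "bar_arc C e \<noteq> bar_arc D e" by (rule class_differ[OF C])
 have "contact \<alpha> \<beta> = contact (bar_arc C) (bar_arc D)"
 proof (rule contact_below[OF _ _ e(1) _ arcs])
  fix e assume "e < snd B"
  then show "\<alpha> e = bar_arc C e" "\<beta> e = bar_arc D e" using ab cls(2)[OF C(1)] cls(2)[OF C(2)] by (simp_all add: above_def)
 next
  show "\<alpha> e \<noteq> \<beta> e" using e ab cls(2)[OF C(1)] cls(2)[OF C(2)] by (simp add: above_def)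
 qed
 then show ?thesis using C(3) by (simp add: rcontact_def bar_contact_def)
qed

lemma rcontact_bar_arc_at:
 assumes C: "C \<in> \<BB>" "D \<in> \<BB>" and ne: "bar_arc_at C a \<noteq> bar_arc_at D b"
 shows "rcontact (bar_arc_at C a) (bar_arc_at D b) = bar_contact C D"
proof (cases "C = D")
 case True
 then have "a \<noteq> b" using ne by auto
 then have "contact (bar_arc_at C a) (bar_arc_at D b) = ereal (snd C)"
  unfolding True by (intro contact_eqI) (simp_all add: bar_arc_at_def)
 then show ?thesis using True by (simp add: rcontact_def bar_contact_def)
next
 case False
 then show ?thesis using rcontact_class_above[OF C False] above_bar_arc_at is_arc_bar_arc_at cls(1) C by blast
qed

lemma char_exponents_bar_arc: "char_exponents (bar_arc B) = bar_contact B ` (\<BB> - {B})"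
proof -
 have "contact (bar_arc B) (conj_arc k (bar_arc B)) = ereal e \<longleftrightarrow>
   conj_bar k B \<noteq> B \<and> e = bar_contact B (conj_bar k B)" for k e
 proof (cases "conj_bar k B = B")
  case True
  then have "conj_arc k (bar_arc B) = bar_arc B" using bar_arc_conj[OF B, of k] by simp
  then show ?thesis using True by simp
 next
  case False
  have k: "conj_bar k B \<in> \<BB>" unfolding \<BB> by blast
  obtain e' where "bar_arc B e' \<noteq> bar_arc (conj_bar k B) e'"
   using class_differ[OF self_in_class[OF B \<BB> h nc] k] False by metis
  then have "bar_arc B \<noteq> conj_arc k (bar_arc B)" using bar_arc_conj[OF B, of k] by auto
  then have "contact (bar_arc B) (conj_arc k (bar_arc B)) = ereal (rcontact (bar_arc B) (conj_arc k (bar_arc B)))"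
   using bar_arc_arc[OF B] by (intro ereal_rcontact) auto
  then show ?thesis using False by (auto simp: bar_contact_def bar_arc_conj[OF B])
 qed
 then have "char_exponents (bar_arc B) = {e. \<exists>k. conj_bar k B \<noteq> B \<and> e = bar_contact B (conj_bar k B)}"
  unfolding char_exponents_eq[OF bar_arc_arc[OF B]] by simp
 then show ?thesis unfolding \<BB> by auto
qed

subsection \<open>Orbits of truncated polar roots\<close>

lemma truncated_obtain:
 assumes "\<xi> \<in># T"
 obtains C a where "C \<in> \<BB>" "a \<in> pure_zeros f g C" "\<xi> = bar_arc_at C a"
proof -
 have "\<xi> \<in> (\<lambda>(C, a). bar_arc_at C a) ` Sigma \<BB> (pure_zeros f g)" using assms unfolding set_truncated[OF B \<BB> h nc] .
 then obtain p where p: "p \<in> Sigma \<BB> (pure_zeros f g)" "\<xi> = (case p of (C, a) \<Rightarrow> bar_arc_at C a)" by (rule imageE) blast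
 obtain C a where pp: "p = (C, a)" by (cases p)
 show ?thesis using that[of C a] p unfolding pp by auto
qed

lemma truncated_conv_arc:
 assumes "\<xi> \<in># T"
 shows "conv_arc \<xi>"
proof -
 obtain C a where C: "C \<in> \<BB>" "\<xi> = bar_arc_at C a" by (rule truncated_obtain[OF assms])
 have "0 < snd C" using cls(2)[OF C(1)] h by simp
 then show ?thesis unfolding C(2) conv_arc_def using is_arc_bar_arc_at[OF cls(1)[OF C(1)]] bar_arc_at_0[OF cls(1)[OF C(1)]]
   bar_arc_at_convergent[OF cls(1)[OF C(1)]] arc_denom_pos by blast
qed

private lemmas stable = truncated_stable[OF B \<BB> h nc]

lemma card_truncated:
 "card {\<xi> \<in> set_mset T. count T \<xi> = w} = (\<Sum>C\<in>\<BB>. card {a \<in> pure_zeros f g C. zero_mult f g C a = w})"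
proof -
 let ?F = "\<lambda>(C, a). bar_arc_at C a"
 let ?Z = "Sigma \<BB> (\<lambda>C. {a \<in> pure_zeros f g C. zero_mult f g C a = w})"
 have c: "count T (bar_arc_at C a) = zero_mult f g C a" if "C \<in> \<BB>" "a \<in> pure_zeros f g C" for C a
  using count_truncated[OF B \<BB> h nc that(1)] that(2) pure_zeros_eq[OF cls(1)[OF that(1)]] by blast
 have "{\<xi> \<in> set_mset T. count T \<xi> = w} = ?F ` {p \<in> Sigma \<BB> (pure_zeros f g). count T (?F p) = w}"
  unfolding set_truncated[OF B \<BB> h nc] by blast
 also have "{p \<in> Sigma \<BB> (pure_zeros f g). count T (?F p) = w} = ?Z" using c by auto
 finally have "{\<xi> \<in> set_mset T. count T \<xi> = w} = ?F ` ?Z" .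
 then have "card {\<xi> \<in> set_mset T. count T \<xi> = w} = card ?Z" using card_image[OF inj_bar_arc_at[OF B \<BB> h nc]] by simp
 also have "\<dots> = (\<Sum>C\<in>\<BB>. card {a \<in> pure_zeros f g C. zero_mult f g C a = w})"
  using finite_\<BB> finite_pure_zeros[OF B \<BB> h nc] by (intro card_SigmaI) auto
 finally show ?thesis .
qed

lemma truncated_orbit_size:
 assumes "\<xi> \<in># T"
 shows "card (orb \<xi>) = card \<BB> \<or> card (orb \<xi>) = extended_den (card \<BB>) (snd B)"
proof -
 obtain C a where C: "C \<in> \<BB>" "\<xi> = bar_arc_at C a" by (rule truncated_obtain[OF assms])
 show ?thesis using card_orb[OF conv_arcD(1)[OF truncated_conv_arc[OF assms]]] arc_den_bar_arc_at[OF C(1)] C(2) by simp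
qed

text \<open>Only \<open>a = 0\<close> gives the smaller denominator, and the arcs \<open>\<lambda>\<^sub>C\<close> form a single orbit.\<close>

lemma truncated_small_orbit:
 assumes \<xi>: "\<xi> \<in># T" and D: "extended_den (card \<BB>) (snd B) \<noteq> card \<BB>" and sz: "card (orb \<xi>) = card \<BB>"
 shows "orb \<xi> = orb (bar_arc B)"
proof -
 obtain C a where C: "C \<in> \<BB>" "\<xi> = bar_arc_at C a" by (rule truncated_obtain[OF \<xi>])
 have "a = 0" using card_orb[OF conv_arcD(1)[OF truncated_conv_arc[OF \<xi>]]] arc_den_bar_arc_at[OF C(1), of a] C(2) D sz
  by (cases "a = 0") auto
 then have "\<xi> = bar_arc C" using C(2) bar_arc_ge[of C "snd C"] by (auto simp: bar_arc_at_def)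
 then have "\<xi> \<in> orb (bar_arc B)" using C(1) bar_arc_class by blast
 then show ?thesis by (rule orb_eq[OF bar_arc_arc[OF B]])
qed

text \<open>The choice does not matter, as multiplicities are constant on orbits.\<close>

definition orbit_key :: "arc set \<Rightarrow> nat \<times> nat" where
 "orbit_key A = (count T (SOME \<xi>. \<xi> \<in> A), card A)"

lemma orbit_key_orb: "orbit_key (orb \<xi>) = (count T \<xi>, card (orb \<xi>))"
proof -
 have "(SOME \<zeta>. \<zeta> \<in> orb \<xi>) \<in> orb \<xi>" by (rule someI[of "\<lambda>\<zeta>. \<zeta> \<in> orb \<xi>", OF self_in_orb])
 then show ?thesis using count_orb[OF stable] by (simp add: orbit_key_def)
qed

text \<open>
  The truncated roots of multiplicity \<open>w\<close> correspond to the pure mero-zeros of this multiplicity, whence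
  their number.
\<close>

lemma card_orbits:
 "card {A \<in> orb ` set_mset T. orbit_key A = (w, s)} =
  orbit_number (card \<BB>) (extended_den (card \<BB>) (snd B))
   (\<Sum>C\<in>\<BB>. card {a \<in> pure_zeros f g C. zero_mult f g C a = w}) s"
proof -
 let ?A = "orb ` {\<xi> \<in> set_mset T. count T \<xi> = w}"
 have "{A \<in> orb ` set_mset T. orbit_key A = (w, s)} = {A \<in> ?A. card A = s}" using orbit_key_orb by auto
 also have "card \<dots> = orbit_number (card \<BB>) (extended_den (card \<BB>) (snd B)) (\<Sum>A\<in>?A. card A) s"
 proof (rule orbit_number_eq[OF _ card_class_pos extended_den_class(1)])
  show "finite ?A" by simp
  fix A assume "A \<in> ?A"
  then show "card A = card \<BB> \<or> card A = extended_den (card \<BB>) (snd B)" using truncated_orbit_size by blast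
 next
  assume "extended_den (card \<BB>) (snd B) \<noteq> card \<BB>"
  then have "{A \<in> ?A. card A = card \<BB>} \<subseteq> {orb (bar_arc B)}" using truncated_small_orbit by blast
  from card_mono[OF _ this] show "card {A \<in> ?A. card A = card \<BB>} \<le> 1" by simp
 qed
 also have "(\<Sum>A\<in>?A. card A) = card (\<Union>?A)"
 proof (rule card_Union_disjoint[symmetric])
  show "pairwise disjnt ?A"
  proof (rule pairwiseI)
   fix A A' assume "A \<in> ?A" "A' \<in> ?A" "A \<noteq> A'"
   then obtain \<xi> \<zeta> where x: "\<xi> \<in># T" "A = orb \<xi>" "\<zeta> \<in># T" "A' = orb \<zeta>" by blast
   show "disjnt A A'" unfolding disjnt_iff x
    using orb_eq[OF conv_arcD(1)[OF truncated_conv_arc[OF x(1)]]] orb_eq[OF conv_arcD(1)[OF truncated_conv_arc[OF x(3)]]]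
     \<open>A \<noteq> A'\<close> x by metis
  qed
  fix A assume "A \<in> ?A"
  then show "finite A" using finite_orb[OF conv_arcD(1)[OF truncated_conv_arc]] by blast
 qed
 also have "\<Union>?A = {\<xi> \<in> set_mset T. count T \<xi> = w}"
 proof (intro subset_antisym subsetI)
  fix \<zeta> assume "\<zeta> \<in> \<Union>?A"
  then obtain \<xi> where "\<xi> \<in># T" "count T \<xi> = w" "\<zeta> \<in> orb \<xi>" by blast
  then show "\<zeta> \<in> {\<xi> \<in> set_mset T. count T \<xi> = w}" using orb_subset_mset[OF stable] count_orb[OF stable] by auto
 qed (use self_in_orb in blast)
 finally show ?thesis unfolding card_truncated .
qed

lemma orbit_over:
 assumes "\<xi> \<in># T" "\<alpha> \<in> orb \<xi>"
 obtains C a where "C \<in> \<BB>" "\<alpha> = bar_arc_at C a" "above C \<alpha>"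
proof -
 have "\<alpha> \<in># T" using orb_subset_mset[OF stable] assms by blast
 then obtain C a where "C \<in> \<BB>" "\<alpha> = bar_arc_at C a" by (rule truncated_obtain)
 then show ?thesis using that above_bar_arc_at[OF cls(1)] by blast
qed

lemma sum_orbit:
 assumes \<xi>: "\<xi> \<in># T"
 shows "(\<Sum>\<alpha>\<in>orb \<xi>. F \<alpha>) = (\<Sum>C\<in>\<BB>. \<Sum>\<alpha>\<in>{\<alpha> \<in> orb \<xi>. above C \<alpha>}. F \<alpha>)"
proof -
 have "orb \<xi> = (\<Union>C\<in>\<BB>. {\<alpha> \<in> orb \<xi>. above C \<alpha>})" using orbit_over[OF \<xi>] by blast
 then have "(\<Sum>\<alpha>\<in>orb \<xi>. F \<alpha>) = (\<Sum>\<alpha>\<in>(\<Union>C\<in>\<BB>. {\<alpha> \<in> orb \<xi>. above C \<alpha>}). F \<alpha>)" by simp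
 also have "\<dots> = (\<Sum>C\<in>\<BB>. \<Sum>\<alpha>\<in>{\<alpha> \<in> orb \<xi>. above C \<alpha>}. F \<alpha>)"
 proof (rule sum.UNION_disjoint[OF finite_\<BB>])
  show "\<forall>C\<in>\<BB>. finite {\<alpha> \<in> orb \<xi>. above C \<alpha>}" using finite_orb[OF conv_arcD(1)[OF truncated_conv_arc[OF \<xi>]]] by simp
 qed (use class_unique in blast)
 finally show ?thesis .
qed

text \<open>Conjugation preserves the orbit and permutes the bars of the class transitively.\<close>

lemma card_orbit_over:
 assumes \<xi>: "\<xi> \<in># T" and C: "C \<in> \<BB>"
 shows "card {\<alpha> \<in> orb \<xi>. above C \<alpha>} = card (orb \<xi>) div card \<BB>"
proof -
 have fin: "finite (orb \<xi>)" by (rule finite_orb[OF conv_arcD(1)[OF truncated_conv_arc[OF \<xi>]]])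
 have le: "card {\<alpha> \<in> orb \<xi>. above D \<alpha>} \<le> card {\<alpha> \<in> orb \<xi>. above D' \<alpha>}" if D: "D \<in> \<BB>" "D' \<in> \<BB>" for D D'
 proof -
  obtain l where "D = conj_bar l B" using ob[OF D(1)] by blast
  then have "D' \<in> range (\<lambda>k. conj_bar k D)" using D(2) class_range[OF B] \<BB> by metis
  then obtain k where k: "D' = conj_bar k D" by blast
  have "conj_arc k ` {\<alpha> \<in> orb \<xi>. above D \<alpha>} \<subseteq> {\<alpha> \<in> orb \<xi>. above D' \<alpha>}"
   using conj_in_orb above_conj[OF cls(1)[OF D(1)]] by (auto simp: k)
  then have "card (conj_arc k ` {\<alpha> \<in> orb \<xi>. above D \<alpha>}) \<le> card {\<alpha> \<in> orb \<xi>. above D' \<alpha>}" using fin by (intro card_mono) auto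
  then show ?thesis using card_image[OF inj_on_subset[OF inj_conj_arc[of k] subset_UNIV]] by simp
 qed
 have eq: "card {\<alpha> \<in> orb \<xi>. above D \<alpha>} = card {\<alpha> \<in> orb \<xi>. above C \<alpha>}" if "D \<in> \<BB>" for D
  using le[OF that C] le[OF C that] by simp
 have "card (orb \<xi>) = (\<Sum>D\<in>\<BB>. card {\<alpha> \<in> orb \<xi>. above D \<alpha>})" unfolding card_eq_sum by (rule sum_orbit[OF \<xi>])
 also have "\<dots> = card \<BB> * card {\<alpha> \<in> orb \<xi>. above C \<alpha>}" using eq by simp
 finally show ?thesis using card_class_pos by simp
qed

lemma orbit_contact_sum:
 assumes \<xi>: "\<xi> \<in># T" and \<zeta>: "\<zeta> \<in># T" and ne: "orb \<xi> \<noteq> orb \<zeta>"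
 shows "(\<Sum>\<beta>\<in>orb \<zeta>. \<Sum>\<alpha>\<in>orb \<xi>. rcontact \<beta> \<alpha>) =
  real (card (orb \<zeta>) div card \<BB>) * real (card (orb \<xi>) div card \<BB>) * (\<Sum>D\<in>\<BB>. \<Sum>C\<in>\<BB>. bar_contact D C)"
proof -
 have r: "rcontact \<beta> \<alpha> = bar_contact D C"
  if D: "D \<in> \<BB>" "\<beta> \<in> {\<beta> \<in> orb \<zeta>. above D \<beta>}" and C: "C \<in> \<BB>" "\<alpha> \<in> {\<alpha> \<in> orb \<xi>. above C \<alpha>}" for \<alpha> \<beta> C D
 proof -
  have ba: "\<beta> \<in> orb \<zeta>" "above D \<beta>" "\<alpha> \<in> orb \<xi>" "above C \<alpha>" using C D by auto
  obtain C' a where a: "C' \<in> \<BB>" "\<alpha> = bar_arc_at C' a" "above C' \<alpha>" by (rule orbit_over[OF \<xi> ba(3)])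
  obtain D' b where b: "D' \<in> \<BB>" "\<beta> = bar_arc_at D' b" "above D' \<beta>" by (rule orbit_over[OF \<zeta> ba(1)])
  have CD: "C' = C" "D' = D" using class_unique a b C(1) D(1) ba by blast+
  have "\<beta> \<noteq> \<alpha>"
   using ba ne orb_eq[OF conv_arcD(1)[OF truncated_conv_arc[OF \<xi>]]] orb_eq[OF conv_arcD(1)[OF truncated_conv_arc[OF \<zeta>]]] by metis
  then show ?thesis using rcontact_bar_arc_at[OF D(1) C(1), of b a] a(2) b(2) unfolding CD by simp
 qed
 have "(\<Sum>\<beta>\<in>orb \<zeta>. \<Sum>\<alpha>\<in>orb \<xi>. rcontact \<beta> \<alpha>) =
   (\<Sum>D\<in>\<BB>. \<Sum>\<beta>\<in>{\<beta> \<in> orb \<zeta>. above D \<beta>}. \<Sum>C\<in>\<BB>. \<Sum>\<alpha>\<in>{\<alpha> \<in> orb \<xi>. above C \<alpha>}. rcontact \<beta> \<alpha>)"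
  unfolding sum_orbit[OF \<xi>] by (rule sum_orbit[OF \<zeta>])
 also have "\<dots> = (\<Sum>D\<in>\<BB>. \<Sum>\<beta>\<in>{\<beta> \<in> orb \<zeta>. above D \<beta>}. \<Sum>C\<in>\<BB>. \<Sum>\<alpha>\<in>{\<alpha> \<in> orb \<xi>. above C \<alpha>}. bar_contact D C)"
  by (intro sum.cong refl r)
 finally show ?thesis by (simp add: card_orbit_over[OF \<xi>] card_orbit_over[OF \<zeta>] sum_distrib_left mult.assoc)
qed

end

end

section \<open>Invariance under mero-equivalence\<close>

lemma (in mero_pair) class_bar_range:
 assumes \<BB>: "\<BB> \<in> conj_classes f g" and C: "C \<in> \<BB>"
 shows "C \<in> bars f g" "\<BB> = range (\<lambda>k. conj_bar k C)"
proof -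
 obtain B where B: "B \<in> bars f g" "\<BB> = range (\<lambda>k. conj_bar k B)" by (rule conj_class_obtain[OF \<BB>])
 obtain l where l: "C = conj_bar l B" using C unfolding B(2) by blast
 show "C \<in> bars f g" unfolding l by (rule conj_bar_in_bars[OF B(1)])
 show "\<BB> = range (\<lambda>k. conj_bar k C)" unfolding l B(2) by (rule class_range[OF B(1), symmetric])
qed

lemma zariski_equisingular_1: "zariski_equisingular 1 1"
proof -
 have "zariski_equisingular (arc_prod {#}) (arc_prod {#})"
  by (rule equisingular_arc_prod[of _ _ id]) (simp_all add: conj_stable_def)
 then show ?thesis by simp
qed

locale mero_equiv = P: mero_pair f g E1 E2 + Q: mero_pair f' g' E1 E2
 for f g f' g' :: germ and E1 E2 :: nat +
 fixes \<phi>
 assumes equiv: "mero_equivalence E1 E2 f g f' g' \<phi>"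
begin

lemma \<phi>: "bij_betw \<phi> (roots f) (roots f')" "bij_betw \<phi> (roots g) (roots g')"
  "\<And>\<kappa> \<mu>. \<kappa> \<in> P.R \<Longrightarrow> \<mu> \<in> P.R \<Longrightarrow> contact (\<phi> \<kappa>) (\<phi> \<mu>) = contact \<kappa> \<mu>" using equiv by (auto simp: mero_equivalence_def)

text \<open>The images of the two sets of roots are disjoint, so that membership is reflected as well.\<close>

lemma \<phi>_mem: "\<kappa> \<in> P.R \<Longrightarrow> \<phi> \<kappa> \<in> roots f' \<longleftrightarrow> \<kappa> \<in> roots f" "\<kappa> \<in> P.R \<Longrightarrow> \<phi> \<kappa> \<in> roots g' \<longleftrightarrow> \<kappa> \<in> roots g"
proof -
 assume "\<kappa> \<in> P.R"
 then have "\<kappa> \<in> roots f \<or> \<kappa> \<in> roots g" by (simp add: tree_roots_def)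
 moreover have "\<kappa> \<in> roots f \<Longrightarrow> \<phi> \<kappa> \<in> roots f'" "\<kappa> \<in> roots g \<Longrightarrow> \<phi> \<kappa> \<in> roots g'"
  using bij_betwE[OF \<phi>(1)] bij_betwE[OF \<phi>(2)] by blast+
 ultimately show "\<phi> \<kappa> \<in> roots f' \<longleftrightarrow> \<kappa> \<in> roots f" "\<phi> \<kappa> \<in> roots g' \<longleftrightarrow> \<kappa> \<in> roots g"
  using P.roots_disjoint Q.roots_disjoint by blast+
qed

lemma inj_\<phi>: "inj_on \<phi> P.R"
proof (rule inj_onI)
 fix \<kappa> \<mu> assume *: "\<kappa> \<in> P.R" "\<mu> \<in> P.R" "\<phi> \<kappa> = \<phi> \<mu>"
 have "contact \<kappa> \<mu> = \<infinity>" using \<phi>(3)[OF *(1,2)] *(3) by simp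
 then show "\<kappa> = \<mu>" using ereal_rcontact[OF P.R_arc[OF *(1)] P.R_arc[OF *(2)]] by fastforce
qed

lemma \<phi>_image: "\<phi> ` P.R = Q.R" using \<phi>(1,2) by (simp add: tree_roots_def image_Un bij_betw_def)

lemma trunks_on_\<phi>:
 assumes "fst B \<subseteq> P.R"
 shows "trunks_on (bar_map \<phi> B) = image \<phi> ` trunks_on B"
proof -
 have "{\<mu> \<in> \<phi> ` fst B. contact (\<phi> \<kappa>) \<mu> > ereal (snd B)} = \<phi> ` {\<mu> \<in> fst B. contact \<kappa> \<mu> > ereal (snd B)}"
  if "\<kappa> \<in> fst B" for \<kappa>
 proof -
  have "contact (\<phi> \<kappa>) (\<phi> \<mu>) = contact \<kappa> \<mu>" if "\<mu> \<in> fst B" for \<mu> using \<phi>(3) that \<open>\<kappa> \<in> fst B\<close> assms by blast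
  then show ?thesis by auto
 qed
 then show ?thesis unfolding trunks_on_def bar_map_def setcompr_eq_image by (simp add: image_image cong: image_cong)
qed

context
 fixes B assumes B: "B \<in> bars f g" and B': "bar_map \<phi> B \<in> bars f' g'"
begin

lemma nu_\<phi>: "nu f' (bar_map \<phi> B) = nu f B" "nu g' (bar_map \<phi> B) = nu g B"
proof -
 have *: "nu F' (bar_map \<phi> B) = nu F B"
  if np: "np_factorization F E (mset_set S)" "np_factorization F' E (mset_set S')"
   and conv: "germ_convergent F" "germ_convergent F'"
   and S: "S \<subseteq> P.R" "S' \<subseteq> Q.R" and bij: "bij_betw \<phi> S S'" for F F' E S S'
 proof (cases "snd B = 0")
  case True
  then have "B = (P.R, 0)" by (rule P.bar_ground[OF B])
  moreover from this have "bar_map \<phi> B = (Q.R, 0)" by (simp add: bar_map_def \<phi>_image)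
  ultimately show ?thesis using P.nu_ground[OF conv(1) np(1)] Q.nu_ground[OF conv(2) np(2)] by simp
 next
  case False
  then have h: "0 < snd B" using P.bar_height_nonneg[OF B] by simp
  obtain \<kappa> where \<kappa>: "\<kappa> \<in> fst B" using P.bar_nonempty[OF B] by blast
  have \<kappa>': "\<phi> \<kappa> \<in> fst (bar_map \<phi> B)" using \<kappa> by (simp add: bar_map_def)
  have \<kappa>R: "\<kappa> \<in> P.R" "fst B \<subseteq> P.R" using \<kappa> P.bar_subset[OF B] by auto
  have h': "0 < snd (bar_map \<phi> B)" using h by (simp add: bar_map_def)
  have "nu F' (bar_map \<phi> B) = real E + (\<Sum>\<alpha>\<in>S'. if \<alpha> \<in> fst (bar_map \<phi> B) then snd (bar_map \<phi> B) else rcontact (\<phi> \<kappa>) \<alpha>)"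
   by (rule Q.np_nu[OF B' h' \<kappa>' np(2) S(2)])
  also have "\<dots> = real E + (\<Sum>\<alpha>\<in>S. if \<phi> \<alpha> \<in> fst (bar_map \<phi> B) then snd (bar_map \<phi> B) else rcontact (\<phi> \<kappa>) (\<phi> \<alpha>))"
   by (subst sum.reindex_bij_betw[OF bij, symmetric]) (rule refl)
  also have "\<dots> = real E + (\<Sum>\<alpha>\<in>S. if \<alpha> \<in> fst B then snd B else rcontact \<kappa> \<alpha>)"
  proof (intro arg_cong2[of _ _ _ _ "(+)"] sum.cong refl)
   fix \<alpha> assume "\<alpha> \<in> S"
   then have \<alpha>: "\<alpha> \<in> P.R" using S(1) by auto
   have "\<phi> \<alpha> \<in> fst (bar_map \<phi> B) \<longleftrightarrow> \<alpha> \<in> fst B" using inj_on_image_mem_iff[OF inj_\<phi> \<alpha> \<kappa>R(2)] by (simp add: bar_map_def)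
   moreover have "rcontact (\<phi> \<kappa>) (\<phi> \<alpha>) = rcontact \<kappa> \<alpha>" using \<phi>(3)[OF \<kappa>R(1) \<alpha>] by (simp add: rcontact_def)
   ultimately show "(if \<phi> \<alpha> \<in> fst (bar_map \<phi> B) then snd (bar_map \<phi> B) else rcontact (\<phi> \<kappa>) (\<phi> \<alpha>)) =
     (if \<alpha> \<in> fst B then snd B else rcontact \<kappa> \<alpha>)" by (simp add: bar_map_def)
  qed
  finally show ?thesis using P.np_nu[OF B h \<kappa> np(1) S(1)] by simp
 qed
 show "nu f' (bar_map \<phi> B) = nu f B"
  by (rule *[OF P.np_fg(1) Q.np_fg(1) P.germ_convergent_fg(1) Q.germ_convergent_fg(1) _ _ \<phi>(1)]) (auto simp: tree_roots_def)
 show "nu g' (bar_map \<phi> B) = nu g B"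
  by (rule *[OF P.np_fg(2) Q.np_fg(2) P.germ_convergent_fg(2) Q.germ_convergent_fg(2) _ _ \<phi>(2)]) (auto simp: tree_roots_def)
qed

lemma Delta_\<phi>:
 assumes T: "T \<subseteq> P.R"
 shows "Delta f' g' (bar_map \<phi> B) (\<phi> ` T) = Delta f g B T"
proof -
 have "\<phi> ` T \<inter> roots f' = \<phi> ` (T \<inter> roots f)" "\<phi> ` T \<inter> roots g' = \<phi> ` (T \<inter> roots g)" using \<phi>_mem T by blast+
 moreover have "card (\<phi> ` (T \<inter> S)) = card (T \<inter> S)" for S using inj_on_subset[OF inj_\<phi>] T by (intro card_image) blast
 ultimately show ?thesis by (simp add: Delta_def nu_\<phi>)
qed

lemma noncollinear_\<phi>:
 assumes "noncollinear_bar f g B"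
 shows "noncollinear_bar f' g' (bar_map \<phi> B)"
proof -
 obtain T where T: "T \<in> trunks_on B" "Delta f g B T \<noteq> 0"
  using assms by (auto simp: noncollinear_bar_def noncollinear_points_def)
 have "T \<subseteq> P.R" using T(1) P.bar_subset[OF B] by (auto simp: trunks_on_def)
 then have "\<phi> ` T \<in> trunks_on (bar_map \<phi> B)" "Delta f' g' (bar_map \<phi> B) (\<phi> ` T) \<noteq> 0"
  using T trunks_on_\<phi>[OF P.bar_subset[OF B]] Delta_\<phi> by auto
 then show ?thesis unfolding noncollinear_bar_def noncollinear_points_def by blast
qed

lemma card_pure_zeros_\<phi>:
 assumes nc: "noncollinear_bar f g B"
 shows "card {a \<in> pure_zeros f' g' (bar_map \<phi> B). zero_mult f' g' (bar_map \<phi> B) a = w} =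
  card {a \<in> pure_zeros f g B. zero_mult f g B a = w}"
proof -
 obtain \<theta> where \<theta>: "bij_betw \<theta> (pure_zeros f g B) (pure_zeros f' g' (bar_map \<phi> B))"
  "\<And>z. z \<in> pure_zeros f g B \<Longrightarrow> zero_mult f' g' (bar_map \<phi> B) (\<theta> z) = zero_mult f g B z"
  using equiv B nc noncollinear_\<phi>[OF nc] unfolding mero_equivalence_def by blast
 have "\<theta> ` {a \<in> pure_zeros f g B. zero_mult f g B a = w} =
   {a \<in> pure_zeros f' g' (bar_map \<phi> B). zero_mult f' g' (bar_map \<phi> B) a = w}"
 proof (intro subset_antisym image_subsetI subsetI)
  fix z assume "z \<in> {a \<in> pure_zeros f g B. zero_mult f g B a = w}"
  then show "\<theta> z \<in> {a \<in> pure_zeros f' g' (bar_map \<phi> B). zero_mult f' g' (bar_map \<phi> B) a = w}"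
   using \<theta>(2)[of z] bij_betwE[OF \<theta>(1)] by simp
 next
  fix a assume "a \<in> {a \<in> pure_zeros f' g' (bar_map \<phi> B). zero_mult f' g' (bar_map \<phi> B) a = w}"
  then have a: "a \<in> pure_zeros f' g' (bar_map \<phi> B)" "zero_mult f' g' (bar_map \<phi> B) a = w" by auto
  then obtain z where z: "z \<in> pure_zeros f g B" "a = \<theta> z" using bij_betw_imp_surj_on[OF \<theta>(1)] by blast
  then show "a \<in> \<theta> ` {a \<in> pure_zeros f g B. zero_mult f g B a = w}" using a(2) \<theta>(2)[of z] by simp
 qed
 moreover have "inj_on \<theta> {a \<in> pure_zeros f g B. zero_mult f g B a = w}"
  by (rule inj_on_subset[OF bij_betw_imp_inj_on[OF \<theta>(1)]]) auto
 ultimately show ?thesis using card_image[of \<theta> "{a \<in> pure_zeros f g B. zero_mult f g B a = w}"] by simp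
qed

end

text \<open>
  Since the orbits on both sides are equinumerous for each multiplicity and size, they can be matched. The
  characteristic exponents and the contact sums then depend on the sizes and on the contact orders between
  bars only, and \<open>\<phi>\<close> preserves the latter.
\<close>

theorem truncated_factor_equisingular:
 assumes \<BB>: "\<BB> \<in> conj_classes f g" and nc: "noncollinear_class f g \<BB>"
  and \<BB>': "\<BB>' \<in> conj_classes f' g'" and map: "\<BB>' = bar_map \<phi> ` \<BB>"
 shows "zariski_equisingular (truncated_factor f g \<BB>) (truncated_factor f' g' \<BB>')"
proof -
 obtain B where B: "B \<in> bars f g" "\<BB> = range (\<lambda>k. conj_bar k B)" by (rule P.conj_class_obtain[OF \<BB>])
 have BB: "C \<in> bars f g" if "C \<in> \<BB>" for C by (rule P.class_bar_range(1)[OF \<BB> that])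
 have BB': "bar_map \<phi> C \<in> bars f' g'" if "C \<in> \<BB>" for C using Q.class_bar_range(1)[OF \<BB>'] that map by blast
 have "conj_bar 0 B = B" by (simp add: conj_bar_def prod_eq_iff)
 then have self: "B \<in> \<BB>" unfolding B(2) by (metis rangeI)
 have nc': "noncollinear_class f' g' \<BB>'" using nc noncollinear_\<phi>[OF BB BB'] unfolding noncollinear_class_def map by blast
 show ?thesis
 proof (cases "snd B = 0")
  case True
  then have BR: "B = (P.R, 0)" by (rule P.bar_ground[OF B(1)])
  have b: "\<BB> = {(P.R, 0)}" unfolding B(2) BR using P.conj_roots(3) by (auto simp: conj_bar_def)
  have b': "\<BB>' = {(Q.R, 0)}" unfolding map b by (simp add: bar_map_def \<phi>_image)
  have "noncollinear_bar f g (P.R, 0)" using nc by (simp add: noncollinear_class_def b)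
  moreover have "noncollinear_bar f' g' (Q.R, 0)" using nc' by (simp add: noncollinear_class_def b')
  ultimately have "truncated_factor f g \<BB> = 1" "truncated_factor f' g' \<BB>' = 1"
   unfolding b b' by (simp_all add: P.ground_factors Q.ground_factors)
  then show ?thesis using zariski_equisingular_1 by simp
 next
  case False
  then have h: "0 < snd B" using P.bar_height_nonneg[OF B(1)] by simp
  define B' where "B' = bar_map \<phi> B"
  have snd': "snd (bar_map \<phi> C) = snd C" for C by (simp add: bar_map_def)
  have self': "B' \<in> \<BB>'" unfolding B'_def map using self by blast
  note P1 = B(1) B(2) h nc
  have h': "0 < snd B'" using h by (simp add: B'_def snd')
  note Q1 = Q.class_bar_range[OF \<BB>' self'] h' nc'
  have inj: "inj_on (bar_map \<phi>) \<BB>"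
  proof (rule inj_onI)
   fix C D assume C: "C \<in> \<BB>" "D \<in> \<BB>" "bar_map \<phi> C = bar_map \<phi> D"
   then have "\<phi> ` fst C = \<phi> ` fst D" "snd C = snd D" by (simp_all add: bar_map_def)
   then show "C = D" using inj_on_image_eq_iff[OF inj_\<phi> P.bar_subset[OF BB[OF C(1)]] P.bar_subset[OF BB[OF C(2)]]]
    by (simp add: prod_eq_iff)
  qed
  have card: "card \<BB>' = card \<BB>" unfolding map by (rule card_image[OF inj])
  have bc: "Q.bar_contact (bar_map \<phi> C) (bar_map \<phi> D) = P.bar_contact C D" if C: "C \<in> \<BB>" "D \<in> \<BB>" for C D
  proof (cases "C = D")
   case True
   then show ?thesis by (simp add: P.bar_contact_def[OF P1] Q.bar_contact_def[OF Q1] snd')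
  next
   case ne: False
   then have ne': "bar_map \<phi> C \<noteq> bar_map \<phi> D" using inj_onD[OF inj] C by blast
   obtain \<kappa> where \<kappa>: "\<kappa> \<in> fst C" using P.bar_nonempty[OF BB[OF C(1)]] by blast
   obtain \<mu> where \<mu>: "\<mu> \<in> fst D" using P.bar_nonempty[OF BB[OF C(2)]] by blast
   have R: "\<kappa> \<in> P.R" "\<mu> \<in> P.R" "P.above C \<kappa>" "P.above D \<mu>"
    using \<kappa> \<mu> P.bar_members[OF BB[OF C(1)]] P.bar_members[OF BB[OF C(2)]] by auto
   have "\<phi> \<kappa> \<in> fst (bar_map \<phi> C)" "\<phi> \<mu> \<in> fst (bar_map \<phi> D)" using \<kappa> \<mu> by (simp_all add: bar_map_def)
   then have R': "\<phi> \<kappa> \<in> Q.R" "\<phi> \<mu> \<in> Q.R" "Q.above (bar_map \<phi> C) (\<phi> \<kappa>)" "Q.above (bar_map \<phi> D) (\<phi> \<mu>)"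
    using Q.bar_members[OF BB'[OF C(1)]] Q.bar_members[OF BB'[OF C(2)]] by auto
   have C': "bar_map \<phi> C \<in> \<BB>'" "bar_map \<phi> D \<in> \<BB>'" unfolding map using C by blast+
   have "P.bar_contact C D = rcontact \<kappa> \<mu>"
    by (rule P.rcontact_class_above[OF P1 C ne R(3,4) P.R_arc[OF R(1)] P.R_arc[OF R(2)], symmetric])
   also have "\<dots> = rcontact (\<phi> \<kappa>) (\<phi> \<mu>)" using \<phi>(3)[OF R(1,2)] by (simp add: rcontact_def)
   also have "\<dots> = Q.bar_contact (bar_map \<phi> C) (bar_map \<phi> D)"
    by (rule Q.rcontact_class_above[OF Q1 C' ne' R'(3,4) Q.R_arc[OF R'(1)] Q.R_arc[OF R'(2)]])
   finally show ?thesis by simp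
  qed
  have CE: "char_exponents (bar_arc B') = char_exponents (bar_arc B)"
  proof -
   have "\<BB>' - {B'} = bar_map \<phi> ` (\<BB> - {B})"
    unfolding map B'_def using inj_on_image_set_diff[OF inj, of \<BB> "{B}"] self by auto
   then have "Q.bar_contact B' ` (\<BB>' - {B'}) = (\<lambda>C. Q.bar_contact (bar_map \<phi> B) (bar_map \<phi> C)) ` (\<BB> - {B})"
    by (simp add: image_image B'_def)
   also have "\<dots> = P.bar_contact B ` (\<BB> - {B})" using bc[OF self] by (intro image_cong) auto
   finally show ?thesis unfolding P.char_exponents_bar_arc[OF P1] Q.char_exponents_bar_arc[OF Q1] .
  qed
  let ?T = "image_mset (truncation f g) (class_polar_roots f g \<BB>)"
  let ?T' = "image_mset (truncation f' g') (class_polar_roots f' g' \<BB>')"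
  have weights: "(\<Sum>C\<in>\<BB>'. card {a \<in> pure_zeros f' g' C. zero_mult f' g' C a = w}) =
    (\<Sum>C\<in>\<BB>. card {a \<in> pure_zeros f g C. zero_mult f g C a = w})" for w unfolding map sum.reindex[OF inj] comp_def
   using card_pure_zeros_\<phi>[OF BB BB'] nc by (intro sum.cong refl) (simp add: noncollinear_class_def)
  have keys: "card {A \<in> orb ` set_mset ?T. P.orbit_key \<BB> A = c} = card {A \<in> orb ` set_mset ?T'. Q.orbit_key \<BB>' A = c}" for c
  proof -
   obtain w s where c: "c = (w, s)" by (cases c)
   show ?thesis unfolding c P.card_orbits[OF P1] Q.card_orbits[OF Q1] weights card B'_def snd' ..
  qed
  obtain \<Psi> where \<Psi>: "bij_betw \<Psi> (orb ` set_mset ?T) (orb ` set_mset ?T')"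
   and \<Psi>_key: "\<And>A. A \<in> orb ` set_mset ?T \<Longrightarrow> Q.orbit_key \<BB>' (\<Psi> A) = P.orbit_key \<BB> A"
   using bij_by_key[OF _ _ keys] by (metis finite_imageI finite_set_mset)
  have key: "count ?T \<xi> = count ?T' \<xi>' \<and> card (orb \<xi>) = card (orb \<xi>')"
   if "\<xi> \<in># ?T" "\<xi>' \<in># ?T'" "\<Psi> (orb \<xi>) = orb \<xi>'" for \<xi> \<xi>'
   using \<Psi>_key[of "orb \<xi>"] that unfolding P.orbit_key_orb[OF P1] that(3) Q.orbit_key_orb[OF Q1] by auto
  note cv = P.truncated_conv_arc[OF P1] and cv' = Q.truncated_conv_arc[OF Q1]
  have "zariski_equisingular (arc_prod ?T) (arc_prod ?T')"
  proof (rule equisingular_arc_prod[OF P.truncated_stable[OF P1] cv Q.truncated_stable[OF Q1] cv' \<Psi>])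
   fix \<xi> \<xi>' assume \<xi>: "\<xi> \<in># ?T" "\<xi>' \<in># ?T'" "\<Psi> (orb \<xi>) = orb \<xi>'"
   note k = key[OF \<xi>]
   have d: "arc_den \<xi> = arc_den \<xi>'"
    using k card_orb[OF conv_arcD(1)[OF cv[OF \<xi>(1)]]] card_orb[OF conv_arcD(1)[OF cv'[OF \<xi>(2)]]] by simp
   obtain C a where C: "C \<in> \<BB>" "\<xi> = bar_arc_at C a" by (rule P.truncated_obtain[OF P1 \<xi>(1)])
   obtain C' a' where C': "C' \<in> \<BB>'" "\<xi>' = bar_arc_at C' a'" by (rule Q.truncated_obtain[OF Q1 \<xi>(2)])
   have "char_exponents \<xi> = char_exponents \<xi>'"
    using P.char_exponents_bar_arc_at[OF P1 C(1), of a] Q.char_exponents_bar_arc_at[OF Q1 C'(1), of a'] d CE card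
    unfolding C(2)[symmetric] C'(2)[symmetric] by (simp add: B'_def snd')
   then show "count ?T \<xi> = count ?T' \<xi>' \<and> arc_den \<xi> = arc_den \<xi>' \<and> char_exponents \<xi> = char_exponents \<xi>'" using k d by simp
  next
   fix A D assume A: "A \<in> orb ` set_mset ?T" "D \<in> orb ` set_mset ?T" "A \<noteq> D"
   obtain \<xi> where \<xi>: "\<xi> \<in># ?T" "A = orb \<xi>" using A(1) by blast
   obtain \<zeta> where \<zeta>: "\<zeta> \<in># ?T" "D = orb \<zeta>" using A(2) by blast
   obtain \<xi>' where \<xi>': "\<xi>' \<in># ?T'" "\<Psi> A = orb \<xi>'" using bij_betwE[OF \<Psi>] A(1) by blast
   obtain \<zeta>' where \<zeta>': "\<zeta>' \<in># ?T'" "\<Psi> D = orb \<zeta>'" using bij_betwE[OF \<Psi>] A(2) by blast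
   have ne: "orb \<xi> \<noteq> orb \<zeta>" using A(3) \<xi>(2) \<zeta>(2) by simp
   have ne': "orb \<xi>' \<noteq> orb \<zeta>'" using inj_onD[OF bij_betw_imp_inj_on[OF \<Psi>] _ A(1,2)] A(3) \<xi>'(2) \<zeta>'(2) by metis
   have "card (orb \<xi>) = card (orb \<xi>')" "card (orb \<zeta>) = card (orb \<zeta>')"
    using key[OF \<xi>(1) \<xi>'(1)] key[OF \<zeta>(1) \<zeta>'(1)] \<xi>(2) \<xi>'(2) \<zeta>(2) \<zeta>'(2) by simp_all
   moreover have "(\<Sum>C\<in>\<BB>'. \<Sum>D\<in>\<BB>'. Q.bar_contact C D) = (\<Sum>C\<in>\<BB>. \<Sum>D\<in>\<BB>. P.bar_contact C D)"
    unfolding map sum.reindex[OF inj] comp_def using bc by (intro sum.cong refl) simp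
   ultimately show "(\<Sum>\<beta>\<in>D. \<Sum>\<alpha>\<in>A. rcontact \<beta> \<alpha>) = (\<Sum>\<beta>\<in>\<Psi> D. \<Sum>\<alpha>\<in>\<Psi> A. rcontact \<beta> \<alpha>)" unfolding \<xi>'(2) \<zeta>'(2) unfolding \<xi>(2) \<zeta>(2)
     P.orbit_contact_sum[OF P1 \<xi>(1) \<zeta>(1) ne] Q.orbit_contact_sum[OF Q1 \<xi>'(1) \<zeta>'(1) ne'] card by simp
  qed
  then show ?thesis by (simp add: truncated_factor_def)
 qed
qed

end

theorem mainTheorem6:
 fixes f g :: germ and E1 E2 :: nat and \<BB> :: "bar set"
 assumes "mero_setting f g E1 E2"
  and "\<BB> \<in> conj_classes f g"
  and "noncollinear_class f g \<BB>"
 shows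
  "int_mult f (truncated_factor f g \<BB>) = int_mult f (polar_factor f g \<BB>) \<and>
   ereal_of_enat (int_mult f (polar_factor f g \<BB>)) =
    ereal (nu_class f \<BB> * real (mero_mult_class f g \<BB>)) \<and>
   int_mult g (truncated_factor f g \<BB>) = int_mult g (polar_factor f g \<BB>) \<and>
   ereal_of_enat (int_mult g (polar_factor f g \<BB>)) =
    ereal (nu_class g \<BB> * real (mero_mult_class f g \<BB>)) \<and>
   int_mult (f * g) (truncated_factor f g \<BB>) = int_mult (f * g) (polar_factor f g \<BB>) \<and>
   ereal_of_enat (int_mult (f * g) (polar_factor f g \<BB>)) =
    ereal ((nu_class f \<BB> + nu_class g \<BB>) * real (mero_mult_class f g \<BB>)) \<and>
   (\<forall>f' g' \<phi> \<BB>'. mero_equivalence E1 E2 f g f' g' \<phi> \<longrightarrow>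
    \<BB>' \<in> conj_classes f' g' \<longrightarrow> \<BB>' = bar_map \<phi> ` \<BB> \<longrightarrow>
    zariski_equisingular (truncated_factor f g \<BB>) (truncated_factor f' g' \<BB>'))"
proof -
 interpret P: mero_pair f g E1 E2 by (rule mero_pair.intro) (rule assms(1))
 have "zariski_equisingular (truncated_factor f g \<BB>) (truncated_factor f' g' \<BB>')"
  if eq: "mero_equivalence E1 E2 f g f' g' \<phi>" and \<BB>': "\<BB>' \<in> conj_classes f' g'" "\<BB>' = bar_map \<phi> ` \<BB>" for f' g' \<phi> \<BB>'
 proof -
  interpret Q: mero_pair f' g' E1 E2 by (rule mero_pair.intro) (use eq in \<open>simp add: mero_equivalence_def\<close>)
  interpret mero_equiv f g f' g' E1 E2 \<phi> by unfold_locales (rule eq)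
  show ?thesis by (rule truncated_factor_equisingular[OF assms(2,3) \<BB>'])
 qed
 moreover note P.class_int_mult[OF assms(2,3), of f "nu_class f \<BB>"] P.class_int_mult[OF assms(2,3), of g "nu_class g \<BB>"]
  P.class_int_mult[OF assms(2,3), of "f * g" "nu_class f \<BB> + nu_class g \<BB>"]
 ultimately show ?thesis by blast
qed

end
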